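(* Let $u_\rho=\operatorname{grad}\log(\rho/\pi)$. The Wasserstein and Stein entropy law tangents agree at $\rho$, i.e. $K^W_\rho\log(\rho/\pi)=K^S_\rho\log(\rho/\pi)$, if and only if $$M_\rho u_\rho=u_\rho .$$ They determine the same unparametrised entropy trajectory on a region if $M_\rho u_\rho=a(\rho)u_\rho$ for a positive function $a$. Their instantaneous entropy dissipations agree if and only if $$\langle u_\rho,M_\rho u_\rho\rangle_{L^2(\rho)}=\|u_\rho\|^2_{L^2(\rho)} .$$ Equality in this last display need not imply equality of the law tangents.
   Context: $M$ is a connected, closed, oriented Riemannian manifold with metric $g$ and volume $\mathrm{vol}$; $\mathcal P^\infty_+(M)$ is the set of smooth strictly positive $\rho$ with $\int_M\rho\,d\mathrm{vol}=1$; $\pi\in\mathcal P^\infty_+(M)$ is fixed and $\rho\in\mathcal P^\infty_+(M)$; a region means a region of $\mathcal P^\infty_+(M)$. $\mathcal H_k$ is the reproducing kernel Hilbert space of vector fields of a smooth positive definite kernel $k(x,y):T_xM\to T_yM$, assumed continuously included in $C^1(M;TM)$; $I_\rho:\mathcal H_k\to L^2(\rho;TM)$ is the inclusion (target inner product $\int_M\langle u,v\rangle_g\rho\,d\mathrm{vol}$), and $I_\rho^*$ is its adjoint. $K^W_\rho f=-\operatorname{div}(\rho\operatorname{grad}f)$ and $K^S_\rho f=-\operatorname{div}(\rho I_\rho^*\operatorname{grad}f)$ are the Wasserstein (Otto) and Stein maps from regular covectors (smooth functions modulo constants) to density tangents. $H^W_\rho$ is the $L^2(\rho;TM)$-closure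 of gradients of smooth functions, $P^{\mathrm{hor}}_\rho$ is the orthogonal projection of $L^2(\rho;TM)$ onto it, and $M_\rho=P^{\mathrm{hor}}_\rho I_\rho I_\rho^*|_{H^W_\rho}$. The relative entropy is $\mathrm{Ent}_\pi(\rho)=\int_M\rho\log(\rho/\pi)\,d\mathrm{vol}$, whose differential is represented by $\log(\rho/\pi)$ modulo constants. The Wasserstein and Stein entropy flows are $\partial_t\rho=-K^W_\rho\log(\rho/\pi)$ and $\partial_t\rho=-K^S_\rho\log(\rho/\pi)$. The instantaneous entropy dissipation is $\frac{d}{dt}\mathrm{Ent}_\pi(\rho_t)$ along the respective flow, namely $-\|u_\rho\|^2_{L^2(\rho)}$ (Wasserstein) and $-\|I_\rho^*u_\rho\|^2_{\mathcal H_k}=-\langle u_\rho,M_\rho u_\rho\rangle_{L^2(\rho)}$ (Stein). The same unparametrised trajectory means the same curve of laws up to a change of time. *)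

theory Defs
  imports "HOL-Analysis.Analysis"
begin

section \<open>Smoothness on open subsets of Euclidean space\<close>

fun iter_deriv :: "'e::euclidean_space list \<Rightarrow> ('e \<Rightarrow> 'f::real_normed_vector) \<Rightarrow> 'e \<Rightarrow> 'f" where
  "iter_deriv [] f = f"
| "iter_deriv (v # vs) f = (\<lambda>x. frechet_derivative (iter_deriv vs f) (at x) v)"

text \<open>\<open>C\<^sup>\<infinity>\<close>: every iterated directional derivative is again Frechet differentiable (hence continuous).
  Only meant for open \<open>S\<close>.\<close>

definition smooth_on :: "'e::euclidean_space set \<Rightarrow> ('e \<Rightarrow> 'f::real_normed_vector) \<Rightarrow> bool" where
  "smooth_on S f \<longleftrightarrow> (\<forall>vs. \<forall>x\<in>S. iter_deriv vs f differentiable (at x))"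

definition C1_on :: "'e::euclidean_space set \<Rightarrow> ('e \<Rightarrow> 'f::real_normed_vector) \<Rightarrow> bool" where
  "C1_on S f \<longleftrightarrow> (\<forall>x\<in>S. f differentiable (at x)) \<and>
     (\<forall>v. continuous_on S (\<lambda>x. frechet_derivative f (at x) v))"


section \<open>Closed oriented Riemannian manifolds\<close>

text \<open>A chart is a domain together with a coordinate map, of which only the values on the
  domain matter.  The dimension is \<open>CARD('n)\<close>.

  The tangent space at \<open>p\<close> is realised as \<open>\<real>\<^sup>n\<close>, a tangent vector being given by its components in
  the distinguished chart \<open>chart_at S p\<close>.  Since the distinguished chart jumps from
  point to point, regularity of a vector field always refers to its components
  \<open>coord S c V\<close> in one and the same chart \<open>c\<close>.\<close>

type_synonym ('a, 'n) chart = "'a set \<times> ('a \<Rightarrow> real ^ 'n)"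

type_synonym ('a, 'n) vfield = "'a \<Rightarrow> real ^ 'n"

record ('a, 'n::finite) riemannian =
  mtop :: "'a topology"
  atlas :: "('a, 'n) chart set"
  metric :: "'a \<Rightarrow> real ^ 'n \<Rightarrow> real ^ 'n \<Rightarrow> real"
  vol :: "'a measure"

abbreviation pts :: "('a, 'n::finite, 'z) riemannian_scheme \<Rightarrow> 'a set" where
  "pts S \<equiv> topspace (mtop S)"

abbreviation cdom :: "('a, 'n::finite) chart \<Rightarrow> 'a set" where
  "cdom c \<equiv> fst c"

abbreviation cmap :: "('a, 'n::finite) chart \<Rightarrow> 'a \<Rightarrow> real ^ 'n" where
  "cmap c \<equiv> snd c"

abbreviation img :: "('a, 'n::finite) chart \<Rightarrow> (real ^ 'n) set" where
  "img c \<equiv> cmap c ` cdom c"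

definition cinv :: "('a, 'n::finite) chart \<Rightarrow> real ^ 'n \<Rightarrow> 'a" where
  "cinv c = inv_into (cdom c) (cmap c)"

definition trans_map :: "('a, 'n::finite) chart \<Rightarrow> ('a, 'n) chart \<Rightarrow> real ^ 'n \<Rightarrow> real ^ 'n" where
  "trans_map c d = cmap d \<circ> cinv c"

text \<open>Change of components at \<open>p\<close> from the chart \<open>c\<close> to the chart \<open>d\<close>.\<close>

definition jac :: "('a, 'n::finite) chart \<Rightarrow> ('a, 'n) chart \<Rightarrow> 'a \<Rightarrow> real ^ 'n \<Rightarrow> real ^ 'n" where
  "jac c d p = frechet_derivative (trans_map c d) (at (cmap c p))"

definition closed_oriented_manifold :: "('a, 'n::finite, 'z) riemannian_scheme \<Rightarrow> bool" where
  "closed_oriented_manifold S \<longleftrightarrow>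
     pts S \<noteq> {} \<and> compact_space (mtop S) \<and> connected_space (mtop S) \<and>
     Hausdorff_space (mtop S) \<and> second_countable (mtop S) \<and>
     (\<Union>c\<in>atlas S. cdom c) = pts S \<and>
     (\<forall>c\<in>atlas S. openin (mtop S) (cdom c) \<and> open (img c) \<and>
        homeomorphic_map (subtopology (mtop S) (cdom c)) (top_of_set (img c)) (cmap c)) \<and>
     (\<forall>c\<in>atlas S. \<forall>d\<in>atlas S.
        smooth_on (cmap c ` (cdom c \<inter> cdom d)) (trans_map c d) \<and>
        (\<forall>p\<in>cdom c \<inter> cdom d. det (matrix (jac c d p)) > 0))"

definition chart_at :: "('a, 'n::finite, 'z) riemannian_scheme \<Rightarrow> 'a \<Rightarrow> ('a, 'n) chart" where
  "chart_at S p = (SOME c. c \<in> atlas S \<and> p \<in> cdom c)"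

definition coord ::
  "('a, 'n::finite, 'z) riemannian_scheme \<Rightarrow> ('a, 'n) chart \<Rightarrow> ('a, 'n) vfield \<Rightarrow> 'a \<Rightarrow> real ^ 'n" where
  "coord S c V p = jac (chart_at S p) c p (V p)"

text \<open>\<open>frame S c p w\<close> is the tangent vector at \<open>p\<close> with components \<open>w\<close> in the chart \<open>c\<close>.\<close>

definition frame ::
  "('a, 'n::finite, 'z) riemannian_scheme \<Rightarrow> ('a, 'n) chart \<Rightarrow> 'a \<Rightarrow> real ^ 'n \<Rightarrow> real ^ 'n" where
  "frame S c p w = jac c (chart_at S p) p w"

definition smooth_fun :: "('a, 'n::finite, 'z) riemannian_scheme \<Rightarrow> ('a \<Rightarrow> real) \<Rightarrow> bool" where
  "smooth_fun S f \<longleftrightarrow> (\<forall>c\<in>atlas S. smooth_on (img c) (f \<circ> cinv c))"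

definition C1_vfield :: "('a, 'n::finite, 'z) riemannian_scheme \<Rightarrow> ('a, 'n) vfield \<Rightarrow> bool" where
  "C1_vfield S V \<longleftrightarrow> (\<forall>x. x \<notin> pts S \<longrightarrow> V x = 0) \<and>
     (\<forall>c\<in>atlas S. C1_on (img c) (coord S c V \<circ> cinv c))"

text \<open>The matrix \<open>g\<^sub>i\<^sub>j\<close> of the metric in the chart \<open>c\<close>.\<close>

definition gram ::
  "('a, 'n::finite, 'z) riemannian_scheme \<Rightarrow> ('a, 'n) chart \<Rightarrow> 'a \<Rightarrow> real ^ 'n ^ 'n" where
  "gram S c p = (\<chi> i j. metric S p (frame S c p (axis i 1)) (frame S c p (axis j 1)))"

definition riemannian_metric :: "('a, 'n::finite, 'z) riemannian_scheme \<Rightarrow> bool" where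
  "riemannian_metric S \<longleftrightarrow>
     (\<forall>p\<in>pts S. bilinear (metric S p) \<and>
        (\<forall>v w. metric S p v w = metric S p w v) \<and>
        (\<forall>v. v \<noteq> 0 \<longrightarrow> metric S p v v > 0)) \<and>
     (\<forall>c\<in>atlas S. smooth_on (img c) (gram S c \<circ> cinv c))"

text \<open>The measure with density \<open>sqrt (det g\<^sub>i\<^sub>j)\<close> with respect to Lebesgue measure in each chart.\<close>

definition riemannian_volume :: "('a, 'n::finite, 'z) riemannian_scheme \<Rightarrow> bool" where
  "riemannian_volume S \<longleftrightarrow>
     space (vol S) = pts S \<and>
     sets (vol S) = sigma_sets (pts S) {U. openin (mtop S) U} \<and>
     (\<forall>c\<in>atlas S. \<forall>B\<in>sets (vol S). B \<subseteq> cdom c \<longrightarrow>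
        emeasure (vol S) B =
          (\<integral>\<^sup>+ y\<in>cmap c ` B. ennreal (sqrt (det (gram S c (cinv c y)))) \<partial>lborel))"

definition closed_riemannian :: "('a, 'n::finite, 'z) riemannian_scheme \<Rightarrow> bool" where
  "closed_riemannian S \<longleftrightarrow>
     closed_oriented_manifold S \<and> riemannian_metric S \<and> riemannian_volume S"

definition grad :: "('a, 'n::finite, 'z) riemannian_scheme \<Rightarrow> ('a \<Rightarrow> real) \<Rightarrow> ('a, 'n) vfield" where
  "grad S f p = (if p \<in> pts S
     then (THE w. \<forall>v. metric S p w v =
             frechet_derivative (f \<circ> cinv (chart_at S p)) (at (cmap (chart_at S p) p)) v)
     else 0)"

text \<open>\<open>div V = (det g)\<^sup>-\<^sup>1\<^sup>/\<^sup>2 \<Sum>\<^sub>i \<partial>\<^sub>i ((det g)\<^sup>1\<^sup>/\<^sup>2 V\<^sup>i)\<close>, evaluated in the distinguished chart at the point;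
  the value does not depend on the chart.\<close>

definition divergence :: "('a, 'n::finite, 'z) riemannian_scheme \<Rightarrow> ('a, 'n) vfield \<Rightarrow> 'a \<Rightarrow> real" where
  "divergence S V p =
     (let c = chart_at S p;
          sg = (\<lambda>y. sqrt (det (gram S c (cinv c y))))
      in (\<Sum>i\<in>UNIV. frechet_derivative (\<lambda>y. sg y * coord S c V (cinv c y) $ i)
                      (at (cmap c p)) (axis i 1)) / sg (cmap c p))"


section \<open>Densities, relative entropy and the horizontal projection\<close>

definition densities :: "('a, 'n::finite, 'z) riemannian_scheme \<Rightarrow> ('a \<Rightarrow> real) set" where
  "densities S = {\<rho>. smooth_fun S \<rho> \<and> (\<forall>x\<in>pts S. \<rho> x > 0) \<and> (\<forall>x. x \<notin> pts S \<longrightarrow> \<rho> x = 0) \<and>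
     integral\<^sup>L (vol S) \<rho> = 1}"

definition Ent ::
  "('a, 'n::finite, 'z) riemannian_scheme \<Rightarrow> ('a \<Rightarrow> real) \<Rightarrow> ('a \<Rightarrow> real) \<Rightarrow> real" where
  "Ent S \<pi> \<rho> = (\<integral>x. \<rho> x * ln (\<rho> x / \<pi> x) \<partial>vol S)"

definition log_ratio :: "('a \<Rightarrow> real) \<Rightarrow> ('a \<Rightarrow> real) \<Rightarrow> 'a \<Rightarrow> real" where
  "log_ratio \<pi> \<rho> = (\<lambda>x. ln (\<rho> x / \<pi> x))"

definition entropy_grad ::
  "('a, 'n::finite, 'z) riemannian_scheme \<Rightarrow> ('a \<Rightarrow> real) \<Rightarrow> ('a \<Rightarrow> real) \<Rightarrow> ('a, 'n) vfield" where
  "entropy_grad S \<pi> \<rho> = grad S (log_ratio \<pi> \<rho>)"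

text \<open>Elements of \<open>L\<^sup>2(\<rho>;TM)\<close> are represented by vector fields; equality in \<open>L\<^sup>2(\<rho>;TM)\<close> is equality
  almost everywhere.\<close>

definition L2_fields ::
  "('a, 'n::finite, 'z) riemannian_scheme \<Rightarrow> ('a \<Rightarrow> real) \<Rightarrow> ('a, 'n) vfield set" where
  "L2_fields S \<rho> = {V. (\<forall>x. x \<notin> pts S \<longrightarrow> V x = 0) \<and>
     (\<forall>c\<in>atlas S. coord S c V \<in> borel_measurable (restrict_space (vol S) (cdom c))) \<and>
     integrable (vol S) (\<lambda>x. metric S x (V x) (V x) * \<rho> x)}"

definition L2_inner ::
  "('a, 'n::finite, 'z) riemannian_scheme \<Rightarrow> ('a \<Rightarrow> real) \<Rightarrow>
     ('a, 'n) vfield \<Rightarrow> ('a, 'n) vfield \<Rightarrow> real" where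
  "L2_inner S \<rho> U V = (\<integral>x. metric S x (U x) (V x) * \<rho> x \<partial>vol S)"

definition HW ::
  "('a, 'n::finite, 'z) riemannian_scheme \<Rightarrow> ('a \<Rightarrow> real) \<Rightarrow> ('a, 'n) vfield set" where
  "HW S \<rho> = {V \<in> L2_fields S \<rho>. \<forall>e>0. \<exists>f. smooth_fun S f \<and>
     L2_inner S \<rho> (\<lambda>x. V x - grad S f x) (\<lambda>x. V x - grad S f x) < e}"

text \<open>A representative of the orthogonal projection onto \<open>H\<^sup>W\<^sub>\<rho>\<close>, determined up to null sets.\<close>

definition P_hor ::
  "('a, 'n::finite, 'z) riemannian_scheme \<Rightarrow> ('a \<Rightarrow> real) \<Rightarrow> ('a, 'n) vfield \<Rightarrow> ('a, 'n) vfield" where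
  "P_hor S \<rho> V = (SOME W. W \<in> HW S \<rho> \<and> (\<forall>Z\<in>HW S \<rho>. L2_inner S \<rho> (\<lambda>x. V x - W x) Z = 0))"


section \<open>The reproducing kernel Hilbert space\<close>

text \<open>\<open>kernel S x y\<close> maps the tangent space at \<open>x\<close> to the tangent space at \<open>y\<close>.  The Hilbert space
  \<open>\<H>\<^sub>k\<close> has underlying set \<open>rkhs S\<close> and inner product \<open>rkhs_inner S\<close>; it is uniquely determined by
  \<open>kernel S\<close> through the predicate \<open>reproducing_space\<close>.\<close>

record ('a, 'n::finite) stein = "('a, 'n) riemannian" +
  kernel :: "'a \<Rightarrow> 'a \<Rightarrow> real ^ 'n \<Rightarrow> real ^ 'n"
  rkhs :: "('a \<Rightarrow> real ^ 'n) set"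
  rkhs_inner :: "('a \<Rightarrow> real ^ 'n) \<Rightarrow> ('a \<Rightarrow> real ^ 'n) \<Rightarrow> real"

definition smooth_pd_kernel :: "('a, 'n::finite, 'z) stein_scheme \<Rightarrow> bool" where
  "smooth_pd_kernel S \<longleftrightarrow>
     (\<forall>x\<in>pts S. \<forall>y\<in>pts S. linear (kernel S x y) \<and>
        (\<forall>v w. metric S y (kernel S x y v) w = metric S x v (kernel S y x w))) \<and>
     (\<forall>F v. finite F \<and> F \<subseteq> pts S \<longrightarrow>
        0 \<le> (\<Sum>x\<in>F. \<Sum>y\<in>F. metric S y (kernel S x y (v x)) (v y))) \<and>
     (\<forall>c\<in>atlas S. \<forall>d\<in>atlas S. \<forall>w.
        smooth_on (img c \<times> img d)
          (\<lambda>(a, b). jac (chart_at S (cinv d b)) d (cinv d b)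
                      (kernel S (cinv c a) (cinv d b) (frame S c (cinv c a) w))))"

definition kernel_section ::
  "('a, 'n::finite, 'z) stein_scheme \<Rightarrow> 'a \<Rightarrow> real ^ 'n \<Rightarrow> ('a, 'n) vfield" where
  "kernel_section S x v = (\<lambda>y. if y \<in> pts S then kernel S x y v else 0)"

definition rkhs_norm :: "('a, 'n::finite, 'z) stein_scheme \<Rightarrow> ('a, 'n) vfield \<Rightarrow> real" where
  "rkhs_norm S V = sqrt (rkhs_inner S V V)"

definition hilbert_space_of_fields :: "('a, 'n::finite, 'z) stein_scheme \<Rightarrow> bool" where
  "hilbert_space_of_fields S \<longleftrightarrow>
     (\<forall>V\<in>rkhs S. \<forall>x. x \<notin> pts S \<longrightarrow> V x = 0) \<and>
     (\<lambda>x. 0) \<in> rkhs S \<and>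
     (\<forall>U\<in>rkhs S. \<forall>V\<in>rkhs S. (\<lambda>x. U x + V x) \<in> rkhs S) \<and>
     (\<forall>r. \<forall>V\<in>rkhs S. (\<lambda>x. r *\<^sub>R V x) \<in> rkhs S) \<and>
     (\<forall>U\<in>rkhs S. \<forall>V\<in>rkhs S. rkhs_inner S U V = rkhs_inner S V U) \<and>
     (\<forall>U\<in>rkhs S. \<forall>V\<in>rkhs S. \<forall>W\<in>rkhs S.
        rkhs_inner S (\<lambda>x. U x + V x) W = rkhs_inner S U W + rkhs_inner S V W) \<and>
     (\<forall>r. \<forall>U\<in>rkhs S. \<forall>V\<in>rkhs S. rkhs_inner S (\<lambda>x. r *\<^sub>R U x) V = r * rkhs_inner S U V) \<and>
     (\<forall>V\<in>rkhs S. V \<noteq> (\<lambda>x. 0) \<longrightarrow> rkhs_inner S V V > 0) \<and>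
     (\<forall>F :: nat \<Rightarrow> 'a \<Rightarrow> real ^ 'n. (\<forall>n. F n \<in> rkhs S) \<and>
        (\<forall>e>0. \<exists>N. \<forall>m\<ge>N. \<forall>n\<ge>N. rkhs_norm S (\<lambda>x. F m x - F n x) < e) \<longrightarrow>
        (\<exists>L\<in>rkhs S. (\<lambda>n. rkhs_norm S (\<lambda>x. F n x - L x)) \<longlonglongrightarrow> 0))"

definition reproducing_space :: "('a, 'n::finite, 'z) stein_scheme \<Rightarrow> bool" where
  "reproducing_space S \<longleftrightarrow> hilbert_space_of_fields S \<and>
     (\<forall>x\<in>pts S. \<forall>v. kernel_section S x v \<in> rkhs S \<and>
        (\<forall>V\<in>rkhs S. rkhs_inner S V (kernel_section S x v) = metric S x (V x) v))"

text \<open>Continuity of the inclusion is stated for the seminorms generating the \<open>C\<^sup>1\<close> topology.\<close>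

definition continuously_in_C1 :: "('a, 'n::finite, 'z) stein_scheme \<Rightarrow> bool" where
  "continuously_in_C1 S \<longleftrightarrow>
     (\<forall>V\<in>rkhs S. C1_vfield S V) \<and>
     (\<forall>c\<in>atlas S. \<forall>K. compact K \<and> K \<subseteq> img c \<longrightarrow>
        (\<exists>C. \<forall>V\<in>rkhs S. \<forall>y\<in>K.
           norm (coord S c V (cinv c y)) \<le> C * rkhs_norm S V \<and>
           (\<forall>w. norm (frechet_derivative (coord S c V \<circ> cinv c) (at y) w)
                  \<le> C * rkhs_norm S V * norm w)))"

definition stein_setting :: "('a, 'n::finite, 'z) stein_scheme \<Rightarrow> bool" where
  "stein_setting S \<longleftrightarrow> closed_riemannian S \<and> smooth_pd_kernel S \<and> reproducing_space S \<and>
     continuously_in_C1 S"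

text \<open>The adjoint \<open>I\<^sub>\<rho>\<^sup>*\<close> of the inclusion.  The inclusion \<open>I\<^sub>\<rho>\<close> itself is the identity on vector
  fields and is not written.\<close>

definition I_adj ::
  "('a, 'n::finite, 'z) stein_scheme \<Rightarrow> ('a \<Rightarrow> real) \<Rightarrow> ('a, 'n) vfield \<Rightarrow> ('a, 'n) vfield" where
  "I_adj S \<rho> V = (THE W. W \<in> rkhs S \<and> (\<forall>h\<in>rkhs S. rkhs_inner S W h = L2_inner S \<rho> V h))"

definition M_op ::
  "('a, 'n::finite, 'z) stein_scheme \<Rightarrow> ('a \<Rightarrow> real) \<Rightarrow> ('a, 'n) vfield \<Rightarrow> ('a, 'n) vfield" where
  "M_op S \<rho> V = P_hor S \<rho> (I_adj S \<rho> V)"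

definition K_W ::
  "('a, 'n::finite, 'z) riemannian_scheme \<Rightarrow> ('a \<Rightarrow> real) \<Rightarrow> ('a \<Rightarrow> real) \<Rightarrow> 'a \<Rightarrow> real" where
  "K_W S \<rho> f = (\<lambda>x. - divergence S (\<lambda>p. \<rho> p *\<^sub>R grad S f p) x)"

definition K_S ::
  "('a, 'n::finite, 'z) stein_scheme \<Rightarrow> ('a \<Rightarrow> real) \<Rightarrow> ('a \<Rightarrow> real) \<Rightarrow> 'a \<Rightarrow> real" where
  "K_S S \<rho> f = (\<lambda>x. - divergence S (\<lambda>p. \<rho> p *\<^sub>R I_adj S \<rho> (grad S f) p) x)"


section \<open>Entropy flows\<close>

text \<open>The joint continuity condition says that \<open>r\<close> is continuous from \<open>J\<close> into the densities with
  their \<open>C\<^sup>\<infinity>\<close> topology.\<close>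

definition law_curve ::
  "('a, 'n::finite, 'z) riemannian_scheme \<Rightarrow> real set \<Rightarrow> (real \<Rightarrow> 'a \<Rightarrow> real) \<Rightarrow> bool" where
  "law_curve S J r \<longleftrightarrow> is_interval J \<and> interior J \<noteq> {} \<and> (\<forall>t\<in>J. r t \<in> densities S) \<and>
     (\<forall>c\<in>atlas S. \<forall>vs. continuous_on (J \<times> img c) (\<lambda>(t, y). iter_deriv vs (r t \<circ> cinv c) y))"

definition wasserstein_flow ::
  "('a, 'n::finite, 'z) riemannian_scheme \<Rightarrow> ('a \<Rightarrow> real) \<Rightarrow> real set \<Rightarrow> (real \<Rightarrow> 'a \<Rightarrow> real) \<Rightarrow> bool" where
  "wasserstein_flow S \<pi> J r \<longleftrightarrow> law_curve S J r \<and>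
     (\<forall>t\<in>J. \<forall>x\<in>pts S. ((\<lambda>s. r s x) has_real_derivative - K_W S (r t) (log_ratio \<pi> (r t)) x)
        (at t within J))"

definition stein_flow ::
  "('a, 'n::finite, 'z) stein_scheme \<Rightarrow> ('a \<Rightarrow> real) \<Rightarrow> real set \<Rightarrow> (real \<Rightarrow> 'a \<Rightarrow> real) \<Rightarrow> bool" where
  "stein_flow S \<pi> J r \<longleftrightarrow> law_curve S J r \<and>
     (\<forall>t\<in>J. \<forall>x\<in>pts S. ((\<lambda>s. r s x) has_real_derivative - K_S S (r t) (log_ratio \<pi> (r t)) x)
        (at t within J))"

definition time_change :: "(real \<Rightarrow> real) \<Rightarrow> real set \<Rightarrow> real set \<Rightarrow> bool" where
  "time_change \<tau> J' J \<longleftrightarrow> bij_betw \<tau> J' J \<and>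
     (\<exists>\<tau>'. continuous_on J' \<tau>' \<and>
        (\<forall>s\<in>J'. \<tau>' s > 0 \<and> (\<tau> has_real_derivative \<tau>' s) (at s within J')))"

definition same_unparametrised_trajectories ::
  "('a, 'n::finite, 'z) stein_scheme \<Rightarrow> ('a \<Rightarrow> real) \<Rightarrow> ('a \<Rightarrow> real) set \<Rightarrow> bool" where
  "same_unparametrised_trajectories S \<pi> R \<longleftrightarrow>
     (\<forall>J r. stein_flow S \<pi> J r \<and> r ` J \<subseteq> R \<longrightarrow>
        (\<exists>J' \<tau>. time_change \<tau> J' J \<and> wasserstein_flow S \<pi> J' (r \<circ> \<tau>))) \<and>
     (\<forall>J r. wasserstein_flow S \<pi> J r \<and> r ` J \<subseteq> R \<longrightarrow>
        (\<exists>J' \<tau>. time_change \<tau> J' J \<and> stein_flow S \<pi> J' (r \<circ> \<tau>)))"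

text \<open>The rate of change of the entropy at \<open>\<rho>\<close> in the direction of the density tangent \<open>\<sigma>\<close>, and its
  values for the velocities of the two flows.\<close>

definition Ent_rate ::
  "('a, 'n::finite, 'z) riemannian_scheme \<Rightarrow> ('a \<Rightarrow> real) \<Rightarrow> ('a \<Rightarrow> real) \<Rightarrow> ('a \<Rightarrow> real) \<Rightarrow> real" where
  "Ent_rate S \<pi> \<rho> \<sigma> = deriv (\<lambda>t. Ent S \<pi> (\<lambda>x. \<rho> x + t * \<sigma> x)) 0"

definition dissipation_W ::
  "('a, 'n::finite, 'z) riemannian_scheme \<Rightarrow> ('a \<Rightarrow> real) \<Rightarrow> ('a \<Rightarrow> real) \<Rightarrow> real" where
  "dissipation_W S \<pi> \<rho> = Ent_rate S \<pi> \<rho> (\<lambda>x. - K_W S \<rho> (log_ratio \<pi> \<rho>) x)"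

definition dissipation_S ::
  "('a, 'n::finite, 'z) stein_scheme \<Rightarrow> ('a \<Rightarrow> real) \<Rightarrow> ('a \<Rightarrow> real) \<Rightarrow> real" where
  "dissipation_S S \<pi> \<rho> = Ent_rate S \<pi> \<rho> (\<lambda>x. - K_S S \<rho> (log_ratio \<pi> \<rho>) x)"

end

theory Submission
  imports Defs
begin

text \<open>
  Every claim about \<open>K\<^sup>W\<close> and \<open>K\<^sup>S\<close> is decided by testing against smooth functions \<open>f\<close>.  Write
  \<open>u = grad (log (\<rho>/\<pi>))\<close> and \<open>b = I\<^sup>* u\<close>.  Green's formula (\<open>green\<close>) gives
  \<open>\<integral> f K\<^sup>W log (\<rho>/\<pi>) = \<langle>u, grad f\<rangle>\<close> and \<open>\<integral> f K\<^sup>S log (\<rho>/\<pi>) = \<langle>b, grad f\<rangle>\<close> in \<open>L\<^sup>2(\<rho>)\<close>.  Hence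
  \<open>K\<^sup>S = r K\<^sup>W\<close> holds at every point exactly when \<open>b - r u\<close> is orthogonal to all gradients, that is,
  when the horizontal projection of \<open>b\<close>, which is \<open>M u\<close>, equals \<open>r u\<close>
  (\<open>tangents_proportional_iff\<close>).  For \<open>r = 1\<close> this is the criterion for equal law tangents.  The
  choice \<open>f = log (\<rho>/\<pi>) + 1\<close> evaluates the dissipations as \<open>- \<langle>u, u\<rangle>\<close> and
  \<open>- \<langle>u, b\<rangle> = - \<langle>u, M u\<rangle>\<close>, both for the rate of change of the entropy in the direction of the tangent
  (\<open>dissipation_W_eq\<close>, \<open>dissipation_S_eq\<close>) and along the flows (\<open>entropy_along_W\<close>, \<open>entropy_along_S\<close>).
  The projection and the adjoint exist by the theorem of Riesz (\<open>riesz_representation\<close>), the former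
  because \<open>L\<^sup>2(\<rho>;TM)\<close> is complete (\<open>L2_complete\<close>).

  If \<open>M u = a u\<close> on a region, then along a curve in the region the Stein velocity is \<open>a\<close> times the
  Wasserstein velocity, and a change of time with speed \<open>a\<close> turns one flow into the other.  The
  speed has to be continuous.  Pairing \<open>M u = a u\<close> with \<open>u\<close> shows that \<open>a\<close> is the quotient of
  \<open>\<parallel>b\<parallel>\<^sup>2\<close> (norm of the kernel space) and \<open>\<parallel>u\<parallel>\<^sup>2\<close>, which is continuous in time as long as the curve stays away from \<open>\<pi>\<close>, the only
  density with \<open>u = 0\<close>.  At \<open>\<pi>\<close> itself \<open>a\<close> is arbitrary, so it must be excluded that a flow
  passes through \<open>\<pi>\<close> without resting there (\<open>equilibrium_propagates\<close>).  The Wasserstein entropy flow is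
  linear in \<open>h = \<rho>/\<pi> - 1\<close> and symmetric in \<open>L\<^sup>2(\<pi>)\<close>.  Therefore the pairing of \<open>h\<close> at the times
  \<open>m + s\<close> and \<open>m - s\<close> does not depend on \<open>s\<close> (\<open>cov_reflection\<close>), and a solution which tends to \<open>0\<close> at one end of a bounded
  time interval vanishes at its midpoint.  A Stein flow in the region is brought into this form by a change of
  time; the interval stays bounded because \<open>\<parallel>b\<parallel>\<^sup>2 \<le> C \<parallel>u\<parallel>\<^sup>2\<close>.

  For the last claim take a kernel of rank one, \<open>k(x,y) v = \<langle>e(x), v\<rangle> e(y)\<close>, so that \<open>b = \<langle>u, e\<rangle> e\<close> and
  \<open>\<langle>u, M u\<rangle> = \<langle>u, e\<rangle>\<^sup>2\<close>.  With \<open>e = u / \<parallel>u\<parallel> + h\<close> for a gradient \<open>h \<noteq> 0\<close> orthogonal to \<open>u\<close>, the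
  dissipations agree, but \<open>b = u + \<parallel>u\<parallel> h\<close> has the horizontal component \<open>\<parallel>u\<parallel> h\<close> in excess of \<open>u\<close>
  (\<open>equal_dissipation_distinct_tangents\<close>).  On the unit circle such a gradient is found in \<open>circle_example\<close>.
\<close>

section \<open>Families of functions of class C^k\<close>

text \<open>A family \<open>F\<close> depending on a time \<open>t\<close> that has spatial derivatives up
  to order \<open>k\<close>, all jointly continuous in time and space.  Curves of densities are
  such families, so every estimate that is uniform on compact time intervals can be read off from
  compactness.  Single functions are the constant families.\<close>

fun Cfam :: "nat \<Rightarrow> real set \<Rightarrow> 'e::euclidean_space set \<Rightarrow> (real \<Rightarrow> 'e \<Rightarrow> 'f::real_normed_vector) \<Rightarrow> bool" where
  "Cfam 0 J U F = continuous_on (J \<times> U) (\<lambda>(t, y). F t y)"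
| "Cfam (Suc k) J U F = (continuous_on (J \<times> U) (\<lambda>(t, y). F t y) \<and>
     (\<forall>t\<in>J. \<forall>y\<in>U. F t differentiable (at y)) \<and>
     (\<forall>v. Cfam k J U (\<lambda>t y. frechet_derivative (F t) (at y) v)))"

abbreviation Ck :: "nat \<Rightarrow> 'e::euclidean_space set \<Rightarrow> ('e \<Rightarrow> 'f::real_normed_vector) \<Rightarrow> bool" where
  "Ck k U f \<equiv> Cfam k UNIV U (\<lambda>_. f)"

lemma Cfam_continuous: "Cfam k J U F \<Longrightarrow> continuous_on (J \<times> U) (\<lambda>(t, y). F t y)"
  by (cases k) auto

lemma Cfam_differentiable: "Cfam (Suc k) J U F \<Longrightarrow> t \<in> J \<Longrightarrow> y \<in> U \<Longrightarrow> F t differentiable (at y)"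
  by auto

lemma Cfam_deriv: "Cfam (Suc k) J U F \<Longrightarrow> Cfam k J U (\<lambda>t y. frechet_derivative (F t) (at y) v)"
  by auto

lemma Cfam_has_derivative:
  "Cfam (Suc k) J U F \<Longrightarrow> t \<in> J \<Longrightarrow> y \<in> U \<Longrightarrow> (F t has_derivative frechet_derivative (F t) (at y)) (at y)"
  by (simp add: frechet_derivative_works[symmetric])

lemma Cfam_SucD: "Cfam (Suc k) J U F \<Longrightarrow> Cfam k J U F"
  by (induction k arbitrary: F) auto

lemma Cfam_le: "Cfam m J U F \<Longrightarrow> k \<le> m \<Longrightarrow> Cfam k J U F"
  by (induction m) (auto simp: le_Suc_eq simp del: Cfam.simps dest: Cfam_SucD)

lemma Cfam_subset: "Cfam k J U F \<Longrightarrow> J' \<subseteq> J \<Longrightarrow> U' \<subseteq> U \<Longrightarrow> Cfam k J' U' F"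
proof (induction k arbitrary: F)
  case 0 then show ?case by (auto intro: continuous_on_subset)
next
  case (Suc k)
  have "continuous_on (J' \<times> U') (\<lambda>(t, y). F t y)"
    by (rule continuous_on_subset[OF Cfam_continuous[OF Suc.prems(1)]]) (use Suc.prems in auto)
  then show ?case using Suc.IH[OF Cfam_deriv[OF Suc.prems(1)]] Suc.prems by (simp add: subset_iff)
qed

lemma frechet_derivative_cong_open:
  assumes "open U" "y \<in> U" "\<And>z. z \<in> U \<Longrightarrow> f z = g z"
  shows "frechet_derivative f (at y) = frechet_derivative g (at y)"
proof -
  have "(f has_derivative D) (at y) \<longleftrightarrow> (g has_derivative D) (at y)" for D
    using has_derivative_transform_within_open[OF _ assms(1,2), of f D UNIV g]
      has_derivative_transform_within_open[OF _ assms(1,2), of g D UNIV f] assms(3) by auto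
  then show ?thesis unfolding frechet_derivative_def by simp
qed

lemma differentiable_cong_open:
  assumes "open U" "y \<in> U" "\<And>z. z \<in> U \<Longrightarrow> f z = g z"
  shows "f differentiable (at y) \<longleftrightarrow> g differentiable (at y)"
proof -
  have "(f has_derivative D) (at y) \<longleftrightarrow> (g has_derivative D) (at y)" for D
    using has_derivative_transform_within_open[OF _ assms(1,2), of f D UNIV g]
      has_derivative_transform_within_open[OF _ assms(1,2), of g D UNIV f] assms(3) by auto
  then show ?thesis unfolding differentiable_def by simp
qed

lemma Cfam_cong:
  assumes "open U" "\<And>t y. t \<in> J \<Longrightarrow> y \<in> U \<Longrightarrow> F t y = G t y"
  shows "Cfam k J U F \<longleftrightarrow> Cfam k J U G"
  using assms(2)
proof (induction k arbitrary: F G)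
  case 0 then show ?case by (auto intro!: continuous_on_cong)
next
  case (Suc k)
  have 1: "continuous_on (J \<times> U) (\<lambda>(t, y). F t y) \<longleftrightarrow> continuous_on (J \<times> U) (\<lambda>(t, y). G t y)"
    using Suc.prems by (intro continuous_on_cong) auto
  have 2: "F t differentiable (at y) \<longleftrightarrow> G t differentiable (at y)" if "t \<in> J" "y \<in> U" for t y
    using differentiable_cong_open[OF assms(1) that(2)] Suc.prems that by metis
  have 3: "Cfam k J U (\<lambda>t y. frechet_derivative (F t) (at y) v) \<longleftrightarrow>
     Cfam k J U (\<lambda>t y. frechet_derivative (G t) (at y) v)" for v
    by (rule Suc.IH) (metis frechet_derivative_cong_open[OF assms(1)] Suc.prems)
  show ?case using 1 2 3 by simp
qed

lemma Cfam_SucI: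
  assumes "open U" "continuous_on (J \<times> U) (\<lambda>(t, y). F t y)"
    and "\<And>t y. t \<in> J \<Longrightarrow> y \<in> U \<Longrightarrow> (F t has_derivative F' t y) (at y)"
    and "\<And>v. Cfam k J U (\<lambda>t y. F' t y v)"
  shows "Cfam (Suc k) J U F"
proof -
  have "Cfam k J U (\<lambda>t y. frechet_derivative (F t) (at y) v)" for v
    using assms(4)[of v] by (subst Cfam_cong[OF assms(1), of _ _ "\<lambda>t y. F' t y v"])
      (auto simp: frechet_derivative_at[OF assms(3), symmetric])
  then show ?thesis using assms(2,3) by (auto simp: differentiable_def)
qed

text \<open>Being of class \<open>C\<^sup>k\<close> is a local property; this is what allows functions on
  the manifold to be treated chart by chart.\<close>

lemma Cfam_local:
  assumes "open U" "\<And>y. y \<in> U \<Longrightarrow> \<exists>V. open V \<and> y \<in> V \<and> Cfam k J (V \<inter> U) F"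
  shows "Cfam k J U F"
  using assms(2)
proof (induction k arbitrary: F)
  have c: "continuous_on (J \<times> U) (\<lambda>(t, y). F t y)"
    if "\<And>y. y \<in> U \<Longrightarrow> \<exists>V. open V \<and> y \<in> V \<and> Cfam k J (V \<inter> U) F" for F :: "real \<Rightarrow> 'a \<Rightarrow> 'b" and k
    unfolding continuous_on_eq_continuous_within
  proof (safe)
    fix t y assume t: "t \<in> J" "y \<in> U"
    from that[OF t(2)] obtain V where V: "open V" "y \<in> V" "Cfam k J (V \<inter> U) F" by blast
    have "continuous (at (t, y) within J \<times> (V \<inter> U)) (\<lambda>(t, y). F t y)"
      using Cfam_continuous[OF V(3)] t V by (auto simp: continuous_on_eq_continuous_within)
    moreover have "at (t, y) within J \<times> (V \<inter> U) = at (t, y) within J \<times> U"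
      by (rule at_within_nhd[of _ "UNIV \<times> V"]) (use V in \<open>auto intro: open_Times\<close>)
    ultimately show "continuous (at (t, y) within J \<times> U) (\<lambda>(t, y). F t y)" by simp
  qed
  case 0
  from c[OF 0] show ?case by simp
next
  have c: "continuous_on (J \<times> U) (\<lambda>(t, y). F t y)"
    if "\<And>y. y \<in> U \<Longrightarrow> \<exists>V. open V \<and> y \<in> V \<and> Cfam k J (V \<inter> U) F" for F :: "real \<Rightarrow> 'a \<Rightarrow> 'b" and k
    unfolding continuous_on_eq_continuous_within
  proof (safe)
    fix t y assume t: "t \<in> J" "y \<in> U"
    from that[OF t(2)] obtain V where V: "open V" "y \<in> V" "Cfam k J (V \<inter> U) F" by blast
    have "continuous (at (t, y) within J \<times> (V \<inter> U)) (\<lambda>(t, y). F t y)"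
      using Cfam_continuous[OF V(3)] t V by (auto simp: continuous_on_eq_continuous_within)
    moreover have "at (t, y) within J \<times> (V \<inter> U) = at (t, y) within J \<times> U"
      by (rule at_within_nhd[of _ "UNIV \<times> V"]) (use V in \<open>auto intro: open_Times\<close>)
    ultimately show "continuous (at (t, y) within J \<times> U) (\<lambda>(t, y). F t y)" by simp
  qed
  case (Suc k)
  have "\<exists>V. open V \<and> y \<in> V \<and> Cfam k J (V \<inter> U) (\<lambda>t y. frechet_derivative (F t) (at y) v)"
    if "y \<in> U" for y v using Suc.prems[OF that] by auto
  then have "Cfam k J U (\<lambda>t y. frechet_derivative (F t) (at y) v)" for v by (rule Suc.IH)
  moreover have "F t differentiable (at y)" if "t \<in> J" "y \<in> U" for t y
    using Suc.prems[OF that(2)] that by auto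
  ultimately show ?case using c[OF Suc.prems] by auto
qed

lemma Cfam_const: "Cfam k J U (\<lambda>t y. c)"
proof (induction k arbitrary: c)
  case 0 show ?case by (simp add: case_prod_unfold)
next
  case (Suc k)
  have "frechet_derivative (\<lambda>y::'a. c) (at y) v = (0::'b)" for y v
    using frechet_derivative_at[OF has_derivative_const[of c "at y"]] by metis
  then show ?case using Suc.IH[of 0] by (simp add: case_prod_unfold)
qed

lemma Cfam_linear:
  assumes "open U" "bounded_linear L" "Cfam k J U F"
  shows "Cfam k J U (\<lambda>t y. L (F t y))"
  using assms(3)
proof (induction k arbitrary: F)
  case 0
  then show ?case by (auto simp: case_prod_unfold intro: bounded_linear.continuous_on[OF assms(2)])
next
  case (Suc k)
  show ?case
  proof (rule Cfam_SucI[OF assms(1)])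
    show "continuous_on (J \<times> U) (\<lambda>(t, y). L (F t y))"
      using Cfam_continuous[OF Suc.prems] by (auto simp: case_prod_unfold intro: bounded_linear.continuous_on[OF assms(2)])
    show "((\<lambda>y. L (F t y)) has_derivative (\<lambda>v. L (frechet_derivative (F t) (at y) v))) (at y)"
      if "t \<in> J" "y \<in> U" for t y
      using bounded_linear.has_derivative[OF assms(2) Cfam_has_derivative[OF Suc.prems that]] .
    show "Cfam k J U (\<lambda>t y. L (frechet_derivative (F t) (at y) v))" for v
      using Suc.IH[OF Cfam_deriv[OF Suc.prems]] .
  qed
qed

lemma Cfam_add:
  assumes "open U" "Cfam k J U F" "Cfam k J U G"
  shows "Cfam k J U (\<lambda>t y. F t y + G t y)"
  using assms(2,3)
proof (induction k arbitrary: F G)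
  case 0 then show ?case by (auto simp: case_prod_unfold intro: continuous_on_add)
next
  case (Suc k)
  show ?case
  proof (rule Cfam_SucI[OF assms(1)])
    show "continuous_on (J \<times> U) (\<lambda>(t, y). F t y + G t y)"
      using Cfam_continuous[OF Suc.prems(1)] Cfam_continuous[OF Suc.prems(2)]
      by (auto simp: case_prod_unfold intro: continuous_on_add)
    show "((\<lambda>y. F t y + G t y) has_derivative
        (\<lambda>v. frechet_derivative (F t) (at y) v + frechet_derivative (G t) (at y) v)) (at y)"
      if "t \<in> J" "y \<in> U" for t y
      using has_derivative_add[OF Cfam_has_derivative[OF Suc.prems(1) that] Cfam_has_derivative[OF Suc.prems(2) that]] .
  qed (intro Suc.IH Cfam_deriv Suc.prems)
qed

lemma Cfam_sum:
  assumes "open U" "\<And>i. i \<in> I \<Longrightarrow> Cfam k J U (F i)"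
  shows "Cfam k J U (\<lambda>t y. \<Sum>i\<in>I. F i t y)"
  using assms(2)
proof (induction I rule: infinite_finite_induct)
  case (insert x A)
  then show ?case using Cfam_add[OF assms(1), of k J "F x" "\<lambda>t y. \<Sum>i\<in>A. F i t y"] by simp
qed (auto intro: Cfam_const)

lemma Cfam_scaleR:
  fixes f :: "real \<Rightarrow> 'e::euclidean_space \<Rightarrow> real"
  assumes "open U" "Cfam k J U f" "Cfam k J U F"
  shows "Cfam k J U (\<lambda>t y. f t y *\<^sub>R F t y)"
  using assms(2,3)
proof (induction k arbitrary: f F)
  case 0 then show ?case by (auto simp: case_prod_unfold intro: continuous_on_scaleR)
next
  case (Suc k)
  show ?case
  proof (rule Cfam_SucI[OF assms(1)])
    show "continuous_on (J \<times> U) (\<lambda>(t, y). f t y *\<^sub>R F t y)"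
      using Cfam_continuous[OF Suc.prems(1)] Cfam_continuous[OF Suc.prems(2)]
      by (auto simp: case_prod_unfold intro: continuous_on_scaleR)
    show "((\<lambda>y. f t y *\<^sub>R F t y) has_derivative
        (\<lambda>v. f t y *\<^sub>R frechet_derivative (F t) (at y) v + frechet_derivative (f t) (at y) v *\<^sub>R F t y)) (at y)"
      if "t \<in> J" "y \<in> U" for t y
      using has_derivative_scaleR[OF Cfam_has_derivative[OF Suc.prems(1) that] Cfam_has_derivative[OF Suc.prems(2) that]] .
    show "Cfam k J U (\<lambda>t y. f t y *\<^sub>R frechet_derivative (F t) (at y) v + frechet_derivative (f t) (at y) v *\<^sub>R F t y)" for v
      by (intro Cfam_add[OF assms(1)] Suc.IH Cfam_deriv Suc.prems Cfam_SucD[OF Suc.prems(1)] Cfam_SucD[OF Suc.prems(2)])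
  qed
qed

lemma Cfam_mult:
  fixes f g :: "real \<Rightarrow> 'e::euclidean_space \<Rightarrow> real"
  assumes "open U" "Cfam k J U f" "Cfam k J U g"
  shows "Cfam k J U (\<lambda>t y. f t y * g t y)"
  using Cfam_scaleR[OF assms] by simp

lemma Cfam_minus:
  assumes "open U" "Cfam k J U F"
  shows "Cfam k J U (\<lambda>t y. - F t y)"
  using Cfam_linear[OF assms(1) bounded_linear_minus[OF bounded_linear_ident] assms(2)] .

lemma Cfam_diff:
  assumes "open U" "Cfam k J U F" "Cfam k J U G"
  shows "Cfam k J U (\<lambda>t y. F t y - G t y)"
  using Cfam_add[OF assms(1,2) Cfam_minus[OF assms(1,3)]] by simp

lemma Cfam_prod:
  fixes F :: "'i \<Rightarrow> real \<Rightarrow> 'e::euclidean_space \<Rightarrow> real"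
  assumes "open U" "\<And>i. i \<in> I \<Longrightarrow> Cfam k J U (F i)"
  shows "Cfam k J U (\<lambda>t y. \<Prod>i\<in>I. F i t y)"
  using assms(2)
proof (induction I rule: infinite_finite_induct)
  case (insert x A)
  then show ?case using Cfam_mult[OF assms(1), of k J "F x" "\<lambda>t y. \<Prod>i\<in>A. F i t y"] by simp
qed (auto intro: Cfam_const)

text \<open>The chain rule, which reduces the derivative of the composite to sums of products of lower order
  families.\<close>

lemma Cfam_compose:
  fixes F :: "real \<Rightarrow> 'm::euclidean_space \<Rightarrow> 'f::real_normed_vector" and G :: "real \<Rightarrow> 'e::euclidean_space \<Rightarrow> 'm"
  assumes "open U" "\<And>t y. t \<in> J \<Longrightarrow> y \<in> U \<Longrightarrow> G t y \<in> W" "Cfam k J W F" "Cfam k J U G"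
  shows "Cfam k J U (\<lambda>t y. F t (G t y))"
  using assms(3,4)
proof (induction k arbitrary: F)
  have c: "continuous_on (J \<times> U) (\<lambda>(t, y). F t (G t y))" if "Cfam k J W F" "Cfam k J U G"
    for k and F :: "real \<Rightarrow> 'm \<Rightarrow> 'f"
  proof -
    have "continuous_on (J \<times> U) (\<lambda>p. (fst p, G (fst p) (snd p)))"
      using Cfam_continuous[OF that(2)] by (auto simp: case_prod_unfold intro!: continuous_intros)
    from continuous_on_compose2[OF Cfam_continuous[OF that(1)] this]
    have "continuous_on (J \<times> U) (\<lambda>x. case (fst x, G (fst x) (snd x)) of (t, y) \<Rightarrow> F t y)"
      using assms(2) by force
    then show ?thesis by (simp add: case_prod_unfold)
  qed
  case 0
  from c[OF 0] show ?case by simp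
next
  have c: "continuous_on (J \<times> U) (\<lambda>(t, y). F t (G t y))" if "Cfam k J W F" "Cfam k J U G"
    for k and F :: "real \<Rightarrow> 'm \<Rightarrow> 'f"
  proof -
    have "continuous_on (J \<times> U) (\<lambda>p. (fst p, G (fst p) (snd p)))"
      using Cfam_continuous[OF that(2)] by (auto simp: case_prod_unfold intro!: continuous_intros)
    from continuous_on_compose2[OF Cfam_continuous[OF that(1)] this]
    have "continuous_on (J \<times> U) (\<lambda>x. case (fst x, G (fst x) (snd x)) of (t, y) \<Rightarrow> F t y)"
      using assms(2) by force
    then show ?thesis by (simp add: case_prod_unfold)
  qed
  case (Suc k)
  show ?case
  proof (rule Cfam_SucI[OF assms(1)])
    show "continuous_on (J \<times> U) (\<lambda>(t, y). F t (G t y))" by (rule c[OF Suc.prems])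
    show "((\<lambda>y. F t (G t y)) has_derivative (\<lambda>v. \<Sum>b\<in>Basis. (frechet_derivative (G t) (at y) v \<bullet> b) *\<^sub>R
        frechet_derivative (F t) (at (G t y)) b)) (at y)"
      if "t \<in> J" "y \<in> U" for t y
    proof -
      let ?D = "frechet_derivative (F t) (at (G t y))"
      have d: "(F t has_derivative ?D) (at (G t y))"
        using Cfam_has_derivative[OF Suc.prems(1) that(1) assms(2)[OF that]] .
      have l: "linear ?D" using has_derivative_linear[OF d] .
      have "?D w = (\<Sum>b\<in>Basis. (w \<bullet> b) *\<^sub>R ?D b)" for w
        by (subst (1) euclidean_representation[symmetric, of w]) (simp add: linear_sum[OF l] linear_scale[OF l])
      from has_derivative_eq_rhs[OF has_derivative_compose[OF Cfam_has_derivative[OF Suc.prems(2) that] d] ext, OF this]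
      show ?thesis .
    qed
    show "Cfam k J U (\<lambda>t y. \<Sum>b\<in>Basis. (frechet_derivative (G t) (at y) v \<bullet> b) *\<^sub>R
        frechet_derivative (F t) (at (G t y)) b)" for v
      by (intro Cfam_sum Cfam_scaleR assms(1) Suc.IH Cfam_SucD[OF Suc.prems(2)]
        Cfam_linear[OF assms(1) bounded_linear_inner_left] Cfam_deriv[OF Suc.prems(1)] Cfam_deriv[OF Suc.prems(2)])
  qed
qed

lemma continuous_on_const_family: "continuous_on U f \<Longrightarrow> continuous_on (J \<times> U) (\<lambda>(t, y). f y)"
  unfolding case_prod_unfold by (erule continuous_on_compose2[OF _ continuous_on_snd[OF continuous_on_id]]) auto

lemma Ck_continuous: "Ck k U f \<Longrightarrow> continuous_on U f"
proof -
  assume "Ck k U f"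
  then have "continuous_on (UNIV \<times> U) (\<lambda>(t::real, y). f y)" by (rule Cfam_continuous)
  then have "continuous_on U (\<lambda>x. case (0::real, x) of (t, y) \<Rightarrow> f y)"
    by (rule continuous_on_compose2) (auto intro!: continuous_intros)
  then show ?thesis by simp
qed

lemma Ck_0: "Ck 0 U f \<longleftrightarrow> continuous_on U f"
  using Ck_continuous[of 0] continuous_on_const_family by auto

lemma Ck_SucI:
  assumes "open U" "\<And>y. y \<in> U \<Longrightarrow> (f has_derivative f' y) (at y)" "\<And>v. Ck k U (\<lambda>y. f' y v)"
  shows "Ck (Suc k) U f"
proof (rule Cfam_SucI[OF assms(1) _ assms(2,3)])
  have "continuous_on U f" by (rule has_derivative_continuous_on) (use assms(2) has_derivative_at_withinI in blast)
  then show "continuous_on (UNIV \<times> U) (\<lambda>(t::real, y). f y)" by (rule continuous_on_const_family)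
qed auto

lemma iter_deriv_append: "iter_deriv (vs @ ws) f = iter_deriv vs (iter_deriv ws f)"
  by (induction vs) auto

text \<open>Joint continuity of all iterated directional derivatives is how regularity of a curve of
  densities is given; the inductive form above is more convenient for closure under operations.\<close>

lemma Cfam_of_iter_deriv:
  assumes "\<And>t. t \<in> J \<Longrightarrow> smooth_on U (F t)"
    and "\<And>vs. continuous_on (J \<times> U) (\<lambda>(t, y). iter_deriv vs (F t) y)"
  shows "Cfam k J U F"
  using assms
proof (induction k arbitrary: F)
  case 0 show ?case using 0(2)[of "[]"] by simp
next
  case (Suc k)
  have e: "iter_deriv vs (\<lambda>y. frechet_derivative (F t) (at y) v) = iter_deriv (vs @ [v]) (F t)" for vs v t
    by (simp add: iter_deriv_append)
  have "Cfam k J U (\<lambda>t y. frechet_derivative (F t) (at y) v)" for v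
    by (rule Suc.IH) (use Suc.prems in \<open>auto simp: smooth_on_def e simp del: iter_deriv.simps\<close>)
  moreover have "F t differentiable at y" if "t \<in> J" "y \<in> U" for t y
    using Suc.prems(1)[OF that(1)] that(2) iter_deriv.simps(1)[of "F t"] unfolding smooth_on_def by metis
  ultimately show ?case using Suc.prems(2)[of "[]"] by auto
qed

lemma smooth_on_iff: 
  assumes "open U"
  shows "smooth_on U f \<longleftrightarrow> (\<forall>k. Ck k U f)"
proof
  assume s: "smooth_on U f"
  then have "iter_deriv vs f differentiable at y" if "y \<in> U" for y vs
    using that by (auto simp: smooth_on_def)
  then have "continuous_on U (iter_deriv vs f)" for vs
    by (intro differentiable_imp_continuous_on) (auto simp: differentiable_on_def intro: differentiable_at_withinI)
  then have "continuous_on (UNIV \<times> U) (\<lambda>(t::real, y). iter_deriv vs f y)" for vs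
    by (rule continuous_on_const_family)
  then show "\<forall>k. Ck k U f" using s by (intro allI Cfam_of_iter_deriv) auto
next
  assume r: "\<forall>k. Ck k U f"
  have "\<forall>k. Ck k U (iter_deriv vs f)" for vs
  proof (induction vs)
    case Nil then show ?case using r by simp
  next
    case (Cons v vs) 
    show ?case using Cons.IH Cfam_deriv[of _ UNIV U "\<lambda>_. iter_deriv vs f" v] by (simp del: Cfam.simps)
  qed
  then show "smooth_on U f" unfolding smooth_on_def
    using Cfam_differentiable[of 0 UNIV U "\<lambda>_. iter_deriv vs f" 0 for vs] by blast
qed

lemma C1_on_iff: "open U \<Longrightarrow> C1_on U f \<longleftrightarrow> Ck 1 U f"
proof
  assume u: "open U" and c: "C1_on U f"
  have "continuous_on U f" using c unfolding C1_on_def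
    by (intro differentiable_imp_continuous_on) (auto simp: differentiable_on_def intro: differentiable_at_withinI)
  then show "Ck 1 U f" using c unfolding C1_on_def One_nat_def
    by (auto intro: continuous_on_const_family)
next
  assume u: "open U" and c: "Ck 1 U f"
  show "C1_on U f" unfolding C1_on_def
    using c Ck_continuous[of 0 U "\<lambda>y. frechet_derivative f (at y) v" for v] by (auto simp: One_nat_def)
qed

section \<open>Elementary smooth functions\<close>

lemma Ck_ident: "Ck k U (\<lambda>y. y)" if "open U"
proof (cases k)
  case 0 show ?thesis unfolding 0 by (rule Ck_0[THEN iffD2]) (rule continuous_on_id)
next
  case (Suc n)
  show ?thesis unfolding Suc by (rule Ck_SucI[OF that has_derivative_ident Cfam_const])
qed

lemma Ck_inverse: "Ck k {x::real. x \<noteq> 0} inverse"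
proof (induction k)
  case 0
  have "continuous_on {x::real. x \<noteq> 0} inverse" by (auto intro!: continuous_intros)
  then show ?case by (rule Ck_0[THEN iffD2])
next
  case (Suc k)
  have o: "open {x::real. x \<noteq> 0}" by (simp add: open_Collect_neq)
  show ?case
  proof (rule Ck_SucI[OF o, where f' = "\<lambda>x h. - (inverse x * h * inverse x)"])
    show "(inverse has_derivative (\<lambda>h. - (inverse y * h * inverse y))) (at y)" if "y \<in> {x. x \<noteq> 0}" for y :: real
      by (rule has_derivative_inverse') (use that in simp)
    show "Ck k {x. x \<noteq> 0} (\<lambda>y. - (inverse y * v * inverse y))" for v :: real
      by (intro Cfam_minus Cfam_mult Suc.IH Cfam_const o)
  qed
qed

lemma Ck_ln: "Ck k {0<..} (ln :: real \<Rightarrow> real)"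
proof (cases k)
  case 0
  have "continuous_on {0<..} (ln :: real \<Rightarrow> real)" by (auto intro!: continuous_intros)
  then show ?thesis unfolding 0 by (rule Ck_0[THEN iffD2])
next
  case (Suc n)
  show ?thesis unfolding Suc
  proof (rule Ck_SucI[where f' = "\<lambda>x h. h * inverse x"])
    show "(ln has_derivative (\<lambda>h. h * inverse y)) (at y)" if "y \<in> {0<..}" for y :: real
      using DERIV_ln[of y] that by (simp add: has_field_derivative_def mult.commute[of _ "inverse y"] cong: )
    show "Ck n {0<..} (\<lambda>y. v * inverse y)" for v :: real
      by (intro Cfam_mult Cfam_const Cfam_subset[OF Ck_inverse]) auto
  qed auto
qed

lemma Ck_sqrt: "Ck k {0<..} sqrt"
proof (induction k)
  case 0
  have "continuous_on {0<..} sqrt" by (auto intro!: continuous_intros)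
  then show ?case by (rule Ck_0[THEN iffD2])
next
  case (Suc k)
  show ?case
  proof (rule Ck_SucI[where f' = "\<lambda>x h. h * (inverse (sqrt x) * (1/2))"])
    show "(sqrt has_derivative (\<lambda>h. h * (inverse (sqrt y) * (1/2)))) (at y)" if "y \<in> {0<..}" for y :: real
      by (rule has_derivative_eq_rhs[OF DERIV_real_sqrt[of y, unfolded has_field_derivative_def]]) (use that in auto)
    have "Ck k {0<..} (\<lambda>y. inverse (sqrt y))"
      by (rule Cfam_compose[OF _ _ Ck_inverse Suc.IH]) auto
    then show "Ck k {0<..} (\<lambda>y. v * (inverse (sqrt y) * (1/2)))" for v :: real
      by (intro Cfam_mult Cfam_const) auto
  qed auto
qed

lemma Cfam_comp_real:
  fixes f :: "real \<Rightarrow> 'e::euclidean_space \<Rightarrow> real" and \<phi> :: "real \<Rightarrow> real"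
  assumes "open U" "Cfam k J U f" "Ck k W \<phi>" "\<And>t y. t \<in> J \<Longrightarrow> y \<in> U \<Longrightarrow> f t y \<in> W"
  shows "Cfam k J U (\<lambda>t y. \<phi> (f t y))"
  by (rule Cfam_compose[OF assms(1,4) Cfam_subset[OF assms(3)] assms(2)]) auto

lemma Cfam_inverse:
  fixes f :: "real \<Rightarrow> 'e::euclidean_space \<Rightarrow> real"
  assumes "open U" "Cfam k J U f" "\<And>t y. t \<in> J \<Longrightarrow> y \<in> U \<Longrightarrow> f t y \<noteq> 0"
  shows "Cfam k J U (\<lambda>t y. inverse (f t y))"
  using Cfam_comp_real[OF assms(1,2) Ck_inverse] assms(3) by auto

lemma Cfam_divide:
  fixes f :: "real \<Rightarrow> 'e::euclidean_space \<Rightarrow> real"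
  assumes "open U" "Cfam k J U f" "Cfam k J U g" "\<And>t y. t \<in> J \<Longrightarrow> y \<in> U \<Longrightarrow> g t y \<noteq> 0"
  shows "Cfam k J U (\<lambda>t y. f t y / g t y)"
  using Cfam_mult[OF assms(1,2) Cfam_inverse[OF assms(1,3,4)]] by (simp add: divide_inverse)

section \<open>Bump functions\<close>

text \<open>The function \<open>exp (- 1/x) / x\<^sup>n\<close>, continued by \<open>0\<close>.  The
  derivative of \<open>flat n\<close> is a combination of \<open>flat (n + 2)\<close> and
  \<open>flat (n + 1)\<close>, so the whole scale is smooth.\<close>

definition flat :: "nat \<Rightarrow> real \<Rightarrow> real" where
  "flat n x = (if x > 0 then exp (- inverse x) * inverse x ^ n else 0)"

lemma flat_tendsto_0: "(flat n \<longlongrightarrow> 0) (at 0)"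
proof (rule filterlim_split_at)
  have "\<forall>\<^sub>F x in at_left 0. flat n x = 0"
    using eventually_at_left_real[of "-1" 0] by (auto elim!: eventually_mono simp: flat_def)
  then show "(flat n \<longlongrightarrow> 0) (at_left 0)"
    by (rule tendsto_eventually)
  have "((\<lambda>y::real. y ^ n / exp y) \<longlongrightarrow> 0) at_top" by (rule tendsto_power_div_exp_0)
  from filterlim_compose[OF this filterlim_inverse_at_top_right]
  have *: "((\<lambda>x::real. inverse x ^ n / exp (inverse x)) \<longlongrightarrow> 0) (at_right 0)" .
  have "\<forall>\<^sub>F x in at_right 0. inverse x ^ n / exp (inverse x) = flat n x"
    using eventually_at_right_real[of 0 1] by (auto elim!: eventually_mono simp: flat_def exp_minus divide_inverse)
  with * show "(flat n \<longlongrightarrow> 0) (at_right 0)"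
    by (rule Lim_transform_eventually)
qed

lemma flat_has_derivative:
  "(flat n has_derivative (\<lambda>h. h * (flat (n + 2) x - of_nat n * flat (n + 1) x))) (at x)"
proof -
  consider "x > 0" | "x < 0" | "x = 0" by linarith
  then have "(flat n has_real_derivative (flat (n + 2) x - of_nat n * flat (n + 1) x)) (at x)"
  proof cases
    case 1
    have i: "(inverse has_real_derivative - (inverse x)\<^sup>2) (at x)"
      using DERIV_inverse[of x UNIV] 1 by (simp add: power2_eq_square)
    have e: "((\<lambda>x. exp (- inverse x)) has_real_derivative exp (- inverse x) * (inverse x)\<^sup>2) (at x)"
      using DERIV_fun_exp[OF DERIV_minus[OF i]] by simp
    have "of_nat n * (- (inverse x)\<^sup>2 * inverse x ^ (n - Suc 0)) = - (of_nat n * inverse x ^ (n + 1))"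
      by (cases n) (simp_all add: power2_eq_square)
    then have "((\<lambda>x. inverse x ^ n) has_real_derivative - (of_nat n * inverse x ^ (n + 1))) (at x)"
      using DERIV_power[OF i, of n] by (metis)
    from DERIV_mult[OF e this]
    have "((\<lambda>x. exp (- inverse x) * inverse x ^ n) has_real_derivative
        (flat (n + 2) x - of_nat n * flat (n + 1) x)) (at x)"
      using 1 by (simp add: flat_def power_add algebra_simps power2_eq_square)
    moreover have "\<forall>\<^sub>F y in nhds x. exp (- inverse y) * inverse y ^ n = flat n y"
      using eventually_nhds_in_open[of "{0<..}" x] 1 by (auto elim!: eventually_mono simp: flat_def)
    ultimately show ?thesis by (subst DERIV_cong_ev[OF refl _ refl, symmetric])
  next
    case 2
    have "\<forall>\<^sub>F y in nhds x. 0 = flat n y"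
      using eventually_nhds_in_open[of "{..<0}" x] 2 by (auto elim!: eventually_mono simp: flat_def)
    from DERIV_cong_ev[OF refl this refl, THEN iffD1, of 0]
    have "(flat n has_real_derivative 0) (at x)" by simp
    moreover have "flat (n + 2) x - of_nat n * flat (n + 1) x = 0" using 2 by (simp add: flat_def)
    ultimately show ?thesis by simp
  next
    case 3
    have "((\<lambda>h. (flat n (0 + h) - flat n 0) / h) \<longlongrightarrow> 0) (at 0)"
      by (rule Lim_transform_eventually[OF flat_tendsto_0[of "n + 1"]])
        (rule always_eventually, simp add: flat_def divide_inverse)
    then show ?thesis using 3 unfolding DERIV_def by (simp add: flat_def)
  qed
  then show ?thesis 
    unfolding has_field_derivative_def by (rule has_derivative_eq_rhs) (simp add: fun_eq_iff mult.commute)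
qed

lemma Ck_flat: "Ck k UNIV (flat n)"
proof (induction k arbitrary: n)
  case 0
  have "continuous_on UNIV (flat n)"
    by (rule has_derivative_continuous_on) (rule has_derivative_at_withinI[OF flat_has_derivative])
  then show ?case by (rule Ck_0[THEN iffD2])
next
  case (Suc k)
  show ?case
    by (rule Ck_SucI[OF _ flat_has_derivative]) (auto intro!: Cfam_mult Cfam_diff Cfam_const Suc.IH)
qed

definition bump :: "'e::euclidean_space \<Rightarrow> real \<Rightarrow> 'e \<Rightarrow> real" where
  "bump y0 r y = flat 0 (r\<^sup>2 - (\<Sum>b\<in>Basis. ((y - y0) \<bullet> b)\<^sup>2))"

lemma Ck_bump: "Ck k UNIV (bump y0 r)"
proof -
  have i: "Ck k UNIV (\<lambda>y. (y - y0) \<bullet> b)" for b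
    by (intro Cfam_linear[OF _ bounded_linear_inner_left] Cfam_diff Ck_ident Cfam_const) auto
  show ?thesis unfolding bump_def[abs_def] power2_eq_square
    by (rule Cfam_comp_real[OF _ _ Ck_flat]) (auto intro!: Cfam_diff Cfam_const Cfam_sum Cfam_mult i)
qed

lemma bump_sum: "(\<Sum>b\<in>Basis. ((y - y0) \<bullet> b)\<^sup>2) = (dist y0 y)\<^sup>2"
proof -
  have "(dist y0 y)\<^sup>2 = (y - y0) \<bullet> (y - y0)"
    by (simp add: dist_norm norm_minus_commute power2_norm_eq_inner)
  also have "\<dots> = (\<Sum>b\<in>Basis. ((y - y0) \<bullet> b)\<^sup>2)"
    by (subst euclidean_inner) (simp add: power2_eq_square)
  finally show ?thesis by simp
qed

lemma bump_nonneg: "bump y0 r y \<ge> 0"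
  by (simp add: bump_def flat_def)

lemma bump_pos: "r > 0 \<Longrightarrow> bump y0 r y > 0 \<longleftrightarrow> y \<in> ball y0 r"
  using power_less_imp_less_base[of "dist y0 y" 2 r] power_strict_mono[of "dist y0 y" r 2]
  unfolding bump_def bump_sum flat_def by (cases "dist y0 y < r") auto

section \<open>Differentiation under the integral\<close>

lemma has_real_derivative_integral:
  fixes f f' :: "real \<Rightarrow> 'x \<Rightarrow> real"
  assumes J: "is_interval J" "t0 \<in> J" "d > 0"
    and int: "\<And>t. t \<in> J \<Longrightarrow> \<bar>t - t0\<bar> < d \<Longrightarrow> integrable M (f t)"
    and der: "\<And>t x. t \<in> J \<Longrightarrow> \<bar>t - t0\<bar> < d \<Longrightarrow> x \<in> space M \<Longrightarrow>
        ((\<lambda>s. f s x) has_real_derivative f' t x) (at t within J)"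
    and bd: "\<And>t x. t \<in> J \<Longrightarrow> \<bar>t - t0\<bar> < d \<Longrightarrow> x \<in> space M \<Longrightarrow> \<bar>f' t x\<bar> \<le> g x"
    and g: "integrable M g"
  shows "((\<lambda>t. \<integral>x. f t x \<partial>M) has_real_derivative (\<integral>x. f' t0 x \<partial>M)) (at t0 within J)"
  unfolding has_field_derivative_iff tendsto_at_iff_sequentially
proof (intro allI impI)
  fix X :: "nat \<Rightarrow> real" assume X: "\<forall>i. X i \<in> J - {t0}" "X \<longlonglongrightarrow> t0"
  obtain N where N: "\<And>i. i \<ge> N \<Longrightarrow> \<bar>X i - t0\<bar> < d"
    using X(2) J(3) unfolding LIMSEQ_def dist_real_def by blast
  define Y where "Y i = X (i + N)" for i
  have Y: "Y i \<in> J" "Y i \<noteq> t0" "\<bar>Y i - t0\<bar> < d" for i using X N by (auto simp: Y_def)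
  have Yl: "Y \<longlonglongrightarrow> t0" unfolding Y_def using X(2) by (rule LIMSEQ_ignore_initial_segment)
  let ?q = "\<lambda>i x. (f (Y i) x - f t0 x) / (Y i - t0)"
  have lim: "(\<lambda>i. ?q i x) \<longlonglongrightarrow> f' t0 x" if "x \<in> space M" for x
  proof -
    have "((\<lambda>y. (f y x - f t0 x) / (y - t0)) \<longlongrightarrow> f' t0 x) (at t0 within J)"
      using der[OF J(2) _ that] J(3) by (simp add: has_field_derivative_iff)
    then show ?thesis using Y(1,2) Yl unfolding tendsto_at_iff_sequentially comp_def by auto
  qed
  have meas: "?q i \<in> borel_measurable M" for i
    using borel_measurable_integrable[OF int[OF Y(1,3), of i]] borel_measurable_integrable[OF int[OF J(2)]] J(3)
    by auto
  have bound: "norm (?q i x) \<le> g x" if "x \<in> space M" for i x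
  proof -
    let ?S = "J \<inter> ball t0 d"
    have "convex ?S" using is_interval_convex[OF J(1)] by (intro convex_Int convex_ball)
    moreover have "((\<lambda>s. f s x) has_real_derivative f' z x) (at z within ?S)" if "z \<in> ?S" for z
      using der[of z x] that \<open>x \<in> space M\<close> by (auto intro: DERIV_subset simp: dist_real_def abs_minus_commute)
    moreover have "norm (f' z x) \<le> g x" if "z \<in> ?S" for z
      using bd[of z x] that \<open>x \<in> space M\<close> by (auto simp: dist_real_def abs_minus_commute)
    moreover have "Y i \<in> ?S" "t0 \<in> ?S" using Y[of i] J by (auto simp: dist_real_def abs_minus_commute)
    ultimately have "norm (f (Y i) x - f t0 x) \<le> g x * norm (Y i - t0)"
      by (rule field_differentiable_bound)
    then show ?thesis using Y(2)[of i] by (simp add: norm_divide divide_le_eq)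
  qed
  have m': "f' t0 \<in> borel_measurable M"
    by (rule borel_measurable_LIMSEQ_real[OF lim meas])
  have "(\<lambda>i. \<integral>x. ?q i x \<partial>M) \<longlonglongrightarrow> (\<integral>x. f' t0 x \<partial>M)"
    by (rule integral_dominated_convergence[OF m' meas g]) (use lim bound in auto)
  moreover have "(\<integral>x. ?q i x \<partial>M) = ((\<integral>x. f (Y i) x \<partial>M) - (\<integral>x. f t0 x \<partial>M)) / (Y i - t0)" for i
    using int[OF Y(1,3), of i] int[OF J(2)] J(3) by simp
  ultimately have "(\<lambda>i. ((\<integral>x. f (Y i) x \<partial>M) - (\<integral>x. f t0 x \<partial>M)) / (Y i - t0)) \<longlonglongrightarrow> (\<integral>x. f' t0 x \<partial>M)"
    by (simp only:)
  then have "(\<lambda>i. ((\<lambda>y. ((\<integral>x. f y x \<partial>M) - (\<integral>x. f t0 x \<partial>M)) / (y - t0)) \<circ> X) (i + N)) \<longlonglongrightarrow> (\<integral>x. f' t0 x \<partial>M)"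
    unfolding Y_def comp_def .
  then show "((\<lambda>y. ((\<integral>x. f y x \<partial>M) - (\<integral>x. f t0 x \<partial>M)) / (y - t0)) \<circ> X) \<longlonglongrightarrow> (\<integral>x. f' t0 x \<partial>M)"
    by (rule LIMSEQ_offset)
qed

text \<open>The integral of \<open>G\<close> is invariant under translation along \<open>v\<close>;
  differentiating under the integral sign at the origin gives the claim.\<close>

lemma integral_derivative_compact_support:
  fixes G :: "'e::euclidean_space \<Rightarrow> real"
  assumes G: "Ck 1 UNIV G" and supp: "\<And>y. y \<notin> cball 0 R \<Longrightarrow> G y = 0"
  shows "(\<integral>y. frechet_derivative G (at y) v \<partial>lborel) = 0"
    and "integrable lborel (\<lambda>y. frechet_derivative G (at y) v)"
proof -
  let ?D = "\<lambda>y. frechet_derivative G (at y) v"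
  have cG: "continuous_on UNIV G" using Ck_continuous[OF G] .
  have cD: "continuous_on UNIV ?D" by (rule Ck_continuous[OF Cfam_deriv[of 0, OF G[unfolded One_nat_def]]])
  have hd: "(G has_derivative frechet_derivative G (at y)) (at y)" for y
    using Cfam_has_derivative[of 0 UNIV UNIV "\<lambda>_. G"] G by auto
  have D0: "?D y = 0" if "y \<notin> cball 0 R" for y
  proof -
    have "frechet_derivative G (at y) = frechet_derivative (\<lambda>_. 0) (at y)"
      by (rule frechet_derivative_cong_open[of "- cball 0 R"]) (use that supp in auto)
    then show ?thesis by (simp add: frechet_derivative_const)
  qed
  have int: "integrable lborel f" if "continuous_on UNIV f" "\<And>y. y \<notin> cball 0 R \<Longrightarrow> f y = 0" for f :: "'e \<Rightarrow> real"
  proof -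
    have "integrable lborel (\<lambda>y. indicator (cball 0 R) y *\<^sub>R f y)"
      by (rule borel_integrable_compact) (auto intro: continuous_on_subset[OF that(1)])
    moreover have "(\<lambda>y. indicator (cball 0 R) y *\<^sub>R f y) = f"
      using that(2) by (auto simp: fun_eq_iff indicator_def)
    ultimately show ?thesis by simp
  qed
  show "integrable lborel ?D" by (rule int[OF cD D0])
  have "compact (?D ` cball 0 R)" by (rule compact_continuous_image[OF continuous_on_subset[OF cD]]) auto
  then have "bounded (?D ` cball 0 R)" by (rule compact_imp_bounded)
  then obtain C where "\<forall>x\<in>?D ` cball 0 R. norm x \<le> C" unfolding bounded_iff by blast
  then have C: "\<And>y. y \<in> cball 0 R \<Longrightarrow> \<bar>?D y\<bar> \<le> C" by simp
  have meas[measurable]: "G \<in> borel_measurable borel" by (rule borel_measurable_continuous_onI[OF cG])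
  have tr: "integrable lborel (\<lambda>y. G (y + t *\<^sub>R v))" "(\<integral>y. G (y + t *\<^sub>R v) \<partial>lborel) = (\<integral>y. G y \<partial>lborel)" for t
  proof -
    have e: "lborel = distr lborel borel ((+) (t *\<^sub>R v))" by (rule lborel_distr_plus[symmetric])
    have "integrable (distr lborel borel ((+) (t *\<^sub>R v))) G" using int[OF cG supp] by (subst e[symmetric])
    then show "integrable lborel (\<lambda>y. G (y + t *\<^sub>R v))" by (subst (asm) integrable_distr_eq) (auto simp: add.commute)
    have "(\<integral>y. G y \<partial>lborel) = (\<integral>y. G y \<partial>distr lborel borel ((+) (t *\<^sub>R v)))" by (subst e) simp
    also have "\<dots> = (\<integral>y. G (y + t *\<^sub>R v) \<partial>lborel)" by (subst integral_distr) (auto simp: add.commute)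
    finally show "(\<integral>y. G (y + t *\<^sub>R v) \<partial>lborel) = (\<integral>y. G y \<partial>lborel)" by simp
  qed
  have "((\<lambda>t. \<integral>y. G (y + t *\<^sub>R v) \<partial>lborel) has_real_derivative (\<integral>y. ?D (y + 0 *\<^sub>R v) \<partial>lborel)) (at 0 within UNIV)"
  proof (rule has_real_derivative_integral[where d = 1 and g = "\<lambda>y. \<bar>C\<bar> * indicator (cball 0 (R + norm v)) y"])
    fix t :: real and y :: 'e assume t: "\<bar>t - 0\<bar> < 1"
    have "((\<lambda>s. y + s *\<^sub>R v) has_derivative (\<lambda>s. s *\<^sub>R v)) (at t)" by (auto intro!: derivative_eq_intros)
    from has_derivative_compose[OF this hd]
    have "((\<lambda>s. G (y + s *\<^sub>R v)) has_derivative (\<lambda>s. frechet_derivative G (at (y + t *\<^sub>R v)) (s *\<^sub>R v))) (at t)" .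
    moreover have "frechet_derivative G (at (y + t *\<^sub>R v)) (s *\<^sub>R v) = ?D (y + t *\<^sub>R v) * s" for s
      using linear_scale[OF has_derivative_linear[OF hd], of _ s v] by (simp add: mult.commute)
    ultimately show "((\<lambda>s. G (y + s *\<^sub>R v)) has_real_derivative ?D (y + t *\<^sub>R v)) (at t)"
      by (simp add: has_field_derivative_def)
    show "\<bar>?D (y + t *\<^sub>R v)\<bar> \<le> \<bar>C\<bar> * indicator (cball 0 (R + norm v)) y"
    proof (cases "y + t *\<^sub>R v \<in> cball 0 R")
      case True
      have "norm y \<le> norm (y + t *\<^sub>R v) + norm (t *\<^sub>R v)"
        using norm_triangle_ineq4[of "y + t *\<^sub>R v" "t *\<^sub>R v"] by simp
      also have "norm (t *\<^sub>R v) \<le> 1 * norm v" unfolding norm_scaleR by (rule mult_right_mono) (use t in auto)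
      finally have "y \<in> cball 0 (R + norm v)" using True by simp
      then show ?thesis using C[OF True] by simp
    next
      case False
      then show ?thesis using D0[OF False] by simp
    qed
  next
    show "integrable lborel (\<lambda>y. \<bar>C\<bar> * indicator (cball 0 (R + norm v)) y)"
      by (intro integrable_mult_right integrable_real_indicator) (use emeasure_lborel_cball_finite[of 0 "R + norm v"] in \<open>auto simp: less_top[symmetric]\<close>)
  qed (use tr in auto)
  then have "((\<lambda>t::real. \<integral>y. G y \<partial>lborel) has_real_derivative (\<integral>y. ?D y \<partial>lborel)) (at 0)"
    unfolding tr by simp
  from DERIV_unique[OF this DERIV_const] show "(\<integral>y. ?D y \<partial>lborel) = 0" .
qed

section \<open>The representation theorem of Riesz on a complete space of vector fields\<close>

text \<open>A semidefinite inner product on a space of functions.  Positivity is required only up to null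
  vectors, because square integrable fields are identified almost everywhere.\<close>

locale field_space =
  fixes H :: "('a \<Rightarrow> 'v::real_vector) set" and B :: "('a \<Rightarrow> 'v) \<Rightarrow> ('a \<Rightarrow> 'v) \<Rightarrow> real"
  assumes add_mem: "U \<in> H \<Longrightarrow> V \<in> H \<Longrightarrow> (\<lambda>x. U x + V x) \<in> H"
    and scale_mem: "V \<in> H \<Longrightarrow> (\<lambda>x. r *\<^sub>R V x) \<in> H"
    and sym: "U \<in> H \<Longrightarrow> V \<in> H \<Longrightarrow> B U V = B V U"
    and add_left: "U \<in> H \<Longrightarrow> V \<in> H \<Longrightarrow> W \<in> H \<Longrightarrow> B (\<lambda>x. U x + V x) W = B U W + B V W"
    and scale_left: "U \<in> H \<Longrightarrow> V \<in> H \<Longrightarrow> B (\<lambda>x. r *\<^sub>R U x) V = r * B U V"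
    and nonneg: "V \<in> H \<Longrightarrow> B V V \<ge> 0"
begin

lemma diff_mem: "U \<in> H \<Longrightarrow> V \<in> H \<Longrightarrow> (\<lambda>x. U x - V x) \<in> H"
  using add_mem[OF _ scale_mem[of V "-1"], of U] by simp

lemma diff_left: "U \<in> H \<Longrightarrow> V \<in> H \<Longrightarrow> W \<in> H \<Longrightarrow> B (\<lambda>x. U x - V x) W = B U W - B V W"
  using add_left[OF _ scale_mem[of V "-1"], of U W] scale_left[of V W "-1"] by simp

lemma add_right: "U \<in> H \<Longrightarrow> V \<in> H \<Longrightarrow> W \<in> H \<Longrightarrow> B W (\<lambda>x. U x + V x) = B W U + B W V"
  using sym[of W "\<lambda>x. U x + V x"] sym[of W U] sym[of W V] add_left[of U V W] add_mem[of U V] by simp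

lemma scale_right: "U \<in> H \<Longrightarrow> V \<in> H \<Longrightarrow> B V (\<lambda>x. r *\<^sub>R U x) = r * B V U"
  using sym[of V "\<lambda>x. r *\<^sub>R U x"] sym[of V U] scale_left[of U V r] scale_mem[of U r] by simp

lemma diff_right: "U \<in> H \<Longrightarrow> V \<in> H \<Longrightarrow> W \<in> H \<Longrightarrow> B W (\<lambda>x. U x - V x) = B W U - B W V"
  using sym[of W "\<lambda>x. U x - V x"] sym[of W U] sym[of W V] diff_left[of U V W] diff_mem[of U V] by simp

lemma quadratic:
  "U \<in> H \<Longrightarrow> V \<in> H \<Longrightarrow> B (\<lambda>x. U x + s *\<^sub>R V x) (\<lambda>x. U x + s *\<^sub>R V x) = B U U + 2 * s * B U V + s\<^sup>2 * B V V"
  using sym[of U V]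
  by (simp add: add_left add_right scale_left scale_right add_mem scale_mem power2_eq_square algebra_simps)

lemma quadratic_diff:
  "U \<in> H \<Longrightarrow> V \<in> H \<Longrightarrow> B (\<lambda>x. U x - V x) (\<lambda>x. U x - V x) = B U U - 2 * B U V + B V V"
  using quadratic[of U V "-1"] by simp

lemma Cauchy_Schwarz: 
  assumes "U \<in> H" "V \<in> H" shows "\<bar>B U V\<bar> \<le> sqrt (B U U) * sqrt (B V V)"
proof -
  have q: "0 \<le> B U U + 2 * s * B U V + s\<^sup>2 * B V V" for s
    using quadratic[OF assms, of s] nonneg[OF add_mem[OF assms(1) scale_mem[OF assms(2)]], of s] by simp
  have "(B U V)\<^sup>2 \<le> B U U * B V V"
  proof (cases "B V V = 0")
    case True
    have "B U V = 0"
    proof (rule ccontr)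
      assume n: "B U V \<noteq> 0"
      define s where "s = - (B U U + 1) / (2 * B U V)"
      have "2 * s * B U V = - (B U U + 1)" using n by (simp add: s_def)
      then show False using q[of s] True by simp
    qed
    then show ?thesis using True by simp
  next
    case False
    then have p: "B V V > 0" using nonneg[OF assms(2)] by simp
    define k where "k = B U V / B V V"
    have k: "B U V = k * B V V" using p by (simp add: k_def)
    have "0 \<le> B U U - k\<^sup>2 * B V V" using q[of "- k"] unfolding k by (simp add: power2_eq_square algebra_simps)
    then have "0 \<le> B V V * (B U U - k\<^sup>2 * B V V)" using p by simp
    then show ?thesis unfolding k by (simp add: power2_eq_square algebra_simps)
  qed
  then have "sqrt ((B U V)\<^sup>2) \<le> sqrt (B U U * B V V)" by (rule real_sqrt_le_mono)
  then show ?thesis by (simp add: real_sqrt_mult)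
qed

text \<open>The representing vector minimises \<open>B V V - 2 l V\<close>.  A minimising sequence is Cauchy
  by the parallelogram identity, and the first variation vanishes at its limit.\<close>

lemma riesz_representation:
  assumes complete: "\<And>F :: nat \<Rightarrow> 'a \<Rightarrow> 'v. (\<And>n. F n \<in> H) \<Longrightarrow>
      (\<forall>e>0. \<exists>N. \<forall>m\<ge>N. \<forall>n\<ge>N. sqrt (B (\<lambda>x. F m x - F n x) (\<lambda>x. F m x - F n x)) < e) \<Longrightarrow>
      \<exists>L\<in>H. (\<lambda>n. sqrt (B (\<lambda>x. F n x - L x) (\<lambda>x. F n x - L x))) \<longlonglongrightarrow> 0"
    and ne: "H \<noteq> {}"
    and l_add: "\<And>U V. U \<in> H \<Longrightarrow> V \<in> H \<Longrightarrow> l (\<lambda>x. U x + V x) = l U + l V"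
    and l_scale: "\<And>V r. V \<in> H \<Longrightarrow> l (\<lambda>x. r *\<^sub>R V x) = r * l V"
    and l_bound: "\<And>V. V \<in> H \<Longrightarrow> \<bar>l V\<bar> \<le> C * sqrt (B V V)"
  shows "\<exists>W\<in>H. \<forall>V\<in>H. B W V = l V"
proof -
  \<comment> \<open>Completing the square bounds \<open>E\<close> below by \<open>- C\<^sup>2\<close>.\<close>
  define E where "E V = B V V - 2 * l V" for V
  have Eb: "E V \<ge> - C\<^sup>2" if "V \<in> H" for V
  proof -
    have "0 \<le> (sqrt (B V V) - C)\<^sup>2" by simp
    also have "\<dots> = B V V - 2 * (C * sqrt (B V V)) + C\<^sup>2"
      using nonneg[OF that] by (simp add: power2_diff)
    finally show ?thesis using l_bound[OF that] unfolding E_def by linarith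
  qed
  define m where "m = Inf (E ` H)"
  have mle: "m \<le> E V" if "V \<in> H" for V
    unfolding m_def by (rule cInf_lower) (use that Eb in \<open>auto intro!: bdd_belowI2\<close>)
  have "\<exists>V\<in>H. E V < m + 1 / real (Suc n)" for n
  proof -
    have "Inf (E ` H) < m + 1 / real (Suc n)" unfolding m_def[symmetric] by simp
    then show ?thesis using cInf_lessD[of "E ` H"] ne by blast
  qed
  then obtain F where F: "\<And>n. F n \<in> H" "\<And>n. E (F n) < m + 1 / real (Suc n)" by metis
  have par: "B (\<lambda>x. U x - V x) (\<lambda>x. U x - V x) \<le> 2 * (E U - m) + 2 * (E V - m)" if "U \<in> H" "V \<in> H" for U V
  proof -
    let ?M = "\<lambda>x. (1/2) *\<^sub>R (U x + V x)"
    have "m \<le> E ?M" by (rule mle) (intro scale_mem[of "\<lambda>x. U x + V x"] add_mem that)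
    moreover have "B ?M ?M = (1/4) * (B U U + 2 * B U V + B V V)"
      using quadratic[OF that, of 1] scale_left[OF add_mem[OF that] scale_mem[OF add_mem[OF that]], of "1/2" "1/2"]
        scale_right[OF add_mem[OF that] add_mem[OF that], of "1/2"] by simp
    moreover have "l ?M = (1/2) * (l U + l V)"
      using l_scale[OF add_mem[OF that], of "1/2"] l_add[OF that] by simp
    moreover have "4 * m \<le> x + 2 * y + z - 4 * (p + q)"
      if "m \<le> b - 2 * a" "b = (1/4) * (x + 2 * y + z)" "a = (1/2) * (p + q)" for a b p q x y z :: real
      using that by argo
    ultimately have "4 * m \<le> B U U + 2 * B U V + B V V - 4 * (l U + l V)" unfolding E_def by blast
    then show ?thesis using quadratic_diff[OF that] unfolding E_def by simp
  qed
  have cauchy: "\<forall>e>0. \<exists>N. \<forall>m\<ge>N. \<forall>n\<ge>N. sqrt (B (\<lambda>x. F m x - F n x) (\<lambda>x. F m x - F n x)) < e"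
  proof (intro allI impI)
    fix e :: real assume e: "e > 0"
    then obtain N where N: "1 / real (Suc N) < e\<^sup>2 / 4" using nat_approx_posE[of "e\<^sup>2 / 4"] by auto
    have small: "E (F n) - m < e\<^sup>2 / 4" if "n \<ge> N" for n
    proof -
      have "1 / real (Suc n) \<le> 1 / real (Suc N)" using that by (simp add: frac_le)
      then show ?thesis using F(2)[of n] N by linarith
    qed
    show "\<exists>N. \<forall>m\<ge>N. \<forall>n\<ge>N. sqrt (B (\<lambda>x. F m x - F n x) (\<lambda>x. F m x - F n x)) < e"
    proof (intro exI allI impI)
      fix k n assume "N \<le> k" "N \<le> n"
      then have "B (\<lambda>x. F k x - F n x) (\<lambda>x. F k x - F n x) < e\<^sup>2"
        using par[OF F(1)[of k] F(1)[of n]] small[of k] small[of n] by argo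
      then show "sqrt (B (\<lambda>x. F k x - F n x) (\<lambda>x. F k x - F n x)) < e"
        using e real_sqrt_less_mono[of _ "e\<^sup>2"] by fastforce
    qed
  qed
  from complete[OF F(1) cauchy] obtain W where W: "W \<in> H"
    and lim: "(\<lambda>n. sqrt (B (\<lambda>x. F n x - W x) (\<lambda>x. F n x - W x))) \<longlonglongrightarrow> 0" by blast
  have conv: "(\<lambda>n. B (F n) V) \<longlonglongrightarrow> B W V" if V: "V \<in> H" for V
  proof -
    have "(\<lambda>n. sqrt (B (\<lambda>x. F n x - W x) (\<lambda>x. F n x - W x)) * sqrt (B V V)) \<longlonglongrightarrow> 0 * sqrt (B V V)"
      by (intro tendsto_mult lim tendsto_const)
    then have z: "(\<lambda>n. sqrt (B (\<lambda>x. F n x - W x) (\<lambda>x. F n x - W x)) * sqrt (B V V)) \<longlonglongrightarrow> 0" by simp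
    have bnd: "norm (B (F n) V - B W V) \<le> sqrt (B (\<lambda>x. F n x - W x) (\<lambda>x. F n x - W x)) * sqrt (B V V)" for n
      using Cauchy_Schwarz[OF diff_mem[OF F(1)[of n] W] V] unfolding diff_left[OF F(1)[of n] W V] by simp
    have "(\<lambda>n. B (F n) V - B W V) \<longlonglongrightarrow> 0"
      by (rule Lim_null_comparison[OF always_eventually[OF allI[OF bnd]] z])
    then show ?thesis by (simp add: LIM_zero_iff)
  qed
  have pos: "0 \<le> s\<^sup>2 * B V V + 2 * s * (B W V - l V)" if V: "V \<in> H" for V s
  proof -
    have "- (1 / real (Suc n)) \<le> s\<^sup>2 * B V V + 2 * s * (B (F n) V - l V)" for n
    proof -
      have "m \<le> E (\<lambda>x. F n x + s *\<^sub>R V x)" by (rule mle) (intro add_mem scale_mem V F)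
      also have "\<dots> = E (F n) + (s\<^sup>2 * B V V + 2 * s * (B (F n) V - l V))"
        unfolding E_def quadratic[OF F(1) V] l_add[OF F(1) scale_mem[OF V]] l_scale[OF V]
        by (simp add: algebra_simps)
      finally show ?thesis using F(2)[of n] by linarith
    qed
    moreover have "(\<lambda>n. - (1 / real (Suc n))) \<longlonglongrightarrow> - 0"
      by (rule tendsto_minus[OF LIMSEQ_inverse_real_of_nat[unfolded inverse_eq_divide]])
    moreover have "(\<lambda>n. s\<^sup>2 * B V V + 2 * s * (B (F n) V - l V)) \<longlonglongrightarrow> s\<^sup>2 * B V V + 2 * s * (B W V - l V)"
      by (intro tendsto_intros conv V)
    ultimately show ?thesis using LIMSEQ_le[of "\<lambda>n. - (1 / real (Suc n))" "-0"] by auto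
  qed
  have "B W V = l V" if V: "V \<in> H" for V
  proof (rule ccontr)
    assume ne: "B W V \<noteq> l V"
    define d where "d = B W V - l V"
    have d: "d \<noteq> 0" using ne d_def by simp
    define k where "k = d / (B V V + 1)"
    have p: "B V V + 1 > 0" using nonneg[OF V] by linarith
    then have dk: "d = k * (B V V + 1)" by (simp add: k_def)
    have k0: "k \<noteq> 0" using d dk by auto
    have "0 \<le> k\<^sup>2 * B V V + 2 * (- k) * d" using pos[OF V, of "- k"] d_def by simp
    also have "\<dots> = - (k\<^sup>2 * (B V V + 2))" unfolding dk by (simp add: power2_eq_square algebra_simps)
    finally have "k\<^sup>2 * (B V V + 2) \<le> 0" by simp
    moreover have "k\<^sup>2 * (B V V + 2) > 0" using k0 nonneg[OF V] by simp
    ultimately show False by linarith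
  qed
  then show ?thesis using W by blast
qed

end

section \<open>Positive definite matrices\<close>

lemma continuous_on_det:
  fixes A :: "'b::topological_space \<Rightarrow> real^'n^'n"
  assumes "\<And>i j. continuous_on S (\<lambda>x. A x $ i $ j)"
  shows "continuous_on S (\<lambda>x. det (A x))"
  unfolding det_def by (intro continuous_intros assms)

text \<open>The determinant cannot vanish on the segment from the identity to \<open>A\<close>, all of whose
  points are positive definite, so its sign is constant there.\<close>

lemma det_pos_of_posdef:
  fixes A :: "real^'n^'n"
  assumes pd: "\<And>v. v \<noteq> 0 \<Longrightarrow> v \<bullet> (A *v v) > 0"
  shows "det A > 0"
proof (rule ccontr)
  assume n: "\<not> det A > 0"
  define P where "P t = det ((1 - t) *\<^sub>R mat 1 + t *\<^sub>R A)" for t :: real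
  have "continuous_on {0..1} P" unfolding P_def
    by (intro continuous_on_det) (auto intro!: continuous_intros)
  moreover have "P 0 = 1" "P 1 = det A" by (simp_all add: P_def)
  ultimately obtain t where t: "0 \<le> t" "t \<le> 1" "P t = 0"
    using IVT2'[of P 1 0 0] n by auto
  let ?M = "(1 - t) *\<^sub>R mat 1 + t *\<^sub>R A"
  have "\<not> invertible ?M" using t(3) unfolding P_def invertible_det_nz by simp
  then have "\<not> (\<forall>x. ?M *v x = 0 \<longrightarrow> x = 0)"
    using invertible_left_inverse[of ?M] matrix_left_invertible_ker[of ?M] by blast
  then obtain v where v: "v \<noteq> 0" "?M *v v = 0" by blast
  have "0 = v \<bullet> (?M *v v)" using v by simp
  also have "\<dots> = (1 - t) * (v \<bullet> v) + t * (v \<bullet> (A *v v))"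
    by (simp add: matrix_vector_mult_add_rdistrib inner_add_right scaleR_matrix_vector_assoc[symmetric])
  finally have z: "(1 - t) * (v \<bullet> v) + t * (v \<bullet> (A *v v)) = 0" by simp
  have "(1 - t) * (v \<bullet> v) \<ge> 0" "t * (v \<bullet> (A *v v)) \<ge> 0" using t pd[OF v(1)] by auto
  with z have "(1 - t) * (v \<bullet> v) = 0" "t * (v \<bullet> (A *v v)) = 0" by linarith+
  then show False using v pd[OF v(1)] by auto
qed

section \<open>Changes of time on an interval\<close>

text \<open>The interval need be neither open, closed nor bounded, and the derivative is one-sided at an end
  point that belongs to it.\<close>

lemma antiderivative_on_interval:
  fixes b :: "real \<Rightarrow> real"
  assumes J: "is_interval J" and b: "continuous_on J b"
  shows "\<exists>B. \<forall>t\<in>J. (B has_real_derivative b t) (at t within J)"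
proof (cases "J = {}")
  case False
  then obtain t0 where t0: "t0 \<in> J" by blast
  define B where "B t = integral {t0..t} b - integral {t..t0} b" for t
  have "(B has_real_derivative b t) (at t within J)" if t: "t \<in> J" for t
  proof -
    obtain d where d: "d \<in> J" "t \<le> d" "t0 \<le> d" "\<exists>u>t. J \<inter> {..<u} \<subseteq> {..d}"
    proof (cases "\<exists>x\<in>J. x > max t t0")
      case True
      then obtain x where "x \<in> J" "x > max t t0" by blast
      then show ?thesis by (intro that[of x]) (auto intro!: exI[of _ x])
    next
      case False
      then show ?thesis by (intro that[of "max t t0"]) (use t t0 in \<open>auto simp: max_def not_less intro!: exI[of _ "t + 1"]\<close>)
    qed
    obtain c where c: "c \<in> J" "c \<le> t" "c \<le> t0" "\<exists>u<t. J \<inter> {u<..} \<subseteq> {c..}"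
    proof (cases "\<exists>x\<in>J. x < min t t0")
      case True
      then obtain x where "x \<in> J" "x < min t t0" by blast
      then show ?thesis by (intro that[of x]) (auto intro!: exI[of _ x])
    next
      case False
      then show ?thesis by (intro that[of "min t t0"]) (use t t0 in \<open>auto simp: min_def not_less intro!: exI[of _ "t - 1"]\<close>)
    qed
    obtain u v where uv: "u < t" "J \<inter> {u<..} \<subseteq> {c..}" "t < v" "J \<inter> {..<v} \<subseteq> {..d}" using c(4) d(4) by blast
    have sub: "{c..d} \<subseteq> J" using mem_is_interval_1_I[OF J c(1) d(1)] by auto
    have bc: "continuous_on {c..d} b" using continuous_on_subset[OF b sub] .
    then have bi: "b integrable_on {x..y}" if "c \<le> x" "y \<le> d" for x y
      by (intro integrable_continuous_interval continuous_on_subset[OF bc]) (use that in auto)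
    have eq: "integral {c..x} b - integral {c..t0} b = B x" if "x \<in> {c..d}" for x
    proof (cases "x \<le> t0")
      case True
      then have "integral {c..x} b + integral {x..t0} b = integral {c..t0} b"
        using that c(3) d(3) by (intro Henstock_Kurzweil_Integration.integral_combine bi) auto
      moreover have "integral {t0..x} b = 0" using True by (cases "x = t0") auto
      ultimately show ?thesis unfolding B_def by simp
    next
      case False
      then have "integral {c..t0} b + integral {t0..x} b = integral {c..x} b"
        using that c(3) d(3) by (intro Henstock_Kurzweil_Integration.integral_combine bi) auto
      then show ?thesis using False unfolding B_def by simp
    qed
    have "((\<lambda>x. integral {c..x} b - integral {c..t0} b) has_real_derivative b t) (at t within {c..d})"
      using DERIV_diff[OF integral_has_real_derivative[OF bc, of t] DERIV_const] c d by simp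
    then have "(B has_real_derivative b t) (at t within {c..d})"
      by (rule has_field_derivative_transform_within[OF _ zero_less_one]) (use eq c d in auto)
    moreover have "at t within {c..d} = at t within J"
      by (rule at_within_nhd[of _ "{u<..<v}"]) (use uv sub in auto)
    ultimately show ?thesis by simp
  qed
  then show ?thesis by blast
qed auto

text \<open>The change of time with speed \<open>b\<close>: the new time \<open>\<sigma>\<close> is an
  antiderivative of \<open>b\<close>, and \<open>\<tau>\<close> is its inverse.\<close>

lemma interval_reparametrisation:
  fixes b :: "real \<Rightarrow> real"
  assumes J: "is_interval J" and b: "continuous_on J b" "\<And>t. t \<in> J \<Longrightarrow> b t > 0"
  obtains \<sigma> \<tau> J' where "is_interval J'" "bij_betw \<tau> J' J" "continuous_on J' \<tau>" "\<sigma> ` J = J'"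
    "\<And>t. t \<in> J \<Longrightarrow> \<tau> (\<sigma> t) = t" "\<And>s. s \<in> J' \<Longrightarrow> \<sigma> (\<tau> s) = s"
    "\<And>t. t \<in> J \<Longrightarrow> (\<sigma> has_real_derivative b t) (at t within J)"
    "\<And>s. s \<in> J' \<Longrightarrow> (\<tau> has_real_derivative 1 / b (\<tau> s)) (at s within J')"
    "strict_mono_on J \<sigma>"
proof -
  obtain \<sigma> where \<sigma>: "\<And>t. t \<in> J \<Longrightarrow> (\<sigma> has_real_derivative b t) (at t within J)"
    using antiderivative_on_interval[OF J b(1)] by blast
  have c\<sigma>: "continuous_on J \<sigma>" by (rule DERIV_continuous_on[OF \<sigma>])
  have mono: "\<sigma> s < \<sigma> t" if st: "s \<in> J" "t \<in> J" "s < t" for s t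
  proof -
    have sub: "{s..t} \<subseteq> J" using mem_is_interval_1_I[OF J st(1,2)] by auto
    have "\<exists>x\<in>{s<..<t}. \<sigma> t - \<sigma> s = (t - s) * b x"
    proof (rule mvt_simple[OF st(3), of \<sigma> "\<lambda>x. (\<lambda>h. h * b x)", simplified])
      fix x assume "s \<le> x" "x \<le> t"
      then have "(\<sigma> has_real_derivative b x) (at x within {s..t})" using DERIV_subset[OF \<sigma> sub] sub by auto
      then show "(\<sigma> has_derivative (\<lambda>h. h * b x)) (at x within {s..t})"
        by (simp add: has_field_derivative_def mult.commute[of _ "b x"])
    qed
    then obtain x where "x \<in> {s<..<t}" "\<sigma> t - \<sigma> s = (t - s) * b x" by blast
    moreover have "x \<in> J" using sub \<open>x \<in> {s<..<t}\<close> by auto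
    then have "b x > 0" by (rule b(2))
    ultimately have "\<sigma> t - \<sigma> s > 0" using st(3) by simp
    then show ?thesis by simp
  qed
  have smono: "strict_mono_on J \<sigma>" using mono by (auto simp: strict_mono_on_def)
  have inj: "inj_on \<sigma> J" by (rule strict_mono_on_imp_inj_on[OF smono])
  have pc: "path_connected J" using J is_interval_path_connected by blast
  obtain \<tau> where h: "homeomorphism J (\<sigma> ` J) \<sigma> \<tau>" using homeomorphism_into_1d[OF pc c\<sigma> refl inj] by blast
  have \<tau>: "\<And>t. t \<in> J \<Longrightarrow> \<tau> (\<sigma> t) = t" "\<And>s. s \<in> \<sigma> ` J \<Longrightarrow> \<sigma> (\<tau> s) = s" "\<tau> ` \<sigma> ` J = J" "continuous_on (\<sigma> ` J) \<tau>"
    using h unfolding homeomorphism_def by auto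
  have iv: "is_interval (\<sigma> ` J)" unfolding is_interval_connected_1
    by (rule connected_continuous_image[OF c\<sigma>]) (use J is_interval_connected_1 in blast)
  have bij: "bij_betw \<tau> (\<sigma> ` J) J" unfolding bij_betw_def using \<tau> by (metis inj_on_inverseI)
  have d\<tau>: "(\<tau> has_real_derivative 1 / b (\<tau> s)) (at s within \<sigma> ` J)" if s: "s \<in> \<sigma> ` J" for s
    unfolding has_field_derivative_iff
  proof -
    have ts: "\<tau> s \<in> J" using s \<tau> by auto
    have q: "((\<lambda>y. (\<sigma> y - \<sigma> (\<tau> s)) / (y - \<tau> s)) \<longlongrightarrow> b (\<tau> s)) (at (\<tau> s) within J)"
      using \<sigma>[OF ts] by (simp add: has_field_derivative_iff)
    have inJ: "\<forall>\<^sub>F s' in at s within \<sigma> ` J. \<tau> s' \<in> J \<and> \<tau> s' \<noteq> \<tau> s \<and> s' \<in> \<sigma> ` J"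
    proof -
      have "\<tau> s' \<in> J \<and> \<tau> s' \<noteq> \<tau> s \<and> s' \<in> \<sigma> ` J" if "s' \<noteq> s" "s' \<in> \<sigma> ` J" for s'
      proof -
        have "\<tau> s' \<in> J" using \<tau>(3) that(2) by blast
        moreover have "\<tau> s' \<noteq> \<tau> s" using \<tau>(2)[OF that(2)] \<tau>(2)[OF s] that(1) by metis
        ultimately show ?thesis using that(2) by blast
      qed
      then show ?thesis unfolding eventually_at_filter by (simp add: always_eventually)
    qed
    have "filterlim \<tau> (at (\<tau> s) within J) (at s within \<sigma> ` J)"
      unfolding filterlim_at using inJ \<tau>(4) s by (auto elim!: eventually_mono simp: continuous_on_def)
    from tendsto_inverse[OF filterlim_compose[OF q this]]
    have "((\<lambda>s'. inverse ((\<sigma> (\<tau> s') - \<sigma> (\<tau> s)) / (\<tau> s' - \<tau> s))) \<longlongrightarrow> inverse (b (\<tau> s))) (at s within \<sigma> ` J)"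
      using b(2)[OF ts] by simp
    then show "((\<lambda>y. (\<tau> y - \<tau> s) / (y - s)) \<longlongrightarrow> 1 / b (\<tau> s)) (at s within \<sigma> ` J)"
      unfolding inverse_eq_divide[of "b (\<tau> s)"]
      by (rule Lim_transform_eventually) (use inJ in \<open>auto elim!: eventually_mono simp: \<tau>(2) s\<close>)
  qed
  show ?thesis by (rule that[OF iv bij \<tau>(4) refl \<tau>(1,2) \<sigma> d\<tau> smono])
qed


lemma Cfam_reparam:
  assumes "Cfam k J U F" "continuous_on J' \<tau>" "\<tau> ` J' \<subseteq> J"
  shows "Cfam k J' U (\<lambda>s. F (\<tau> s))"
  using assms(1)
proof (induction k arbitrary: F)
  have c: "continuous_on (J' \<times> U) (\<lambda>(s, y). F (\<tau> s) y)" if "Cfam k J U F" for k and F :: "real \<Rightarrow> 'a \<Rightarrow> 'b"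
  proof -
    have "continuous_on (J' \<times> U) (\<lambda>p. (\<tau> (fst p), snd p))"
      by (intro continuous_on_Pair continuous_on_compose2[OF assms(2)] continuous_intros) auto
    from continuous_on_compose2[OF Cfam_continuous[OF that] this]
    have "continuous_on (J' \<times> U) (\<lambda>x. case (\<tau> (fst x), snd x) of (t, y) \<Rightarrow> F t y)" using assms(3) by force
    then show ?thesis by (simp add: case_prod_unfold)
  qed
  case 0
  from c[OF 0] show ?case by simp
next
  have c: "continuous_on (J' \<times> U) (\<lambda>(s, y). F (\<tau> s) y)" if "Cfam k J U F" for k and F :: "real \<Rightarrow> 'a \<Rightarrow> 'b"
  proof -
    have "continuous_on (J' \<times> U) (\<lambda>p. (\<tau> (fst p), snd p))"
      by (intro continuous_on_Pair continuous_on_compose2[OF assms(2)] continuous_intros) auto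
    from continuous_on_compose2[OF Cfam_continuous[OF that] this]
    have "continuous_on (J' \<times> U) (\<lambda>x. case (\<tau> (fst x), snd x) of (t, y) \<Rightarrow> F t y)" using assms(3) by force
    then show ?thesis by (simp add: case_prod_unfold)
  qed
  case (Suc k)
  show ?case using c[OF Suc.prems] Suc.IH[OF Cfam_deriv[OF Suc.prems]] Cfam_differentiable[OF Suc.prems] assms(3)
    by (simp add: image_subset_iff)
qed

lemma Cfam_at: "Cfam k J U F \<Longrightarrow> t \<in> J \<Longrightarrow> Ck k U (F t)"
  using Cfam_reparam[of k J U F UNIV "\<lambda>_. t"] by auto

lemma Cfam_of_Ck: "Ck k U f \<Longrightarrow> Cfam k J U (\<lambda>_. f)"
  by (rule Cfam_subset) auto

lemma Cfam_nth:
  fixes F :: "real \<Rightarrow> 'e::euclidean_space \<Rightarrow> real^'n"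
  shows "open U \<Longrightarrow> Cfam k J U F \<Longrightarrow> Cfam k J U (\<lambda>t y. F t y $ i)"
  by (rule Cfam_linear[OF _ bounded_linear_vec_nth])

lemma Cfam_vec:
  fixes F :: "real \<Rightarrow> 'e::euclidean_space \<Rightarrow> real^'n"
  assumes "open U" "\<And>i. Cfam k J U (\<lambda>t y. F t y $ i)"
  shows "Cfam k J U F"
proof -
  have e: "(\<Sum>i\<in>UNIV. (x $ i) *\<^sub>R axis i 1) = x" for x :: "real^'n"
    using basis_expansion[of x] by (simp add: scalar_mult_eq_scaleR)
  have "Cfam k J U (\<lambda>t y. \<Sum>i\<in>UNIV. (F t y $ i) *\<^sub>R (axis i 1 :: real^'n))"
    by (intro Cfam_sum Cfam_scaleR assms Cfam_const)
  then show ?thesis unfolding e .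
qed

lemma Cfam_det:
  fixes A :: "real \<Rightarrow> 'e::euclidean_space \<Rightarrow> real^'n^'n"
  assumes "open U" "\<And>i j. Cfam k J U (\<lambda>t y. A t y $ i $ j)"
  shows "Cfam k J U (\<lambda>t y. det (A t y))"
  unfolding det_def by (intro Cfam_sum Cfam_mult Cfam_prod Cfam_const assms)

lemma bilinear_expand:
  fixes h :: "real^'n \<Rightarrow> real^'n \<Rightarrow> real"
  assumes "bilinear h"
  shows "h v w = (\<Sum>i\<in>UNIV. \<Sum>j\<in>UNIV. v $ i * w $ j * h (axis i 1) (axis j 1))"
proof -
  have e: "(\<Sum>i\<in>UNIV. (x $ i) *\<^sub>R axis i 1) = x" for x :: "real^'n"
    using basis_expansion[of x] by (simp add: scalar_mult_eq_scaleR)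
  have "h v w = h (\<Sum>i\<in>UNIV. (v $ i) *\<^sub>R axis i 1) (\<Sum>i\<in>UNIV. (w $ i) *\<^sub>R axis i 1)"
    unfolding e ..
  also have "\<dots> = (\<Sum>(i, j)\<in>UNIV \<times> UNIV. h ((v $ i) *\<^sub>R axis i 1) ((w $ j) *\<^sub>R axis j 1))"
    by (rule bilinear_sum[OF assms])
  also have "\<dots> = (\<Sum>i\<in>UNIV. \<Sum>j\<in>UNIV. v $ i * w $ j * h (axis i 1) (axis j 1))"
    by (simp add: sum.cartesian_product bilinear_lmul[OF assms] bilinear_rmul[OF assms] mult.assoc mult.left_commute)
  finally show ?thesis .
qed

declare Cfam.simps [simp del] split_paired_All [simp del] split_paired_Ex [simp del]

section \<open>Charts of a closed Riemannian manifold\<close>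

locale riem =
  fixes S :: "('a, 'n::finite, 'z) riemannian_scheme"
  assumes closed_riemannian: "closed_riemannian S"
begin

lemma manifold: "closed_oriented_manifold S" and metric_ax: "riemannian_metric S" and volume_ax: "riemannian_volume S"
  using closed_riemannian unfolding closed_riemannian_def by auto

lemma pts_ne: "pts S \<noteq> {}" and compact_pts: "compact_space (mtop S)" and connected_pts: "connected_space (mtop S)"
  and hausdorff: "Hausdorff_space (mtop S)"
  and cover: "(\<Union>c\<in>atlas S. cdom c) = pts S"
  using manifold unfolding closed_oriented_manifold_def by auto

lemma open_cdom: "c \<in> atlas S \<Longrightarrow> openin (mtop S) (cdom c)"
  and open_img: "c \<in> atlas S \<Longrightarrow> open (img c)"
  and chart_homeo: "c \<in> atlas S \<Longrightarrow> homeomorphic_map (subtopology (mtop S) (cdom c)) (top_of_set (img c)) (cmap c)"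
  using manifold unfolding closed_oriented_manifold_def by auto

lemma cdom_sub: "c \<in> atlas S \<Longrightarrow> cdom c \<subseteq> pts S"
  using cover by auto

lemma in_pts: "c \<in> atlas S \<Longrightarrow> p \<in> cdom c \<Longrightarrow> p \<in> pts S"
  using cdom_sub by blast

lemma chart_exists: "p \<in> pts S \<Longrightarrow> \<exists>c. c \<in> atlas S \<and> p \<in> cdom c"
  using cover by blast

lemma chart_at_atlas: "p \<in> pts S \<Longrightarrow> chart_at S p \<in> atlas S"
  and chart_at_dom: "p \<in> pts S \<Longrightarrow> p \<in> cdom (chart_at S p)"
  using someI_ex[OF chart_exists[of p]] unfolding chart_at_def by auto

lemma topspace_sub: "c \<in> atlas S \<Longrightarrow> topspace (subtopology (mtop S) (cdom c)) = cdom c"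
  using cdom_sub[of c] unfolding topspace_subtopology by blast

lemma cmap_inj: "c \<in> atlas S \<Longrightarrow> inj_on (cmap c) (cdom c)"
  using homeomorphic_imp_injective_map[OF chart_homeo[of c]] topspace_sub[of c] by simp

lemma cinv_cmap: "c \<in> atlas S \<Longrightarrow> p \<in> cdom c \<Longrightarrow> cinv c (cmap c p) = p"
  unfolding cinv_def by (rule inv_into_f_f[OF cmap_inj])

lemma cmap_cinv: "y \<in> img c \<Longrightarrow> cmap c (cinv c y) = y"
  unfolding cinv_def by (rule f_inv_into_f)

lemma cinv_in: "y \<in> img c \<Longrightarrow> cinv c y \<in> cdom c"
  unfolding cinv_def by (rule inv_into_into)

lemma cinv_pts: "c \<in> atlas S \<Longrightarrow> y \<in> img c \<Longrightarrow> cinv c y \<in> pts S"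
  by (rule in_pts[OF _ cinv_in])

lemma chart_open_image:
  assumes "c \<in> atlas S" "openin (mtop S) W" "W \<subseteq> cdom c" shows "open (cmap c ` W)"
proof -
  have "openin (subtopology (mtop S) (cdom c)) W"
    unfolding openin_subtopology by (rule exI[of _ W]) (use assms in auto)
  then have "openin (top_of_set (img c)) (cmap c ` W)"
    using homeomorphic_imp_open_map[OF chart_homeo[OF assms(1)]] unfolding open_map_def by blast
  then show ?thesis using open_img[OF assms(1)] openin_open_trans by blast
qed

lemma chart_open_preimage:
  assumes "c \<in> atlas S" "open W" shows "openin (mtop S) {p \<in> cdom c. cmap c p \<in> W}"
proof -
  have "continuous_map (subtopology (mtop S) (cdom c)) (top_of_set (img c)) (cmap c)"
    by (rule homeomorphic_imp_continuous_map[OF chart_homeo[OF assms(1)]])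
  then have "openin (subtopology (mtop S) (cdom c)) {p \<in> topspace (subtopology (mtop S) (cdom c)). cmap c p \<in> img c \<inter> W}"
    by (rule openin_continuous_map_preimage) (use assms in \<open>auto simp: openin_open\<close>)
  moreover have "{p \<in> topspace (subtopology (mtop S) (cdom c)). cmap c p \<in> img c \<inter> W} = {p \<in> cdom c. cmap c p \<in> W}"
    unfolding topspace_sub[OF assms(1)] by auto
  ultimately show ?thesis using openin_trans_full[OF _ open_cdom[OF assms(1)]] by simp
qed

abbreviation overlap :: "('a, 'n) chart \<Rightarrow> ('a, 'n) chart \<Rightarrow> (real^'n) set" where
  "overlap c d \<equiv> cmap c ` (cdom c \<inter> cdom d)"

lemma open_overlap: "c \<in> atlas S \<Longrightarrow> d \<in> atlas S \<Longrightarrow> open (overlap c d)"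
  by (rule chart_open_image) (auto intro: openin_Int open_cdom)

lemma trans_map_Ck: "c \<in> atlas S \<Longrightarrow> d \<in> atlas S \<Longrightarrow> Ck k (overlap c d) (trans_map c d)"
  using manifold smooth_on_iff[OF open_overlap] unfolding closed_oriented_manifold_def by blast

lemma trans_map_cmap: "c \<in> atlas S \<Longrightarrow> p \<in> cdom c \<Longrightarrow> trans_map c d (cmap c p) = cmap d p"
  by (simp add: trans_map_def cinv_cmap)

lemma cinv_trans_map: "c \<in> atlas S \<Longrightarrow> d \<in> atlas S \<Longrightarrow> y \<in> overlap c d \<Longrightarrow> cinv d (trans_map c d y) = cinv c y"
  by (auto simp: trans_map_cmap cinv_cmap)

lemma jac_has_derivative:
  "c \<in> atlas S \<Longrightarrow> d \<in> atlas S \<Longrightarrow> p \<in> cdom c \<Longrightarrow> p \<in> cdom d \<Longrightarrow>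
    (trans_map c d has_derivative jac c d p) (at (cmap c p))"
  unfolding jac_def using Cfam_has_derivative[OF trans_map_Ck[of c d "Suc 0"], of 0 "cmap c p"] by auto

lemma jac_linear: "c \<in> atlas S \<Longrightarrow> d \<in> atlas S \<Longrightarrow> p \<in> cdom c \<Longrightarrow> p \<in> cdom d \<Longrightarrow> linear (jac c d p)"
  using has_derivative_linear[OF jac_has_derivative] by blast

lemma jac_comp:
  assumes "c \<in> atlas S" "d \<in> atlas S" "e \<in> atlas S" "p \<in> cdom c" "p \<in> cdom d" "p \<in> cdom e"
  shows "jac d e p (jac c d p v) = jac c e p v"
proof -
  have "(trans_map d e has_derivative jac d e p) (at (trans_map c d (cmap c p)))"
    using jac_has_derivative[of d e p] assms by (simp add: trans_map_cmap)
  from has_derivative_compose[OF jac_has_derivative[of c d p] this] assms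
  have "((\<lambda>y. trans_map d e (trans_map c d y)) has_derivative (\<lambda>v. jac d e p (jac c d p v))) (at (cmap c p))" by simp
  then have "(trans_map c e has_derivative (\<lambda>v. jac d e p (jac c d p v))) (at (cmap c p))"
    by (rule has_derivative_transform_within_open[OF _ open_overlap[of c d]]) (use assms in \<open>auto simp: trans_map_cmap\<close>)
  from has_derivative_unique[OF this jac_has_derivative[of c e p]] assms show ?thesis by (simp add: fun_eq_iff)
qed

lemma jac_self:
  assumes "c \<in> atlas S" "p \<in> cdom c" shows "jac c c p v = v"
proof -
  have "((\<lambda>y. y) has_derivative (\<lambda>v. v)) (at (cmap c p))" by simp
  then have "(trans_map c c has_derivative (\<lambda>v. v)) (at (cmap c p))"
    by (rule has_derivative_transform_within_open[OF _ open_overlap[of c c]]) (use assms in \<open>auto simp: trans_map_cmap\<close>)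
  from has_derivative_unique[OF this jac_has_derivative[of c c p]] assms show ?thesis by (simp add: fun_eq_iff)
qed

abbreviation comps :: "('a, 'n) chart \<Rightarrow> 'a \<Rightarrow> real^'n \<Rightarrow> real^'n" where
  "comps c p v \<equiv> jac (chart_at S p) c p v"

lemma comps_linear: "c \<in> atlas S \<Longrightarrow> p \<in> cdom c \<Longrightarrow> linear (comps c p)"
  by (rule jac_linear) (simp_all add: chart_at_atlas chart_at_dom in_pts)

lemma frame_linear: "c \<in> atlas S \<Longrightarrow> p \<in> cdom c \<Longrightarrow> linear (frame S c p)"
  unfolding frame_def[abs_def] by (rule jac_linear) (simp_all add: chart_at_atlas chart_at_dom in_pts)

lemma frame_comps: "c \<in> atlas S \<Longrightarrow> p \<in> cdom c \<Longrightarrow> frame S c p (comps c p v) = v"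
  unfolding frame_def
  using jac_comp[of "chart_at S p" c "chart_at S p" p v] jac_self[of "chart_at S p" p v]
  by (simp add: chart_at_atlas chart_at_dom in_pts)

lemma comps_frame: "c \<in> atlas S \<Longrightarrow> p \<in> cdom c \<Longrightarrow> comps c p (frame S c p w) = w"
  unfolding frame_def
  using jac_comp[of c "chart_at S p" c p w] jac_self[of c p w]
  by (simp add: chart_at_atlas chart_at_dom in_pts)

lemma coord_comps: "coord S c V p = comps c p (V p)"
  by (simp add: coord_def)

section \<open>Regularity of functions and fields\<close>

text \<open>Families of functions and of vector fields of class \<open>C\<^sup>k\<close> on the manifold,
  expressed in all charts of the atlas.\<close>

definition Mfam :: "nat \<Rightarrow> real set \<Rightarrow> (real \<Rightarrow> 'a \<Rightarrow> real) \<Rightarrow> bool" where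
  "Mfam k J F \<longleftrightarrow> (\<forall>c\<in>atlas S. Cfam k J (img c) (\<lambda>t y. F t (cinv c y)))"

definition Vfam :: "nat \<Rightarrow> real set \<Rightarrow> (real \<Rightarrow> ('a, 'n) vfield) \<Rightarrow> bool" where
  "Vfam k J V \<longleftrightarrow> (\<forall>c\<in>atlas S. Cfam k J (img c) (\<lambda>t y. coord S c (V t) (cinv c y)))"

abbreviation Mk :: "nat \<Rightarrow> ('a \<Rightarrow> real) \<Rightarrow> bool" where "Mk k f \<equiv> Mfam k UNIV (\<lambda>_. f)"
abbreviation Vk :: "nat \<Rightarrow> ('a, 'n) vfield \<Rightarrow> bool" where "Vk k V \<equiv> Vfam k UNIV (\<lambda>_. V)"

lemma smooth_fun_iff: "smooth_fun S f \<longleftrightarrow> (\<forall>k. Mk k f)"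
  unfolding smooth_fun_def Mfam_def comp_def using smooth_on_iff[OF open_img] by blast

lemma C1_vfield_Vk: "C1_vfield S V \<Longrightarrow> Vk 1 V"
  unfolding C1_vfield_def Vfam_def comp_def using C1_on_iff[OF open_img] by blast

lemma Mfam_at: "Mfam k J F \<Longrightarrow> t \<in> J \<Longrightarrow> Mk k (F t)"
  unfolding Mfam_def using Cfam_at by fast

lemma Vfam_at: "Vfam k J F \<Longrightarrow> t \<in> J \<Longrightarrow> Vk k (F t)"
  unfolding Vfam_def using Cfam_at by fast

lemma Mfam_of_Mk: "Mk k f \<Longrightarrow> Mfam k J (\<lambda>_. f)"
  unfolding Mfam_def using Cfam_of_Ck by blast

lemma Vfam_of_Vk: "Vk k f \<Longrightarrow> Vfam k J (\<lambda>_. f)"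
  unfolding Vfam_def using Cfam_of_Ck by blast

lemma Vfam_le: "Vfam m J F \<Longrightarrow> k \<le> m \<Longrightarrow> Vfam k J F"
  unfolding Vfam_def using Cfam_le by blast

lemma Mfam_cong: "(\<And>t p. t \<in> J \<Longrightarrow> p \<in> pts S \<Longrightarrow> F t p = G t p) \<Longrightarrow> Mfam k J F \<longleftrightarrow> Mfam k J G"
  unfolding Mfam_def
  by (intro ball_cong refl Cfam_cong open_img) (simp_all add: cinv_pts)

lemma Mfam_const: "Mfam k J (\<lambda>t p. r)"
  unfolding Mfam_def by (simp add: Cfam_const)

lemma Mfam_add: "Mfam k J F \<Longrightarrow> Mfam k J G \<Longrightarrow> Mfam k J (\<lambda>t p. F t p + G t p)"
  unfolding Mfam_def by (intro ballI Cfam_add open_img) auto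

lemma Mfam_diff: "Mfam k J F \<Longrightarrow> Mfam k J G \<Longrightarrow> Mfam k J (\<lambda>t p. F t p - G t p)"
  unfolding Mfam_def by (intro ballI Cfam_diff open_img) auto

lemma Mfam_mult: "Mfam k J F \<Longrightarrow> Mfam k J G \<Longrightarrow> Mfam k J (\<lambda>t p. F t p * G t p)"
  unfolding Mfam_def by (intro ballI Cfam_mult open_img) auto

lemma Mfam_sum: "(\<And>i. i \<in> I \<Longrightarrow> Mfam k J (F i)) \<Longrightarrow> Mfam k J (\<lambda>t p. \<Sum>i\<in>I. F i t p)"
  unfolding Mfam_def by (intro ballI Cfam_sum open_img) auto

lemma Mfam_divide:
  "Mfam k J F \<Longrightarrow> Mfam k J G \<Longrightarrow> (\<And>t p. t \<in> J \<Longrightarrow> p \<in> pts S \<Longrightarrow> G t p \<noteq> 0) \<Longrightarrow> Mfam k J (\<lambda>t p. F t p / G t p)"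
  unfolding Mfam_def by (intro ballI Cfam_divide open_img) (simp_all add: cinv_pts)

lemma Mfam_ln:
  "Mfam k J F \<Longrightarrow> (\<And>t p. t \<in> J \<Longrightarrow> p \<in> pts S \<Longrightarrow> F t p > 0) \<Longrightarrow> Mfam k J (\<lambda>t p. ln (F t p))"
  unfolding Mfam_def by (intro ballI Cfam_comp_real[OF open_img _ Ck_ln]) (simp_all add: cinv_pts)

lemma Vfam_scaleR:
  assumes "Mfam k J F" "Vfam k J V" shows "Vfam k J (\<lambda>t p. F t p *\<^sub>R V t p)"
  unfolding Vfam_def
proof
  fix c assume c: "c \<in> atlas S"
  have "Cfam k J (img c) (\<lambda>t y. F t (cinv c y) *\<^sub>R coord S c (V t) (cinv c y))"
    using Cfam_scaleR[OF open_img[OF c]] assms c unfolding Mfam_def Vfam_def by blast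
  then show "Cfam k J (img c) (\<lambda>t y. coord S c (\<lambda>p. F t p *\<^sub>R V t p) (cinv c y))"
    by (subst (asm) Cfam_cong[OF open_img[OF c]])
      (auto simp: coord_def linear_scale[OF comps_linear[OF c cinv_in]])
qed

lemma Vfam_diff:
  assumes "Vfam k J U" "Vfam k J V" shows "Vfam k J (\<lambda>t p. U t p - V t p)"
  unfolding Vfam_def
proof
  fix c assume c: "c \<in> atlas S"
  have "Cfam k J (img c) (\<lambda>t y. coord S c (U t) (cinv c y) - coord S c (V t) (cinv c y))"
    using Cfam_diff[OF open_img[OF c]] assms c unfolding Vfam_def by blast
  then show "Cfam k J (img c) (\<lambda>t y. coord S c (\<lambda>p. U t p - V t p) (cinv c y))"
    by (subst (asm) Cfam_cong[OF open_img[OF c]])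
      (auto simp: coord_def linear_diff[OF comps_linear[OF c cinv_in]])
qed

section \<open>Metric and gradient in charts\<close>

lemma metric_bilinear: "p \<in> pts S \<Longrightarrow> bilinear (metric S p)"
  and metric_sym: "p \<in> pts S \<Longrightarrow> metric S p v w = metric S p w v"
  and metric_pos: "p \<in> pts S \<Longrightarrow> v \<noteq> 0 \<Longrightarrow> metric S p v v > 0"
  using metric_ax unfolding riemannian_metric_def by auto

lemma metric_zero: "p \<in> pts S \<Longrightarrow> metric S p 0 v = 0" "p \<in> pts S \<Longrightarrow> metric S p v 0 = 0"
  using bilinear_lzero[OF metric_bilinear] bilinear_rzero[OF metric_bilinear] by auto

lemma metric_nonneg: "p \<in> pts S \<Longrightarrow> metric S p v v \<ge> 0"
  using metric_pos[of p v] metric_zero[of p] by (cases "v = 0") auto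

lemma metric_eq_0: "p \<in> pts S \<Longrightarrow> metric S p v v = 0 \<longleftrightarrow> v = 0"
  using metric_pos[of p v] metric_zero[of p] by (cases "v = 0") simp_all

lemma metric_add: "p \<in> pts S \<Longrightarrow> metric S p (u + v) w = metric S p u w + metric S p v w"
    "p \<in> pts S \<Longrightarrow> metric S p w (u + v) = metric S p w u + metric S p w v"
  using bilinear_ladd[OF metric_bilinear] bilinear_radd[OF metric_bilinear] by auto

lemma metric_diff: "p \<in> pts S \<Longrightarrow> metric S p (u - v) w = metric S p u w - metric S p v w"
    "p \<in> pts S \<Longrightarrow> metric S p w (u - v) = metric S p w u - metric S p w v"
  using bilinear_lsub[OF metric_bilinear] bilinear_rsub[OF metric_bilinear] by auto

lemma metric_scale: "p \<in> pts S \<Longrightarrow> metric S p (r *\<^sub>R v) w = r * metric S p v w"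
    "p \<in> pts S \<Longrightarrow> metric S p w (r *\<^sub>R v) = r * metric S p w v"
  using bilinear_lmul[OF metric_bilinear] bilinear_rmul[OF metric_bilinear] by auto

lemma metric_coords:
  assumes "c \<in> atlas S" "p \<in> cdom c"
  shows "metric S p v w = (\<Sum>i\<in>UNIV. \<Sum>j\<in>UNIV. comps c p v $ i * comps c p w $ j * gram S c p $ i $ j)"
proof -
  have b: "bilinear (\<lambda>a b. metric S p (frame S c p a) (frame S c p b))"
    using metric_bilinear[OF in_pts[OF assms]] frame_linear[OF assms] unfolding bilinear_def
    by (auto intro: linear_compose[unfolded comp_def])
  show ?thesis
    using bilinear_expand[OF b, of "comps c p v" "comps c p w"] by (simp add: frame_comps[OF assms] gram_def)
qed

lemma gram_posdef:
  assumes "c \<in> atlas S" "p \<in> cdom c" "v \<noteq> 0" shows "v \<bullet> (gram S c p *v v) > 0"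
proof -
  have "frame S c p v \<noteq> 0" using assms(3) comps_frame[OF assms(1,2), of v] linear_0[OF comps_linear[OF assms(1,2)]] by auto
  then have "0 < metric S p (frame S c p v) (frame S c p v)" using metric_pos[OF in_pts[OF assms(1,2)]] by blast
  also have "\<dots> = v \<bullet> (gram S c p *v v)"
    unfolding metric_coords[OF assms(1,2)] comps_frame[OF assms(1,2)]
    by (simp add: inner_vec_def matrix_vector_mult_def sum_distrib_left algebra_simps)
  finally show ?thesis .
qed

lemma gram_det_pos: "c \<in> atlas S \<Longrightarrow> p \<in> cdom c \<Longrightarrow> det (gram S c p) > 0"
  by (rule det_pos_of_posdef) (rule gram_posdef)

abbreviation sg :: "('a, 'n) chart \<Rightarrow> 'a \<Rightarrow> real" where "sg c p \<equiv> sqrt (det (gram S c p))"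

lemma gram_Cfam: "c \<in> atlas S \<Longrightarrow> Cfam k J (img c) (\<lambda>t y. gram S c (cinv c y) $ i $ j)"
proof -
  assume c: "c \<in> atlas S"
  have "Ck k (img c) (gram S c \<circ> cinv c)"
    using metric_ax smooth_on_iff[OF open_img[OF c], of "gram S c \<circ> cinv c"] c unfolding riemannian_metric_def by simp
  from Cfam_of_Ck[OF this, of J] have "Cfam k J (img c) (\<lambda>t y. gram S c (cinv c y))" unfolding comp_def .
  then show ?thesis by (intro Cfam_linear[OF open_img[OF c] bounded_linear_vec_nth])
qed

lemma sg_Cfam: "c \<in> atlas S \<Longrightarrow> Cfam k J (img c) (\<lambda>t y. sg c (cinv c y))"
  by (rule Cfam_comp_real[OF open_img Cfam_det[OF open_img gram_Cfam] Ck_sqrt]) (auto intro: gram_det_pos cinv_in)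

lemma sg_pos: "c \<in> atlas S \<Longrightarrow> p \<in> cdom c \<Longrightarrow> sg c p > 0"
  using gram_det_pos by simp

lemma Mfam_metric:
  assumes "Vfam k J U" "Vfam k J V" shows "Mfam k J (\<lambda>t p. metric S p (U t p) (V t p))"
  unfolding Mfam_def
proof
  fix c assume c: "c \<in> atlas S"
  have "Cfam k J (img c) (\<lambda>t y. \<Sum>i\<in>UNIV. \<Sum>j\<in>UNIV. coord S c (U t) (cinv c y) $ i * coord S c (V t) (cinv c y) $ j * gram S c (cinv c y) $ i $ j)"
    using assms c unfolding Vfam_def by (intro Cfam_sum Cfam_mult gram_Cfam Cfam_nth open_img) auto
  then show "Cfam k J (img c) (\<lambda>t y. metric S (cinv c y) (U t (cinv c y)) (V t (cinv c y)))"
    by (subst (asm) Cfam_cong[OF open_img[OF c]]) (auto simp: coord_def metric_coords[OF c cinv_in])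
qed

lemma grad_outside: "p \<notin> pts S \<Longrightarrow> grad S f p = 0"
  by (simp add: grad_def)

text \<open>The gradient is defined through the distinguished chart at the point; the transformation
  behaviour of components and of derivatives under a change of chart shows that any chart may be
  used.\<close>

lemma metric_grad:
  assumes c: "c \<in> atlas S" "p \<in> cdom c" and D: "((\<lambda>y. f (cinv c y)) has_derivative D) (at (cmap c p))"
  shows "metric S p (grad S f p) v = D (comps c p v)"
proof -
  let ?h = "chart_at S p"
  have p: "p \<in> pts S" using in_pts c by blast
  note h = chart_at_atlas[OF p] chart_at_dom[OF p]
  have "((\<lambda>y. f (cinv c y)) has_derivative D) (at (trans_map ?h c (cmap ?h p)))"
    using D by (simp add: trans_map_cmap h)
  from has_derivative_compose[OF jac_has_derivative[OF h(1) c(1) h(2) c(2)] this]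
  have "((\<lambda>y. f (cinv c (trans_map ?h c y))) has_derivative (\<lambda>v. D (comps c p v))) (at (cmap ?h p))" .
  then have "(f \<circ> cinv ?h has_derivative (\<lambda>v. D (comps c p v))) (at (cmap ?h p))"
    by (rule has_derivative_transform_within_open[OF _ open_overlap[OF h(1) c(1)]])
      (use h c in \<open>auto simp: cinv_trans_map\<close>)
  from frechet_derivative_at[OF this] have fd: "frechet_derivative (f \<circ> cinv ?h) (at (cmap ?h p)) = (\<lambda>v. D (comps c p v))" by simp
  let ?E = "\<lambda>v. D (comps c p v)"
  have lE: "linear ?E"
    using linear_compose[OF comps_linear[OF c] has_derivative_linear[OF D]] by (simp add: comp_def)
  let ?G = "gram S ?h p"
  have det: "det (transpose ?G) \<noteq> 0" using gram_det_pos[OF h] by simp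
  define w where "w = (\<chi> k. det (\<chi> i j. if j = k then (\<chi> j. ?E (axis j 1)) $ i else transpose ?G $ i $ j) / det (transpose ?G))"
  have w: "transpose ?G *v w = (\<chi> j. ?E (axis j 1))" unfolding cramer[OF det] w_def ..
  have 1: "metric S p w v = ?E v" for v
  proof -
    have "metric S p w v = (\<Sum>i\<in>UNIV. \<Sum>j\<in>UNIV. w $ i * v $ j * ?G $ i $ j)"
      using metric_coords[OF h, of w v] by (simp add: jac_self[OF h])
    also have "\<dots> = (\<Sum>j\<in>UNIV. v $ j * (transpose ?G *v w) $ j)"
      by (subst sum.swap) (simp add: matrix_vector_mult_def transpose_def sum_distrib_left algebra_simps)
    also have "\<dots> = (\<Sum>j\<in>UNIV. v $ j * ?E (axis j 1))" unfolding w by simp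
    also have "\<dots> = ?E (\<Sum>j\<in>UNIV. (v $ j) *\<^sub>R axis j 1)"
      by (simp only: linear_sum[OF lE] linear_scale[OF lE] real_scaleR_def)
    also have "(\<Sum>j\<in>UNIV. (v $ j) *\<^sub>R axis j 1) = v"
      using basis_expansion[of v] by (simp add: scalar_mult_eq_scaleR)
    finally show ?thesis .
  qed
  have "grad S f p = (THE w. \<forall>v. metric S p w v = ?E v)"
    unfolding grad_def fd using p by simp
  also have "\<dots> = w"
  proof (rule the_equality)
    fix w' assume w': "\<forall>v. metric S p w' v = ?E v"
    then have "metric S p (w' - w) (w' - w) = 0" using 1 by (simp add: metric_diff(1)[OF p])
    then show "w' = w" using metric_eq_0[OF p] by simp
  qed (use 1 in blast)
  finally show ?thesis using 1 by simp
qed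

text \<open>In a chart the components of the gradient solve a linear system with matrix
  \<open>g\<^sub>i\<^sub>j\<close>.  Cramer's rule shows that the solution is as regular as the
  right hand side.\<close>

lemma Vfam_grad:
  assumes F: "Mfam (Suc k) J F" shows "Vfam k J (\<lambda>t. grad S (F t))"
  unfolding Vfam_def
proof
  fix c assume c: "c \<in> atlas S"
  let ?b = "\<lambda>t y. (\<chi> j. frechet_derivative (\<lambda>y. F t (cinv c y)) (at y) (axis j 1)) :: real^'n"
  let ?w = "\<lambda>t y. (\<chi> k. det (\<chi> i j. if j = k then ?b t y $ i else gram S c (cinv c y) $ j $ i) / det (gram S c (cinv c y))) :: real^'n"
  have Fc: "Cfam (Suc k) J (img c) (\<lambda>t y. F t (cinv c y))" using F c unfolding Mfam_def by blast
  have "Cfam k J (img c) ?w"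
  proof (rule Cfam_vec[OF open_img[OF c]])
    fix m
    have "Cfam k J (img c) (\<lambda>t y. if j = m then ?b t y $ i else gram S c (cinv c y) $ j $ i)" for i j
      using Cfam_deriv[OF Fc] gram_Cfam[OF c] by (cases "j = m") simp_all
    then have "Cfam k J (img c) (\<lambda>t y. det (\<chi> i j. if j = m then ?b t y $ i else gram S c (cinv c y) $ j $ i) / det (gram S c (cinv c y)))"
      by (intro Cfam_divide[OF open_img[OF c]] Cfam_det[OF open_img[OF c]] gram_Cfam[OF c])
        (use gram_det_pos[OF c cinv_in] in \<open>force+\<close>)
    then show "Cfam k J (img c) (\<lambda>t y. ?w t y $ m)" by simp
  qed
  moreover have "?w t y = coord S c (grad S (F t)) (cinv c y)" if t: "t \<in> J" "y \<in> img c" for t y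
  proof -
    let ?p = "cinv c y"
    note p = c cinv_in[OF t(2)]
    let ?G = "gram S c ?p" and ?a = "coord S c (grad S (F t)) ?p"
    have "((\<lambda>y. F t (cinv c y)) has_derivative frechet_derivative (\<lambda>y. F t (cinv c y)) (at y)) (at (cmap c ?p))"
      using Cfam_has_derivative[OF Fc t] by (simp add: cmap_cinv[OF t(2)])
    from metric_grad[OF p this] have m: "metric S ?p (grad S (F t) ?p) (frame S c ?p (axis j 1)) = ?b t y $ j" for j
      by (simp add: comps_frame[OF p])
    have "(transpose ?G *v ?a) $ j = ?b t y $ j" for j
    proof -
      have "(\<Sum>i\<in>UNIV. \<Sum>k\<in>UNIV. ?a $ i * axis j 1 $ k * ?G $ i $ k) = ?b t y $ j"
        using m[of j] unfolding metric_coords[OF p] comps_frame[OF p] coord_def .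
      moreover have "(\<Sum>k\<in>UNIV. ?a $ i * axis j 1 $ k * ?G $ i $ k) = ?a $ i * ?G $ i $ j" for i
        by (subst sum.remove[of _ j]) (auto simp: axis_def intro!: sum.neutral)
      ultimately show ?thesis by (simp add: matrix_vector_mult_def transpose_def mult.commute)
    qed
    then have "transpose ?G *v ?a = ?b t y" by (simp add: vec_eq_iff)
    moreover have "det (transpose ?G) \<noteq> 0" using gram_det_pos[OF p] by simp
    ultimately have "?a = (\<chi> k. det (\<chi> i j. if j = k then ?b t y $ i else transpose ?G $ i $ j) / det (transpose ?G))"
      using cramer by blast
    moreover have "transpose ?G $ i $ j = ?G $ j $ i" for i j by (simp add: transpose_def)
    ultimately show ?thesis by (simp add: det_transpose cong: if_cong)
  qed
  ultimately show "Cfam k J (img c) (\<lambda>t y. coord S c (grad S (F t)) (cinv c y))"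
    using Cfam_cong[OF open_img[OF c], of J ?w] by simp
qed

end


context riem
begin

section \<open>A finite cover by coordinate balls\<close>

abbreviation coord_ball :: "('a, 'n) chart \<times> (real^'n) \<times> real \<Rightarrow> 'a set" where
  "coord_ball i \<equiv> {p \<in> cdom (fst i). cmap (fst i) p \<in> ball (fst (snd i)) (snd (snd i))}"

abbreviation good_ball :: "('a, 'n) chart \<times> (real^'n) \<times> real \<Rightarrow> bool" where
  "good_ball i \<equiv> fst i \<in> atlas S \<and> snd (snd i) > 0 \<and> cball (fst (snd i)) (snd (snd i)) \<subseteq> img (fst i)"

text \<open>Compactness of the manifold.  The closed balls stay inside the images of their charts, so
  continuous functions are bounded on each of them.\<close>

lemma finite_cover: "\<exists>N. finite N \<and> (\<forall>i\<in>N. good_ball i) \<and> (\<Union>i\<in>N. coord_ball i) = pts S"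
proof -
  have op: "openin (mtop S) (coord_ball i)" if "good_ball i" for i
    using chart_open_preimage[of "fst i" "ball (fst (snd i)) (snd (snd i))"] that by simp
  have ex: "\<exists>i. good_ball i \<and> p \<in> coord_ball i" if p: "p \<in> pts S" for p
  proof -
    obtain c where c: "c \<in> atlas S" "p \<in> cdom c" using chart_exists[OF p] by blast
    then obtain e where e: "e > 0" "cball (cmap c p) e \<subseteq> img c"
      using open_contains_cball[of "img c"] open_img[OF c(1)] by blast
    then show ?thesis using c by (intro exI[of _ "(c, cmap c p, e)"]) simp
  qed
  have un: "\<Union>(coord_ball ` {i. good_ball i}) = pts S"
  proof (rule subset_antisym)
    show "\<Union>(coord_ball ` {i. good_ball i}) \<subseteq> pts S"
    proof (rule Union_least)
      fix X assume "X \<in> coord_ball ` {i. good_ball i}"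
      then obtain i where "good_ball i" "X = coord_ball i" by blast
      then show "X \<subseteq> pts S" using openin_subset[OF op[of i]] by simp
    qed
    show "pts S \<subseteq> \<Union>(coord_ball ` {i. good_ball i})"
    proof
      fix p assume "p \<in> pts S"
      from ex[OF this] obtain i where "good_ball i" "p \<in> coord_ball i" by blast
      then show "p \<in> \<Union>(coord_ball ` {i. good_ball i})" by (intro UnionI[of "coord_ball i"]) simp_all
    qed
  qed
  have "\<exists>F. finite F \<and> F \<subseteq> coord_ball ` {i. good_ball i} \<and> \<Union>F = pts S"
    by (rule compact_pts[unfolded compact_space, rule_format]) (use un op in auto)
  then obtain F where F: "finite F" "F \<subseteq> coord_ball ` {i. good_ball i}" "\<Union>F = pts S"
    by (elim exE conjE) (rule that)
  from finite_subset_image[OF F(1,2)] obtain N where N: "N \<subseteq> {i. good_ball i}" "finite N" "F = coord_ball ` N"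
    by (elim exE conjE) (rule that)
  show ?thesis
  proof (intro exI[of _ N] conjI ballI)
    show "finite N" by (rule N(2))
    show "(\<Union>i\<in>N. coord_ball i) = pts S" using F(3) unfolding N(3) .
    fix i assume "i \<in> N"
    with N(1) have "i \<in> {i. good_ball i}" by (rule subsetD)
    then have g: "good_ball i" by (rule CollectD)
    show "fst i \<in> atlas S" "snd (snd i) > 0" "cball (fst (snd i)) (snd (snd i)) \<subseteq> img (fst i)" using g by simp_all
  qed
qed

lemma finite_ball_bound:
  assumes "finite N" "\<And>i. i \<in> N \<Longrightarrow> \<exists>C::real. \<forall>x\<in>X. Q i x \<longrightarrow> f x \<le> C" "\<And>x. x \<in> X \<Longrightarrow> \<exists>i\<in>N. Q i x"
  shows "\<exists>C. \<forall>x\<in>X. f x \<le> C"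
proof -
  have "\<forall>i\<in>N. \<exists>C. \<forall>x\<in>X. Q i x \<longrightarrow> f x \<le> C" using assms(2) by blast
  from bchoice[OF this] obtain C where C: "\<And>i. i \<in> N \<Longrightarrow> \<forall>x\<in>X. Q i x \<longrightarrow> f x \<le> C i" by blast
  have "f x \<le> (\<Sum>i\<in>N. \<bar>C i\<bar>)" if x: "x \<in> X" for x
  proof -
    obtain i where i: "i \<in> N" "Q i x" using assms(3)[OF x] by blast
    have "f x \<le> C i" using C[OF i(1)] i(2) x by blast
    then have "f x \<le> \<bar>C i\<bar>" by simp
    also have "\<dots> \<le> (\<Sum>i\<in>N. \<bar>C i\<bar>)" by (rule member_le_sum[OF i(1)]) (use assms(1) in auto)
    finally show ?thesis .
  qed
  then show ?thesis by blast
qed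

text \<open>Compactness in time and space together; each of the finitely many coordinate balls contributes
  one bound.\<close>

lemma Mfam_bounded:
  assumes F: "Mfam k J F" and K: "compact K" "K \<subseteq> J"
  shows "\<exists>C. \<forall>t\<in>K. \<forall>p\<in>pts S. \<bar>F t p\<bar> \<le> C"
proof -
  obtain N where N: "finite N" "\<forall>i\<in>N. good_ball i" "(\<Union>i\<in>N. coord_ball i) = pts S" using finite_cover by blast
  have "\<exists>C. \<forall>x\<in>K \<times> pts S. \<bar>F (fst x) (snd x)\<bar> \<le> C"
  proof (rule finite_ball_bound[OF N(1), where Q = "\<lambda>i x. snd x \<in> coord_ball i"])
    fix i assume i: "i \<in> N"
    let ?c = "fst i" and ?B = "cball (fst (snd i)) (snd (snd i))"
    have c: "?c \<in> atlas S" "?B \<subseteq> img ?c" using N(2) i by auto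
    have "continuous_on (K \<times> ?B) (\<lambda>(t, y). F t (cinv ?c y))"
      by (rule continuous_on_subset[OF Cfam_continuous])
        (use F c K in \<open>auto simp: Mfam_def simp del: split_paired_all\<close>)
    then have "bounded ((\<lambda>(t, y). F t (cinv ?c y)) ` (K \<times> ?B))"
      by (intro compact_imp_bounded compact_continuous_image compact_Times K) simp_all
    then obtain C where C: "\<forall>z\<in>K \<times> ?B. norm (case z of (t, y) \<Rightarrow> F t (cinv ?c y)) \<le> C"
      unfolding bounded_iff by blast
    have "\<bar>F (fst x) (snd x)\<bar> \<le> C" if x: "x \<in> K \<times> pts S" "snd x \<in> coord_ball i" for x
    proof -
      have "(fst x, cmap ?c (snd x)) \<in> K \<times> ?B" using x by (cases x) auto
      from C[rule_format, OF this] have "norm (F (fst x) (cinv ?c (cmap ?c (snd x)))) \<le> C" by simp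
      then show ?thesis using cinv_cmap[OF c(1), of "snd x"] x(2) by simp
    qed
    then show "\<exists>C. \<forall>x\<in>K \<times> pts S. snd x \<in> coord_ball i \<longrightarrow> \<bar>F (fst x) (snd x)\<bar> \<le> C" by blast
  next
    fix x assume "x \<in> K \<times> pts S"
    then have "snd x \<in> pts S" by (cases x) simp
    then show "\<exists>i\<in>N. snd x \<in> coord_ball i" using N(3) by blast
  qed
  then obtain C where C: "\<forall>x\<in>K \<times> pts S. \<bar>F (fst x) (snd x)\<bar> \<le> C" by blast
  have "\<bar>F t p\<bar> \<le> C" if "t \<in> K" "p \<in> pts S" for t p
    using C[rule_format, of "(t, p)"] that by simp
  then show ?thesis by blast
qed

lemma Mk_bounded: "Mk k f \<Longrightarrow> \<exists>C. \<forall>p\<in>pts S. \<bar>f p\<bar> \<le> C"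
  using Mfam_bounded[of k UNIV "\<lambda>_. f" "{0}"] by auto

section \<open>The Riemannian volume in charts\<close>

lemma space_vol: "space (vol S) = pts S" and sets_vol: "sets (vol S) = sigma_sets (pts S) {U. openin (mtop S) U}"
  and emeasure_chart: "c \<in> atlas S \<Longrightarrow> B \<in> sets (vol S) \<Longrightarrow> B \<subseteq> cdom c \<Longrightarrow>
        emeasure (vol S) B = (\<integral>\<^sup>+ y\<in>cmap c ` B. ennreal (sg c (cinv c y)) \<partial>lborel)"
  using volume_ax unfolding riemannian_volume_def by blast+

lemma open_sets_vol: "openin (mtop S) U \<Longrightarrow> U \<in> sets (vol S)"
  unfolding sets_vol by (rule sigma_sets.Basic) simp

lemma cdom_sets: "c \<in> atlas S \<Longrightarrow> cdom c \<in> sets (vol S)"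
  by (rule open_sets_vol[OF open_cdom])

lemma preimage_cinv: "c \<in> atlas S \<Longrightarrow> {y \<in> img c. cinv c y \<in> W} = cmap c ` (W \<inter> cdom c)"
proof (intro set_eqI iffI)
  fix y assume c: "c \<in> atlas S" and y: "y \<in> {y \<in> img c. cinv c y \<in> W}"
  then show "y \<in> cmap c ` (W \<inter> cdom c)"
    using cmap_cinv[of y c] cinv_in[of y c] by (intro image_eqI[of _ _ "cinv c y"]) simp_all
next
  fix y assume c: "c \<in> atlas S" and "y \<in> cmap c ` (W \<inter> cdom c)"
  then obtain p where "p \<in> W" "p \<in> cdom c" "y = cmap c p" by blast
  then show "y \<in> {y \<in> img c. cinv c y \<in> W}" using cinv_cmap[OF c, of p] by simp
qed

lemma open_preimage_cinv: "c \<in> atlas S \<Longrightarrow> openin (mtop S) W \<Longrightarrow> open {y \<in> img c. cinv c y \<in> W}"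
  unfolding preimage_cinv by (rule chart_open_image) (auto intro: openin_Int open_cdom)

lemma cinv_continuous: "c \<in> atlas S \<Longrightarrow> continuous_map (top_of_set (img c)) (mtop S) (cinv c)"
  unfolding continuous_map_def
proof (intro conjI allI impI)
  assume c: "c \<in> atlas S"
  show "cinv c \<in> topspace (top_of_set (img c)) \<rightarrow> pts S" using cinv_pts[OF c] by simp
  fix W assume W: "openin (mtop S) W"
  have "openin (top_of_set (img c)) ({y \<in> img c. cinv c y \<in> W} \<inter> img c)"
    using openin_open_Int[OF open_preimage_cinv[OF c W], of "img c"] by (simp add: Int_commute)
  moreover have "{y \<in> img c. cinv c y \<in> W} \<inter> img c = {y \<in> topspace (top_of_set (img c)). cinv c y \<in> W}" by auto
  ultimately show "openin (top_of_set (img c)) {y \<in> topspace (top_of_set (img c)). cinv c y \<in> W}" by simp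
qed

lemma measurable_Mk:
  assumes "Mk k f" shows "f \<in> borel_measurable (vol S)"
proof (rule borel_measurableI)
  fix U :: "real set" assume U: "open U"
  have "openin (mtop S) {p \<in> cdom c. cmap c p \<in> {y \<in> img c. f (cinv c y) \<in> U}}" if c: "c \<in> atlas S" for c
  proof (rule chart_open_preimage[OF c])
    have "continuous_on (img c) (\<lambda>y. f (cinv c y))"
      using assms c unfolding Mfam_def by (blast intro: Ck_continuous)
    from continuous_open_preimage[OF this open_img[OF c] U]
    show "open {y \<in> img c. f (cinv c y) \<in> U}" by (simp add: vimage_def Int_def)
  qed
  then have "openin (mtop S) (\<Union>c\<in>atlas S. {p \<in> cdom c. cmap c p \<in> {y \<in> img c. f (cinv c y) \<in> U}})" by blast
  moreover have "(\<Union>c\<in>atlas S. {p \<in> cdom c. cmap c p \<in> {y \<in> img c. f (cinv c y) \<in> U}}) = f -` U \<inter> pts S"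
  proof (intro set_eqI iffI)
    fix p assume "p \<in> (\<Union>c\<in>atlas S. {p \<in> cdom c. cmap c p \<in> {y \<in> img c. f (cinv c y) \<in> U}})"
    then obtain c where c: "c \<in> atlas S" "p \<in> cdom c" "f (cinv c (cmap c p)) \<in> U" by blast
    then show "p \<in> f -` U \<inter> pts S" using cinv_cmap[OF c(1,2)] in_pts[OF c(1,2)] by simp
  next
    fix p assume p: "p \<in> f -` U \<inter> pts S"
    then obtain c where c: "c \<in> atlas S" "p \<in> cdom c" using chart_exists by blast
    then show "p \<in> (\<Union>c\<in>atlas S. {p \<in> cdom c. cmap c p \<in> {y \<in> img c. f (cinv c y) \<in> U}})"
      using p cinv_cmap[OF c] by (intro UN_I[OF c(1)]) simp
  qed
  ultimately show "f -` U \<inter> space (vol S) \<in> sets (vol S)" using open_sets_vol unfolding space_vol by simp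
qed

abbreviation chart_lebesgue :: "('a, 'n) chart \<Rightarrow> (real^'n) measure" where
  "chart_lebesgue c \<equiv> restrict_space lborel (img c)"

lemma img_borel: "c \<in> atlas S \<Longrightarrow> img c \<in> sets borel"
  using open_img by (simp add: borel_open)

lemma chart_lebesgue_space: "space (chart_lebesgue c) = img c"
  by (simp add: space_restrict_space)

lemma cinv_measurable: "c \<in> atlas S \<Longrightarrow> cinv c \<in> measurable (chart_lebesgue c) (vol S)"
proof (rule measurable_sigma_sets[OF sets_vol])
  assume c: "c \<in> atlas S"
  show "{U. openin (mtop S) U} \<subseteq> Pow (pts S)" using openin_subset by blast
  show "cinv c \<in> space (chart_lebesgue c) \<rightarrow> pts S" unfolding chart_lebesgue_space using cinv_pts[OF c] by blast
  fix W assume "W \<in> {U. openin (mtop S) U}"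
  then have "open {y \<in> img c. cinv c y \<in> W}" using open_preimage_cinv[OF c] by simp
  moreover have "cinv c -` W \<inter> space (chart_lebesgue c) = {y \<in> img c. cinv c y \<in> W}"
    unfolding chart_lebesgue_space by blast
  ultimately show "cinv c -` W \<inter> space (chart_lebesgue c) \<in> sets (chart_lebesgue c)"
    using img_borel[OF c] by (simp add: sets_restrict_space_iff) 
qed

lemma sg_measurable: "c \<in> atlas S \<Longrightarrow> (\<lambda>y. sg c (cinv c y)) \<in> borel_measurable (chart_lebesgue c)"
proof -
  assume c: "c \<in> atlas S"
  have "continuous_on (img c) (\<lambda>y. sg c (cinv c y))" by (rule Ck_continuous[OF sg_Cfam[OF c]])
  from borel_measurable_continuous_on_restrict[OF this]
  show ?thesis by (simp add: measurable_def space_restrict_space sets_restrict_space)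
qed

lemma cinv_density_measurable:
  assumes c: "c \<in> atlas S"
  shows "cinv c \<in> measurable (density (chart_lebesgue c) h) (restrict_space (vol S) (cdom c))"
proof (rule measurable_restrict_space2)
  show "cinv c \<in> measurable (density (chart_lebesgue c) h) (vol S)"
    using cinv_measurable[OF c] unfolding measurable_cong_sets[OF sets_density refl] .
  show "cinv c \<in> space (density (chart_lebesgue c) h) \<rightarrow> cdom c"
  proof
    fix y assume "y \<in> space (density (chart_lebesgue c) h)"
    then have "y \<in> img c" by (simp add: chart_lebesgue_space)
    then show "cinv c y \<in> cdom c" by (rule cinv_in)
  qed
qed

text \<open>The volume is given only on Borel subsets of chart domains.  This form, an equality of measures,
  allows integrals to be transported.\<close>

lemma chart_measure:
  assumes c: "c \<in> atlas S"
  shows "distr (density (chart_lebesgue c) (\<lambda>y. ennreal (sg c (cinv c y)))) (restrict_space (vol S) (cdom c)) (cinv c)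
    = restrict_space (vol S) (cdom c)" (is "?L = ?R")
proof (rule measure_eqI)
  have cs: "cdom c \<inter> space (vol S) \<in> sets (vol S)"
    using cdom_sets[OF c] sets.sets_into_space[OF cdom_sets[OF c]] by (simp add: Int_absorb2)
  have m: "cinv c \<in> measurable (density (chart_lebesgue c) (\<lambda>y. ennreal (sg c (cinv c y)))) (restrict_space (vol S) (cdom c))"
    by (rule cinv_density_measurable[OF c])
  show "sets ?L = sets ?R" by simp
  fix A assume "A \<in> sets ?L"
  then have A3: "A \<in> sets ?R" by simp
  have A: "A \<in> sets (vol S)" "A \<subseteq> cdom c" "A \<in> sets ?R"
    using A3 sets_restrict_space_iff[OF cs, of A] by simp_all
  have pm: "cinv c -` A \<inter> img c \<in> sets (chart_lebesgue c)"
    using measurable_sets[OF cinv_measurable[OF c] A(1)] unfolding chart_lebesgue_space .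
  have "emeasure ?L A = emeasure (density (chart_lebesgue c) (\<lambda>y. ennreal (sg c (cinv c y)))) (cinv c -` A \<inter> img c)"
    by (subst emeasure_distr[OF m A(3)]) (simp add: chart_lebesgue_space)
  also have "\<dots> = (\<integral>\<^sup>+ y. ennreal (sg c (cinv c y)) * indicator (cinv c -` A \<inter> img c) y \<partial>chart_lebesgue c)"
    using sg_measurable[OF c] pm by (intro emeasure_density) auto
  also have "\<dots> = (\<integral>\<^sup>+ y. ennreal (sg c (cinv c y)) * indicator (cinv c -` A \<inter> img c) y * indicator (img c) y \<partial>lborel)"
    by (rule nn_integral_restrict_space) (use img_borel[OF c] in simp)
  also have "\<dots> = (\<integral>\<^sup>+ y\<in>cmap c ` A. ennreal (sg c (cinv c y)) \<partial>lborel)"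
  proof (rule nn_integral_cong)
    fix y
    have "cmap c ` A = {y \<in> img c. cinv c y \<in> A}"
      unfolding preimage_cinv[OF c] using A(2) by (simp add: Int_absorb2)
    then show "ennreal (sg c (cinv c y)) * indicator (cinv c -` A \<inter> img c) y * indicator (img c) y =
        ennreal (sg c (cinv c y)) * indicator (cmap c ` A) y"
      by (cases "y \<in> img c"; cases "cinv c y \<in> A") simp_all
  qed
  also have "\<dots> = emeasure (vol S) A" using emeasure_chart[OF c A(1,2)] by simp
  also have "\<dots> = emeasure ?R A" by (rule emeasure_restrict_space[symmetric, OF cs A(2)])
  finally show "emeasure ?L A = emeasure ?R A" .
qed

lemma chart_integral:
  fixes f :: "'a \<Rightarrow> real"
  assumes c: "c \<in> atlas S" and f: "f \<in> borel_measurable (vol S)" and z: "\<And>p. p \<in> pts S \<Longrightarrow> p \<notin> cdom c \<Longrightarrow> f p = 0"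
  shows "integral\<^sup>L (vol S) f = (\<integral>y. indicator (img c) y *\<^sub>R (sg c (cinv c y) * f (cinv c y)) \<partial>lborel)"
proof -
  have cs: "cdom c \<inter> space (vol S) \<in> sets (vol S)"
    using cdom_sets[OF c] sets.sets_into_space[OF cdom_sets[OF c]] by (simp add: Int_absorb2)
  let ?D = "density (chart_lebesgue c) (\<lambda>y. ennreal (sg c (cinv c y)))"
  have m: "cinv c \<in> measurable ?D (restrict_space (vol S) (cdom c))"
    by (rule cinv_density_measurable[OF c])
  have fr: "f \<in> borel_measurable (restrict_space (vol S) (cdom c))" by (rule measurable_restrict_space1[OF f])
  have "integral\<^sup>L (vol S) f = (\<integral>x. indicator (cdom c) x *\<^sub>R f x \<partial>vol S)"
    by (rule Bochner_Integration.integral_cong) (use z in \<open>auto simp: space_vol indicator_def\<close>)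
  also have "\<dots> = integral\<^sup>L (restrict_space (vol S) (cdom c)) f" by (rule integral_restrict_space[symmetric, OF cs])
  also have "\<dots> = integral\<^sup>L (distr ?D (restrict_space (vol S) (cdom c)) (cinv c)) f" unfolding chart_measure[OF c] ..
  also have "\<dots> = (\<integral>y. f (cinv c y) \<partial>?D)" by (rule integral_distr[OF m fr])
  also have "\<dots> = (\<integral>y. sg c (cinv c y) *\<^sub>R f (cinv c y) \<partial>chart_lebesgue c)"
    by (rule integral_density[OF measurable_compose[OF cinv_measurable[OF c] f] sg_measurable[OF c]])
      (rule AE_I2, rule less_imp_le[OF sg_pos[OF c cinv_in]], simp add: chart_lebesgue_space)
  also have "\<dots> = (\<integral>y. indicator (img c) y *\<^sub>R (sg c (cinv c y) *\<^sub>R f (cinv c y)) \<partial>lborel)"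
    by (rule integral_restrict_space) (use img_borel[OF c] in simp)
  finally show ?thesis by simp
qed

lemma finite_volume: "emeasure (vol S) (pts S) < \<infinity>"
proof -
  obtain N where N: "finite N" "\<forall>i\<in>N. good_ball i" "(\<Union>i\<in>N. coord_ball i) = pts S" using finite_cover by blast
  have fin: "emeasure (vol S) (coord_ball i) < \<infinity>" if i: "i \<in> N" for i
  proof -
    let ?c = "fst i" and ?y = "fst (snd i)" and ?r = "snd (snd i)"
    have c: "?c \<in> atlas S" "?r > 0" "cball ?y ?r \<subseteq> img ?c" using N(2) i by auto
    have cs: "coord_ball i \<in> sets (vol S)"
      by (rule open_sets_vol[OF chart_open_preimage[OF c(1) open_ball]])
    have "continuous_on (cball ?y ?r) (\<lambda>y. sg ?c (cinv ?c y))"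
      by (rule continuous_on_subset[OF Ck_continuous[OF sg_Cfam[OF c(1)]] c(3)])
    then have "bounded ((\<lambda>y. sg ?c (cinv ?c y)) ` cball ?y ?r)"
      by (intro compact_imp_bounded compact_continuous_image) simp_all
    then obtain C where C: "\<forall>y\<in>cball ?y ?r. norm (sg ?c (cinv ?c y)) \<le> C" unfolding bounded_iff by blast
    have im: "cmap ?c ` coord_ball i \<subseteq> ball ?y ?r" by auto
    have "emeasure (vol S) (coord_ball i) = (\<integral>\<^sup>+ y\<in>cmap ?c ` coord_ball i. ennreal (sg ?c (cinv ?c y)) \<partial>lborel)"
      by (rule emeasure_chart[OF c(1) cs]) blast
    also have "\<dots> \<le> (\<integral>\<^sup>+ y. ennreal C * indicator (cball ?y ?r) y \<partial>lborel)"
    proof (rule nn_integral_mono)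
      fix y show "ennreal (sg ?c (cinv ?c y)) * indicator (cmap ?c ` coord_ball i) y \<le> ennreal C * indicator (cball ?y ?r) y"
      proof (cases "y \<in> cmap ?c ` coord_ball i")
        case True
        then have yb: "y \<in> cball ?y ?r" using im ball_subset_cball by blast
        then have "sg ?c (cinv ?c y) \<le> C" using C by fastforce
        then show ?thesis using yb by (simp add: indicator_def ennreal_leI)
      qed (simp add: indicator_def)
    qed
    also have "\<dots> = ennreal C * emeasure lborel (cball ?y ?r)" by (simp add: nn_integral_cmult_indicator)
    also have "\<dots> < \<infinity>" using emeasure_lborel_cball_finite[of ?y ?r] by (simp add: ennreal_mult_less_top)
    finally show ?thesis .
  qed
  have "emeasure (vol S) (\<Union>i\<in>N. coord_ball i) \<le> (\<Sum>i\<in>N. emeasure (vol S) (coord_ball i))"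
    by (rule emeasure_subadditive_finite[OF N(1)])
      (use N(2) open_sets_vol[OF chart_open_preimage[OF _ open_ball]] in auto)
  also have "\<dots> < \<infinity>" using fin N(1) by simp
  finally show ?thesis unfolding N(3) .
qed

lemma finite_measure_vol: "finite_measure (vol S)"
  by (rule finite_measureI) (use finite_volume in \<open>simp add: space_vol\<close>)

lemma integrable_bounded:
  fixes f :: "'a \<Rightarrow> real"
  assumes "f \<in> borel_measurable (vol S)" "\<And>p. p \<in> pts S \<Longrightarrow> \<bar>f p\<bar> \<le> C"
  shows "integrable (vol S) f"
  by (rule finite_measure.integrable_const_bound[OF finite_measure_vol _ assms(1), of C])
    (use assms(2) in \<open>auto intro!: AE_I2 simp: space_vol\<close>)

lemma integrable_Mk: assumes "Mk k f" shows "integrable (vol S) f"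
proof -
  obtain C where "\<forall>p\<in>pts S. \<bar>f p\<bar> \<le> C" using Mk_bounded[OF assms] by blast
  then show ?thesis using integrable_bounded[OF measurable_Mk[OF assms]] by blast
qed

text \<open>A continuous function that is positive at one point is positive on a neighbourhood, and a
  nonempty open set has positive volume.\<close>

lemma integral_pos:
  assumes f: "Mk k f" and nn: "\<And>p. p \<in> pts S \<Longrightarrow> f p \<ge> 0" and p0: "p0 \<in> pts S" "f p0 > 0"
  shows "integral\<^sup>L (vol S) f > 0"
proof -
  have "integral\<^sup>L (vol S) f \<ge> 0" by (rule integral_nonneg_AE) (auto intro!: AE_I2 nn simp: space_vol)
  moreover have "integral\<^sup>L (vol S) f \<noteq> 0"
  proof
    assume "integral\<^sup>L (vol S) f = 0"
    moreover have "AE p in vol S. 0 \<le> f p" by (rule AE_I2) (simp add: nn space_vol)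
    ultimately have ae: "AE p in vol S. f p = 0"
      using integral_nonneg_eq_0_iff_AE[OF integrable_Mk[OF f]] by simp
    obtain c where c: "c \<in> atlas S" "p0 \<in> cdom c" using chart_exists[OF p0(1)] by blast
    have cont: "continuous_on (img c) (\<lambda>y. f (cinv c y))"
      using f c unfolding Mfam_def by (blast intro: Ck_continuous)
    let ?O = "{y \<in> img c. f (cinv c y) \<in> {0<..}}"
    have "open (img c \<inter> (\<lambda>y. f (cinv c y)) -` {0<..})"
      by (rule continuous_open_preimage[OF cont open_img[OF c(1)]]) simp
    then have O: "open ?O" by (simp add: vimage_def Int_def)
    have ne: "cmap c p0 \<in> ?O" using c p0 cinv_cmap[OF c] by simp
    let ?W = "{p \<in> cdom c. cmap c p \<in> ?O}"
    have W: "openin (mtop S) ?W" by (rule chart_open_preimage[OF c(1) O])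
    have Wf: "f p > 0" if "p \<in> ?W" for p using that cinv_cmap[OF c(1), of p] by simp
    have cW: "cmap c ` ?W = ?O" 
    proof (intro set_eqI iffI)
      fix y assume "y \<in> ?O"
      then show "y \<in> cmap c ` ?W" using cmap_cinv[of y c] cinv_in[of y c] by (intro image_eqI[of _ _ "cinv c y"]) simp_all
    qed blast
    have "AE p in vol S. p \<notin> ?W"
    proof (rule eventually_mono[OF ae], rule notI)
      fix p assume "f p = 0" "p \<in> ?W"
      then show False using Wf[of p] by simp
    qed
    then have "?W \<in> null_sets (vol S)" using AE_iff_null_sets[OF open_sets_vol[OF W]] by blast
    then have "emeasure (vol S) ?W = 0" by (rule null_setsD1)
    then have "(\<integral>\<^sup>+ y\<in>?O. ennreal (sg c (cinv c y)) \<partial>lborel) = 0"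
      using emeasure_chart[OF c(1) open_sets_vol[OF W]] unfolding cW by auto
    moreover have "(\<lambda>y. ennreal (sg c (cinv c y)) * indicator ?O y) \<in> borel_measurable lborel"
    proof -
      have "(\<lambda>y. indicator ?O y *\<^sub>R sg c (cinv c y)) \<in> borel_measurable borel"
      proof (rule borel_measurable_continuous_on_indicator)
        show "?O \<in> sets borel" by (rule borel_open[OF O])
        show "continuous_on ?O (\<lambda>y. sg c (cinv c y))"
          by (rule continuous_on_subset[OF Ck_continuous[OF sg_Cfam[OF c(1)]]]) blast
      qed
      then have "(\<lambda>y. ennreal (indicator ?O y *\<^sub>R sg c (cinv c y))) \<in> borel_measurable borel" by measurable
      moreover have "(\<lambda>y. ennreal (indicator ?O y *\<^sub>R sg c (cinv c y))) = (\<lambda>y. ennreal (sg c (cinv c y)) * indicator ?O y)"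
        by (auto simp: fun_eq_iff indicator_def)
      ultimately show ?thesis by simp
    qed
    ultimately have "AE y in lborel. ennreal (sg c (cinv c y)) * indicator ?O y = 0"
      using nn_integral_0_iff_AE by blast
    moreover have "y \<notin> ?O" if z: "ennreal (sg c (cinv c y)) * indicator ?O y = 0" for y
    proof
      assume y: "y \<in> ?O"
      then have "sg c (cinv c y) > 0" by (intro sg_pos[OF c(1) cinv_in]) simp
      with z y show False by (simp add: ennreal_eq_0_iff)
    qed
    ultimately have "AE y in lborel. y \<notin> ?O" by (rule eventually_mono)
    then have "?O \<in> null_sets lborel"
      using AE_iff_null_sets[of ?O lborel] O by simp
    then have "negligible ?O" unfolding negligible_iff_null_sets by (rule null_sets_completionI)
    then show False using open_not_negligible[OF O] ne by blast
  qed
  ultimately show ?thesis by simp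
qed

section \<open>Smooth functions supported in a chart\<close>

lemma closed_chart_compact:
  assumes "c \<in> atlas S" "compact C" "C \<subseteq> img c"
  shows "openin (mtop S) (pts S - cinv c ` C)"
proof -
  have "compactin (top_of_set (img c)) C" using assms by (simp add: compactin_subtopology)
  from image_compactin[OF this cinv_continuous[OF assms(1)]]
  have "compactin (mtop S) (cinv c ` C)" .
  from compactin_imp_closedin[OF hausdorff this] show ?thesis by (simp add: openin_diff)
qed

text \<open>The complement of the compact support is open, and the function vanishes there, so regularity is
  to be checked only inside the one chart.\<close>

lemma Mk_extend:
  assumes c: "c \<in> atlas S" and C: "compact C" "C \<subseteq> img c"
    and z: "\<And>p. p \<in> pts S \<Longrightarrow> p \<notin> cinv c ` C \<Longrightarrow> f p = 0"
    and f: "Ck k (img c) (\<lambda>y. f (cinv c y))"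
  shows "Mk k f"
  unfolding Mfam_def
proof
  fix d assume d: "d \<in> atlas S"
  show "Ck k (img d) (\<lambda>y. f (cinv d y))"
  proof (rule Cfam_local[OF open_img[OF d]])
    fix y assume y: "y \<in> img d"
    note p = cinv_in[OF y]
    show "\<exists>V. open V \<and> y \<in> V \<and> Ck k (V \<inter> img d) (\<lambda>y. f (cinv d y))"
    proof (cases "cinv d y \<in> cdom c")
      case True
      have "y \<in> overlap d c" using True p cmap_cinv[OF y] by (intro image_eqI[of _ _ "cinv d y"]) simp_all
      moreover have "Ck k (overlap d c) (\<lambda>y. f (cinv c (trans_map d c y)))"
        by (rule Cfam_compose[OF open_overlap[OF d c] _ f trans_map_Ck[OF d c]]) (auto simp: trans_map_cmap[OF d])
      then have "Ck k (overlap d c) (\<lambda>y. f (cinv d y))"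
        by (subst (asm) Cfam_cong[OF open_overlap[OF d c]]) (auto simp: cinv_trans_map[OF d c])
      then have "Ck k (overlap d c \<inter> img d) (\<lambda>y. f (cinv d y))" by (rule Cfam_subset) auto
      ultimately show ?thesis using open_overlap[OF d c] by (intro exI[of _ "overlap d c"] conjI)
    next
      case False
      let ?W = "(pts S - cinv c ` C) \<inter> cdom d"
      have W: "openin (mtop S) ?W" by (intro openin_Int closed_chart_compact[OF c C] open_cdom d)
      have o: "open (cmap d ` ?W)" by (rule chart_open_image[OF d W]) simp
      have "cinv d y \<notin> cinv c ` C"
      proof
        assume "cinv d y \<in> cinv c ` C"
        then obtain x where "x \<in> C" "cinv d y = cinv c x" by (elim imageE) (rule that)
        then show False using False cinv_in[OF subsetD[OF C(2), of x]] by simp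
      qed
      then have "y \<in> cmap d ` ?W"
        using p in_pts[OF d p] cmap_cinv[OF y] by (intro image_eqI[of _ _ "cinv d y"]) simp_all
      moreover have z2: "f (cinv d x) = 0" if "x \<in> cmap d ` ?W \<inter> img d" for x
      proof -
        have "x \<in> cmap d ` ?W" using \<open>x \<in> cmap d ` ?W \<inter> img d\<close> by (rule IntD1)
        then obtain q where "x = cmap d q" "q \<in> ?W" by (rule imageE)
        then show ?thesis using z[of q] cinv_cmap[OF d, of q] by simp
      qed
      then have "Ck k (cmap d ` ?W \<inter> img d) (\<lambda>y. f (cinv d y))"
        using Cfam_cong[OF open_Int[OF o open_img[OF d]], of UNIV "\<lambda>_ y. f (cinv d y)" "\<lambda>_ _. 0" k] by (simp add: Cfam_const)
      ultimately show ?thesis using o by (intro exI[of _ "cmap d ` ?W"] conjI)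
    qed
  qed
qed

definition mbump :: "('a, 'n) chart \<Rightarrow> real^'n \<Rightarrow> real \<Rightarrow> 'a \<Rightarrow> real" where
  "mbump c y0 r p = (if p \<in> cdom c then bump y0 r (cmap c p) else 0)"

lemma mbump_nonneg: "mbump c y0 r p \<ge> 0"
  by (simp add: mbump_def bump_nonneg)

lemma mbump_pos: "r > 0 \<Longrightarrow> mbump c y0 r p > 0 \<longleftrightarrow> p \<in> cdom c \<and> cmap c p \<in> ball y0 r"
  by (simp add: mbump_def bump_pos)

lemma mbump_supp: "c \<in> atlas S \<Longrightarrow> r > 0 \<Longrightarrow> p \<notin> cinv c ` cball y0 r \<Longrightarrow> mbump c y0 r p = 0"
proof (rule ccontr)
  assume a: "c \<in> atlas S" "r > 0" "p \<notin> cinv c ` cball y0 r" "mbump c y0 r p \<noteq> 0"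
  then have "mbump c y0 r p > 0" using mbump_nonneg[of c y0 r p] by simp
  then have "p \<in> cdom c" "cmap c p \<in> cball y0 r" using mbump_pos[OF a(2)] by auto
  then show False using a(3) cinv_cmap[OF a(1), of p] by force
qed

lemma mbump_Mk:
  assumes "c \<in> atlas S" "r > 0" "cball y0 r \<subseteq> img c" shows "Mk k (mbump c y0 r)"
proof (rule Mk_extend[OF assms(1) compact_cball assms(3)])
  show "mbump c y0 r p = 0" if "p \<notin> cinv c ` cball y0 r" for p using mbump_supp assms that by blast
  have "Ck k (img c) (bump y0 r)" by (rule Cfam_subset[OF Ck_bump]) auto
  then show "Ck k (img c) (\<lambda>y. mbump c y0 r (cinv c y))"
    by (subst (asm) Cfam_cong[OF open_img[OF assms(1)]]) (auto simp: mbump_def cinv_in cmap_cinv)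
qed

end


context riem
begin

section \<open>Calculus of the gradient\<close>

lemma Mk_chart_derivative:
  assumes "Mk 1 f" "c \<in> atlas S" "p \<in> cdom c"
  shows "((\<lambda>y. f (cinv c y)) has_derivative frechet_derivative (\<lambda>y. f (cinv c y)) (at (cmap c p))) (at (cmap c p))"
proof -
  have "Cfam (Suc 0) UNIV (img c) (\<lambda>_ y. f (cinv c y))" using assms(1,2) unfolding Mfam_def by simp
  from Cfam_has_derivative[OF this, of 0 "cmap c p"] assms(3) show ?thesis by simp
qed

lemma metric_grad_sum:
  assumes "finite I" "\<And>i. i \<in> I \<Longrightarrow> Mk 1 (f i)" "p \<in> pts S"
  shows "metric S p (grad S (\<lambda>p. \<Sum>i\<in>I. f i p) p) v = (\<Sum>i\<in>I. metric S p (grad S (f i) p) v)"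
proof -
  note c = chart_at_atlas[OF assms(3)] chart_at_dom[OF assms(3)]
  show ?thesis
    by (subst metric_grad[OF c has_derivative_sum[OF Mk_chart_derivative[OF assms(2) c]]])
      (auto intro!: sum.cong simp: metric_grad[OF c Mk_chart_derivative[OF assms(2) c]])
qed

lemma grad_eqI:
  assumes "p \<in> pts S" "\<And>v. metric S p (grad S f p) v = metric S p w v" shows "grad S f p = w"
proof -
  have "metric S p (grad S f p - w) (grad S f p - w) = 0" using assms by (simp add: metric_diff)
  then show ?thesis using metric_eq_0[OF assms(1)] by simp
qed

lemma grad_cong:
  assumes "\<And>p. p \<in> pts S \<Longrightarrow> f p = g p" shows "grad S f = grad S g"
proof
  fix p show "grad S f p = grad S g p"
  proof (cases "p \<in> pts S")
    case True
    note c = chart_at_atlas[OF True] chart_at_dom[OF True]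
    have "frechet_derivative (f \<circ> cinv (chart_at S p)) (at (cmap (chart_at S p) p)) =
      frechet_derivative (g \<circ> cinv (chart_at S p)) (at (cmap (chart_at S p) p))"
      by (rule frechet_derivative_cong_open[OF open_img[OF c(1)]]) (use c assms cinv_pts[OF c(1)] in simp_all)
    then show ?thesis unfolding grad_def by simp
  qed (simp add: grad_outside)
qed

lemma grad_locally_zero:
  assumes W: "openin (mtop S) W" "p \<in> W" "\<And>q. q \<in> W \<Longrightarrow> f q = 0" shows "grad S f p = 0"
proof -
  have p: "p \<in> pts S" using openin_subset[OF W(1)] W(2) by (rule subsetD)
  note c = chart_at_atlas[OF p] chart_at_dom[OF p]
  let ?c = "chart_at S p"
  have d: "((\<lambda>y. f (cinv ?c y)) has_derivative (\<lambda>_. 0)) (at (cmap ?c p))"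
  proof (rule has_derivative_transform_within_open[OF has_derivative_const[of 0]])
    show "open {y \<in> img ?c. cinv ?c y \<in> W}" by (rule open_preimage_cinv[OF c(1) W(1)])
    show "cmap ?c p \<in> {y \<in> img ?c. cinv ?c y \<in> W}" using c W(2) cinv_cmap[OF c] by simp
  qed (use W(3) in simp)
  show ?thesis by (rule grad_eqI[OF p]) (simp add: metric_grad[OF c d] metric_zero[OF p])
qed

section \<open>The divergence\<close>

text \<open>The divergence computed in an arbitrary chart instead of the distinguished one.\<close>

definition cdiv :: "('a, 'n) chart \<Rightarrow> ('a, 'n) vfield \<Rightarrow> 'a \<Rightarrow> real" where
  "cdiv c V p = (\<Sum>i\<in>UNIV. frechet_derivative (\<lambda>y. sg c (cinv c y) * coord S c V (cinv c y) $ i)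
                      (at (cmap c p)) (axis i 1)) / sg c (cinv c (cmap c p))"

lemma divergence_cdiv: "divergence S V p = cdiv (chart_at S p) V p"
  by (simp add: divergence_def cdiv_def Let_def)

lemma flux_Cfam:
  assumes "c \<in> atlas S" "Vfam k J V"
  shows "Cfam k J (img c) (\<lambda>t y. sg c (cinv c y) * coord S c (V t) (cinv c y) $ i)"
  using assms(2) assms(1) unfolding Vfam_def by (intro Cfam_mult open_img sg_Cfam Cfam_nth) auto

lemma cdiv_Cfam:
  assumes c: "c \<in> atlas S" and V: "Vfam (Suc k) J V"
  shows "Cfam k J (img c) (\<lambda>t y. cdiv c (V t) (cinv c y))"
proof -
  have "Cfam k J (img c) (\<lambda>t y. (\<Sum>i\<in>UNIV. frechet_derivative (\<lambda>y. sg c (cinv c y) * coord S c (V t) (cinv c y) $ i)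
      (at y) (axis i 1)) / sg c (cinv c y))"
  proof (intro Cfam_divide[OF open_img[OF c]] Cfam_sum[OF open_img[OF c]] sg_Cfam[OF c])
    show "Cfam k J (img c) (\<lambda>t y. frechet_derivative (\<lambda>y. sg c (cinv c y) * coord S c (V t) (cinv c y) $ i) (at y) (axis i 1))" for i
      by (rule Cfam_deriv[OF flux_Cfam[OF c V]])
    show "sg c (cinv c y) \<noteq> 0" if "y \<in> img c" for y using sg_pos[OF c cinv_in[OF that]] by simp
  qed
  then show ?thesis
    by (subst (asm) Cfam_cong[OF open_img[OF c]]) (simp_all add: cdiv_def cmap_cinv)
qed

text \<open>In the chart the integrand is \<open>f \<Sum>\<^sub>i \<partial>\<^sub>i (\<surd>det g
  V\<^sup>i)\<close>, with \<open>f\<close> of compact support.  By the product rule the two sides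
  differ by the integral of a derivative.\<close>

lemma chart_green:
  assumes c: "c \<in> atlas S" and V: "Vk 1 V" and f: "Mk 1 f" and C: "compact C" "C \<subseteq> img c"
    and z: "\<And>p. p \<in> pts S \<Longrightarrow> p \<notin> cinv c ` C \<Longrightarrow> f p = 0"
  shows "Mk 0 (\<lambda>p. f p * cdiv c V p)"
    and "(\<integral>p. f p * cdiv c V p \<partial>vol S) = - (\<integral>p. metric S p (grad S f p) (V p) \<partial>vol S)"
proof -
  let ?s = "\<lambda>i y. sg c (cinv c y) * coord S c V (cinv c y) $ i"
  let ?F = "\<lambda>y. f (cinv c y)"
  define G where "G i y = (if y \<in> img c then ?F y * ?s i y else 0)" for i y
  have notC: "cinv c y \<notin> cinv c ` C" if "y \<in> img c" "y \<notin> C" for y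
  proof
    assume "cinv c y \<in> cinv c ` C"
    then obtain x where x: "cinv c y = cinv c x" "x \<in> C" by (rule imageE)
    have "y = cmap c (cinv c y)" using cmap_cinv[OF that(1)] by simp
    also have "\<dots> = x" unfolding x(1) using cmap_cinv[OF subsetD[OF C(2) x(2)]] .
    finally show False using x(2) that(2) by simp
  qed
  have G0: "G i y = 0" if "y \<notin> C" for i y
    using z[OF cinv_pts[OF c] notC[OF _ that]] by (simp add: G_def)
  have Fc: "Ck 1 (img c) ?F" using f c unfolding Mfam_def by simp
  have sc: "Ck 1 (img c) (?s i)" for i using flux_Cfam[OF c V] .
  have GC: "Ck 1 UNIV (G i)" for i
  proof (rule Cfam_local[OF open_UNIV])
    fix y :: "real^'n"
    show "\<exists>W. open W \<and> y \<in> W \<and> Ck 1 (W \<inter> UNIV) (G i)"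
    proof (cases "y \<in> img c")
      case True
      have "Ck 1 (img c) (G i)"
        using Cfam_mult[OF open_img[OF c] Fc sc] by (subst Cfam_cong[OF open_img[OF c]]) (simp_all add: G_def)
      then show ?thesis using True open_img[OF c] by (intro exI[of _ "img c"]) simp
    next
      case False
      have o: "open (- C)" using compact_imp_closed[OF C(1)] by (rule open_Compl)
      have "Ck 1 (- C) (G i)"
        using Cfam_cong[OF o, of UNIV "\<lambda>_. G i" "\<lambda>_ _. 0" 1] G0 by (simp add: Cfam_const)
      moreover have "y \<in> - C" using contra_subsetD[OF C(2) False] by simp
      ultimately show ?thesis using o by (intro exI[of _ "- C"]) simp
    qed
  qed
  from bounded_subset_ballD[OF compact_imp_bounded[OF C(1)], of 0] obtain R where "C \<subseteq> ball 0 R"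
    by (elim exE conjE) (rule that)
  from subset_trans[OF this ball_subset_cball] have R: "C \<subseteq> cball 0 R" .
  have Gs: "G i y = 0" if "y \<notin> cball 0 R" for i y by (rule G0[OF contra_subsetD[OF R that]])
  define h where "h p = metric S p (grad S f p) (V p) + f p * cdiv c V p" for p
  show 1: "Mk 0 (\<lambda>p. f p * cdiv c V p)"
  proof (rule Mk_extend[OF c C])
    show "f p * cdiv c V p = 0" if "p \<in> pts S" "p \<notin> cinv c ` C" for p using z[OF that] by simp
    show "Ck 0 (img c) (\<lambda>y. f (cinv c y) * cdiv c V (cinv c y))"
      by (rule Cfam_mult[OF open_img[OF c] Cfam_le[OF Fc] cdiv_Cfam[OF c]]) (use V in simp_all)
  qed
  have 2: "Mk 0 (\<lambda>p. metric S p (grad S f p) (V p))"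
    using Mfam_metric[OF Vfam_grad[of 0 UNIV "\<lambda>_. f"] Vfam_le[OF V]] f by simp
  have Dsum: "(\<Sum>i\<in>UNIV. frechet_derivative (G i) (at y) (axis i 1)) = indicator (img c) y *\<^sub>R (sg c (cinv c y) * h (cinv c y))" for y
  proof (cases "y \<in> img c")
    case True
    note p = c cinv_in[OF True]
    have dF: "(?F has_derivative frechet_derivative ?F (at y)) (at y)"
      using Cfam_has_derivative[of 0 UNIV "img c" "\<lambda>_. ?F" 0 y] Fc True by simp
    have ds: "(?s i has_derivative frechet_derivative (?s i) (at y)) (at y)" for i
      using Cfam_has_derivative[of 0 UNIV "img c" "\<lambda>_. ?s i" 0 y] sc True by simp
    have "(G i has_derivative (\<lambda>v. ?F y * frechet_derivative (?s i) (at y) v + frechet_derivative ?F (at y) v * ?s i y)) (at y)" for i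
      by (rule has_derivative_transform_within_open[OF has_derivative_mult[OF dF ds] open_img[OF c] True]) (simp add: G_def)
    note fd = fun_cong[OF frechet_derivative_at[OF this, symmetric]]
    have DG: "frechet_derivative (G i) (at y) v = ?F y * frechet_derivative (?s i) (at y) v + frechet_derivative ?F (at y) v * ?s i y" for i v
      by (rule fd)
    have lin: "linear (frechet_derivative ?F (at y))" by (rule has_derivative_linear[OF dF])
    let ?a = "coord S c V (cinv c y)"
    have "metric S (cinv c y) (grad S f (cinv c y)) (V (cinv c y)) = frechet_derivative ?F (at y) ?a"
      using metric_grad[OF p, of f "frechet_derivative ?F (at y)"] dF unfolding cmap_cinv[OF True] coord_def by blast
    also have "\<dots> = frechet_derivative ?F (at y) (\<Sum>i\<in>UNIV. (?a $ i) *\<^sub>R axis i 1)"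
      using basis_expansion[of ?a] by (simp add: scalar_mult_eq_scaleR)
    also have "\<dots> = (\<Sum>i\<in>UNIV. ?a $ i * frechet_derivative ?F (at y) (axis i 1))"
      by (simp add: linear_sum[OF lin] linear_scale[OF lin])
    finally have m: "metric S (cinv c y) (grad S f (cinv c y)) (V (cinv c y)) = (\<Sum>i\<in>UNIV. ?a $ i * frechet_derivative ?F (at y) (axis i 1))" .
    have d: "sg c (cinv c y) * cdiv c V (cinv c y) = (\<Sum>i\<in>UNIV. frechet_derivative (?s i) (at y) (axis i 1))"
      using sg_pos[OF p] by (simp add: cdiv_def cmap_cinv[OF True])
    have "(\<Sum>i\<in>UNIV. frechet_derivative (G i) (at y) (axis i 1)) =
      ?F y * (\<Sum>i\<in>UNIV. frechet_derivative (?s i) (at y) (axis i 1)) + sg c (cinv c y) * (\<Sum>i\<in>UNIV. ?a $ i * frechet_derivative ?F (at y) (axis i 1))"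
      unfolding DG sum.distrib sum_distrib_left by (simp add: mult_ac)
    also have "\<dots> = sg c (cinv c y) * h (cinv c y)"
      unfolding d[symmetric] m[symmetric] h_def by (simp add: algebra_simps)
    finally show ?thesis using True by simp
  next
    case False
    have o: "open (- C)" using compact_imp_closed[OF C(1)] by (rule open_Compl)
    have "frechet_derivative (G i) (at y) = frechet_derivative (\<lambda>_. 0) (at y)" for i
      by (rule frechet_derivative_cong_open[OF o]) (use contra_subsetD[OF C(2) False] G0 in simp_all)
    then show ?thesis using False by (simp add: frechet_derivative_const)
  qed
  have h0: "h p = 0" if "p \<in> pts S" "p \<notin> cdom c" for p
  proof -
    have nC: "p \<notin> cinv c ` C"
    proof
      assume "p \<in> cinv c ` C"
      then obtain x where "p = cinv c x" "x \<in> C" by (rule imageE)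
      then show False using that(2) cinv_in[OF subsetD[OF C(2)]] by simp
    qed
    have "grad S f p = 0"
      by (rule grad_locally_zero[OF closed_chart_compact[OF c C]]) (use that nC z in simp_all)
    then show ?thesis using z[OF that(1) nC] metric_zero[OF that(1)] by (simp add: h_def)
  qed
  have hM: "Mk 0 h" unfolding h_def by (rule Mfam_add[OF 2 1])
  have "integral\<^sup>L (vol S) h = (\<integral>y. indicator (img c) y *\<^sub>R (sg c (cinv c y) * h (cinv c y)) \<partial>lborel)"
    by (rule chart_integral[OF c measurable_Mk[OF hM] h0])
  also have "\<dots> = (\<integral>y. (\<Sum>i\<in>UNIV. frechet_derivative (G i) (at y) (axis i 1)) \<partial>lborel)"
    unfolding Dsum ..
  also have "\<dots> = (\<Sum>i\<in>UNIV. \<integral>y. frechet_derivative (G i) (at y) (axis i 1) \<partial>lborel)"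
    by (rule Bochner_Integration.integral_sum) (rule integral_derivative_compact_support(2)[OF GC Gs])
  also have "\<dots> = 0" by (rule sum.neutral) (use integral_derivative_compact_support(1)[OF GC Gs] in blast)
  finally have "integral\<^sup>L (vol S) h = 0" .
  then show "(\<integral>p. f p * cdiv c V p \<partial>vol S) = - (\<integral>p. metric S p (grad S f p) (V p) \<partial>vol S)"
    unfolding h_def using Bochner_Integration.integral_add[OF integrable_Mk[OF 2] integrable_Mk[OF 1]] by simp
qed

text \<open>Independence of the chart is derived from Green's formula: if the two expressions differed at
  \<open>p0\<close>, integrating their difference against a bump function around \<open>p0\<close>
  would contradict the fact that both integrals equal the same expression in the gradient.\<close>

lemma cdiv_le:
  assumes c: "c \<in> atlas S" "p0 \<in> cdom c" and d: "d \<in> atlas S" "p0 \<in> cdom d" and V: "Vk 1 V"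
  shows "cdiv c V p0 \<le> cdiv d V p0"
proof (rule ccontr)
  assume n: "\<not> cdiv c V p0 \<le> cdiv d V p0"
  let ?O = "overlap c d"
  define D where "D y = cdiv c V (cinv c y) - cdiv d V (cinv c y)" for y
  have V1: "Vfam (Suc 0) UNIV (\<lambda>_. V)" using V by simp
  have "Ck 0 ?O (\<lambda>y. cdiv d V (cinv d (trans_map c d y)))"
    by (rule Cfam_compose[OF open_overlap[OF c(1) d(1)] _ cdiv_Cfam[OF d(1) V1] trans_map_Ck[OF c(1) d(1)]])
      (auto simp: trans_map_cmap[OF c(1)])
  then have "Ck 0 ?O (\<lambda>y. cdiv d V (cinv c y))"
    by (subst (asm) Cfam_cong[OF open_overlap[OF c(1) d(1)]]) (simp_all add: cinv_trans_map[OF c(1) d(1)])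
  moreover have "Ck 0 ?O (\<lambda>y. cdiv c V (cinv c y))" by (rule Cfam_subset[OF cdiv_Cfam[OF c(1) V1]]) auto
  ultimately have "Ck 0 ?O D" unfolding D_def by (intro Cfam_diff open_overlap[OF c(1) d(1)])
  then have op: "open (?O \<inter> D -` {0<..})"
    by (intro continuous_open_preimage[OF Ck_continuous] open_overlap[OF c(1) d(1)]) simp_all
  have "cmap c p0 \<in> ?O" using c(2) d(2) by (intro imageI IntI)
  then have "cmap c p0 \<in> ?O \<inter> D -` {0<..}" using n cinv_cmap[OF c] by (simp add: D_def)
  from open_contains_cball[THEN iffD1, OF op, rule_format, OF this]
  obtain r where r: "r > 0" "cball (cmap c p0) r \<subseteq> ?O \<inter> D -` {0<..}"
    by (elim exE conjE) (rule that)
  let ?B = "cball (cmap c p0) r" and ?f = "mbump c (cmap c p0) r"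
  have BO: "?B \<subseteq> ?O" by (rule subset_trans[OF r(2) Int_lower1])
  have BD: "?B \<subseteq> D -` {0<..}" by (rule subset_trans[OF r(2) Int_lower2])
  have Bc: "?B \<subseteq> img c" by (rule subset_trans[OF BO]) (rule image_mono, rule Int_lower1)
  have fM: "Mk 1 ?f" by (rule mbump_Mk[OF c(1) r(1) Bc])
  have z: "?f p = 0" if "p \<notin> cinv c ` ?B" for p using mbump_supp[OF c(1) r(1) that] .
  have cont: "continuous_on ?B (trans_map c d)"
    by (rule continuous_on_subset[OF Ck_continuous[OF trans_map_Ck[OF c(1) d(1), of 0]] BO])
  have C': "compact (trans_map c d ` ?B)" by (rule compact_continuous_image[OF cont compact_cball])
  have Cd: "trans_map c d ` ?B \<subseteq> img d"
  proof
    fix x assume "x \<in> trans_map c d ` ?B"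
    then obtain y where y: "x = trans_map c d y" "y \<in> ?B" by (rule imageE)
    from subsetD[OF BO y(2)] obtain q where "y = cmap c q" "q \<in> cdom c \<inter> cdom d" by (rule imageE)
    then show "x \<in> img d" using y(1) trans_map_cmap[OF c(1), of q d] by simp
  qed
  have im: "cinv d ` trans_map c d ` ?B = cinv c ` ?B"
    unfolding image_image by (rule image_cong[OF refl]) (rule cinv_trans_map[OF c(1) d(1) subsetD[OF BO]])
  have zd: "?f p = 0" if "p \<notin> cinv d ` trans_map c d ` ?B" for p using z that unfolding im .
  note g1 = chart_green[OF c(1) V fM compact_cball Bc z]
  note g2 = chart_green[OF d(1) V fM C' Cd zd]
  let ?k = "\<lambda>p. ?f p * cdiv c V p - ?f p * cdiv d V p"
  have kM: "Mk 0 ?k" by (rule Mfam_diff[OF g1(1) g2(1)])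
  have "integral\<^sup>L (vol S) ?k > 0"
  proof (rule integral_pos[OF kM])
    fix p assume "p \<in> pts S"
    show "?k p \<ge> 0"
    proof (cases "p \<in> cinv c ` ?B")
      case True
      then obtain y where y: "p = cinv c y" "y \<in> ?B" by (rule imageE)
      then have "D y > 0" using subsetD[OF BD y(2)] by simp
      then have "0 \<le> ?f p * (cdiv c V p - cdiv d V p)"
        using mbump_nonneg y(1) by (simp add: D_def)
      then show ?thesis by (simp add: right_diff_distrib)
    qed (simp add: z)
  next
    show "p0 \<in> pts S" by (rule in_pts[OF c])
    have "?f p0 > 0" using mbump_pos[OF r(1)] c r(1) by simp
    then have "0 < ?f p0 * (cdiv c V p0 - cdiv d V p0)" using n by simp
    then show "0 < ?k p0" by (simp add: right_diff_distrib)
  qed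
  moreover have "integral\<^sup>L (vol S) ?k = 0"
    using Bochner_Integration.integral_diff[OF integrable_Mk[OF g1(1)] integrable_Mk[OF g2(1)]] g1(2) g2(2) by simp
  ultimately show False by simp
qed

lemma divergence_chart:
  assumes "c \<in> atlas S" "p \<in> cdom c" "Vk 1 V"
  shows "divergence S V p = cdiv c V p"
proof -
  note h = chart_at_atlas[OF in_pts[OF assms(1,2)]] chart_at_dom[OF in_pts[OF assms(1,2)]]
  show ?thesis unfolding divergence_cdiv using cdiv_le[OF assms(1,2) h assms(3)] cdiv_le[OF h assms(1,2,3)] by simp
qed

lemma Mfam_divergence:
  assumes "Vfam (Suc k) J V" shows "Mfam k J (\<lambda>t. divergence S (V t))"
  unfolding Mfam_def
proof
  fix c assume c: "c \<in> atlas S"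
  have "divergence S (V t) (cinv c y) = cdiv c (V t) (cinv c y)" if "t \<in> J" "y \<in> img c" for t y
    by (rule divergence_chart[OF c cinv_in[OF that(2)] Vfam_le[OF Vfam_at[OF assms that(1)]]]) simp
  then show "Cfam k J (img c) (\<lambda>t y. divergence S (V t) (cinv c y))"
    using cdiv_Cfam[OF c assms] Cfam_cong[OF open_img[OF c], of J "\<lambda>t y. divergence S (V t) (cinv c y)"] by simp
qed

text \<open>A partition of unity made of bump functions splits \<open>f\<close> into summands with support
  in a single chart.\<close>

theorem green:
  assumes f: "Mk 1 f" and V: "Vk 1 V"
  shows "(\<integral>p. f p * divergence S V p \<partial>vol S) = - (\<integral>p. metric S p (grad S f p) (V p) \<partial>vol S)"
proof -
  obtain N where N: "finite N" "\<forall>i\<in>N. good_ball i" "(\<Union>i\<in>N. coord_ball i) = pts S" using finite_cover by blast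
  define \<psi> where "\<psi> i = mbump (fst i) (fst (snd i)) (snd (snd i))" for i :: "('a, 'n) chart \<times> (real^'n) \<times> real"
  define sm where "sm p = (\<Sum>i\<in>N. \<psi> i p)" for p
  have g: "fst i \<in> atlas S" "snd (snd i) > 0" "cball (fst (snd i)) (snd (snd i)) \<subseteq> img (fst i)" if "i \<in> N" for i
    using N(2) that by simp_all
  have \<psi>M: "Mk 1 (\<psi> i)" if "i \<in> N" for i unfolding \<psi>_def by (rule mbump_Mk[OF g[OF that]])
  have smM: "Mk 1 sm" unfolding sm_def by (rule Mfam_sum[OF \<psi>M])
  have smpos: "sm p > 0" if "p \<in> pts S" for p
  proof -
    have "p \<in> (\<Union>i\<in>N. coord_ball i)" using that unfolding N(3) .
    then obtain i where i: "i \<in> N" "p \<in> coord_ball i" by (rule UN_E)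
    have "\<psi> i p > 0" using mbump_pos[OF g(2)[OF i(1)]] i(2) by (simp add: \<psi>_def)
    then show ?thesis unfolding sm_def
      by (intro sum_pos2[OF N(1) i(1)]) (simp_all add: \<psi>_def mbump_nonneg)
  qed
  define xi where "xi i p = \<psi> i p / sm p * f p" for i p
  have xiM: "Mk 1 (xi i)" if "i \<in> N" for i
    unfolding xi_def by (intro Mfam_mult Mfam_divide \<psi>M smM f that) (use smpos in force)
  have sumxi: "(\<Sum>i\<in>N. xi i p) = f p" if "p \<in> pts S" for p
  proof -
    have "(\<Sum>i\<in>N. xi i p) = sm p / sm p * f p"
      unfolding xi_def sm_def sum_divide_distrib sum_distrib_right ..
    then show ?thesis using smpos[OF that] by simp
  qed
  have xiz: "xi i p = 0" if "i \<in> N" "p \<notin> cinv (fst i) ` cball (fst (snd i)) (snd (snd i))" for i p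
    using mbump_supp[OF g(1,2)[OF that(1)] that(2)] by (simp add: xi_def \<psi>_def)
  have gr: "Mk 0 (\<lambda>p. xi i p * cdiv (fst i) V p)"
     "(\<integral>p. xi i p * cdiv (fst i) V p \<partial>vol S) = - (\<integral>p. metric S p (grad S (xi i) p) (V p) \<partial>vol S)" if i: "i \<in> N" for i
    using chart_green[OF g(1)[OF i] V xiM[OF i] compact_cball g(3)[OF i] xiz[OF i]] by simp_all
  have mM: "Mk 0 (\<lambda>p. metric S p (grad S (xi i) p) (V p))" if i: "i \<in> N" for i
    using Mfam_metric[OF Vfam_grad[of 0 UNIV "\<lambda>_. xi i"] Vfam_le[OF V]] xiM[OF i] by simp
  have "(\<integral>p. f p * divergence S V p \<partial>vol S) = (\<integral>p. (\<Sum>i\<in>N. xi i p * cdiv (fst i) V p) \<partial>vol S)"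
  proof (rule Bochner_Integration.integral_cong[OF refl])
    fix p assume "p \<in> space (vol S)"
    then have p: "p \<in> pts S" by (simp add: space_vol)
    have "xi i p * cdiv (fst i) V p = xi i p * divergence S V p" if i: "i \<in> N" for i
    proof (cases "p \<in> cdom (fst i)")
      case True
      then show ?thesis using divergence_chart[OF g(1)[OF i] True V] by simp
    next
      case False
      then have "xi i p = 0" by (simp add: xi_def \<psi>_def mbump_def)
      then show ?thesis by simp
    qed
    then have "(\<Sum>i\<in>N. xi i p * cdiv (fst i) V p) = (\<Sum>i\<in>N. xi i p) * divergence S V p"
      unfolding sum_distrib_right by (rule sum.cong[OF refl])
    then show "f p * divergence S V p = (\<Sum>i\<in>N. xi i p * cdiv (fst i) V p)" using sumxi[OF p] by simp
  qed
  also have "\<dots> = (\<Sum>i\<in>N. \<integral>p. xi i p * cdiv (fst i) V p \<partial>vol S)"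
    by (rule Bochner_Integration.integral_sum) (rule integrable_Mk[OF gr(1)])
  also have "\<dots> = - (\<Sum>i\<in>N. \<integral>p. metric S p (grad S (xi i) p) (V p) \<partial>vol S)"
    by (simp add: gr(2) sum_negf)
  also have "(\<Sum>i\<in>N. \<integral>p. metric S p (grad S (xi i) p) (V p) \<partial>vol S) = (\<integral>p. (\<Sum>i\<in>N. metric S p (grad S (xi i) p) (V p)) \<partial>vol S)"
    by (rule Bochner_Integration.integral_sum[symmetric]) (rule integrable_Mk[OF mM])
  also have "\<dots> = (\<integral>p. metric S p (grad S f p) (V p) \<partial>vol S)"
  proof (rule Bochner_Integration.integral_cong[OF refl])
    fix p assume "p \<in> space (vol S)"
    then have p: "p \<in> pts S" by (simp add: space_vol)
    have "grad S f = grad S (\<lambda>p. \<Sum>i\<in>N. xi i p)" by (rule grad_cong) (simp add: sumxi)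
    then show "(\<Sum>i\<in>N. metric S p (grad S (xi i) p) (V p)) = metric S p (grad S f p) (V p)"
      using metric_grad_sum[OF N(1) xiM p] by simp
  qed
  finally show ?thesis .
qed

lemma cdiv_scaleR:
  assumes f: "Mk 1 f" and V: "Vk 1 V" and p: "p \<in> pts S"
  shows "divergence S (\<lambda>p. f p *\<^sub>R V p) p = f p * divergence S V p + metric S p (grad S f p) (V p)"
proof -
  let ?c = "chart_at S p"
  note c = chart_at_atlas[OF p] chart_at_dom[OF p]
  let ?y = "cmap ?c p"
  have y: "?y \<in> img ?c" using c(2) by (rule imageI)
  let ?F = "\<lambda>y. f (cinv ?c y)" and ?s = "\<lambda>i y. sg ?c (cinv ?c y) * coord S ?c V (cinv ?c y) $ i"
  have dF: "(?F has_derivative frechet_derivative ?F (at ?y)) (at ?y)" by (rule Mk_chart_derivative[OF f c])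
  have V1: "Vfam (Suc 0) UNIV (\<lambda>_. V)" using V by simp
  have ds: "(?s i has_derivative frechet_derivative (?s i) (at ?y)) (at ?y)" for i
    using Cfam_has_derivative[OF flux_Cfam[OF c(1) V1] UNIV_I y] .
  have "((\<lambda>y. sg ?c (cinv ?c y) * coord S ?c (\<lambda>p. f p *\<^sub>R V p) (cinv ?c y) $ i) has_derivative
      (\<lambda>v. ?F ?y * frechet_derivative (?s i) (at ?y) v + frechet_derivative ?F (at ?y) v * ?s i ?y)) (at ?y)" for i
    by (rule has_derivative_transform_within_open[OF has_derivative_mult[OF dF ds] open_img[OF c(1)] y])
      (simp add: coord_def linear_scale[OF comps_linear[OF c(1) cinv_in]])
  note fd = fun_cong[OF frechet_derivative_at[OF this, symmetric]]
  have D: "frechet_derivative (\<lambda>y. sg ?c (cinv ?c y) * coord S ?c (\<lambda>p. f p *\<^sub>R V p) (cinv ?c y) $ i) (at ?y) v =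
      ?F ?y * frechet_derivative (?s i) (at ?y) v + frechet_derivative ?F (at ?y) v * ?s i ?y" for i v by (rule fd)
  have lin: "linear (frechet_derivative ?F (at ?y))" by (rule has_derivative_linear[OF dF])
  let ?a = "coord S ?c V p"
  have "metric S p (grad S f p) (V p) = frechet_derivative ?F (at ?y) ?a"
    using metric_grad[OF c dF] by (simp add: coord_def)
  also have "\<dots> = frechet_derivative ?F (at ?y) (\<Sum>i\<in>UNIV. (?a $ i) *\<^sub>R axis i 1)"
    using basis_expansion[of ?a] by (simp add: scalar_mult_eq_scaleR)
  also have "\<dots> = (\<Sum>i\<in>UNIV. ?a $ i * frechet_derivative ?F (at ?y) (axis i 1))"
    by (simp add: linear_sum[OF lin] linear_scale[OF lin])
  finally have m: "metric S p (grad S f p) (V p) = (\<Sum>i\<in>UNIV. ?a $ i * frechet_derivative ?F (at ?y) (axis i 1))" .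
  have "(\<Sum>i\<in>UNIV. frechet_derivative (\<lambda>y. sg ?c (cinv ?c y) * coord S ?c (\<lambda>p. f p *\<^sub>R V p) (cinv ?c y) $ i) (at ?y) (axis i 1))
    = f p * (\<Sum>i\<in>UNIV. frechet_derivative (?s i) (at ?y) (axis i 1)) + sg ?c p * metric S p (grad S f p) (V p)"
    unfolding D m sum.distrib sum_distrib_left cinv_cmap[OF c] by (simp add: mult_ac)
  then show ?thesis
    unfolding divergence_cdiv cdiv_def cinv_cmap[OF c] using sg_pos[OF c] by (simp add: add_divide_distrib)
qed

end


context riem
begin

section \<open>Measurable vector fields\<close>

definition measurable_field :: "('a, 'n) vfield \<Rightarrow> bool" where
  "measurable_field V \<longleftrightarrow> (\<forall>c\<in>atlas S. coord S c V \<in> borel_measurable (restrict_space (vol S) (cdom c)))"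

lemma cdom_Int_space: "c \<in> atlas S \<Longrightarrow> cdom c \<inter> space (vol S) \<in> sets (vol S)"
  using cdom_sets sets.sets_into_space[OF cdom_sets] by (simp add: Int_absorb2)

lemma space_cdom: "c \<in> atlas S \<Longrightarrow> space (restrict_space (vol S) (cdom c)) = cdom c"
  using cdom_sub by (simp add: space_restrict_space space_vol Int_absorb2)

lemma chart_measurable:
  fixes g :: "real^'n \<Rightarrow> 'c::topological_space"
  assumes c: "c \<in> atlas S" and g: "continuous_on (img c) g"
  shows "(\<lambda>p. g (cmap c p)) \<in> borel_measurable (restrict_space (vol S) (cdom c))"
proof (rule borel_measurableI)
  fix U :: "'c set" assume "open U"
  from continuous_open_preimage[OF g open_img[OF c] this] have "open (img c \<inter> g -` U)" .
  from open_sets_vol[OF chart_open_preimage[OF c this]]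
  have "{p \<in> cdom c. cmap c p \<in> img c \<inter> g -` U} \<in> sets (vol S)" .
  moreover have "(\<lambda>p. g (cmap c p)) -` U \<inter> space (restrict_space (vol S) (cdom c)) = {p \<in> cdom c. cmap c p \<in> img c \<inter> g -` U}"
    unfolding space_cdom[OF c] by auto
  ultimately show "(\<lambda>p. g (cmap c p)) -` U \<inter> space (restrict_space (vol S) (cdom c)) \<in> sets (restrict_space (vol S) (cdom c))"
    unfolding sets_restrict_space_iff[OF cdom_Int_space[OF c]] by auto
qed

lemma measurable_by_charts:
  assumes "\<And>c. c \<in> atlas S \<Longrightarrow> f \<in> measurable (restrict_space (vol S) (cdom c)) M"
  shows "f \<in> measurable (vol S) M"
proof -
  obtain N where N: "finite N" "\<forall>i\<in>N. good_ball i" "(\<Union>i\<in>N. coord_ball i) = pts S" using finite_cover by blast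
  show ?thesis
  proof (rule measurable_piecewise_restrict[of "(\<lambda>i. cdom (fst i)) ` N"])
    show "countable ((\<lambda>i. cdom (fst i)) ` N)" using N(1) by (simp add: countable_finite)
    show "space (vol S) \<subseteq> \<Union>((\<lambda>i. cdom (fst i)) ` N)" unfolding space_vol N(3)[symmetric] by auto
    fix X assume "X \<in> (\<lambda>i. cdom (fst i)) ` N"
    then obtain i where i: "X = cdom (fst i)" "i \<in> N" by (rule imageE)
    have a: "fst i \<in> atlas S" using N(2) i(2) by simp
    show "X \<inter> space (vol S) \<in> sets (vol S)" unfolding i(1) by (rule cdom_Int_space[OF a])
    show "f \<in> measurable (restrict_space (vol S) X) M" unfolding i(1) by (rule assms[OF a])
  qed
qed

lemma measurable_metric:
  assumes "measurable_field U" "measurable_field V"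
  shows "(\<lambda>x. metric S x (U x) (V x)) \<in> borel_measurable (vol S)"
proof (rule measurable_by_charts)
  fix c assume c: "c \<in> atlas S"
  let ?R = "restrict_space (vol S) (cdom c)"
  have [measurable]: "coord S c U \<in> borel_measurable ?R" "coord S c V \<in> borel_measurable ?R"
    using assms c unfolding measurable_field_def by simp_all
  have gm: "(\<lambda>p. gram S c p $ i $ j) \<in> borel_measurable ?R" for i j
  proof -
    have "(\<lambda>p. gram S c (cinv c (cmap c p)) $ i $ j) \<in> borel_measurable ?R"
      by (rule chart_measurable[OF c Ck_continuous[OF gram_Cfam[OF c]]])
    then show ?thesis by (rule measurable_cong[THEN iffD1, rotated]) (simp add: space_cdom[OF c] cinv_cmap[OF c])
  qed
  have nm: "(\<lambda>p. X p $ i) \<in> borel_measurable ?R" if "X \<in> borel_measurable ?R" for X :: "'a \<Rightarrow> real^'n" and i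
    by (rule borel_measurable_continuous_on[OF _ that]) (intro continuous_intros)
  have "(\<lambda>p. \<Sum>i\<in>UNIV. \<Sum>j\<in>UNIV. coord S c U p $ i * coord S c V p $ j * gram S c p $ i $ j) \<in> borel_measurable ?R"
    by (intro borel_measurable_sum borel_measurable_times gm nm) measurable
  then show "(\<lambda>x. metric S x (U x) (V x)) \<in> borel_measurable ?R"
    by (rule measurable_cong[THEN iffD1, rotated]) (simp add: space_cdom[OF c] metric_coords[OF c] coord_def)
qed

lemma measurable_field_add:
  assumes "measurable_field U" "measurable_field V" shows "measurable_field (\<lambda>x. U x + V x)"
  unfolding measurable_field_def
proof
  fix c assume c: "c \<in> atlas S"
  have "(\<lambda>p. coord S c U p + coord S c V p) \<in> borel_measurable (restrict_space (vol S) (cdom c))"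
    using assms c unfolding measurable_field_def by (intro borel_measurable_add) simp_all
  then show "coord S c (\<lambda>x. U x + V x) \<in> borel_measurable (restrict_space (vol S) (cdom c))"
    by (rule measurable_cong[THEN iffD1, rotated]) (simp add: space_cdom[OF c] coord_def linear_add[OF comps_linear[OF c]])
qed

lemma measurable_field_scale:
  assumes "measurable_field V" shows "measurable_field (\<lambda>x. r *\<^sub>R V x)"
  unfolding measurable_field_def
proof
  fix c assume c: "c \<in> atlas S"
  have "(\<lambda>p. r *\<^sub>R coord S c V p) \<in> borel_measurable (restrict_space (vol S) (cdom c))"
    using assms c unfolding measurable_field_def by (intro borel_measurable_scaleR) simp_all
  then show "coord S c (\<lambda>x. r *\<^sub>R V x) \<in> borel_measurable (restrict_space (vol S) (cdom c))"
    by (rule measurable_cong[THEN iffD1, rotated]) (simp add: space_cdom[OF c] coord_def linear_scale[OF comps_linear[OF c]])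
qed

lemma measurable_field_diff:
  "measurable_field U \<Longrightarrow> measurable_field V \<Longrightarrow> measurable_field (\<lambda>x. U x - V x)"
  using measurable_field_add[of U "\<lambda>x. (-1) *\<^sub>R V x"] measurable_field_scale[of V "-1"] by simp

lemma measurable_field_Vk: assumes "Vk k V" shows "measurable_field V"
  unfolding measurable_field_def
proof
  fix c assume c: "c \<in> atlas S"
  have "Ck k (img c) (\<lambda>y. coord S c V (cinv c y))" using assms c unfolding Vfam_def by simp
  from chart_measurable[OF c Ck_continuous[OF this]]
  show "coord S c V \<in> borel_measurable (restrict_space (vol S) (cdom c))"
    by (rule measurable_cong[THEN iffD1, rotated]) (simp add: space_cdom[OF c] cinv_cmap[OF c])
qed

text \<open>The metric at a point attains a positive minimum on the Euclidean unit sphere.\<close>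

lemma norm_le_metric:
  assumes p: "p \<in> pts S" shows "\<exists>C. \<forall>v. norm v \<le> C * sqrt (metric S p v v)"
proof -
  have bb: "bounded_bilinear (metric S p)" using metric_bilinear[OF p] by (simp add: bilinear_conv_bounded_bilinear)
  have c: "continuous_on (sphere 0 1) (\<lambda>v. metric S p v v)"
    by (rule bounded_bilinear.continuous_on[OF bb continuous_on_id continuous_on_id])
  have ne: "sphere (0::real^'n) 1 \<noteq> {}" by simp
  from continuous_attains_inf[OF compact_sphere ne c] obtain w
    where w1: "w \<in> sphere 0 1" and w': "\<forall>v\<in>sphere 0 1. metric S p w w \<le> metric S p v v"
    by (elim bexE) (rule that)
  note w = w1 w'[rule_format]
  have m: "metric S p w w > 0" by (rule metric_pos[OF p]) (use w(1) in auto)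
  have "norm v \<le> (1 / sqrt (metric S p w w)) * sqrt (metric S p v v)" for v
  proof (cases "v = 0")
    case False
    have "(1 / norm v) *\<^sub>R v \<in> sphere 0 1" using False by simp
    from w(2)[OF this] have "metric S p w w \<le> (1 / norm v) * ((1 / norm v) * metric S p v v)"
      by (simp add: metric_scale[OF p])
    then have "(norm v)\<^sup>2 * metric S p w w \<le> metric S p v v"
      using False by (simp add: field_simps power2_eq_square)
    from real_sqrt_le_mono[OF this] have "norm v * sqrt (metric S p w w) \<le> sqrt (metric S p v v)"
      by (simp add: real_sqrt_mult)
    then show ?thesis using m by (simp add: field_simps)
  qed (simp add: metric_zero[OF p])
  then show ?thesis by blast
qed

end

section \<open>The space of square integrable fields\<close>

locale riem_density = riem S for S :: "('a, 'n::finite, 'z) riemannian_scheme" +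
  fixes \<rho> :: "'a \<Rightarrow> real"
  assumes density: "\<rho> \<in> densities S"
begin

lemma rho_Mk: "Mk k \<rho>" and rho_pos: "x \<in> pts S \<Longrightarrow> \<rho> x > 0" and rho_outside: "x \<notin> pts S \<Longrightarrow> \<rho> x = 0"
  and rho_integral: "integral\<^sup>L (vol S) \<rho> = 1"
  using density unfolding densities_def smooth_fun_iff by auto

lemma rho_meas[measurable]: "\<rho> \<in> borel_measurable (vol S)"
  by (rule measurable_Mk[OF rho_Mk])

lemma L2_iff: "V \<in> L2_fields S \<rho> \<longleftrightarrow> (\<forall>x. x \<notin> pts S \<longrightarrow> V x = 0) \<and> measurable_field V \<and>
    integrable (vol S) (\<lambda>x. metric S x (V x) (V x) * \<rho> x)"
  unfolding L2_fields_def measurable_field_def by simp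

lemma L2_outside: "V \<in> L2_fields S \<rho> \<Longrightarrow> x \<notin> pts S \<Longrightarrow> V x = 0"
  and L2_meas: "V \<in> L2_fields S \<rho> \<Longrightarrow> measurable_field V"
  and L2_int: "V \<in> L2_fields S \<rho> \<Longrightarrow> integrable (vol S) (\<lambda>x. metric S x (V x) (V x) * \<rho> x)"
  unfolding L2_iff by auto

lemma L2_pair_integrable:
  assumes "U \<in> L2_fields S \<rho>" "V \<in> L2_fields S \<rho>"
  shows "integrable (vol S) (\<lambda>x. metric S x (U x) (V x) * \<rho> x)"
proof (rule Bochner_Integration.integrable_bound)
  show "integrable (vol S) (\<lambda>x. metric S x (U x) (U x) * \<rho> x + metric S x (V x) (V x) * \<rho> x)"
    by (rule Bochner_Integration.integrable_add[OF L2_int[OF assms(1)] L2_int[OF assms(2)]])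
  show "(\<lambda>x. metric S x (U x) (V x) * \<rho> x) \<in> borel_measurable (vol S)"
    by (rule borel_measurable_times[OF measurable_metric[OF L2_meas[OF assms(1)] L2_meas[OF assms(2)]] rho_meas])
  show "AE x in vol S. norm (metric S x (U x) (V x) * \<rho> x) \<le> norm (metric S x (U x) (U x) * \<rho> x + metric S x (V x) (V x) * \<rho> x)"
  proof (rule AE_I2)
    fix x assume "x \<in> space (vol S)"
    then have x: "x \<in> pts S" by (simp add: space_vol)
    let ?a = "metric S x (U x) (U x)" and ?b = "metric S x (V x) (V x)" and ?c = "metric S x (U x) (V x)"
    have "0 \<le> metric S x (U x + V x) (U x + V x)" "0 \<le> metric S x (U x - V x) (U x - V x)"
      by (rule metric_nonneg[OF x])+
    then have "0 \<le> ?a + 2 * ?c + ?b" "0 \<le> ?a - 2 * ?c + ?b"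
      using metric_sym[OF x, of "U x" "V x"] by (simp_all add: metric_add[OF x] metric_diff[OF x])
    moreover have "?a \<ge> 0" "?b \<ge> 0" by (rule metric_nonneg[OF x])+
    ultimately have "\<bar>?c\<bar> \<le> ?a + ?b" by linarith
    then have "\<bar>?c\<bar> * \<rho> x \<le> (?a + ?b) * \<rho> x" using rho_pos[OF x] by (intro mult_right_mono) simp_all
    then show "norm (?c * \<rho> x) \<le> norm (?a * \<rho> x + ?b * \<rho> x)"
      using rho_pos[OF x] \<open>?a \<ge> 0\<close> \<open>?b \<ge> 0\<close> by (simp add: abs_mult distrib_right)
  qed
qed

lemma L2_scale_mem: "V \<in> L2_fields S \<rho> \<Longrightarrow> (\<lambda>x. r *\<^sub>R V x) \<in> L2_fields S \<rho>"
proof -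
  assume V: "V \<in> L2_fields S \<rho>"
  have "integrable (vol S) (\<lambda>x. (r * r) * (metric S x (V x) (V x) * \<rho> x))"
    by (rule integrable_mult_right[OF L2_int[OF V]])
  then have "integrable (vol S) (\<lambda>x. metric S x (r *\<^sub>R V x) (r *\<^sub>R V x) * \<rho> x)"
    by (rule Bochner_Integration.integrable_cong[OF refl, THEN iffD1, rotated]) (simp add: space_vol metric_scale)
  then show ?thesis unfolding L2_iff using L2_outside[OF V] measurable_field_scale[OF L2_meas[OF V]] by simp
qed

lemma L2_add_mem:
  assumes U: "U \<in> L2_fields S \<rho>" and V: "V \<in> L2_fields S \<rho>" shows "(\<lambda>x. U x + V x) \<in> L2_fields S \<rho>"
proof -
  have "integrable (vol S) (\<lambda>x. metric S x (U x) (U x) * \<rho> x + (2 * (metric S x (U x) (V x) * \<rho> x) + metric S x (V x) (V x) * \<rho> x))"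
    by (intro Bochner_Integration.integrable_add integrable_mult_right L2_pair_integrable U V)
  then have "integrable (vol S) (\<lambda>x. metric S x (U x + V x) (U x + V x) * \<rho> x)"
  proof (rule Bochner_Integration.integrable_cong[OF refl, THEN iffD1, rotated])
    fix x assume "x \<in> space (vol S)"
    then have x: "x \<in> pts S" by (simp add: space_vol)
    show "metric S x (U x) (U x) * \<rho> x + (2 * (metric S x (U x) (V x) * \<rho> x) + metric S x (V x) (V x) * \<rho> x) =
      metric S x (U x + V x) (U x + V x) * \<rho> x"
      using metric_sym[OF x, of "U x" "V x"] by (simp add: metric_add[OF x] algebra_simps)
  qed
  then show ?thesis unfolding L2_iff
    using L2_outside[OF U] L2_outside[OF V] measurable_field_add[OF L2_meas[OF U] L2_meas[OF V]] by simp
qed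

lemma L2_field_space: "field_space (L2_fields S \<rho>) (L2_inner S \<rho>)"
proof
  fix U V W assume U: "U \<in> L2_fields S \<rho>" and V: "V \<in> L2_fields S \<rho>" 
  show "(\<lambda>x. U x + V x) \<in> L2_fields S \<rho>" by (rule L2_add_mem[OF U V])
  show "L2_inner S \<rho> U V = L2_inner S \<rho> V U" unfolding L2_inner_def
    by (rule Bochner_Integration.integral_cong[OF refl]) (simp add: space_vol metric_sym)
  show "L2_inner S \<rho> (\<lambda>x. r *\<^sub>R U x) V = r * L2_inner S \<rho> U V" for r
  proof -
    have "L2_inner S \<rho> (\<lambda>x. r *\<^sub>R U x) V = (\<integral>x. r * (metric S x (U x) (V x) * \<rho> x) \<partial>vol S)"
      unfolding L2_inner_def by (rule Bochner_Integration.integral_cong[OF refl]) (simp add: space_vol metric_scale)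
    then show ?thesis unfolding L2_inner_def by simp
  qed
  assume W: "W \<in> L2_fields S \<rho>"
  have "L2_inner S \<rho> (\<lambda>x. U x + V x) W = (\<integral>x. metric S x (U x) (W x) * \<rho> x + metric S x (V x) (W x) * \<rho> x \<partial>vol S)"
    unfolding L2_inner_def by (rule Bochner_Integration.integral_cong[OF refl]) (simp add: space_vol metric_add distrib_right)
  then show "L2_inner S \<rho> (\<lambda>x. U x + V x) W = L2_inner S \<rho> U W + L2_inner S \<rho> V W"
    unfolding L2_inner_def by (simp add: Bochner_Integration.integral_add L2_pair_integrable U V W)
next
  fix V r assume V: "V \<in> L2_fields S \<rho>"
  show "(\<lambda>x. r *\<^sub>R V x) \<in> L2_fields S \<rho>" by (rule L2_scale_mem[OF V])
  show "0 \<le> L2_inner S \<rho> V V" unfolding L2_inner_def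
    by (rule integral_nonneg_AE, rule AE_I2) (simp add: space_vol metric_nonneg rho_pos less_imp_le)
qed

sublocale L2: field_space "L2_fields S \<rho>" "L2_inner S \<rho>" by (rule L2_field_space)

lemma L2_null_AE:
  assumes "V \<in> L2_fields S \<rho>" "L2_inner S \<rho> V V = 0" shows "AE x in vol S. V x = 0"
proof -
  have "AE x in vol S. metric S x (V x) (V x) * \<rho> x = 0"
    using assms(2) unfolding L2_inner_def
    by (subst (asm) integral_nonneg_eq_0_iff_AE[OF L2_int[OF assms(1)]])
      (auto intro!: AE_I2 mult_nonneg_nonneg simp: space_vol metric_nonneg rho_pos less_imp_le)
  then show ?thesis
  proof (rule AE_mp, intro AE_I2 impI)
    fix x assume "x \<in> space (vol S)" and z: "metric S x (V x) (V x) * \<rho> x = 0"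
    then have x: "x \<in> pts S" by (simp add: space_vol)
    show "V x = 0" using z rho_pos[OF x] metric_eq_0[OF x] by simp
  qed
qed

lemma L2_inner_AE_cong:
  assumes "measurable_field U" "measurable_field V" "measurable_field W" "AE x in vol S. U x = V x"
  shows "L2_inner S \<rho> U W = L2_inner S \<rho> V W"
  unfolding L2_inner_def
  by (rule integral_cong_AE)
    (use assms measurable_metric rho_meas in \<open>auto intro!: borel_measurable_times elim!: eventually_mono\<close>)

lemma L2_Vk: assumes "Vk k V" "\<And>x. x \<notin> pts S \<Longrightarrow> V x = 0" shows "V \<in> L2_fields S \<rho>"
proof -
  have "Mk k (\<lambda>x. metric S x (V x) (V x) * \<rho> x)" by (intro Mfam_mult Mfam_metric assms rho_Mk)
  from integrable_Mk[OF this] show ?thesis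
    unfolding L2_iff using assms(2) measurable_field_Vk[OF assms(1)] by simp
qed

text \<open>The argument of Riesz and Fischer.  Along a rapidly convergent subsequence the distances of
  successive terms are summable almost everywhere, so the subsequence converges pointwise almost
  everywhere; the lemma of Fatou turns this into convergence in \<open>L\<^sup>2\<close>.\<close>

theorem L2_complete:
  assumes F: "\<And>n::nat. F n \<in> L2_fields S \<rho>"
    and cauchy: "\<forall>e>0. \<exists>N. \<forall>m\<ge>N. \<forall>n\<ge>N. sqrt (L2_inner S \<rho> (\<lambda>x. F m x - F n x) (\<lambda>x. F m x - F n x)) < e"
  shows "\<exists>L\<in>L2_fields S \<rho>. (\<lambda>n. sqrt (L2_inner S \<rho> (\<lambda>x. F n x - L x) (\<lambda>x. F n x - L x))) \<longlonglongrightarrow> 0"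
proof -
  let ?B = "\<lambda>m n. L2_inner S \<rho> (\<lambda>x. F m x - F n x) (\<lambda>x. F m x - F n x)"
  have Bnn: "?B m n \<ge> 0" for m n by (rule L2.nonneg[OF L2.diff_mem[OF F F]])
  have "\<forall>k::nat. \<exists>N. \<forall>m\<ge>N. \<forall>n\<ge>N. sqrt (?B m n) < (1/2)^k"
    using cauchy by simp
  from choice[OF this] obtain M where M': "\<forall>k. \<forall>m\<ge>M k. \<forall>n\<ge>M k. sqrt (?B m n) < (1/2)^k" by (elim exE) (rule that)
  have M: "sqrt (?B m n) < (1/2)^k" if "m \<ge> M k" "n \<ge> M k" for k m n using M' that by simp
  \<comment> \<open>The sum puts \<open>r k\<close> beyond all of \<open>M 0, \<dots>, M k\<close>.\<close>
  define r where "r k = k + (\<Sum>j\<le>k. M j)" for k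
  have rM: "M j \<le> r k" if "j \<le> k" for j k
  proof -
    have "M j \<le> (\<Sum>j\<le>k. M j)" by (rule member_le_sum) (use that in auto)
    then show ?thesis by (simp add: r_def)
  qed
  have small: "?B (r (Suc k)) (r k) \<le> (1/4)^k" for k
  proof -
    have s: "sqrt (?B (r (Suc k)) (r k)) < (1/2)^k" by (rule M) (simp_all add: rM)
    have "(sqrt (?B (r (Suc k)) (r k)))\<^sup>2 \<le> ((1/2)^k)\<^sup>2" by (rule power_mono[OF less_imp_le[OF s]]) (simp add: Bnn)
    then show ?thesis using Bnn by (simp add: power_mult_distrib power2_eq_square power_divide flip: power_mult_distrib)
  qed
  define g where "g k x = sqrt (metric S x (F (r (Suc k)) x - F (r k) x) (F (r (Suc k)) x - F (r k) x))" for k x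
  have dm: "measurable_field (\<lambda>x. F m x - F n x)" for m n by (intro measurable_field_diff L2_meas F)
  have gm[measurable]: "g k \<in> borel_measurable (vol S)" for k
    unfolding g_def by (rule borel_measurable_continuous_on[OF continuous_on_real_sqrt[OF continuous_on_id] measurable_metric[OF dm dm]])
  have gnn: "g k x \<ge> 0" if "x \<in> pts S" for k x unfolding g_def by (simp add: metric_nonneg[OF that])
  have g_int: "(\<integral>\<^sup>+x. ennreal (g k x * \<rho> x) \<partial>vol S) \<le> ennreal ((1/2)^k)" for k
  proof -
    have i2: "integrable (vol S) (\<lambda>x. 2^k * (metric S x (F (r (Suc k)) x - F (r k) x) (F (r (Suc k)) x - F (r k) x) * \<rho> x) + (1/2)^k * \<rho> x)"
      by (intro Bochner_Integration.integrable_add integrable_mult_right L2_int L2.diff_mem F integrable_Mk[OF rho_Mk])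
    have le: "g k x * \<rho> x \<le> (1/2) * (2^k * (metric S x (F (r (Suc k)) x - F (r k) x) (F (r (Suc k)) x - F (r k) x) * \<rho> x) + (1/2)^k * \<rho> x)"
      if x: "x \<in> pts S" for x
    proof -
      let ?m = "metric S x (F (r (Suc k)) x - F (r k) x) (F (r (Suc k)) x - F (r k) x)"
      have g2: "g k x * g k x = ?m" unfolding g_def using metric_nonneg[OF x] by simp
      have h: "(2::real)^k * (1/2)^k = 1" by (simp flip: power_mult_distrib)
      have "0 \<le> 2^k * (g k x - (1/2)^k)\<^sup>2" by simp
      also have "\<dots> = 2^k * (g k x * g k x) - 2 * (2^k * (1/2)^k) * g k x + (2^k * (1/2)^k) * (1/2)^k"
        by (simp add: power2_eq_square algebra_simps)
      finally have "2 * g k x \<le> 2^k * ?m + (1/2)^k" unfolding h g2 by simp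
      then have "2 * g k x * \<rho> x \<le> (2^k * ?m + (1/2)^k) * \<rho> x" using rho_pos[OF x] by (intro mult_right_mono) simp_all
      then show ?thesis by (simp add: algebra_simps)
    qed
    have "(\<integral>\<^sup>+x. ennreal (g k x * \<rho> x) \<partial>vol S) \<le> (\<integral>\<^sup>+x. ennreal ((1/2) * (2^k * (metric S x (F (r (Suc k)) x - F (r k) x) (F (r (Suc k)) x - F (r k) x) * \<rho> x) + (1/2)^k * \<rho> x)) \<partial>vol S)"
      by (rule nn_integral_mono) (rule ennreal_leI, rule le, simp add: space_vol)
    also have "\<dots> = ennreal (\<integral>x. (1/2) * (2^k * (metric S x (F (r (Suc k)) x - F (r k) x) (F (r (Suc k)) x - F (r k) x) * \<rho> x) + (1/2)^k * \<rho> x) \<partial>vol S)"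
      by (rule nn_integral_eq_integral[OF integrable_mult_right[OF i2]], rule AE_I2)
        (simp add: space_vol metric_nonneg rho_pos less_imp_le)
    also have "(\<integral>x. (1/2) * (2^k * (metric S x (F (r (Suc k)) x - F (r k) x) (F (r (Suc k)) x - F (r k) x) * \<rho> x) + (1/2)^k * \<rho> x) \<partial>vol S)
      = (1/2) * (2^k * ?B (r (Suc k)) (r k) + (1/2)^k)"
      unfolding L2_inner_def integral_mult_right_zero
      by (subst Bochner_Integration.integral_add)
        (simp_all add: rho_integral L2_int L2.diff_mem F integrable_Mk[OF rho_Mk])
    also have "\<dots> \<le> (1/2) * (2^k * (1/4)^k + (1/2)^k)" using small[of k] by (intro mult_left_mono add_right_mono) simp_all
    also have "\<dots> = (1/2)^k" by (simp flip: power_mult_distrib)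
    finally show ?thesis by (simp add: ennreal_leI)
  qed
  have "(\<integral>\<^sup>+x. (\<Sum>k. ennreal (g k x * \<rho> x)) \<partial>vol S) = (\<Sum>k. \<integral>\<^sup>+x. ennreal (g k x * \<rho> x) \<partial>vol S)"
    by (rule nn_integral_suminf) measurable
  also have "\<dots> \<le> (\<Sum>k. ennreal ((1/2)^k))" by (rule suminf_le[OF g_int]) auto
  also have "(\<Sum>k. ennreal ((1/2)^k)) < top"
  proof -
    have "(\<Sum>k. ennreal ((1/2)^k)) \<noteq> top" by (rule ennreal_suminf_neq_top) (auto intro: summable_geometric)
    then show ?thesis by (simp only: less_top)
  qed
  finally have "(\<integral>\<^sup>+x. (\<Sum>k. ennreal (g k x * \<rho> x)) \<partial>vol S) \<noteq> \<infinity>" by (simp only: less_top infinity_ennreal_def not_False_eq_True)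
  from nn_integral_PInf_AE[OF _ this]
  have ae1: "AE x in vol S. (\<Sum>k. ennreal (g k x * \<rho> x)) \<noteq> \<infinity>" by measurable
  have conv: "convergent (\<lambda>k. F (r k) x)" if x: "x \<in> pts S" and s: "(\<Sum>k. ennreal (g k x * \<rho> x)) \<noteq> \<infinity>" for x
  proof -
    have "summable (\<lambda>k. g k x * \<rho> x)"
      by (rule summable_suminf_not_top) (use s gnn[OF x] rho_pos[OF x] in \<open>auto simp: less_imp_le\<close>)
    from summable_mult2[OF this, of "1 / \<rho> x"] have sg: "summable (\<lambda>k. g k x)" using rho_pos[OF x] by simp
    obtain C where C: "\<And>v. norm v \<le> C * sqrt (metric S x v v)" using norm_le_metric[OF x] by blast
    have "summable (\<lambda>k. F (r (Suc k)) x - F (r k) x)"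
      by (rule summable_comparison_test'[OF summable_mult[OF sg, of C], of 0]) (use C in \<open>simp add: g_def\<close>)
    then have cs: "convergent (\<lambda>n. \<Sum>k<n. F (r (Suc k)) x - F (r k) x)" by (simp add: summable_iff_convergent)
    have t: "(\<Sum>k<n. F (r (Suc k)) x - F (r k) x) = F (r n) x - F (r 0) x" for n
      by (rule sum_lessThan_telescope[of "\<lambda>k. F (r k) x"])
    from convergent_add[OF convergent_const[of "F (r 0) x"] cs[unfolded t]] show ?thesis by simp
  qed
  define L where "L x = (if x \<in> pts S \<and> convergent (\<lambda>k. F (r k) x) then lim (\<lambda>k. F (r k) x) else 0)" for x
  have Lm: "measurable_field L" unfolding measurable_field_def
  proof
    fix c assume c: "c \<in> atlas S"
    let ?R = "restrict_space (vol S) (cdom c)" and ?X = "\<lambda>k p. coord S c (F (r k)) p"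
    have Xm[measurable]: "?X k \<in> borel_measurable ?R" for k
      using L2_meas[OF F[of "r k"]] c unfolding measurable_field_def by simp
    have Cm: "{p \<in> space ?R. Cauchy (\<lambda>k. ?X k p)} \<in> sets ?R" by (rule sets_Collect_Cauchy) (rule Xm)
    show "coord S c L \<in> borel_measurable ?R"
    proof (rule borel_measurable_LIMSEQ_metric)
      show "(\<lambda>p. if Cauchy (\<lambda>k. ?X k p) then ?X k p else 0) \<in> borel_measurable ?R" for k
        by (rule measurable_If[OF Xm _ Cm]) simp
      fix p assume "p \<in> space ?R"
      then have p: "p \<in> cdom c" by (simp add: space_cdom[OF c])
      have pp: "p \<in> pts S" by (rule in_pts[OF c p])
      have bl: "bounded_linear (comps c p)" "bounded_linear (frame S c p)"
        using comps_linear[OF c p] frame_linear[OF c p] by (simp_all add: linear_conv_bounded_linear)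
      show "(\<lambda>k. if Cauchy (\<lambda>k. ?X k p) then ?X k p else 0) \<longlonglongrightarrow> coord S c L p"
      proof (cases "convergent (\<lambda>k. F (r k) p)")
        case True
        then have "(\<lambda>k. F (r k) p) \<longlonglongrightarrow> L p" using pp by (simp add: L_def convergent_LIMSEQ_iff)
        from bounded_linear.tendsto[OF bl(1) this] have "(\<lambda>k. ?X k p) \<longlonglongrightarrow> coord S c L p" by (simp add: coord_def)
        moreover from this have "Cauchy (\<lambda>k. ?X k p)" by (rule LIMSEQ_imp_Cauchy)
        ultimately show ?thesis by simp
      next
        case False
        have "\<not> Cauchy (\<lambda>k. ?X k p)"
        proof
          assume "Cauchy (\<lambda>k. ?X k p)"
          then obtain l where "(\<lambda>k. ?X k p) \<longlonglongrightarrow> l" by (auto simp: Cauchy_convergent_iff convergent_def)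
          from bounded_linear.tendsto[OF bl(2) this] have "(\<lambda>k. F (r k) p) \<longlonglongrightarrow> frame S c p l"
            by (simp add: coord_def frame_comps[OF c p])
          then show False using False by (simp add: convergentI)
        qed
        moreover have "coord S c L p = 0" using False linear_0[OF comps_linear[OF c p]] by (simp add: L_def coord_def)
        ultimately show ?thesis by simp
      qed
    qed
  qed
  have aelim: "AE x in vol S. (\<lambda>k. F (r k) x) \<longlonglongrightarrow> L x"
    using ae1
  proof (rule AE_mp, intro AE_I2 impI)
    fix x assume x: "x \<in> space (vol S)" and s: "(\<Sum>k. ennreal (g k x * \<rho> x)) \<noteq> \<infinity>"
    then show "(\<lambda>k. F (r k) x) \<longlonglongrightarrow> L x" using conv[of x] by (simp add: space_vol L_def convergent_LIMSEQ_iff)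
  qed
  let ?q = "\<lambda>n x. metric S x (F n x - L x) (F n x - L x) * \<rho> x"
  have FLm: "measurable_field (\<lambda>x. F n x - L x)" for n by (intro measurable_field_diff L2_meas F Lm)
  have qm: "?q n \<in> borel_measurable (vol S)" for n
    by (rule borel_measurable_times[OF measurable_metric[OF FLm FLm] rho_meas])
  have fatou: "(\<integral>\<^sup>+x. ennreal (?q n x) \<partial>vol S) \<le> ennreal (e\<^sup>2)"
    if e: "e > 0" and N: "\<And>m. m \<ge> N \<Longrightarrow> sqrt (?B n m) < e" for n N e
  proof -
    let ?u = "\<lambda>k x. ennreal (metric S x (F n x - F (r k) x) (F n x - F (r k) x) * \<rho> x)"
    have um: "?u k \<in> borel_measurable (vol S)" for k
      using borel_measurable_times[OF measurable_metric[OF dm dm] rho_meas] by measurable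
    have "(\<integral>\<^sup>+x. ennreal (?q n x) \<partial>vol S) = (\<integral>\<^sup>+x. liminf (\<lambda>k. ?u k x) \<partial>vol S)"
    proof (rule nn_integral_cong_AE, rule AE_mp[OF aelim], intro AE_I2 impI)
      fix x assume "x \<in> space (vol S)" and l: "(\<lambda>k. F (r k) x) \<longlonglongrightarrow> L x"
      then have x: "x \<in> pts S" by (simp add: space_vol)
      have bb: "bounded_bilinear (metric S x)" using metric_bilinear[OF x] by (simp add: bilinear_conv_bounded_bilinear)
      have "(\<lambda>k. metric S x (F n x - F (r k) x) (F n x - F (r k) x) * \<rho> x) \<longlonglongrightarrow> ?q n x"
        by (intro tendsto_mult tendsto_const bounded_bilinear.tendsto[OF bb] tendsto_diff l)
      then have "(\<lambda>k. ?u k x) \<longlonglongrightarrow> ennreal (?q n x)" by (rule tendsto_ennrealI)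
      from lim_imp_Liminf[OF _ this] show "ennreal (?q n x) = liminf (\<lambda>k. ?u k x)" by simp
    qed
    also have "\<dots> \<le> liminf (\<lambda>k. \<integral>\<^sup>+x. ?u k x \<partial>vol S)" by (rule nn_integral_liminf[OF um])
    also have "\<dots> \<le> ennreal (e\<^sup>2)"
    proof -
      have "(\<integral>\<^sup>+x. ?u k x \<partial>vol S) \<le> ennreal (e\<^sup>2)" if k: "k \<ge> N" for k
      proof -
        have k': "r k \<ge> N" using k by (simp add: r_def)
        have "(\<integral>\<^sup>+x. ?u k x \<partial>vol S) = ennreal (?B n (r k))" unfolding L2_inner_def
          by (rule nn_integral_eq_integral[OF L2_int[OF L2.diff_mem[OF F F]]], rule AE_I2)
            (simp add: space_vol metric_nonneg rho_pos less_imp_le)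
        moreover have "?B n (r k) \<le> e\<^sup>2"
          using power_mono[OF less_imp_le[OF N[OF k']], of 2] Bnn[of n "r k"] by simp
        ultimately show ?thesis by (simp add: ennreal_leI)
      qed
      then have "eventually (\<lambda>k. (\<integral>\<^sup>+x. ?u k x \<partial>vol S) \<le> ennreal (e\<^sup>2)) sequentially"
        unfolding eventually_sequentially by (intro exI[of _ N] allI impI)
      then have "limsup (\<lambda>k. \<integral>\<^sup>+x. ?u k x \<partial>vol S) \<le> ennreal (e\<^sup>2)" by (rule Limsup_bounded)
      then show ?thesis using Liminf_le_Limsup[of sequentially "\<lambda>k. \<integral>\<^sup>+x. ?u k x \<partial>vol S"] by (rule order_trans[rotated]) simp
    qed
    finally show ?thesis .
  qed
  have FL: "(\<lambda>x. F n x - L x) \<in> L2_fields S \<rho> \<and> L2_inner S \<rho> (\<lambda>x. F n x - L x) (\<lambda>x. F n x - L x) \<le> e\<^sup>2"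
    if e: "e > 0" and N: "\<And>m. m \<ge> N \<Longrightarrow> sqrt (?B n m) < e" for n N e
  proof -
    have qnn: "AE x in vol S. 0 \<le> ?q n x"
      by (rule AE_I2) (simp add: space_vol metric_nonneg rho_pos less_imp_le)
    have f: "(\<integral>\<^sup>+x. ennreal (?q n x) \<partial>vol S) \<le> ennreal (e\<^sup>2)" by (rule fatou[OF e N])
    have i: "integrable (vol S) (?q n)"
      by (rule integrableI_nonneg[OF qm qnn]) (rule le_less_trans[OF f], simp)
    have "(\<lambda>x. F n x - L x) \<in> L2_fields S \<rho>"
      unfolding L2_iff using i FLm[of n] L2_outside[OF F[of n]] by (simp add: L_def)
    moreover have "ennreal (L2_inner S \<rho> (\<lambda>x. F n x - L x) (\<lambda>x. F n x - L x)) \<le> ennreal (e\<^sup>2)"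
      using f unfolding L2_inner_def nn_integral_eq_integral[OF i qnn] .
    ultimately show ?thesis by (simp add: ennreal_le_iff)
  qed
  have ev: "\<exists>N. \<forall>n\<ge>N. \<forall>m\<ge>N. sqrt (?B n m) < e" if "e > 0" for e using cauchy that by blast
  obtain N0 where N0: "\<forall>n\<ge>N0. \<forall>m\<ge>N0. sqrt (?B n m) < 1" using ev[of 1] by auto
  have "(\<lambda>x. F N0 x - L x) \<in> L2_fields S \<rho>" using FL[of 1 N0 N0] N0 by simp
  from L2.diff_mem[OF F[of N0] this] have LL: "L \<in> L2_fields S \<rho>" by simp
  have "(\<lambda>n. sqrt (L2_inner S \<rho> (\<lambda>x. F n x - L x) (\<lambda>x. F n x - L x))) \<longlonglongrightarrow> 0"
    unfolding LIMSEQ_iff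
  proof (intro allI impI)
    fix e :: real assume e: "0 < e"
    then obtain N where N: "\<forall>n\<ge>N. \<forall>m\<ge>N. sqrt (?B n m) < e / 2" using ev[of "e/2"] by auto
    have "norm (sqrt (L2_inner S \<rho> (\<lambda>x. F n x - L x) (\<lambda>x. F n x - L x)) - 0) < e" if n: "n \<ge> N" for n
    proof -
      have h: "L2_inner S \<rho> (\<lambda>x. F n x - L x) (\<lambda>x. F n x - L x) \<le> (e/2)\<^sup>2"
        using FL[of "e/2" N n] N n e by simp
      from real_sqrt_le_mono[OF h] e have "sqrt (L2_inner S \<rho> (\<lambda>x. F n x - L x) (\<lambda>x. F n x - L x)) \<le> e/2" by simp
      moreover have "L2_inner S \<rho> (\<lambda>x. F n x - L x) (\<lambda>x. F n x - L x) \<ge> 0" by (rule L2.nonneg[OF L2.diff_mem[OF F LL]])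
      ultimately show ?thesis using e by simp
    qed
    then show "\<exists>no. \<forall>n\<ge>no. norm (sqrt (L2_inner S \<rho> (\<lambda>x. F n x - L x) (\<lambda>x. F n x - L x)) - 0) < e" by blast
  qed
  then show ?thesis using LL by (intro bexI[of _ L])
qed

lemma grad_smooth_L2: "smooth_fun S f \<Longrightarrow> grad S f \<in> L2_fields S \<rho>"
  by (rule L2_Vk[of 0]) (rule Vfam_grad, simp_all add: smooth_fun_iff grad_outside)

end

context riem
begin

lemma grad_add:
  assumes "Mk 1 f" "Mk 1 g" shows "grad S (\<lambda>p. f p + g p) = (\<lambda>p. grad S f p + grad S g p)"
proof
  fix p show "grad S (\<lambda>p. f p + g p) p = grad S f p + grad S g p"
  proof (cases "p \<in> pts S")
    case True
    note c = chart_at_atlas[OF True] chart_at_dom[OF True]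
    note d = Mk_chart_derivative[OF assms(1) c] Mk_chart_derivative[OF assms(2) c]
    show ?thesis
      by (rule grad_eqI[OF True])
        (simp add: metric_grad[OF c has_derivative_add[OF d]] metric_grad[OF c d(1)] metric_grad[OF c d(2)] metric_add[OF True])
  qed (simp add: grad_outside)
qed

lemma grad_scale:
  assumes "Mk 1 f" shows "grad S (\<lambda>p. r * f p) = (\<lambda>p. r *\<^sub>R grad S f p)"
proof
  fix p show "grad S (\<lambda>p. r * f p) p = r *\<^sub>R grad S f p"
  proof (cases "p \<in> pts S")
    case True
    note c = chart_at_atlas[OF True] chart_at_dom[OF True]
    note d = Mk_chart_derivative[OF assms(1) c]
    show ?thesis
      by (rule grad_eqI[OF True])
        (simp add: metric_grad[OF c has_derivative_mult_right[OF d]] metric_grad[OF c d] metric_scale[OF True])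
  qed (simp add: grad_outside)
qed

text \<open>If \<open>h\<close> did not vanish at \<open>p0\<close>, a bump function supported where
  \<open>h\<close> has the sign of \<open>h p0\<close> would give a nonzero integral.\<close>

lemma fundamental_lemma:
  assumes h: "Mk 0 h" and z: "\<And>f. smooth_fun S f \<Longrightarrow> (\<integral>p. f p * h p \<partial>vol S) = 0" and p0: "p0 \<in> pts S"
  shows "h p0 = 0"
proof (rule ccontr)
  assume n: "h p0 \<noteq> 0"
  note c = chart_at_atlas[OF p0] chart_at_dom[OF p0]
  let ?c = "chart_at S p0"
  let ?g = "\<lambda>y. h (cinv ?c y) * h p0"
  have "Ck 0 (img ?c) ?g"
    by (intro Cfam_mult open_img[OF c(1)] Cfam_const) (use h c(1) in \<open>simp add: Mfam_def\<close>)
  then have op: "open (img ?c \<inter> ?g -` {0<..})"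
    by (intro continuous_open_preimage[OF Ck_continuous] open_img[OF c(1)]) simp_all
  have sq: "h p0 * h p0 > 0" using n not_real_square_gt_zero[of "h p0"] by blast
  then have "cmap ?c p0 \<in> img ?c \<inter> ?g -` {0<..}"
    using c(2) cinv_cmap[OF c] by simp
  from open_contains_cball[THEN iffD1, OF op, rule_format, OF this]
  obtain r where r: "r > 0" "cball (cmap ?c p0) r \<subseteq> img ?c \<inter> ?g -` {0<..}"
    by (elim exE conjE) (rule that)
  have B1: "cball (cmap ?c p0) r \<subseteq> img ?c" by (rule subset_trans[OF r(2) Int_lower1])
  have B2: "cball (cmap ?c p0) r \<subseteq> ?g -` {0<..}" by (rule subset_trans[OF r(2) Int_lower2])
  let ?f = "mbump ?c (cmap ?c p0) r"
  have fM: "Mk k ?f" for k by (rule mbump_Mk[OF c(1) r(1) B1])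
  have kM: "Mk 0 (\<lambda>p. ?f p * h p * h p0)" by (intro Mfam_mult fM h Mfam_const)
  have "integral\<^sup>L (vol S) (\<lambda>p. ?f p * h p * h p0) > 0"
  proof (rule integral_pos[OF kM _ p0])
    show "?f p0 * h p0 * h p0 > 0"
      using mbump_pos[OF r(1), of ?c "cmap ?c p0" p0] c r(1) sq by (simp add: mult.assoc del: zero_less_mult_iff)
    fix p assume "p \<in> pts S"
    show "0 \<le> ?f p * h p * h p0"
    proof (cases "p \<in> cinv ?c ` cball (cmap ?c p0) r")
      case True
      then obtain y where y: "p = cinv ?c y" "y \<in> cball (cmap ?c p0) r" by (rule imageE)
      have "h p * h p0 > 0" using subsetD[OF B2 y(2)] unfolding y(1) by simp
      then show ?thesis using mbump_nonneg by (simp add: mult.assoc)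
    next
      case False
      then show ?thesis using mbump_supp[OF c(1) r(1) False] by simp
    qed
  qed
  moreover have "smooth_fun S ?f" unfolding smooth_fun_iff using fM by blast
  ultimately show False using z[of ?f] by simp
qed

end

section \<open>The horizontal projection\<close>

context riem_density
begin

lemma L2_sum_bound:
  assumes "U \<in> L2_fields S \<rho>" "V \<in> L2_fields S \<rho>"
  shows "L2_inner S \<rho> (\<lambda>x. U x + V x) (\<lambda>x. U x + V x) \<le> 2 * L2_inner S \<rho> U U + 2 * L2_inner S \<rho> V V"
  using L2.quadratic[OF assms, of 1] L2.quadratic_diff[OF assms] L2.nonneg[OF L2.diff_mem[OF assms]] by simp

lemma HW_L2: "V \<in> HW S \<rho> \<Longrightarrow> V \<in> L2_fields S \<rho>"
  unfolding HW_def by simp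

lemma HW_approx: "V \<in> HW S \<rho> \<Longrightarrow> e > 0 \<Longrightarrow>
    \<exists>f. smooth_fun S f \<and> L2_inner S \<rho> (\<lambda>x. V x - grad S f x) (\<lambda>x. V x - grad S f x) < e"
  unfolding HW_def by simp

lemma HW_I:
  assumes "V \<in> L2_fields S \<rho>"
    and "\<And>e. e > 0 \<Longrightarrow> \<exists>f. smooth_fun S f \<and> L2_inner S \<rho> (\<lambda>x. V x - grad S f x) (\<lambda>x. V x - grad S f x) < e"
  shows "V \<in> HW S \<rho>"
  unfolding HW_def using assms by simp

lemma grad_HW: assumes "smooth_fun S f" shows "grad S f \<in> HW S \<rho>"
proof (rule HW_I[OF grad_smooth_L2[OF assms]])
  fix e :: real assume "e > 0"
  moreover have "L2_inner S \<rho> (\<lambda>x. grad S f x - grad S f x) (\<lambda>x. grad S f x - grad S f x) = 0"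
    unfolding L2.diff_left[OF grad_smooth_L2[OF assms] grad_smooth_L2[OF assms] L2.diff_mem[OF grad_smooth_L2[OF assms] grad_smooth_L2[OF assms]]] by simp
  ultimately show "\<exists>g. smooth_fun S g \<and> L2_inner S \<rho> (\<lambda>x. grad S f x - grad S g x) (\<lambda>x. grad S f x - grad S g x) < e"
    using assms by (intro exI[of _ f]) simp
qed

lemma HW_add: assumes "U \<in> HW S \<rho>" "V \<in> HW S \<rho>" shows "(\<lambda>x. U x + V x) \<in> HW S \<rho>"
proof (rule HW_I[OF L2_add_mem[OF HW_L2[OF assms(1)] HW_L2[OF assms(2)]]])
  fix e :: real assume e: "e > 0"
  obtain f where f: "smooth_fun S f" "L2_inner S \<rho> (\<lambda>x. U x - grad S f x) (\<lambda>x. U x - grad S f x) < e/4"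
    using HW_approx[OF assms(1), of "e/4"] e by auto
  obtain g where g: "smooth_fun S g" "L2_inner S \<rho> (\<lambda>x. V x - grad S g x) (\<lambda>x. V x - grad S g x) < e/4"
    using HW_approx[OF assms(2), of "e/4"] e by auto
  have fg: "Mk k f" "Mk k g" for k using f(1) g(1) by (simp_all add: smooth_fun_iff)
  have s: "smooth_fun S (\<lambda>p. f p + g p)" unfolding smooth_fun_iff by (intro allI Mfam_add fg)
  have eq: "(\<lambda>x. U x + V x - grad S (\<lambda>p. f p + g p) x) = (\<lambda>x. (U x - grad S f x) + (V x - grad S g x))"
    unfolding grad_add[OF fg] by (simp add: fun_eq_iff)
  have "L2_inner S \<rho> (\<lambda>x. U x + V x - grad S (\<lambda>p. f p + g p) x) (\<lambda>x. U x + V x - grad S (\<lambda>p. f p + g p) x) < e"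
    unfolding eq
    using L2_sum_bound[OF L2.diff_mem[OF HW_L2[OF assms(1)] grad_smooth_L2[OF f(1)]] L2.diff_mem[OF HW_L2[OF assms(2)] grad_smooth_L2[OF g(1)]]] f(2) g(2)
    by simp
  then show "\<exists>h. smooth_fun S h \<and> L2_inner S \<rho> (\<lambda>x. U x + V x - grad S h x) (\<lambda>x. U x + V x - grad S h x) < e"
    using s by (intro exI[of _ "\<lambda>p. f p + g p"] conjI)
qed

lemma HW_scale: assumes "V \<in> HW S \<rho>" shows "(\<lambda>x. r *\<^sub>R V x) \<in> HW S \<rho>"
proof (rule HW_I[OF L2_scale_mem[OF HW_L2[OF assms]]])
  fix e :: real assume e: "e > 0"
  have p: "r\<^sup>2 + 1 > 0" by (simp add: add_nonneg_pos)
  obtain f where f: "smooth_fun S f" "L2_inner S \<rho> (\<lambda>x. V x - grad S f x) (\<lambda>x. V x - grad S f x) < e / (r\<^sup>2 + 1)"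
    using HW_approx[OF assms, of "e / (r\<^sup>2 + 1)"] e p by auto
  let ?D = "\<lambda>x. V x - grad S f x"
  have D: "?D \<in> L2_fields S \<rho>" by (rule L2.diff_mem[OF HW_L2[OF assms] grad_smooth_L2[OF f(1)]])
  have fM: "Mk k f" for k using f(1) by (simp add: smooth_fun_iff)
  have s: "smooth_fun S (\<lambda>p. r * f p)" unfolding smooth_fun_iff by (intro allI Mfam_mult Mfam_const fM)
  have eq: "(\<lambda>x. r *\<^sub>R V x - grad S (\<lambda>p. r * f p) x) = (\<lambda>x. r *\<^sub>R ?D x)"
    unfolding grad_scale[OF fM] by (simp add: fun_eq_iff scaleR_diff_right)
  have "L2_inner S \<rho> (\<lambda>x. r *\<^sub>R ?D x) (\<lambda>x. r *\<^sub>R ?D x) = r\<^sup>2 * L2_inner S \<rho> ?D ?D"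
    unfolding L2.scale_left[OF D L2_scale_mem[OF D]] L2.scale_right[OF D D] by (simp add: power2_eq_square)
  also have "\<dots> \<le> (r\<^sup>2 + 1) * L2_inner S \<rho> ?D ?D" by (rule mult_right_mono[OF _ L2.nonneg[OF D]]) simp
  also have "\<dots> < e" using f(2) p by (simp add: field_simps)
  finally show "\<exists>h. smooth_fun S h \<and> L2_inner S \<rho> (\<lambda>x. r *\<^sub>R V x - grad S h x) (\<lambda>x. r *\<^sub>R V x - grad S h x) < e"
    using s unfolding eq[symmetric] by (intro exI[of _ "\<lambda>p. r * f p"] conjI)
qed

lemma HW_field_space: "field_space (HW S \<rho>) (L2_inner S \<rho>)"
proof
  show "L2_inner S \<rho> U V = L2_inner S \<rho> V U" if "U \<in> HW S \<rho>" "V \<in> HW S \<rho>" for U V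
    by (rule L2.sym[OF HW_L2[OF that(1)] HW_L2[OF that(2)]])
qed (simp_all add: HW_add HW_scale HW_L2 L2.add_left L2.scale_left L2.nonneg)

lemma HW_closed:
  assumes "\<And>n::nat. F n \<in> HW S \<rho>" "L \<in> L2_fields S \<rho>"
    and l: "(\<lambda>n. sqrt (L2_inner S \<rho> (\<lambda>x. F n x - L x) (\<lambda>x. F n x - L x))) \<longlonglongrightarrow> 0"
  shows "L \<in> HW S \<rho>"
proof (rule HW_I[OF assms(2)])
  fix e :: real assume e: "e > 0"
  have "sqrt (e/4) > 0" using e by simp
  from LIMSEQ_D[OF l this] obtain n where n: "norm (sqrt (L2_inner S \<rho> (\<lambda>x. F n x - L x) (\<lambda>x. F n x - L x)) - 0) < sqrt (e/4)"
    by auto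
  then have n': "L2_inner S \<rho> (\<lambda>x. F n x - L x) (\<lambda>x. F n x - L x) < e/4"
    using L2.nonneg[OF L2.diff_mem[OF HW_L2[OF assms(1)] assms(2)], of n] by (simp add: real_sqrt_less_iff del: real_sqrt_divide)
  obtain f where f: "smooth_fun S f" "L2_inner S \<rho> (\<lambda>x. F n x - grad S f x) (\<lambda>x. F n x - grad S f x) < e/4"
    using HW_approx[OF assms(1)[of n], of "e/4"] e by auto
  note Fn = HW_L2[OF assms(1)[of n]] and G = grad_smooth_L2[OF f(1)]
  have D: "(\<lambda>x. L x - F n x) \<in> L2_fields S \<rho>" by (rule L2.diff_mem[OF assms(2) Fn])
  have "L2_inner S \<rho> (\<lambda>x. L x - F n x) (\<lambda>x. L x - F n x) = L2_inner S \<rho> (\<lambda>x. F n x - L x) (\<lambda>x. F n x - L x)"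
    unfolding L2.quadratic_diff[OF assms(2) Fn] L2.quadratic_diff[OF Fn assms(2)] using L2.sym[OF assms(2) Fn] by simp
  then have "L2_inner S \<rho> (\<lambda>x. (L x - F n x) + (F n x - grad S f x)) (\<lambda>x. (L x - F n x) + (F n x - grad S f x)) < e"
    using L2_sum_bound[OF D L2.diff_mem[OF Fn G]] n' f(2) by simp
  then show "\<exists>h. smooth_fun S h \<and> L2_inner S \<rho> (\<lambda>x. L x - grad S h x) (\<lambda>x. L x - grad S h x) < e"
    using f(1) by (intro exI[of _ f] conjI) simp_all
qed

text \<open>On the complete space \<open>H\<^sup>W\<close> the functional \<open>Z \<mapsto> \<langle>V,
  Z\<rangle>\<close> is bounded, and its representing vector is the projection.\<close>

lemma P_hor_exists:
  assumes V: "V \<in> L2_fields S \<rho>" shows "\<exists>W\<in>HW S \<rho>. \<forall>Z\<in>HW S \<rho>. L2_inner S \<rho> W Z = L2_inner S \<rho> V Z"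
proof (rule field_space.riesz_representation[OF HW_field_space, where C = "sqrt (L2_inner S \<rho> V V)"])
  fix F :: "nat \<Rightarrow> 'a \<Rightarrow> real^'n"
  assume F: "\<And>n. F n \<in> HW S \<rho>"
    and c: "\<forall>e>0. \<exists>N. \<forall>m\<ge>N. \<forall>n\<ge>N. sqrt (L2_inner S \<rho> (\<lambda>x. F m x - F n x) (\<lambda>x. F m x - F n x)) < e"
  from L2_complete[OF HW_L2[OF F] c] obtain L where L: "L \<in> L2_fields S \<rho>"
     "(\<lambda>n. sqrt (L2_inner S \<rho> (\<lambda>x. F n x - L x) (\<lambda>x. F n x - L x))) \<longlonglongrightarrow> 0" by (elim bexE) (rule that)
  show "\<exists>L\<in>HW S \<rho>. (\<lambda>n. sqrt (L2_inner S \<rho> (\<lambda>x. F n x - L x) (\<lambda>x. F n x - L x))) \<longlonglongrightarrow> 0"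
    by (intro bexI[of _ L] L(2) HW_closed[OF F L])
next
  have "smooth_fun S (\<lambda>_. 0)" unfolding smooth_fun_iff by (simp add: Mfam_const)
  from grad_HW[OF this] show "HW S \<rho> \<noteq> {}" by auto
qed (use L2.Cauchy_Schwarz[OF V HW_L2] in \<open>simp_all add: HW_L2 V L2.add_right L2.scale_right\<close>)

lemma P_hor:
  assumes V: "V \<in> L2_fields S \<rho>"
  shows "P_hor S \<rho> V \<in> HW S \<rho>" and "Z \<in> HW S \<rho> \<Longrightarrow> L2_inner S \<rho> (P_hor S \<rho> V) Z = L2_inner S \<rho> V Z"
proof -
  obtain W where W: "W \<in> HW S \<rho>" "\<forall>Z\<in>HW S \<rho>. L2_inner S \<rho> W Z = L2_inner S \<rho> V Z"
    using P_hor_exists[OF V] by (elim bexE) (rule that)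
  have "W \<in> HW S \<rho> \<and> (\<forall>Z\<in>HW S \<rho>. L2_inner S \<rho> (\<lambda>x. V x - W x) Z = 0)"
    using W by (simp add: L2.diff_left[OF V HW_L2[OF W(1)] HW_L2])
  from someI[of "\<lambda>W. W \<in> HW S \<rho> \<and> (\<forall>Z\<in>HW S \<rho>. L2_inner S \<rho> (\<lambda>x. V x - W x) Z = 0)", OF this]
  have P: "P_hor S \<rho> V \<in> HW S \<rho>" "\<forall>Z\<in>HW S \<rho>. L2_inner S \<rho> (\<lambda>x. V x - P_hor S \<rho> V x) Z = 0"
    unfolding P_hor_def by blast+
  show "P_hor S \<rho> V \<in> HW S \<rho>" by (rule P(1))
  assume "Z \<in> HW S \<rho>"
  then show "L2_inner S \<rho> (P_hor S \<rho> V) Z = L2_inner S \<rho> V Z"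
    using P(2) L2.diff_left[OF V HW_L2[OF P(1)] HW_L2[of Z]] by simp
qed

text \<open>Gradients are dense in \<open>H\<^sup>W\<close>, and the inner product is continuous.\<close>

lemma orthogonal_HW:
  assumes V: "V \<in> L2_fields S \<rho>" and o: "\<And>f. smooth_fun S f \<Longrightarrow> L2_inner S \<rho> V (grad S f) = 0" and Z: "Z \<in> HW S \<rho>"
  shows "L2_inner S \<rho> V Z = 0"
proof -
  have "\<bar>L2_inner S \<rho> V Z\<bar> \<le> 0 + e" if e: "e > 0" for e
  proof -
    let ?K = "sqrt (L2_inner S \<rho> V V) + 1"
    have K: "?K > 0" using L2.nonneg[OF V] by (simp add: add_nonneg_pos)
    have "(e / ?K)\<^sup>2 > 0" using e K by simp
    from HW_approx[OF Z this] obtain f where f: "smooth_fun S f"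
      "L2_inner S \<rho> (\<lambda>x. Z x - grad S f x) (\<lambda>x. Z x - grad S f x) < (e / ?K)\<^sup>2" by auto
    note G = grad_smooth_L2[OF f(1)]
    have "sqrt (L2_inner S \<rho> (\<lambda>x. Z x - grad S f x) (\<lambda>x. Z x - grad S f x)) \<le> e / ?K"
      using real_sqrt_le_mono[OF less_imp_le[OF f(2)]] e K by simp
    moreover have "L2_inner S \<rho> V Z = L2_inner S \<rho> V (\<lambda>x. Z x - grad S f x)"
      unfolding L2.diff_right[OF HW_L2[OF Z] G V] o[OF f(1)] by simp
    ultimately have "\<bar>L2_inner S \<rho> V Z\<bar> \<le> sqrt (L2_inner S \<rho> V V) * (e / ?K)"
      using L2.Cauchy_Schwarz[OF V L2.diff_mem[OF HW_L2[OF Z] G]] mult_left_mono[of _ "e / ?K" "sqrt (L2_inner S \<rho> V V)"] L2.nonneg[OF V]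
      by (smt (verit) real_sqrt_ge_zero)
    also have "\<dots> \<le> ?K * (e / ?K)" using e K by (intro mult_right_mono) simp_all
    finally show ?thesis using K by simp
  qed
  then have "\<bar>L2_inner S \<rho> V Z\<bar> \<le> 0" by (rule field_le_epsilon)
  then show ?thesis by simp
qed

text \<open>A horizontal \<open>u\<close> is the projection of \<open>b\<close> exactly when \<open>u -
  b\<close> is orthogonal to \<open>H\<^sup>W\<close>, and orthogonality to gradients suffices for
  that.\<close>

lemma P_hor_eq_iff:
  assumes b: "b \<in> L2_fields S \<rho>" and u: "u \<in> HW S \<rho>"
  shows "(AE x in vol S. P_hor S \<rho> b x = u x) \<longleftrightarrow> (\<forall>f. smooth_fun S f \<longrightarrow> L2_inner S \<rho> (\<lambda>x. u x - b x) (grad S f) = 0)"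
proof
  assume ae: "AE x in vol S. P_hor S \<rho> b x = u x"
  show "\<forall>f. smooth_fun S f \<longrightarrow> L2_inner S \<rho> (\<lambda>x. u x - b x) (grad S f) = 0"
  proof (intro allI impI)
    fix f assume f: "smooth_fun S f"
    note G = grad_smooth_L2[OF f]
    have "L2_inner S \<rho> b (grad S f) = L2_inner S \<rho> (P_hor S \<rho> b) (grad S f)" using P_hor(2)[OF b grad_HW[OF f]] by simp
    also have "\<dots> = L2_inner S \<rho> u (grad S f)"
      by (rule L2_inner_AE_cong[OF _ _ _ ae]) (rule L2_meas, simp add: HW_L2 P_hor(1)[OF b] u G)+
    finally show "L2_inner S \<rho> (\<lambda>x. u x - b x) (grad S f) = 0"
      unfolding L2.diff_left[OF HW_L2[OF u] b G] by simp
  qed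
next
  assume o: "\<forall>f. smooth_fun S f \<longrightarrow> L2_inner S \<rho> (\<lambda>x. u x - b x) (grad S f) = 0"
  let ?P = "P_hor S \<rho> b"
  have D: "(\<lambda>x. ?P x - u x) \<in> HW S \<rho>"
    by (rule field_space.diff_mem[OF HW_field_space P_hor(1)[OF b] u])
  have "L2_inner S \<rho> (\<lambda>x. u x - b x) (\<lambda>x. ?P x - u x) = 0"
    by (rule orthogonal_HW[OF L2.diff_mem[OF HW_L2[OF u] b] _ D]) (use o in blast)
  then have "L2_inner S \<rho> (\<lambda>x. ?P x - u x) (\<lambda>x. ?P x - u x) = 0"
    unfolding L2.diff_left[OF HW_L2[OF P_hor(1)[OF b]] HW_L2[OF u] HW_L2[OF D]]
      L2.diff_left[OF HW_L2[OF u] b HW_L2[OF D]] P_hor(2)[OF b D] by simp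
  from L2_null_AE[OF HW_L2[OF D] this] show "AE x in vol S. ?P x = u x" by (rule eventually_mono) simp
qed

lemma weighted_divergence:
  assumes V: "Vk 1 V" and f: "Mk 1 f"
  shows "(\<integral>p. f p * divergence S (\<lambda>p. \<rho> p *\<^sub>R V p) p \<partial>vol S) = - L2_inner S \<rho> V (grad S f)"
proof -
  have "(\<integral>p. f p * divergence S (\<lambda>p. \<rho> p *\<^sub>R V p) p \<partial>vol S) = - (\<integral>p. metric S p (grad S f p) (\<rho> p *\<^sub>R V p) \<partial>vol S)"
    by (rule green[OF f Vfam_scaleR[OF rho_Mk V]])
  also have "(\<integral>p. metric S p (grad S f p) (\<rho> p *\<^sub>R V p) \<partial>vol S) = L2_inner S \<rho> V (grad S f)"
    unfolding L2_inner_def by (rule Bochner_Integration.integral_cong[OF refl]) (simp add: space_vol metric_scale metric_sym mult.commute)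
  finally show ?thesis .
qed

end


section \<open>The reproducing kernel Hilbert space\<close>

locale stein_loc =
  fixes S :: "('a, 'n::finite, 'z) stein_scheme"
  assumes stein: "stein_setting S"

sublocale stein_loc \<subseteq> riem S
  by unfold_locales (use stein in \<open>simp add: stein_setting_def\<close>)

context stein_loc
begin

lemma hilbert: "hilbert_space_of_fields S" and c1_incl: "continuously_in_C1 S"
  using stein unfolding stein_setting_def reproducing_space_def by simp_all

lemma rkhs_outside: "V \<in> rkhs S \<Longrightarrow> x \<notin> pts S \<Longrightarrow> V x = 0"
  using hilbert unfolding hilbert_space_of_fields_def by blast

lemma rkhs_zero: "(\<lambda>x. 0) \<in> rkhs S"
  using hilbert unfolding hilbert_space_of_fields_def by simp

lemma rkhs_pos: "V \<in> rkhs S \<Longrightarrow> V \<noteq> (\<lambda>x. 0) \<Longrightarrow> rkhs_inner S V V > 0"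
  using hilbert unfolding hilbert_space_of_fields_def by simp

lemma rkhs_field_space: "field_space (rkhs S) (rkhs_inner S)"
proof
  note H = hilbert[unfolded hilbert_space_of_fields_def]
  have 1: "\<forall>U\<in>rkhs S. \<forall>V\<in>rkhs S. (\<lambda>x. U x + V x) \<in> rkhs S" using H by (elim conjE)
  have 2: "\<forall>r. \<forall>V\<in>rkhs S. (\<lambda>x. r *\<^sub>R V x) \<in> rkhs S" using H by (elim conjE)
  have 3: "\<forall>U\<in>rkhs S. \<forall>V\<in>rkhs S. rkhs_inner S U V = rkhs_inner S V U" using H by (elim conjE)
  have 4: "\<forall>U\<in>rkhs S. \<forall>V\<in>rkhs S. \<forall>W\<in>rkhs S.
        rkhs_inner S (\<lambda>x. U x + V x) W = rkhs_inner S U W + rkhs_inner S V W" using H by (elim conjE)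
  have 5: "\<forall>r. \<forall>U\<in>rkhs S. \<forall>V\<in>rkhs S. rkhs_inner S (\<lambda>x. r *\<^sub>R U x) V = r * rkhs_inner S U V" using H by (elim conjE)
  show "(\<lambda>x. U x + V x) \<in> rkhs S" if "U \<in> rkhs S" "V \<in> rkhs S" for U V by (rule 1[rule_format, OF that])
  show "(\<lambda>x. r *\<^sub>R V x) \<in> rkhs S" if "V \<in> rkhs S" for V r by (rule 2[rule_format, OF that])
  show "rkhs_inner S U V = rkhs_inner S V U" if "U \<in> rkhs S" "V \<in> rkhs S" for U V by (rule 3[rule_format, OF that])
  show "rkhs_inner S (\<lambda>x. U x + V x) W = rkhs_inner S U W + rkhs_inner S V W" if "U \<in> rkhs S" "V \<in> rkhs S" "W \<in> rkhs S" for U V W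
    by (rule 4[rule_format, OF that])
  show "rkhs_inner S (\<lambda>x. r *\<^sub>R U x) V = r * rkhs_inner S U V" if "U \<in> rkhs S" "V \<in> rkhs S" for U V r
    by (rule 5[rule_format, OF that])
  show "0 \<le> rkhs_inner S V V" if V: "V \<in> rkhs S" for V
  proof (cases "V = (\<lambda>x. 0)")
    case True
    have "rkhs_inner S (\<lambda>x. 0 *\<^sub>R V x) V = 0 * rkhs_inner S V V"
      using hilbert V unfolding hilbert_space_of_fields_def by blast
    then show ?thesis using True by simp
  qed (use rkhs_pos[OF V] in simp)
qed

sublocale RK: field_space "rkhs S" "rkhs_inner S" by (rule rkhs_field_space)

lemma rkhs_complete:
  assumes "\<And>n::nat. F n \<in> rkhs S"
    and "\<forall>e>0. \<exists>N. \<forall>m\<ge>N. \<forall>n\<ge>N. sqrt (rkhs_inner S (\<lambda>x. F m x - F n x) (\<lambda>x. F m x - F n x)) < e"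
  shows "\<exists>L\<in>rkhs S. (\<lambda>n. sqrt (rkhs_inner S (\<lambda>x. F n x - L x) (\<lambda>x. F n x - L x))) \<longlonglongrightarrow> 0"
proof -
  have "\<forall>F :: nat \<Rightarrow> 'a \<Rightarrow> real ^ 'n. (\<forall>n. F n \<in> rkhs S) \<and>
        (\<forall>e>0. \<exists>N. \<forall>m\<ge>N. \<forall>n\<ge>N. rkhs_norm S (\<lambda>x. F m x - F n x) < e) \<longrightarrow>
        (\<exists>L\<in>rkhs S. (\<lambda>n. rkhs_norm S (\<lambda>x. F n x - L x)) \<longlonglongrightarrow> 0)"
    using hilbert unfolding hilbert_space_of_fields_def by (elim conjE)
  from this[rule_format, of F] assms show ?thesis unfolding rkhs_norm_def by simp
qed

lemma rkhs_Vk: "V \<in> rkhs S \<Longrightarrow> Vk 1 V"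
  using c1_incl C1_vfield_Vk unfolding continuously_in_C1_def by blast

lemma rkhs_norm_nonneg: "V \<in> rkhs S \<Longrightarrow> rkhs_norm S V \<ge> 0"
  unfolding rkhs_norm_def using RK.nonneg by simp

lemma rkhs_norm_sq: "V \<in> rkhs S \<Longrightarrow> (rkhs_norm S V)\<^sup>2 = rkhs_inner S V V"
  unfolding rkhs_norm_def using RK.nonneg by simp

lemma finite_ball_weighted_bound:
  assumes "finite N" "\<And>i. i \<in> N \<Longrightarrow> \<exists>C::real. \<forall>x\<in>X. Q i x \<longrightarrow> f x \<le> C * w x" "\<And>x. x \<in> X \<Longrightarrow> \<exists>i\<in>N. Q i x"
    and w: "\<And>x. x \<in> X \<Longrightarrow> w x \<ge> (0::real)"
  shows "\<exists>C\<ge>0. \<forall>x\<in>X. f x \<le> C * w x"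
proof -
  have "\<forall>i\<in>N. \<exists>C. \<forall>x\<in>X. Q i x \<longrightarrow> f x \<le> C * w x" using assms(2) by blast
  from bchoice[OF this] obtain C where C: "\<forall>i\<in>N. \<forall>x\<in>X. Q i x \<longrightarrow> f x \<le> C i * w x" by (elim exE) (rule that)
  have "f x \<le> (\<Sum>i\<in>N. \<bar>C i\<bar>) * w x" if x: "x \<in> X" for x
  proof -
    obtain i where i: "i \<in> N" "Q i x" using assms(3)[OF x] by blast
    have "f x \<le> C i * w x" using C i x by blast
    also have "C i \<le> (\<Sum>i\<in>N. \<bar>C i\<bar>)"
      using member_le_sum[OF i(1), of "\<lambda>i. \<bar>C i\<bar>"] assms(1) by simp
    then have "C i * w x \<le> (\<Sum>i\<in>N. \<bar>C i\<bar>) * w x" by (rule mult_right_mono[OF _ w[OF x]])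
    finally show ?thesis .
  qed
  then show ?thesis by (intro exI[of _ "\<Sum>i\<in>N. \<bar>C i\<bar>"] conjI ballI) (simp_all add: sum_nonneg)
qed

text \<open>Continuity of the inclusion into \<open>C\<^sup>1\<close> bounds components and their first
  derivatives on the finitely many coordinate balls; the coefficients
  \<open>g\<^sub>i\<^sub>j\<close> and the logarithmic derivative of the volume density are
  bounded there too.\<close>

lemma rkhs_bounds:
  shows rkhs_metric_bound: "\<exists>C\<ge>0. \<forall>V\<in>rkhs S. \<forall>p\<in>pts S. metric S p (V p) (V p) \<le> C * rkhs_inner S V V"
    and rkhs_divergence_bound: "\<exists>C\<ge>0. \<forall>V\<in>rkhs S. \<forall>p\<in>pts S. \<bar>divergence S V p\<bar> \<le> C * rkhs_norm S V"
proof -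
  obtain N where N: "finite N" "\<forall>i\<in>N. good_ball i" "(\<Union>i\<in>N. coord_ball i) = pts S" using finite_cover by blast
  let ?X = "rkhs S \<times> pts S"
  have cov: "\<exists>i\<in>N. snd x \<in> coord_ball i" if "x \<in> ?X" for x
  proof -
    have "snd x \<in> (\<Union>i\<in>N. coord_ball i)" using that unfolding N(3) by (cases x) simp
    then show ?thesis by (elim UN_E) (rule bexI)
  qed
  have main: "\<exists>A B. \<forall>V\<in>rkhs S. \<forall>p\<in>coord_ball i. metric S p (V p) (V p) \<le> A * rkhs_inner S V V \<and> \<bar>divergence S V p\<bar> \<le> B * rkhs_norm S V"
    if i: "i \<in> N" for i
  proof -
    let ?c = "fst i" and ?K = "cball (fst (snd i)) (snd (snd i))"
    have c: "?c \<in> atlas S" "?K \<subseteq> img ?c" using N(2) i by simp_all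
    have "\<exists>C. \<forall>V\<in>rkhs S. \<forall>y\<in>?K. norm (coord S ?c V (cinv ?c y)) \<le> C * rkhs_norm S V \<and>
        (\<forall>w. norm (frechet_derivative (coord S ?c V \<circ> cinv ?c) (at y) w) \<le> C * rkhs_norm S V * norm w)"
      using c1_incl c compact_cball unfolding continuously_in_C1_def by blast
    then obtain C where C: "\<And>V y. V \<in> rkhs S \<Longrightarrow> y \<in> ?K \<Longrightarrow> norm (coord S ?c V (cinv ?c y)) \<le> C * rkhs_norm S V"
        "\<And>V y w. V \<in> rkhs S \<Longrightarrow> y \<in> ?K \<Longrightarrow> norm (frechet_derivative (coord S ?c V \<circ> cinv ?c) (at y) w) \<le> C * rkhs_norm S V * norm w"
      by blast
    let ?sg = "\<lambda>y. sg ?c (cinv ?c y)"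
    let ?h = "\<lambda>y. (\<Sum>i\<in>UNIV. \<Sum>j\<in>UNIV. \<bar>gram S ?c (cinv ?c y) $ i $ j\<bar>) + (\<Sum>i\<in>UNIV. \<bar>frechet_derivative ?sg (at y) (axis i 1) / ?sg y\<bar>)"
    have "continuous_on (img ?c) (\<lambda>y. gram S ?c (cinv ?c y) $ i $ j)" for i j by (rule Ck_continuous[OF gram_Cfam[OF c(1)]])
    moreover have "continuous_on (img ?c) (\<lambda>y. frechet_derivative ?sg (at y) (axis i 1) / ?sg y)" for i
    proof (rule Ck_continuous[of 0], rule Cfam_divide[OF open_img[OF c(1)] Cfam_deriv[OF sg_Cfam[OF c(1)]] sg_Cfam[OF c(1)]])
      show "?sg y \<noteq> 0" if "y \<in> img ?c" for y using sg_pos[OF c(1) cinv_in[OF that]] by simp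
    qed
    ultimately have "continuous_on (img ?c) ?h" by (intro continuous_on_add continuous_on_sum continuous_on_rabs) 
    from compact_continuous_image[OF continuous_on_subset[OF this c(2)] compact_cball]
    have "bounded (?h ` ?K)" by (rule compact_imp_bounded)
    then obtain B where "\<forall>z\<in>?h ` ?K. norm z \<le> B" unfolding bounded_iff by (elim exE) (rule that)
    then have B: "\<bar>?h y\<bar> \<le> B" if "y \<in> ?K" for y using that by (simp only: real_norm_def ball_simps(9))
    have "metric S p (V p) (V p) \<le> (C\<^sup>2 * B) * rkhs_inner S V V \<and> \<bar>divergence S V p\<bar> \<le> (real CARD('n) * C + B * C) * rkhs_norm S V"
      if V: "V \<in> rkhs S" and p: "p \<in> coord_ball i" for V p
    proof
      let ?y = "cmap ?c p"
      have pc: "p \<in> cdom ?c" and y: "?y \<in> ?K" "?y \<in> img ?c" using p by simp_all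
      have cy: "cinv ?c ?y = p" by (rule cinv_cmap[OF c(1) pc])
      let ?a = "coord S ?c V p" and ?n = "rkhs_norm S V"
      have n0: "?n \<ge> 0" by (rule rkhs_norm_nonneg[OF V])
      have an: "norm ?a \<le> C * ?n" using C(1)[OF V y(1)] unfolding cy .
      have ai: "\<bar>?a $ i\<bar> \<le> C * ?n" for i by (rule order_trans[OF component_le_norm_cart an])
      have Cn0: "0 \<le> C * ?n" by (rule order_trans[OF norm_ge_zero an])
      have hb: "(\<Sum>i\<in>UNIV. \<Sum>j\<in>UNIV. \<bar>gram S ?c p $ i $ j\<bar>) + (\<Sum>i\<in>UNIV. \<bar>frechet_derivative ?sg (at ?y) (axis i 1) / sg ?c p\<bar>) \<le> B"
        using B[OF y(1)] unfolding cy by linarith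
      have nn: "(\<Sum>i\<in>UNIV. \<Sum>j\<in>UNIV. \<bar>gram S ?c p $ i $ j\<bar>) \<ge> 0"
        "(\<Sum>i\<in>UNIV. \<bar>frechet_derivative ?sg (at ?y) (axis i 1) / sg ?c p\<bar>) \<ge> 0"
        by (intro sum_nonneg abs_ge_zero)+
      have G: "(\<Sum>i\<in>UNIV. \<Sum>j\<in>UNIV. \<bar>gram S ?c p $ i $ j\<bar>) \<le> B"
        by (rule order_trans[OF _ hb]) (use nn(2) in \<open>simp only: le_add_same_cancel1\<close>)
      have s: "(\<Sum>i\<in>UNIV. \<bar>frechet_derivative ?sg (at ?y) (axis i 1) / sg ?c p\<bar>) \<le> B"
        by (rule order_trans[OF _ hb]) (use nn(1) in \<open>simp only: le_add_same_cancel2\<close>)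
      have "metric S p (V p) (V p) = (\<Sum>i\<in>UNIV. \<Sum>j\<in>UNIV. ?a $ i * ?a $ j * gram S ?c p $ i $ j)"
        using metric_coords[OF c(1) pc] by (simp add: coord_def)
      also have "\<dots> \<le> (\<Sum>i\<in>UNIV. \<Sum>j\<in>UNIV. (C * ?n) * (C * ?n) * \<bar>gram S ?c p $ i $ j\<bar>)"
      proof (intro sum_mono)
        fix i j
        have "?a $ i * ?a $ j * gram S ?c p $ i $ j \<le> \<bar>?a $ i\<bar> * \<bar>?a $ j\<bar> * \<bar>gram S ?c p $ i $ j\<bar>"
          by (simp flip: abs_mult)
        also have "\<dots> \<le> (C * ?n) * (C * ?n) * \<bar>gram S ?c p $ i $ j\<bar>"
          by (intro mult_right_mono mult_mono ai Cn0) simp_all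
        finally show "?a $ i * ?a $ j * gram S ?c p $ i $ j \<le> (C * ?n) * (C * ?n) * \<bar>gram S ?c p $ i $ j\<bar>" .
      qed
      also have "\<dots> = (C * ?n) * (C * ?n) * (\<Sum>i\<in>UNIV. \<Sum>j\<in>UNIV. \<bar>gram S ?c p $ i $ j\<bar>)"
        by (simp only: sum_distrib_left)
      also have "\<dots> \<le> (C * ?n) * (C * ?n) * B" by (intro mult_left_mono G mult_nonneg_nonneg Cn0)
      also have "\<dots> = (C\<^sup>2 * B) * rkhs_inner S V V" unfolding rkhs_norm_sq[OF V, symmetric] by (simp add: power2_eq_square)
      finally show "metric S p (V p) (V p) \<le> (C\<^sup>2 * B) * rkhs_inner S V V" .
      have dV: "Cfam (Suc 0) UNIV (img ?c) (\<lambda>_ y. coord S ?c V (cinv ?c y))" using rkhs_Vk[OF V] c(1) unfolding Vfam_def by simp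
      have dv: "((\<lambda>y. coord S ?c V (cinv ?c y)) has_derivative frechet_derivative (coord S ?c V \<circ> cinv ?c) (at ?y)) (at ?y)"
        using Cfam_has_derivative[OF dV UNIV_I y(2)] unfolding comp_def .
      let ?D = "frechet_derivative (coord S ?c V \<circ> cinv ?c) (at ?y)"
      have dvi: "((\<lambda>y. coord S ?c V (cinv ?c y) $ i) has_derivative (\<lambda>v. ?D v $ i)) (at ?y)" for i
        by (rule bounded_linear.has_derivative[OF bounded_linear_vec_nth dv])
      have ds: "(?sg has_derivative frechet_derivative ?sg (at ?y)) (at ?y)"
        by (rule Cfam_has_derivative[OF sg_Cfam[OF c(1)] UNIV_I y(2)])
      note fd = fun_cong[OF frechet_derivative_at[OF has_derivative_mult[OF ds dvi], symmetric]]
      have sp: "sg ?c p > 0" by (rule sg_pos[OF c(1) pc])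
      have "divergence S V p = (\<Sum>i\<in>UNIV. sg ?c p * ?D (axis i 1) $ i + frechet_derivative ?sg (at ?y) (axis i 1) * ?a $ i) / sg ?c p"
        unfolding divergence_chart[OF c(1) pc rkhs_Vk[OF V]] cdiv_def fd cy ..
      also have "\<dots> = (\<Sum>i\<in>UNIV. ?D (axis i 1) $ i + frechet_derivative ?sg (at ?y) (axis i 1) / sg ?c p * ?a $ i)"
        unfolding sum_divide_distrib using sp by (intro sum.cong refl) (simp add: field_simps)
      finally have "\<bar>divergence S V p\<bar> \<le> (\<Sum>i\<in>UNIV. \<bar>?D (axis i 1) $ i + frechet_derivative ?sg (at ?y) (axis i 1) / sg ?c p * ?a $ i\<bar>)"
        by (simp only: sum_abs)
      also have "\<dots> \<le> (\<Sum>i\<in>(UNIV::'n set). C * ?n + \<bar>frechet_derivative ?sg (at ?y) (axis i 1) / sg ?c p\<bar> * (C * ?n))"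
      proof (intro sum_mono)
        fix i :: 'n
        have "\<bar>?D (axis i 1) $ i\<bar> \<le> norm (?D (axis i 1))" by (rule component_le_norm_cart)
        also have "\<dots> \<le> C * ?n * norm (axis i (1::real) :: real^'n)" by (rule C(2)[OF V y(1)])
        finally have 1: "\<bar>?D (axis i 1) $ i\<bar> \<le> C * ?n" by simp
        have 2: "\<bar>frechet_derivative ?sg (at ?y) (axis i 1) / sg ?c p * ?a $ i\<bar> \<le> \<bar>frechet_derivative ?sg (at ?y) (axis i 1) / sg ?c p\<bar> * (C * ?n)"
          unfolding abs_mult by (rule mult_left_mono[OF ai]) simp
        show "\<bar>?D (axis i 1) $ i + frechet_derivative ?sg (at ?y) (axis i 1) / sg ?c p * ?a $ i\<bar> \<le> C * ?n + \<bar>frechet_derivative ?sg (at ?y) (axis i 1) / sg ?c p\<bar> * (C * ?n)"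
          by (rule order_trans[OF abs_triangle_ineq add_mono[OF 1 2]])
      qed
      also have "\<dots> = real CARD('n) * (C * ?n) + (\<Sum>i\<in>UNIV. \<bar>frechet_derivative ?sg (at ?y) (axis i 1) / sg ?c p\<bar>) * (C * ?n)"
        by (simp only: sum.distrib sum_distrib_right sum_constant) 
      also have "\<dots> \<le> real CARD('n) * (C * ?n) + B * (C * ?n)" by (intro add_left_mono mult_right_mono s Cn0)
      finally show "\<bar>divergence S V p\<bar> \<le> (real CARD('n) * C + B * C) * rkhs_norm S V" by (simp only: distrib_right mult.assoc)
    qed
    then show ?thesis by blast
  qed
  have "\<exists>C\<ge>0. \<forall>x\<in>?X. metric S (snd x) (fst x (snd x)) (fst x (snd x)) \<le> C * rkhs_inner S (fst x) (fst x)"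
  proof (rule finite_ball_weighted_bound[OF N(1) _ cov])
    fix i assume "i \<in> N"
    from main[OF this] obtain A B where AB: "\<forall>V\<in>rkhs S. \<forall>p\<in>coord_ball i. metric S p (V p) (V p) \<le> A * rkhs_inner S V V \<and> \<bar>divergence S V p\<bar> \<le> B * rkhs_norm S V"
      by (elim exE) (rule that)
    then show "\<exists>C. \<forall>x\<in>?X. snd x \<in> coord_ball i \<longrightarrow> metric S (snd x) (fst x (snd x)) (fst x (snd x)) \<le> C * rkhs_inner S (fst x) (fst x)"
      by (intro exI[of _ A] ballI impI) (simp add: mem_Times_iff)
  qed (auto intro: RK.nonneg)
  then obtain C where "C \<ge> 0" and C: "\<forall>x\<in>?X. metric S (snd x) (fst x (snd x)) (fst x (snd x)) \<le> C * rkhs_inner S (fst x) (fst x)" by blast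
  then show "\<exists>C\<ge>0. \<forall>V\<in>rkhs S. \<forall>p\<in>pts S. metric S p (V p) (V p) \<le> C * rkhs_inner S V V"
    using C[rule_format, of "(V, p)" for V p] by (intro exI[of _ C] conjI ballI) simp_all
  have "\<exists>C\<ge>0. \<forall>x\<in>?X. \<bar>divergence S (fst x) (snd x)\<bar> \<le> C * rkhs_norm S (fst x)"
  proof (rule finite_ball_weighted_bound[OF N(1) _ cov])
    fix i assume "i \<in> N"
    from main[OF this] obtain A B where AB: "\<forall>V\<in>rkhs S. \<forall>p\<in>coord_ball i. metric S p (V p) (V p) \<le> A * rkhs_inner S V V \<and> \<bar>divergence S V p\<bar> \<le> B * rkhs_norm S V"
      by (elim exE) (rule that)
    then show "\<exists>C. \<forall>x\<in>?X. snd x \<in> coord_ball i \<longrightarrow> \<bar>divergence S (fst x) (snd x)\<bar> \<le> C * rkhs_norm S (fst x)"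
      by (intro exI[of _ B] ballI impI) (simp add: mem_Times_iff)
  qed (auto intro: rkhs_norm_nonneg)
  then obtain C where "C \<ge> 0" and C: "\<forall>x\<in>?X. \<bar>divergence S (fst x) (snd x)\<bar> \<le> C * rkhs_norm S (fst x)" by blast
  then show "\<exists>C\<ge>0. \<forall>V\<in>rkhs S. \<forall>p\<in>pts S. \<bar>divergence S V p\<bar> \<le> C * rkhs_norm S V"
    using C[rule_format, of "(V, p)" for V p] by (intro exI[of _ C] conjI ballI) simp_all
qed

end

section \<open>The adjoint of the inclusion\<close>

locale stein_density = stein_loc S + riem_density S \<rho>
  for S :: "('a, 'n::finite, 'z) stein_scheme" and \<rho> :: "'a \<Rightarrow> real"
begin

lemma rkhs_L2: "V \<in> rkhs S \<Longrightarrow> V \<in> L2_fields S \<rho>"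
  by (rule L2_Vk[OF rkhs_Vk rkhs_outside])

lemma L2_le_rkhs:
  assumes C: "\<forall>V\<in>rkhs S. \<forall>p\<in>pts S. metric S p (V p) (V p) \<le> C * rkhs_inner S V V" and V: "V \<in> rkhs S"
  shows "L2_inner S \<rho> V V \<le> C * rkhs_inner S V V"
proof -
  have "L2_inner S \<rho> V V \<le> (\<integral>x. (C * rkhs_inner S V V) * \<rho> x \<partial>vol S)" unfolding L2_inner_def
    by (rule integral_mono[OF L2_int[OF rkhs_L2[OF V]] integrable_mult_right[OF integrable_Mk[OF rho_Mk]]])
      (use C V rho_pos in \<open>simp add: space_vol mult_right_mono less_imp_le\<close>)
  then show ?thesis by (simp add: rho_integral)
qed

text \<open>The functional \<open>h \<mapsto> \<langle>V, h\<rangle>\<close> is bounded on the reproducing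
  kernel Hilbert space since the inclusion into continuous fields is.\<close>

lemma I_adj:
  assumes V: "V \<in> L2_fields S \<rho>"
  shows I_adj_mem: "I_adj S \<rho> V \<in> rkhs S"
    and I_adj_inner: "h \<in> rkhs S \<Longrightarrow> rkhs_inner S (I_adj S \<rho> V) h = L2_inner S \<rho> V h"
    and I_adj_unique: "W \<in> rkhs S \<Longrightarrow> (\<forall>h\<in>rkhs S. rkhs_inner S W h = L2_inner S \<rho> V h) \<Longrightarrow> I_adj S \<rho> V = W"
proof -
  obtain C where C: "C \<ge> 0" "\<forall>V\<in>rkhs S. \<forall>p\<in>pts S. metric S p (V p) (V p) \<le> C * rkhs_inner S V V"
    using rkhs_metric_bound by blast
  have "\<exists>W\<in>rkhs S. \<forall>h\<in>rkhs S. rkhs_inner S W h = L2_inner S \<rho> V h"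
  proof (rule RK.riesz_representation[OF rkhs_complete, where C = "sqrt (L2_inner S \<rho> V V) * sqrt C"])
    show "\<bar>L2_inner S \<rho> V h\<bar> \<le> sqrt (L2_inner S \<rho> V V) * sqrt C * sqrt (rkhs_inner S h h)" if h: "h \<in> rkhs S" for h
    proof -
      have "sqrt (L2_inner S \<rho> h h) \<le> sqrt C * sqrt (rkhs_inner S h h)"
        using real_sqrt_le_mono[OF L2_le_rkhs[OF C(2) h]] by (simp add: real_sqrt_mult)
      from mult_left_mono[OF this, of "sqrt (L2_inner S \<rho> V V)"] L2.nonneg[OF V]
      show ?thesis using L2.Cauchy_Schwarz[OF V rkhs_L2[OF h]] by (simp add: mult.assoc)
    qed
  qed (use rkhs_zero in \<open>auto simp: V rkhs_L2 L2.add_right L2.scale_right\<close>)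
  then obtain W0 where W0: "W0 \<in> rkhs S" "\<forall>h\<in>rkhs S. rkhs_inner S W0 h = L2_inner S \<rho> V h" by (elim bexE) (rule that)
  have uniq: "W = W'" if W: "W \<in> rkhs S" "\<forall>h\<in>rkhs S. rkhs_inner S W h = L2_inner S \<rho> V h"
      and W': "W' \<in> rkhs S" "\<forall>h\<in>rkhs S. rkhs_inner S W' h = L2_inner S \<rho> V h" for W W'
  proof -
    have D: "(\<lambda>x. W x - W' x) \<in> rkhs S" by (rule RK.diff_mem[OF W(1) W'(1)])
    have "rkhs_inner S (\<lambda>x. W x - W' x) (\<lambda>x. W x - W' x) = 0"
      unfolding RK.diff_left[OF W(1) W'(1) D] using W(2) W'(2) D by simp
    then have "(\<lambda>x. W x - W' x) = (\<lambda>x. 0)" using rkhs_pos[OF D] by fastforce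
    then show ?thesis by (simp add: fun_eq_iff)
  qed
  show eq: "I_adj S \<rho> V = W" if "W \<in> rkhs S" "\<forall>h\<in>rkhs S. rkhs_inner S W h = L2_inner S \<rho> V h" for W
    unfolding I_adj_def by (rule the_equality) (use that uniq in blast)+
  show "I_adj S \<rho> V \<in> rkhs S" using W0(1) unfolding eq[OF W0] .
  show "h \<in> rkhs S \<Longrightarrow> rkhs_inner S (I_adj S \<rho> V) h = L2_inner S \<rho> V h" using W0(2) unfolding eq[OF W0] by blast
qed

end


section \<open>The two entropy tangents and their dissipations\<close>

context riem
begin

lemma grad_const: "grad S (\<lambda>_. r) = (\<lambda>_. 0)"
proof
  fix p show "grad S (\<lambda>_. r) p = 0"
  proof (cases "p \<in> pts S")
    case True
    note c = chart_at_atlas[OF True] chart_at_dom[OF True]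
    show ?thesis
      by (rule grad_eqI[OF True]) (simp add: metric_grad[OF c has_derivative_const[of r]] metric_zero[OF True])
  qed (simp add: grad_outside)
qed

lemma grad_ln:
  assumes h: "Mk 1 h" and pos: "\<And>p. p \<in> pts S \<Longrightarrow> h p > 0" and p: "p \<in> pts S"
  shows "h p *\<^sub>R grad S (\<lambda>p. ln (h p)) p = grad S h p"
proof -
  note c = chart_at_atlas[OF p] chart_at_dom[OF p]
  have hp: "h (cinv (chart_at S p) (cmap (chart_at S p) p)) > 0" using pos[OF p] by (simp add: cinv_cmap[OF c])
  note d = Mk_chart_derivative[OF h c]
  have "metric S p (grad S h p) v = metric S p (h p *\<^sub>R grad S (\<lambda>p. ln (h p)) p) v" for v
    using pos[OF p] by (simp add: metric_grad[OF c d] metric_grad[OF c has_derivative_ln[OF hp d]] metric_scale[OF p] cinv_cmap[OF c])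
  from grad_eqI[OF p this] show ?thesis by simp
qed

text \<open>The function is locally constant, and the manifold is connected.\<close>

lemma zero_gradient_constant:
  assumes h: "Mk 1 h" and z: "\<And>p. p \<in> pts S \<Longrightarrow> grad S h p = 0" and p0: "p0 \<in> pts S" and q: "q \<in> pts S"
  shows "h q = h p0"
proof -
  have loc: "\<exists>W. openin (mtop S) W \<and> p \<in> W \<and> (\<forall>x\<in>W. h x = h p)" if p: "p \<in> pts S" for p
  proof -
    note c = chart_at_atlas[OF p] chart_at_dom[OF p]
    let ?c = "chart_at S p"
    from open_contains_ball[THEN iffD1, OF open_img[OF c(1)], rule_format, OF imageI[OF c(2)]]
    obtain e where e: "e > 0" "ball (cmap ?c p) e \<subseteq> img ?c" by (elim exE conjE) (rule that)
    have "\<exists>k. \<forall>y\<in>ball (cmap ?c p) e. h (cinv ?c y) = k"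
    proof (rule has_derivative_zero_constant[OF convex_ball])
      fix y assume y: "y \<in> ball (cmap ?c p) e"
      have yi: "y \<in> img ?c" by (rule subsetD[OF e(2) y])
      note c' = c(1) cinv_in[OF yi]
      note d = Mk_chart_derivative[OF h c']
      have "frechet_derivative (\<lambda>y. h (cinv ?c y)) (at (cmap ?c (cinv ?c y))) v = 0" for v
        using metric_grad[OF c' d, of "frame S ?c (cinv ?c y) v"] z[OF in_pts[OF c']] metric_zero[OF in_pts[OF c']]
        by (simp add: comps_frame[OF c'])
      then have "frechet_derivative (\<lambda>y. h (cinv ?c y)) (at (cmap ?c (cinv ?c y))) = (\<lambda>_. 0)" by (simp add: fun_eq_iff)
      with d have "((\<lambda>y. h (cinv ?c y)) has_derivative (\<lambda>_. 0)) (at y)" by (simp add: cmap_cinv[OF yi])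
      then show "((\<lambda>y. h (cinv ?c y)) has_derivative (\<lambda>_. 0)) (at y within ball (cmap ?c p) e)" by (rule has_derivative_at_withinI)
    qed
    then obtain k where k: "\<forall>y\<in>ball (cmap ?c p) e. h (cinv ?c y) = k" by (elim exE) (rule that)
    let ?W = "{x \<in> cdom ?c. cmap ?c x \<in> ball (cmap ?c p) e}"
    have hk: "h x = k" if "x \<in> ?W" for x using k cinv_cmap[OF c(1), of x] that by force
    have pW: "p \<in> ?W" using c(2) e(1) by simp
    show ?thesis
      by (intro exI[of _ ?W] conjI chart_open_preimage[OF c(1) open_ball] pW ballI) (simp only: hk hk[OF pW])
  qed
  have op: "openin (mtop S) {p \<in> pts S. Q (h p)}" for Q
  proof (subst openin_subopen, rule ballI)
    fix p assume p: "p \<in> {p \<in> pts S. Q (h p)}"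
    then have "p \<in> pts S" by simp
    from loc[OF this] obtain W where W: "openin (mtop S) W" "p \<in> W" "\<forall>x\<in>W. h x = h p" by (elim exE conjE) (rule that)
    have "W \<subseteq> {p \<in> pts S. Q (h p)}"
    proof
      fix x assume x: "x \<in> W"
      have "x \<in> pts S" by (rule subsetD[OF openin_subset[OF W(1)] x])
      then show "x \<in> {p \<in> pts S. Q (h p)}" using W(3) x p by simp
    qed
    then show "\<exists>T. openin (mtop S) T \<and> p \<in> T \<and> T \<subseteq> {p \<in> pts S. Q (h p)}" using W(1,2) by (intro exI[of _ W] conjI)
  qed
  show ?thesis
  proof (rule ccontr)
    assume n: "h q \<noteq> h p0"
    have "\<exists>E1 E2. openin (mtop S) E1 \<and> openin (mtop S) E2 \<and> pts S \<subseteq> E1 \<union> E2 \<and> E1 \<inter> E2 = {} \<and> E1 \<noteq> {} \<and> E2 \<noteq> {}"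
    proof (rule exI[of _ "{p \<in> pts S. h p = h p0}"], rule exI[of _ "{p \<in> pts S. h p \<noteq> h p0}"], intro conjI)
      show "openin (mtop S) {p \<in> pts S. h p = h p0}" by (rule op[of "\<lambda>v. v = h p0"])
      show "openin (mtop S) {p \<in> pts S. h p \<noteq> h p0}" by (rule op[of "\<lambda>v. v \<noteq> h p0"])
      have "p0 \<in> {p \<in> pts S. h p = h p0}" using p0 by simp
      then show "{p \<in> pts S. h p = h p0} \<noteq> {}" by auto
      have "q \<in> {p \<in> pts S. h p \<noteq> h p0}" using q n by simp
      then show "{p \<in> pts S. h p \<noteq> h p0} \<noteq> {}" by auto
    qed auto
    then show False using connected_pts unfolding connected_space_def by (rule notE[rotated])
  qed
qed

end

context riem_density
begin

text \<open>For continuous fields equality almost everywhere is equality.\<close>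

lemma smooth_field_zero:
  assumes V: "Vk k V" and z: "L2_inner S \<rho> V V = 0" and p: "p \<in> pts S" shows "V p = 0"
proof (rule ccontr)
  assume n: "V p \<noteq> 0"
  have "L2_inner S \<rho> V V > 0" unfolding L2_inner_def
  proof (rule integral_pos[OF _ _ p])
    show "Mk k (\<lambda>x. metric S x (V x) (V x) * \<rho> x)" by (intro Mfam_mult Mfam_metric V rho_Mk)
    show "0 \<le> metric S x (V x) (V x) * \<rho> x" if "x \<in> pts S" for x
      using that by (simp add: metric_nonneg rho_pos less_imp_le)
    show "0 < metric S p (V p) (V p) * \<rho> p" by (rule mult_pos_pos[OF metric_pos[OF p n] rho_pos[OF p]])
  qed
  then show False using z by simp
qed

end

locale riem_entropy = riem_density S \<rho> + P: riem_density S \<pi>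
  for S :: "('a, 'n::finite, 'z) riemannian_scheme" and \<rho> \<pi> :: "'a \<Rightarrow> real"
begin

abbreviation "phi \<equiv> log_ratio \<pi> \<rho>"
abbreviation "u \<equiv> entropy_grad S \<pi> \<rho>"

lemma ratio_Mk: "Mk k (\<lambda>p. \<rho> p / \<pi> p)"
  by (rule Mfam_divide[OF rho_Mk P.rho_Mk]) (use P.rho_pos in fastforce)

lemma ratio_pos: "p \<in> pts S \<Longrightarrow> \<rho> p / \<pi> p > 0"
  using rho_pos P.rho_pos by simp

lemma phi_Mk: "Mk k phi"
  unfolding log_ratio_def by (rule Mfam_ln[OF ratio_Mk ratio_pos])

lemma phi_smooth: "smooth_fun S phi"
  unfolding smooth_fun_iff using phi_Mk by blast

lemma u_HW: "u \<in> HW S \<rho>"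
  unfolding entropy_grad_def by (rule grad_HW[OF phi_smooth])

lemma u_L2: "u \<in> L2_fields S \<rho>"
  by (rule HW_L2[OF u_HW])

lemma u_Vk: "Vk k u"
  unfolding entropy_grad_def by (rule Vfam_grad[OF phi_Mk])

text \<open>The Fokker-Planck form of the flux: the Wasserstein entropy tangent is linear in the ratio
  \<open>\<rho>/\<pi>\<close>.\<close>

lemma flux: "p \<in> pts S \<Longrightarrow> \<rho> p *\<^sub>R u p = \<pi> p *\<^sub>R grad S (\<lambda>p. \<rho> p / \<pi> p) p"
  unfolding entropy_grad_def log_ratio_def
  by (subst grad_ln[OF ratio_Mk ratio_pos, symmetric]) (use P.rho_pos in \<open>auto simp: less_imp_neq[symmetric]\<close>)

lemma K_W_Mk: "Mk 0 (K_W S \<rho> phi)"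
proof -
  have "Mk 0 (divergence S (\<lambda>p. \<rho> p *\<^sub>R u p))" by (rule Mfam_divergence[OF Vfam_scaleR[OF rho_Mk u_Vk]])
  from Mfam_diff[OF Mfam_const[of 0 UNIV 0] this] show ?thesis by (simp add: K_W_def entropy_grad_def)
qed

lemma K_W_weak: "Mk 1 f \<Longrightarrow> (\<integral>p. f p * K_W S \<rho> phi p \<partial>vol S) = L2_inner S \<rho> u (grad S f)"
  using weighted_divergence[OF u_Vk, of f] by (simp add: K_W_def entropy_grad_def)

text \<open>If \<open>u\<close> vanishes, \<open>\<rho>/\<pi>\<close> is constant, and both densities have
  integral \<open>1\<close>.\<close>

lemma steady_state:
  assumes "L2_inner S \<rho> u u = 0" shows "\<rho> = \<pi>"
proof -
  have u0: "u p = 0" if "p \<in> pts S" for p by (rule smooth_field_zero[OF u_Vk[of 0] assms that])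
  obtain p0 where p0: "p0 \<in> pts S" using pts_ne by blast
  have c: "\<rho> p = exp (phi p0) * \<pi> p" if p: "p \<in> pts S" for p
  proof -
    have "phi p = phi p0"
      by (rule zero_gradient_constant[OF phi_Mk _ p0 p]) (use u0 in \<open>simp add: entropy_grad_def\<close>)
    then have "\<rho> p / \<pi> p = exp (phi p0)" using exp_ln[OF ratio_pos[OF p]] unfolding log_ratio_def by simp
    then show ?thesis using P.rho_pos[OF p] by (simp add: field_simps)
  qed
  have "(\<integral>x. \<rho> x \<partial>vol S) = (\<integral>x. exp (phi p0) * \<pi> x \<partial>vol S)"
    by (rule Bochner_Integration.integral_cong[OF refl]) (simp add: c space_vol)
  then have "exp (phi p0) = 1" using rho_integral P.rho_integral by simp
  with c have "\<rho> p = \<pi> p" for p using rho_outside[of p] P.rho_outside[of p] by (cases "p \<in> pts S") simp_all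
  then show ?thesis by blast
qed

lemma abs_ln_le: "z > 0 \<Longrightarrow> \<bar>ln z\<bar> \<le> z + 1 / z" for z :: real
proof -
  assume z: "z > 0"
  have "ln z \<le> z - 1" by (rule ln_le_minus_one[OF z])
  moreover have "- ln z \<le> 1 / z - 1" using ln_le_minus_one[of "1/z"] z by (simp add: ln_div)
  moreover have "1 / z > 0" using z by simp
  ultimately show ?thesis using z by linarith
qed

text \<open>The derivative of \<open>x ln (x/\<pi>)\<close> is \<open>ln (x/\<pi>) + 1\<close>.  Near
  \<open>t = 0\<close> the perturbed density stays between \<open>\<rho>/2\<close> and \<open>2
  \<rho>\<close>, which provides the dominating constant.\<close>

lemma Ent_rate_eq:
  assumes \<sigma>: "Mk 0 \<sigma>"
  shows "Ent_rate S \<pi> \<rho> \<sigma> = (\<integral>x. \<sigma> x * (phi x + 1) \<partial>vol S)"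
proof -
  obtain A where A: "\<forall>p\<in>pts S. \<bar>\<sigma> p\<bar> \<le> A" using Mk_bounded[OF \<sigma>] by blast
  have "Mk 0 (\<lambda>p. 1 / \<rho> p)" by (rule Mfam_divide[OF Mfam_const rho_Mk]) (use rho_pos in fastforce)
  from Mk_bounded[OF this] obtain B where B: "\<forall>p\<in>pts S. \<bar>1 / \<rho> p\<bar> \<le> B" by blast
  obtain C where C: "\<forall>p\<in>pts S. \<bar>\<rho> p / \<pi> p\<bar> \<le> C" using Mk_bounded[OF ratio_Mk] by blast
  have "Mk 0 (\<lambda>p. \<pi> p / \<rho> p)" by (rule Mfam_divide[OF P.rho_Mk rho_Mk]) (use rho_pos in fastforce)
  from Mk_bounded[OF this] obtain D where D: "\<forall>p\<in>pts S. \<bar>\<pi> p / \<rho> p\<bar> \<le> D" by blast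
  \<comment> \<open>As \<open>\<bar>\<sigma>\<bar> \<le> A\<close> and \<open>1/\<rho> \<le> B\<close>, times below \<open>d\<close> change \<open>\<rho>\<close> by at most half of itself.\<close>
  define d where "d = 1 / (2 * (\<bar>A\<bar> + 1) * (\<bar>B\<bar> + 1))"
  have d: "d > 0" unfolding d_def by (intro divide_pos_pos mult_pos_pos) simp_all
  have half: "\<bar>t * \<sigma> p\<bar> \<le> \<rho> p / 2" if t: "\<bar>t\<bar> < d" and p: "p \<in> pts S" for t p
  proof -
    have "\<bar>t * \<sigma> p\<bar> \<le> d * (\<bar>A\<bar> + 1)" unfolding abs_mult
      using t A[rule_format, OF p] by (intro mult_mono) simp_all
    also have "\<dots> = 1 / (2 * (\<bar>B\<bar> + 1))"
    proof -
      have c: "1 / (2 * x * y) * x = 1 / (2 * y)" if "x \<noteq> 0" for x y :: real using that by simp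
      have "\<bar>A\<bar> + 1 \<noteq> 0" using abs_ge_zero[of A] by linarith
      then show ?thesis unfolding d_def by (rule c)
    qed
    also have "\<dots> \<le> \<rho> p / 2"
    proof -
      have h: "1 / (2 * K) \<le> x / 2" if "1 / x \<le> K" "x > 0" for K x :: real
      proof -
        have x: "1 / x > 0" using that(2) by simp
        have K: "K > 0" by (rule less_le_trans[OF x that(1)])
        have "1 / K \<le> 1 / (1 / x)" by (rule divide_left_mono[OF that(1)]) (use x K that(2) in simp_all)
        then have "1 / K \<le> x" by simp
        then show ?thesis by simp
      qed
      have "1 / \<rho> p \<le> \<bar>B\<bar> + 1" using B[rule_format, OF p] abs_ge_self[of "1 / \<rho> p"] abs_ge_self[of B] by linarith
      from h[OF this rho_pos[OF p]] show ?thesis .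
    qed
    finally show ?thesis .
  qed
  let ?r = "\<lambda>t x. \<rho> x + t * \<sigma> x"
  have rpos: "?r t p > 0" "?r t p \<ge> \<rho> p / 2" "?r t p \<le> 2 * \<rho> p" if "\<bar>t\<bar> < d" "p \<in> pts S" for t p
    using half[OF that] rho_pos[OF that(2)] by (auto simp: abs_le_iff)
  let ?g = "\<lambda>x::'a. \<bar>A\<bar> * (2 * \<bar>C\<bar> + 2 * \<bar>D\<bar> + 1)"
  have "((\<lambda>t. \<integral>x. ?r t x * ln (?r t x / \<pi> x) \<partial>vol S) has_real_derivative (\<integral>x. \<sigma> x * (ln (?r 0 x / \<pi> x) + 1) \<partial>vol S)) (at 0 within UNIV)"
  proof (rule has_real_derivative_integral[where d = d and g = ?g])
    show "is_interval (UNIV :: real set)" by simp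
    show "integrable (vol S) ?g" by (rule finite_measure.integrable_const[OF finite_measure_vol])
    fix t :: real assume "\<bar>t - 0\<bar> < d"
    then have t: "\<bar>t\<bar> < d" by simp
    have rM: "Mk 0 (?r t)" by (intro Mfam_add Mfam_mult rho_Mk \<sigma> Mfam_const)
    have rq: "Mk 0 (\<lambda>x. ?r t x / \<pi> x)" by (rule Mfam_divide[OF rM P.rho_Mk]) (use P.rho_pos in fastforce)
    have "Mk 0 (\<lambda>x. ln (?r t x / \<pi> x))" by (rule Mfam_ln[OF rq]) (use rpos(1)[OF t] P.rho_pos in simp)
    from integrable_Mk[OF Mfam_mult[OF rM this]]
    show "integrable (vol S) (\<lambda>x. ?r t x * ln (?r t x / \<pi> x))" .
    fix x assume "x \<in> space (vol S)"
    then have x: "x \<in> pts S" by (simp add: space_vol)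
    note rp = rpos[OF t x] and pp = P.rho_pos[OF x]
    have q: "?r t x / \<pi> x > 0" using rp pp by simp
    show "((\<lambda>t. ?r t x * ln (?r t x / \<pi> x)) has_real_derivative \<sigma> x * (ln (?r t x / \<pi> x) + 1)) (at t within UNIV)"
    proof -
      have d1: "((\<lambda>t. ?r t x) has_real_derivative \<sigma> x) (at t within UNIV)" by (auto intro!: derivative_eq_intros)
      from DERIV_mult[OF d1 DERIV_chain2[OF DERIV_ln[OF q] DERIV_cdivide[OF d1]]]
      have "((\<lambda>t. ?r t x * ln (?r t x / \<pi> x)) has_real_derivative
        \<sigma> x * ln (?r t x / \<pi> x) + inverse (?r t x / \<pi> x) * (\<sigma> x / \<pi> x) * ?r t x) (at t within UNIV)" .
      moreover have "inverse (R / P) * (s / P) * R = s" if "R > 0" "P > 0" for R P s :: real using that by simp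
      from this[OF rp(1) pp] have "\<sigma> x * ln (?r t x / \<pi> x) + inverse (?r t x / \<pi> x) * (\<sigma> x / \<pi> x) * ?r t x
        = \<sigma> x * (ln (?r t x / \<pi> x) + 1)" unfolding distrib_left by simp
      ultimately show ?thesis by simp
    qed
    have "\<bar>ln (?r t x / \<pi> x)\<bar> \<le> ?r t x / \<pi> x + 1 / (?r t x / \<pi> x)" by (rule abs_ln_le[OF q])
    moreover have "?r t x / \<pi> x \<le> 2 * \<rho> x / \<pi> x" by (rule divide_right_mono[OF rp(3)]) (use pp in simp)
    moreover have "1 / (?r t x / \<pi> x) \<le> 2 * (\<pi> x / \<rho> x)"
    proof -
      have "\<pi> x / ?r t x \<le> \<pi> x / (\<rho> x / 2)" by (rule divide_left_mono[OF rp(2)]) (use pp rp(1) rho_pos[OF x] in simp_all)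
      then show ?thesis by (simp add: mult.commute)
    qed
    moreover have "\<rho> x / \<pi> x \<le> C" by (rule order_trans[OF abs_ge_self C[rule_format, OF x]])
    moreover have "\<pi> x / \<rho> x \<le> D" by (rule order_trans[OF abs_ge_self D[rule_format, OF x]])
    moreover have "2 * \<rho> x / \<pi> x = 2 * (\<rho> x / \<pi> x)" by simp
    moreover have "C \<le> \<bar>C\<bar>" "D \<le> \<bar>D\<bar>" by simp_all
    ultimately have l: "\<bar>ln (?r t x / \<pi> x)\<bar> \<le> 2 * \<bar>C\<bar> + 2 * \<bar>D\<bar>" by linarith
    have "\<bar>\<sigma> x\<bar> * \<bar>ln (?r t x / \<pi> x) + 1\<bar> \<le> \<bar>A\<bar> * (2 * \<bar>C\<bar> + 2 * \<bar>D\<bar> + 1)"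
      using l A[rule_format, OF x] by (intro mult_mono) simp_all
    then show "\<bar>\<sigma> x * (ln (?r t x / \<pi> x) + 1)\<bar> \<le> ?g x" by (simp add: abs_mult)
  qed (use d in simp_all)
  then have "((\<lambda>t. Ent S \<pi> (?r t)) has_real_derivative (\<integral>x. \<sigma> x * (phi x + 1) \<partial>vol S)) (at 0)"
    unfolding Ent_def log_ratio_def by simp
  then show ?thesis unfolding Ent_rate_def by (rule DERIV_imp_deriv)
qed

lemma grad_phi_plus_1: "grad S (\<lambda>p. phi p + 1) = u"
  unfolding grad_add[OF phi_Mk Mfam_const] grad_const entropy_grad_def by simp

lemma K_W_entropy: "(\<integral>x. - K_W S \<rho> phi x * (phi x + 1) \<partial>vol S) = - L2_inner S \<rho> u u"
  using K_W_weak[OF Mfam_add[OF phi_Mk Mfam_const[of 1 UNIV 1]]] unfolding grad_phi_plus_1 by (simp add: mult.commute)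

lemma dissipation_W_eq: "dissipation_W S \<pi> \<rho> = - L2_inner S \<rho> u u"
proof -
  have "Mk 0 (\<lambda>x. - K_W S \<rho> phi x)" using Mfam_diff[OF Mfam_const[of 0 UNIV 0] K_W_Mk] by simp
  from Ent_rate_eq[OF this] show ?thesis unfolding dissipation_W_def K_W_entropy .
qed

end

locale stein_entropy = stein_density S \<rho> + riem_entropy S \<rho> \<pi>
  for S :: "('a, 'n::finite, 'z) stein_scheme" and \<rho> \<pi> :: "'a \<Rightarrow> real"
begin

abbreviation "b \<equiv> I_adj S \<rho> u"

lemma b_rkhs: "b \<in> rkhs S" by (rule I_adj_mem[OF u_L2])

lemma b_L2: "b \<in> L2_fields S \<rho>" by (rule rkhs_L2[OF b_rkhs])

lemma b_Vk: "Vk 1 b" by (rule rkhs_Vk[OF b_rkhs])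

lemma K_S_Mk: "Mk 0 (K_S S \<rho> phi)"
proof -
  have b1: "Vfam (Suc 0) UNIV (\<lambda>_. b)" using b_Vk by simp
  have "Mk 0 (divergence S (\<lambda>p. \<rho> p *\<^sub>R b p))" by (rule Mfam_divergence[OF Vfam_scaleR[OF rho_Mk b1]])
  from Mfam_diff[OF Mfam_const[of 0 UNIV 0] this] show ?thesis by (simp add: K_S_def entropy_grad_def)
qed

lemma K_S_weak: "Mk 1 f \<Longrightarrow> (\<integral>p. f p * K_S S \<rho> phi p \<partial>vol S) = L2_inner S \<rho> b (grad S f)"
  using weighted_divergence[OF b_Vk, of f] by (simp add: K_S_def entropy_grad_def)

text \<open>Both tangents are continuous functions, hence determined by their integrals against smooth
  functions.  These are the inner products of \<open>u\<close> and \<open>b\<close> with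
  gradients, and only the horizontal part of \<open>b\<close> is seen by them.\<close>

theorem tangents_proportional_iff:
  "(\<forall>x\<in>pts S. K_S S \<rho> phi x = r * K_W S \<rho> phi x) \<longleftrightarrow> (AE x in vol S. M_op S \<rho> u x = r *\<^sub>R u x)"
proof -
  let ?h = "\<lambda>x. r * K_W S \<rho> phi x - K_S S \<rho> phi x"
  have hM: "Mk 0 ?h" by (intro Mfam_diff Mfam_mult Mfam_const K_W_Mk K_S_Mk)
  have ru: "(\<lambda>x. r *\<^sub>R u x) \<in> HW S \<rho>" by (rule HW_scale[OF u_HW])
  have w: "(\<integral>x. f x * ?h x \<partial>vol S) = L2_inner S \<rho> (\<lambda>x. r *\<^sub>R u x - b x) (grad S f)" if f: "smooth_fun S f" for f
  proof -
    have fM: "Mk k f" for k using f by (simp add: smooth_fun_iff)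
    have "(\<integral>x. f x * ?h x \<partial>vol S) = (\<integral>x. r * (f x * K_W S \<rho> phi x) - f x * K_S S \<rho> phi x \<partial>vol S)"
      by (rule Bochner_Integration.integral_cong[OF refl]) (simp add: algebra_simps)
    also have "\<dots> = r * (\<integral>x. f x * K_W S \<rho> phi x \<partial>vol S) - (\<integral>x. f x * K_S S \<rho> phi x \<partial>vol S)"
      by (subst Bochner_Integration.integral_diff)
        (auto intro!: integrable_mult_right integrable_Mk Mfam_mult fM K_W_Mk K_S_Mk)
    also have "\<dots> = L2_inner S \<rho> (\<lambda>x. r *\<^sub>R u x - b x) (grad S f)"
      unfolding K_W_weak[OF fM] K_S_weak[OF fM] L2.diff_left[OF HW_L2[OF ru] b_L2 grad_smooth_L2[OF f]]
        L2.scale_left[OF u_L2 grad_smooth_L2[OF f]] ..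
    finally show ?thesis .
  qed
  have "(\<forall>x\<in>pts S. K_S S \<rho> phi x = r * K_W S \<rho> phi x) \<longleftrightarrow> (\<forall>f. smooth_fun S f \<longrightarrow> L2_inner S \<rho> (\<lambda>x. r *\<^sub>R u x - b x) (grad S f) = 0)"
  proof (intro iffI allI impI ballI)
    fix f assume e: "\<forall>x\<in>pts S. K_S S \<rho> phi x = r * K_W S \<rho> phi x" and f: "smooth_fun S f"
    have "(\<integral>x. f x * ?h x \<partial>vol S) = (\<integral>x. 0 \<partial>vol S)"
      by (rule Bochner_Integration.integral_cong[OF refl]) (simp add: e space_vol)
    then show "L2_inner S \<rho> (\<lambda>x. r *\<^sub>R u x - b x) (grad S f) = 0" using w[OF f] by simp
  next
    fix x assume z: "\<forall>f. smooth_fun S f \<longrightarrow> L2_inner S \<rho> (\<lambda>x. r *\<^sub>R u x - b x) (grad S f) = 0" and x: "x \<in> pts S"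
    have "?h x = 0" by (rule fundamental_lemma[OF hM _ x]) (simp only: w z)
    then show "K_S S \<rho> phi x = r * K_W S \<rho> phi x" by simp
  qed
  then show ?thesis unfolding M_op_def P_hor_eq_iff[OF b_L2 ru] .
qed

text \<open>As \<open>u\<close> is horizontal, projecting \<open>b\<close> does not change its inner product
  with \<open>u\<close>.\<close>

lemma M_op_inner: "L2_inner S \<rho> u (M_op S \<rho> u) = L2_inner S \<rho> u b"
  unfolding M_op_def using P_hor(2)[OF b_L2 u_HW] L2.sym[OF u_L2 b_L2] L2.sym[OF u_L2 HW_L2[OF P_hor(1)[OF b_L2]]] by simp

lemma b_norm: "rkhs_inner S b b = L2_inner S \<rho> u b"
  by (rule I_adj_inner[OF u_L2 b_rkhs])

lemma K_S_entropy: "(\<integral>x. - K_S S \<rho> phi x * (phi x + 1) \<partial>vol S) = - L2_inner S \<rho> u b"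
  using K_S_weak[OF Mfam_add[OF phi_Mk Mfam_const[of 1 UNIV 1]]] L2.sym[OF u_L2 b_L2]
  unfolding grad_phi_plus_1 by (simp add: mult.commute)

lemma dissipation_S_eq: "dissipation_S S \<pi> \<rho> = - L2_inner S \<rho> u b"
proof -
  have "Mk 0 (\<lambda>x. - K_S S \<rho> phi x)" using Mfam_diff[OF Mfam_const[of 0 UNIV 0] K_S_Mk] by simp
  from Ent_rate_eq[OF this] show ?thesis unfolding dissipation_S_def K_S_entropy .
qed

text \<open>The factor of proportionality is thereby a quotient of norms, which depends continuously on the
  density.\<close>

lemma M_op_proportional_norm:
  assumes "AE x in vol S. M_op S \<rho> u x = r *\<^sub>R u x" shows "rkhs_inner S b b = r * L2_inner S \<rho> u u"
proof -
  have "L2_inner S \<rho> (M_op S \<rho> u) u = L2_inner S \<rho> (\<lambda>x. r *\<^sub>R u x) u"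
    by (rule L2_inner_AE_cong[OF _ _ _ assms])
      (simp_all add: L2_meas u_L2 L2_scale_mem HW_L2 P_hor(1)[OF b_L2] M_op_def)
  then show ?thesis unfolding b_norm M_op_inner[symmetric]
    using L2.sym[OF u_L2, of "M_op S \<rho> u"] L2.scale_left[OF u_L2 u_L2, of r] HW_L2[OF P_hor(1)[OF b_L2]] by (simp add: M_op_def)
qed

end


context riem
begin

section \<open>Curves of densities\<close>

lemma integral_continuous:
  assumes F: "Mfam 0 J F" shows "continuous_on J (\<lambda>t. \<integral>x. F t x \<partial>vol S)"
  unfolding continuous_on_sequentially comp_def
proof (intro allI ballI impI)
  fix X :: "nat \<Rightarrow> real" and t assume t: "t \<in> J" and X: "(\<forall>n. X n \<in> J) \<and> X \<longlonglongrightarrow> t"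
  have K: "compact (insert t (range X))" using X by (intro compact_sequence_with_limit) simp
  have KJ: "insert t (range X) \<subseteq> J" using X t by auto
  from Mfam_bounded[OF F K KJ] obtain C where C: "\<forall>s\<in>insert t (range X). \<forall>p\<in>pts S. \<bar>F s p\<bar> \<le> C" by (elim exE) (rule that)
  show "(\<lambda>n. \<integral>x. F (X n) x \<partial>vol S) \<longlonglongrightarrow> (\<integral>x. F t x \<partial>vol S)"
  proof (rule integral_dominated_convergence[where w = "\<lambda>_. C"])
    show "F t \<in> borel_measurable (vol S)" by (rule measurable_Mk[OF Mfam_at[OF F t]])
    show "F (X n) \<in> borel_measurable (vol S)" for n using X by (intro measurable_Mk[OF Mfam_at[OF F]]) simp
    show "integrable (vol S) (\<lambda>_. C)" by (rule finite_measure.integrable_const[OF finite_measure_vol])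
    show "AE x in vol S. norm (F (X n) x) \<le> C" for n by (rule AE_I2) (use C in \<open>simp add: space_vol\<close>)
    show "AE x in vol S. (\<lambda>n. F (X n) x) \<longlonglongrightarrow> F t x"
    proof (rule AE_I2)
      fix p assume "p \<in> space (vol S)"
      then have p: "p \<in> pts S" by (simp add: space_vol)
      note c = chart_at_atlas[OF p] chart_at_dom[OF p]
      have "Cfam 0 J (img (chart_at S p)) (\<lambda>t y. F t (cinv (chart_at S p) y))"
        using F c(1) unfolding Mfam_def by simp
      from continuous_on_compose2[OF Cfam_continuous[OF this], of J "\<lambda>t. (t, cmap (chart_at S p) p)"] c(2)
      have "continuous_on J (\<lambda>t. F t p)" by (simp add: cinv_cmap[OF c] continuous_on_Pair image_subset_iff)
      then show "(\<lambda>n. F (X n) p) \<longlonglongrightarrow> F t p" using X t unfolding continuous_on_sequentially comp_def by simp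
    qed
  qed
qed

text \<open>At an end point of the interval the compact neighbourhood is one-sided.\<close>

lemma interval_compact_neighbourhood:
  fixes J :: "real set"
  assumes J: "is_interval J" "t0 \<in> J"
  shows "\<exists>K d. d > 0 \<and> compact K \<and> K \<subseteq> J \<and> (\<forall>t\<in>J. \<bar>t - t0\<bar> < d \<longrightarrow> t \<in> K)"
proof -
  obtain a e where a: "a \<in> J" "a \<le> t0" "e > 0" "\<forall>t\<in>J. t > t0 - e \<longrightarrow> t \<ge> a"
  proof (cases "\<exists>x\<in>J. x < t0")
    case True
    then obtain x where "x \<in> J" "x < t0" by blast
    then show ?thesis by (intro that[of x "t0 - x"]) auto
  next
    case False
    then show ?thesis using J(2) by (intro that[of t0 1]) (auto simp: not_less)
  qed
  obtain b f where b: "b \<in> J" "t0 \<le> b" "f > 0" "\<forall>t\<in>J. t < t0 + f \<longrightarrow> t \<le> b"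
  proof (cases "\<exists>x\<in>J. x > t0")
    case True
    then obtain x where "x \<in> J" "x > t0" by blast
    then show ?thesis by (intro that[of x "x - t0"]) auto
  next
    case False
    then show ?thesis using J(2) by (intro that[of t0 1]) (auto simp: not_less)
  qed
  have "{a..b} \<subseteq> J" using mem_is_interval_1_I[OF J(1) a(1) b(1)] by auto
  moreover have "t \<in> {a..b}" if "t \<in> J" "\<bar>t - t0\<bar> < min e f" for t
    using a(4) b(4) that by (auto simp: abs_less_iff)
  ultimately show ?thesis using a(3) b(3) by (intro exI[of _ "{a..b}"] exI[of _ "min e f"]) auto
qed

lemma integral_has_derivative:
  assumes J: "is_interval J" "t0 \<in> J" and f: "Mfam 0 J f"
    and der: "\<And>t x. t \<in> J \<Longrightarrow> x \<in> pts S \<Longrightarrow> ((\<lambda>s. f s x) has_real_derivative f' t x) (at t within J)"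
    and bd: "\<And>K. compact K \<Longrightarrow> K \<subseteq> J \<Longrightarrow> \<exists>C. \<forall>t\<in>K. \<forall>p\<in>pts S. \<bar>f' t p\<bar> \<le> C"
  shows "((\<lambda>t. \<integral>x. f t x \<partial>vol S) has_real_derivative (\<integral>x. f' t0 x \<partial>vol S)) (at t0 within J)"
proof -
  from interval_compact_neighbourhood[OF J] obtain K d where K: "d > 0" "compact K" "K \<subseteq> J" "\<forall>t\<in>J. \<bar>t - t0\<bar> < d \<longrightarrow> t \<in> K"
    by (elim exE conjE) (rule that)
  from bd[OF K(2,3)] obtain C where C: "\<forall>t\<in>K. \<forall>p\<in>pts S. \<bar>f' t p\<bar> \<le> C" by (elim exE) (rule that)
  show ?thesis
  proof (rule has_real_derivative_integral[OF J K(1), where g = "\<lambda>_. C"])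
    show "integrable (vol S) (\<lambda>_. C)" by (rule finite_measure.integrable_const[OF finite_measure_vol])
  qed (use K(4) C der integrable_Mk[OF Mfam_at[OF f]] in \<open>simp_all add: space_vol\<close>)
qed

lemma metric_abs_le:
  assumes x: "x \<in> pts S" shows "\<bar>metric S x v w\<bar> \<le> metric S x v v + metric S x w w"
proof -
  have "0 \<le> metric S x (v + w) (v + w)" "0 \<le> metric S x (v - w) (v - w)" by (rule metric_nonneg[OF x])+
  then have "0 \<le> metric S x v v + 2 * metric S x v w + metric S x w w" "0 \<le> metric S x v v - 2 * metric S x v w + metric S x w w"
    using metric_sym[OF x, of v w] by (simp_all add: metric_add[OF x] metric_diff[OF x])
  moreover have "metric S x v v \<ge> 0" "metric S x w w \<ge> 0" by (rule metric_nonneg[OF x])+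
  ultimately show ?thesis by linarith
qed

lemma curve_Mfam: assumes "law_curve S J r" shows "Mfam k J r"
  unfolding Mfam_def
proof
  fix c assume c: "c \<in> atlas S"
  have "Cfam k J (img c) (\<lambda>t. r t \<circ> cinv c)"
  proof (rule Cfam_of_iter_deriv)
    show "smooth_on (img c) (r t \<circ> cinv c)" if "t \<in> J" for t
      using assms that c unfolding law_curve_def densities_def smooth_fun_def by simp
    show "continuous_on (J \<times> img c) (\<lambda>(t, y). iter_deriv vs (r t \<circ> cinv c) y)" for vs
      using assms c unfolding law_curve_def by simp
  qed
  then show "Cfam k J (img c) (\<lambda>t y. r t (cinv c y))" by (simp add: comp_def)
qed

lemma curve_density: "law_curve S J r \<Longrightarrow> t \<in> J \<Longrightarrow> r t \<in> densities S"
  and curve_interval: "law_curve S J r \<Longrightarrow> is_interval J"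
  unfolding law_curve_def by simp_all

lemma law_curve_subset:
  assumes "law_curve S J r" "J' \<subseteq> J" "is_interval J'" "interior J' \<noteq> {}" shows "law_curve S J' r"
  unfolding law_curve_def
proof (intro conjI ballI allI assms(3,4))
  show "r t \<in> densities S" if "t \<in> J'" for t using curve_density[OF assms(1)] assms(2) that by blast
  fix c vs assume "c \<in> atlas S"
  then have "continuous_on (J \<times> img c) (\<lambda>(t, y). iter_deriv vs (r t \<circ> cinv c) y)"
    using assms(1) unfolding law_curve_def by simp
  then show "continuous_on (J' \<times> img c) (\<lambda>(t, y). iter_deriv vs (r t \<circ> cinv c) y)"
    by (rule continuous_on_subset) (rule Sigma_mono[OF assms(2) order_refl])
qed

lemma law_curve_compose:
  assumes r: "law_curve S J r" and J': "is_interval J'" "interior J' \<noteq> {}"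
    and \<tau>: "continuous_on J' \<tau>" "\<And>s. s \<in> J' \<Longrightarrow> \<tau> s \<in> J"
  shows "law_curve S J' (r \<circ> \<tau>)"
  unfolding law_curve_def
proof (intro conjI ballI allI J')
  show "(r \<circ> \<tau>) s \<in> densities S" if "s \<in> J'" for s using curve_density[OF r \<tau>(2)[OF that]] by simp
  fix d vs assume d: "d \<in> atlas S"
  have c1: "continuous_on (J \<times> img d) (\<lambda>(t, y). iter_deriv vs (r t \<circ> cinv d) y)"
    using r d unfolding law_curve_def by simp
  have c2: "continuous_on (J' \<times> img d) (\<lambda>z. (\<tau> (fst z), snd z))"
    by (intro continuous_on_Pair continuous_on_compose2[OF \<tau>(1)] continuous_intros) auto
  have "continuous_on (J' \<times> img d) (\<lambda>z. case (\<tau> (fst z), snd z) of (t, y) \<Rightarrow> iter_deriv vs (r t \<circ> cinv d) y)"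
  proof (rule continuous_on_compose2[OF c1 c2], rule image_subsetI)
    fix z assume "z \<in> J' \<times> img d"
    then have "fst z \<in> J'" "snd z \<in> img d" by (simp_all only: mem_Times_iff)
    then show "(\<tau> (fst z), snd z) \<in> J \<times> img d" using \<tau>(2) by (intro SigmaI)
  qed
  then show "continuous_on (J' \<times> img d) (\<lambda>(s, y). iter_deriv vs ((r \<circ> \<tau>) s \<circ> cinv d) y)"
    by (simp add: case_prod_unfold)
qed

text \<open>The velocity is divided by the speed \<open>c\<close>, by the chain rule.  The old time in terms
  of the new one is \<open>\<tau>\<close>; its inverse \<open>\<sigma>\<close> has derivative
  \<open>c\<close>.\<close>

lemma reparametrised_curve:
  fixes w :: "real \<Rightarrow> 'a \<Rightarrow> real"
  assumes r: "law_curve S J r" and c: "continuous_on J c" "\<And>t. t \<in> J \<Longrightarrow> c t > (0::real)"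
    and der: "\<And>t x. t \<in> J \<Longrightarrow> x \<in> pts S \<Longrightarrow> ((\<lambda>s. r s x) has_real_derivative c t * w t x) (at t within J)"
  obtains J' \<tau> \<sigma> where "time_change \<tau> J' J" "law_curve S J' (r \<circ> \<tau>)"
    "\<And>s x. s \<in> J' \<Longrightarrow> x \<in> pts S \<Longrightarrow> ((\<lambda>s. (r \<circ> \<tau>) s x) has_real_derivative w (\<tau> s) x) (at s within J')"
    "\<sigma> ` J = J'" "\<And>t. t \<in> J \<Longrightarrow> \<tau> (\<sigma> t) = t"
    "\<And>t. t \<in> J \<Longrightarrow> (\<sigma> has_real_derivative c t) (at t within J)" "strict_mono_on J \<sigma>"
proof -
  obtain \<sigma> \<tau> J' where p: "is_interval J'" "bij_betw \<tau> J' J" "continuous_on J' \<tau>" "\<sigma> ` J = J'"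
    "\<And>t. t \<in> J \<Longrightarrow> \<tau> (\<sigma> t) = t" "\<And>s. s \<in> J' \<Longrightarrow> \<sigma> (\<tau> s) = s"
    "\<And>t. t \<in> J \<Longrightarrow> (\<sigma> has_real_derivative c t) (at t within J)"
    "\<And>s. s \<in> J' \<Longrightarrow> (\<tau> has_real_derivative 1 / c (\<tau> s)) (at s within J')"
    "strict_mono_on J \<sigma>"
    by (rule interval_reparametrisation[OF curve_interval[OF r] c], assumption)
      (rule that, assumption, assumption, assumption, assumption, simp_all)
  have im: "\<tau> ` J' = J" using p(2) by (simp add: bij_betw_def)
  have \<tau>J: "\<tau> s \<in> J" if "s \<in> J'" for s using im that by blast
  have tc: "time_change \<tau> J' J" unfolding time_change_def
  proof (intro conjI exI[of _ "\<lambda>s. 1 / c (\<tau> s)"] ballI p(2))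
    show "continuous_on J' (\<lambda>s. 1 / c (\<tau> s))"
    proof (intro continuous_on_divide continuous_on_const continuous_on_compose2[OF c(1) p(3)] ballI)
      show "\<tau> ` J' \<subseteq> J" using im by simp
      show "c (\<tau> s) \<noteq> 0" if "s \<in> J'" for s using c(2)[OF \<tau>J[OF that]] by simp
    qed
    show "1 / c (\<tau> s) > 0" if "s \<in> J'" for s using c(2)[OF \<tau>J[OF that]] by simp
  qed (rule p(8))
  have int: "interior J' \<noteq> {}"
  proof -
    have "interior J \<noteq> {}" using r unfolding law_curve_def by simp
    then obtain t e where te: "e > 0" "ball t e \<subseteq> J" using mem_interior[of _ J] by blast
    have t12: "t \<in> J" "t + e/2 \<in> J" by (rule subsetD[OF te(2)], use te(1) in \<open>simp add: dist_real_def\<close>)+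
    have lt: "\<sigma> t < \<sigma> (t + e/2)" by (rule strict_mono_onD[OF p(9) t12]) (use te in simp)
    have m: "\<sigma> t \<in> J'" "\<sigma> (t + e/2) \<in> J'" using t12 p(4) by (auto intro: imageI)
    have "{\<sigma> t<..<\<sigma> (t + e/2)} \<subseteq> J'"
    proof
      fix x assume "x \<in> {\<sigma> t<..<\<sigma> (t + e/2)}"
      then show "x \<in> J'" using mem_is_interval_1_I[OF p(1) m, of x] by simp
    qed
    from interior_maximal[OF this open_greaterThanLessThan] show ?thesis using dense[OF lt] by auto
  qed
  have lc: "law_curve S J' (r \<circ> \<tau>)" by (rule law_curve_compose[OF r p(1) int p(3) \<tau>J])
  have dd: "((\<lambda>s. (r \<circ> \<tau>) s x) has_real_derivative w (\<tau> s) x) (at s within J')" if s: "s \<in> J'" and x: "x \<in> pts S" for s x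
  proof -
    have "((\<lambda>t. r t x) has_real_derivative c (\<tau> s) * w (\<tau> s) x) (at (\<tau> s) within \<tau> ` J')"
      unfolding im by (rule der[OF \<tau>J[OF s] x])
    from DERIV_image_chain[OF this p(8)[OF s]]
    show ?thesis using c(2)[OF \<tau>J[OF s]] by (simp add: comp_def)
  qed
  show ?thesis by (rule that[OF tc lc dd p(4,5,7,9)])
qed

end

section \<open>Entropy flows\<close>

locale stein_target = stein_loc S + P: riem_density S \<pi>
  for S :: "('a, 'n::finite, 'z) stein_scheme" and \<pi> :: "'a \<Rightarrow> real"
begin

lemma entropy_at: "\<rho> \<in> densities S \<Longrightarrow> stein_entropy S \<rho> \<pi>"
  by unfold_locales

abbreviation "uu \<rho> \<equiv> entropy_grad S \<pi> \<rho>"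
abbreviation "bb \<rho> \<equiv> I_adj S \<rho> (uu \<rho>)"
abbreviation "KW \<rho> \<equiv> K_W S \<rho> (log_ratio \<pi> \<rho>)"
abbreviation "KS \<rho> \<equiv> K_S S \<rho> (log_ratio \<pi> \<rho>)"

lemma pi_neq: "p \<in> pts S \<Longrightarrow> \<pi> p \<noteq> 0"
  using P.rho_pos[of p] by simp

lemma curve_ratio: "law_curve S J r \<Longrightarrow> Mfam k J (\<lambda>t p. r t p / \<pi> p)"
  by (rule Mfam_divide[OF curve_Mfam Mfam_of_Mk[OF P.rho_Mk] pi_neq])

lemma curve_pos: "law_curve S J r \<Longrightarrow> t \<in> J \<Longrightarrow> p \<in> pts S \<Longrightarrow> r t p > 0"
  using curve_density[of J r t] unfolding densities_def by simp

lemma curve_phi: "law_curve S J r \<Longrightarrow> Mfam k J (\<lambda>t. log_ratio \<pi> (r t))"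
  unfolding log_ratio_def by (rule Mfam_ln[OF curve_ratio]) (simp_all add: curve_pos P.rho_pos)

lemma curve_u: "law_curve S J r \<Longrightarrow> Vfam k J (\<lambda>t. uu (r t))"
  unfolding entropy_grad_def by (rule Vfam_grad[OF curve_phi])

lemma curve_KW: assumes "law_curve S J r" shows "Mfam 0 J (\<lambda>t. KW (r t))"
proof -
  have "Mfam 0 J (\<lambda>t. divergence S (\<lambda>p. r t p *\<^sub>R uu (r t) p))"
    by (rule Mfam_divergence[OF Vfam_scaleR[OF curve_Mfam[OF assms] curve_u[OF assms]]])
  from Mfam_diff[OF Mfam_const[of 0 J 0] this] show ?thesis by (simp add: K_W_def entropy_grad_def)
qed

text \<open>The field \<open>b\<close> represents the functional \<open>h \<mapsto> \<integral>
  \<langle>\<rho> u, h\<rangle>\<close> on a fixed Hilbert space, whose elements are bounded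
  uniformly by their norms.  So \<open>b\<close> depends on \<open>\<rho> u\<close> in a Lipschitz
  way, although the space \<open>L\<^sup>2(\<rho>)\<close> in which the adjoint is formed varies
  with \<open>\<rho>\<close>.\<close>

lemma adjoint_Lipschitz:
  "\<exists>K\<ge>0. \<forall>\<rho>\<in>densities S. \<forall>\<rho>'\<in>densities S.
     rkhs_inner S (\<lambda>x. bb \<rho> x - bb \<rho>' x) (\<lambda>x. bb \<rho> x - bb \<rho>' x) \<le>
     K * (\<integral>x. metric S x (\<rho> x *\<^sub>R uu \<rho> x - \<rho>' x *\<^sub>R uu \<rho>' x) (\<rho> x *\<^sub>R uu \<rho> x - \<rho>' x *\<^sub>R uu \<rho>' x) \<partial>vol S)"
proof -
  obtain C where C: "C \<ge> 0" "\<forall>V\<in>rkhs S. \<forall>p\<in>pts S. metric S p (V p) (V p) \<le> C * rkhs_inner S V V"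
    using rkhs_metric_bound by (elim exE conjE) (rule that)
  \<comment> \<open>The weight in Young's inequality is such that the norm of the difference can be absorbed on the left; adding \<open>1\<close> keeps it positive.\<close>
  define \<alpha> where "\<alpha> = C * measure (vol S) (space (vol S)) + 1"
  have \<alpha>: "\<alpha> > 0" using C(1) by (simp add: \<alpha>_def add_nonneg_pos)
  have "rkhs_inner S (\<lambda>x. bb \<rho> x - bb \<rho>' x) (\<lambda>x. bb \<rho> x - bb \<rho>' x) \<le>
     \<alpha> * (\<integral>x. metric S x (\<rho> x *\<^sub>R uu \<rho> x - \<rho>' x *\<^sub>R uu \<rho>' x) (\<rho> x *\<^sub>R uu \<rho> x - \<rho>' x *\<^sub>R uu \<rho>' x) \<partial>vol S)"
    if r: "\<rho> \<in> densities S" "\<rho>' \<in> densities S" for \<rho> \<rho>'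
  proof -
    interpret E: stein_entropy S \<rho> \<pi> by (rule entropy_at[OF r(1)])
    interpret E': stein_entropy S \<rho>' \<pi> by (rule entropy_at[OF r(2)])
    let ?h = "\<lambda>x. bb \<rho> x - bb \<rho>' x" and ?X = "\<lambda>x. \<rho> x *\<^sub>R uu \<rho> x - \<rho>' x *\<^sub>R uu \<rho>' x"
    have h: "?h \<in> rkhs S" by (rule RK.diff_mem[OF E.b_rkhs E'.b_rkhs])
    have hV: "Vk 0 ?h" by (rule Vfam_le[OF rkhs_Vk[OF h]]) simp
    have XV: "Vk 0 ?X" by (intro Vfam_diff Vfam_scaleR E.rho_Mk E'.rho_Mk E.u_Vk E'.u_Vk)
    have M: "Mk 0 (\<lambda>x. metric S x (?X x) (?h x))" "Mk 0 (\<lambda>x. metric S x (?X x) (?X x))" "Mk 0 (\<lambda>x. metric S x (?h x) (?h x))"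
      by (intro Mfam_metric hV XV)+
    let ?n = "rkhs_inner S ?h ?h"
    have "?n = L2_inner S \<rho> (uu \<rho>) ?h - L2_inner S \<rho>' (uu \<rho>') ?h"
      unfolding RK.diff_left[OF E.b_rkhs E'.b_rkhs h] E.I_adj_inner[OF E.u_L2 h] E'.I_adj_inner[OF E'.u_L2 h] ..
    also have "\<dots> = (\<integral>x. metric S x (uu \<rho> x) (?h x) * \<rho> x - metric S x (uu \<rho>' x) (?h x) * \<rho>' x \<partial>vol S)"
      unfolding L2_inner_def
      by (rule Bochner_Integration.integral_diff[symmetric])
        (rule E.L2_pair_integrable[OF E.u_L2 E.rkhs_L2[OF h]], rule E'.L2_pair_integrable[OF E'.u_L2 E'.rkhs_L2[OF h]])
    also have "\<dots> = (\<integral>x. metric S x (?X x) (?h x) \<partial>vol S)"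
      by (rule Bochner_Integration.integral_cong[OF refl]) (simp add: space_vol metric_diff(1) metric_scale(1) mult.commute)
    finally have n: "?n = (\<integral>x. metric S x (?X x) (?h x) \<partial>vol S)" .
    have "2 * \<alpha> * ?n = (\<integral>x. 2 * \<alpha> * metric S x (?X x) (?h x) \<partial>vol S)" unfolding n by simp
    also have "\<dots> \<le> (\<integral>x. \<alpha> * \<alpha> * metric S x (?X x) (?X x) + metric S x (?h x) (?h x) \<partial>vol S)"
    proof (rule integral_mono)
      show "integrable (vol S) (\<lambda>x. 2 * \<alpha> * metric S x (?X x) (?h x))" by (rule integrable_mult_right[OF integrable_Mk[OF M(1)]])
      show "integrable (vol S) (\<lambda>x. \<alpha> * \<alpha> * metric S x (?X x) (?X x) + metric S x (?h x) (?h x))"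
        by (intro Bochner_Integration.integrable_add integrable_mult_right integrable_Mk[OF M(2)] integrable_Mk[OF M(3)])
      fix x assume "x \<in> space (vol S)"
      then have x: "x \<in> pts S" by (simp add: space_vol)
      define V where "V = ?X x"
      define H where "H = ?h x"
      have "0 \<le> metric S x (\<alpha> *\<^sub>R V - H) (\<alpha> *\<^sub>R V - H)" by (rule metric_nonneg[OF x])
      then have "2 * \<alpha> * metric S x V H \<le> \<alpha> * \<alpha> * metric S x V V + metric S x H H"
        using metric_sym[OF x, of H V] by (simp add: metric_diff[OF x] metric_scale[OF x] algebra_simps)
      then show "2 * \<alpha> * metric S x (?X x) (?h x) \<le> \<alpha> * \<alpha> * metric S x (?X x) (?X x) + metric S x (?h x) (?h x)"
        unfolding V_def H_def .
    qed
    also have "\<dots> = \<alpha> * \<alpha> * (\<integral>x. metric S x (?X x) (?X x) \<partial>vol S) + (\<integral>x. metric S x (?h x) (?h x) \<partial>vol S)"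
      by (subst Bochner_Integration.integral_add) (simp_all add: integrable_Mk[OF M(2)] integrable_Mk[OF M(3)])
    also have "(\<integral>x. metric S x (?h x) (?h x) \<partial>vol S) \<le> (\<integral>x. C * ?n \<partial>vol S)"
      by (rule integral_mono[OF integrable_Mk[OF M(3)] finite_measure.integrable_const[OF finite_measure_vol]])
        (simp only: space_vol, rule C(2)[rule_format, OF h])
    also have "(\<integral>x. C * ?n \<partial>vol S) = (\<alpha> - 1) * ?n" by (simp add: \<alpha>_def)
    finally have "\<alpha> * ?n + ?n \<le> \<alpha> * (\<alpha> * (\<integral>x. metric S x (?X x) (?X x) \<partial>vol S))" by (simp add: algebra_simps)
    then have "\<alpha> * ?n \<le> \<alpha> * (\<alpha> * (\<integral>x. metric S x (?X x) (?X x) \<partial>vol S))" using RK.nonneg[OF h] by linarith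
    then show ?thesis using \<alpha> by simp
  qed
  then show ?thesis using \<alpha> by (intro exI[of _ \<alpha>]) simp
qed

lemma curve_b_continuous:
  assumes r: "law_curve S J r" shows "continuous_on J (\<lambda>t. rkhs_inner S (bb (r t)) (bb (r t)))"
  unfolding continuous_on_def
proof
  fix t0 assume t0: "t0 \<in> J"
  obtain K where K: "K \<ge> 0" "\<forall>\<rho>\<in>densities S. \<forall>\<rho>'\<in>densities S.
     rkhs_inner S (\<lambda>x. bb \<rho> x - bb \<rho>' x) (\<lambda>x. bb \<rho> x - bb \<rho>' x) \<le>
     K * (\<integral>x. metric S x (\<rho> x *\<^sub>R uu \<rho> x - \<rho>' x *\<^sub>R uu \<rho>' x) (\<rho> x *\<^sub>R uu \<rho> x - \<rho>' x *\<^sub>R uu \<rho>' x) \<partial>vol S)"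
    using adjoint_Lipschitz by (elim exE conjE) (rule that)
  let ?X = "\<lambda>t x. r t x *\<^sub>R uu (r t) x - r t0 x *\<^sub>R uu (r t0) x"
  define Q where "Q t = (\<integral>x. metric S x (?X t x) (?X t x) \<partial>vol S)" for t
  have V1: "Vfam 0 J (\<lambda>t x. r t x *\<^sub>R uu (r t) x)" by (rule Vfam_scaleR[OF curve_Mfam[OF r] curve_u[OF r]])
  have XV: "Vfam 0 J ?X" by (rule Vfam_diff[OF V1 Vfam_of_Vk[OF Vfam_at[OF V1 t0]]])
  have "continuous_on J Q" unfolding Q_def by (rule integral_continuous[OF Mfam_metric[OF XV XV]])
  moreover have "Q t0 = (\<integral>x. 0 \<partial>vol S)" unfolding Q_def
    by (rule Bochner_Integration.integral_cong[OF refl]) (simp add: space_vol metric_zero)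
  then have "Q t0 = 0" by simp
  ultimately have Q: "(Q \<longlongrightarrow> 0) (at t0 within J)" using t0 unfolding continuous_on_def by metis
  let ?n = "\<lambda>t. rkhs_inner S (bb (r t)) (bb (r t))"
  have mem: "bb (r t) \<in> rkhs S" if "t \<in> J" for t
    by (rule stein_entropy.b_rkhs[OF entropy_at[OF curve_density[OF r that]]])
  have bound: "norm (?n t - ?n t0) \<le> 2 * (sqrt (K * Q t) * sqrt (?n t0)) + K * Q t" if t: "t \<in> J" for t
  proof -
    let ?d = "\<lambda>x. bb (r t) x - bb (r t0) x"
    have d: "?d \<in> rkhs S" by (rule RK.diff_mem[OF mem[OF t] mem[OF t0]])
    have e: "(\<lambda>x. ?d x + 1 *\<^sub>R bb (r t0) x) = bb (r t)" by (simp add: fun_eq_iff)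
    have q: "?n t = rkhs_inner S ?d ?d + 2 * rkhs_inner S ?d (bb (r t0)) + ?n t0"
      using RK.quadratic[OF d mem[OF t0], of 1] unfolding e by simp
    have dd: "rkhs_inner S ?d ?d \<le> K * Q t" unfolding Q_def
      by (rule K(2)[rule_format, OF curve_density[OF r t] curve_density[OF r t0]])
    have "\<bar>rkhs_inner S ?d (bb (r t0))\<bar> \<le> sqrt (rkhs_inner S ?d ?d) * sqrt (?n t0)"
      by (rule RK.Cauchy_Schwarz[OF d mem[OF t0]])
    also have "\<dots> \<le> sqrt (K * Q t) * sqrt (?n t0)"
      by (rule mult_right_mono[OF real_sqrt_le_mono[OF dd]]) (simp add: RK.nonneg[OF mem[OF t0]])
    finally have "\<bar>rkhs_inner S ?d (bb (r t0))\<bar> \<le> sqrt (K * Q t) * sqrt (?n t0)" .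
    then show ?thesis using dd RK.nonneg[OF d] unfolding q real_norm_def by linarith
  qed
  have "((\<lambda>t. 2 * (sqrt (K * Q t) * sqrt (?n t0)) + K * Q t) \<longlongrightarrow> 2 * (sqrt (K * 0) * sqrt (?n t0)) + K * 0) (at t0 within J)"
    by (intro tendsto_intros Q)
  then have z: "((\<lambda>t. 2 * (sqrt (K * Q t) * sqrt (?n t0)) + K * Q t) \<longlongrightarrow> 0) (at t0 within J)" by simp
  have "((\<lambda>t. ?n t - ?n t0) \<longlongrightarrow> 0) (at t0 within J)"
    by (rule Lim_null_comparison[OF _ z]) (use bound in \<open>simp add: eventually_at_filter\<close>)
  then show "(?n \<longlongrightarrow> ?n t0) (at t0 within J)" by (simp add: LIM_zero_iff)
qed

text \<open>The field \<open>b\<close> is only known to be continuous in time as an element of the Hilbert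
  space.  By the product rule \<open>K\<^sup>S\<close> involves its values and its divergence, and
  both are controlled by its norm.\<close>

lemma curve_KS_bounded:
  assumes r: "law_curve S J r" and K: "compact K" "K \<subseteq> J"
  shows "\<exists>C. \<forall>t\<in>K. \<forall>p\<in>pts S. \<bar>KS (r t) p\<bar> \<le> C"
proof -
  obtain A where A: "\<forall>t\<in>K. \<forall>p\<in>pts S. \<bar>r t p\<bar> \<le> A" using Mfam_bounded[OF curve_Mfam[OF r, of 0] K] by (elim exE) (rule that)
  obtain G where G: "\<forall>t\<in>K. \<forall>p\<in>pts S. \<bar>metric S p (grad S (r t) p) (grad S (r t) p)\<bar> \<le> G"
    using Mfam_bounded[OF Mfam_metric[OF Vfam_grad[OF curve_Mfam[OF r]] Vfam_grad[OF curve_Mfam[OF r]], of 0] K] by (elim exE) (rule that)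
  obtain C where C: "C \<ge> 0" "\<forall>V\<in>rkhs S. \<forall>p\<in>pts S. metric S p (V p) (V p) \<le> C * rkhs_inner S V V"
    using rkhs_metric_bound by (elim exE conjE) (rule that)
  obtain D where D: "D \<ge> 0" "\<forall>V\<in>rkhs S. \<forall>p\<in>pts S. \<bar>divergence S V p\<bar> \<le> D * rkhs_norm S V"
    using rkhs_divergence_bound by (elim exE conjE) (rule that)
  have "bounded ((\<lambda>t. rkhs_inner S (bb (r t)) (bb (r t))) ` K)"
    by (rule compact_imp_bounded[OF compact_continuous_image[OF continuous_on_subset[OF curve_b_continuous[OF r] K(2)] K(1)]])
  then obtain B where B': "\<forall>z\<in>(\<lambda>t. rkhs_inner S (bb (r t)) (bb (r t))) ` K. norm z \<le> B" unfolding bounded_iff by (elim exE) (rule that)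
  then have B: "\<bar>rkhs_inner S (bb (r t)) (bb (r t))\<bar> \<le> B" if "t \<in> K" for t using that by simp
  have "\<bar>KS (r t) p\<bar> \<le> A * (D * (B + 1)) + (G + C * B)" if t: "t \<in> K" and p: "p \<in> pts S" for t p
  proof -
    have tJ: "t \<in> J" by (rule subsetD[OF K(2) t])
    interpret E: stein_entropy S "r t" \<pi> by (rule entropy_at[OF curve_density[OF r tJ]])
    let ?b = "bb (r t)"
    have n: "rkhs_norm S ?b \<le> B + 1"
    proof -
      have "0 \<le> (rkhs_norm S ?b - 1)\<^sup>2" by simp
      then have "2 * rkhs_norm S ?b \<le> (rkhs_norm S ?b)\<^sup>2 + 1" by (simp add: power2_diff)
      also have "\<dots> \<le> B + 1" using B[OF t] unfolding rkhs_norm_sq[OF E.b_rkhs] by simp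
      finally show ?thesis using rkhs_norm_nonneg[OF E.b_rkhs] by linarith
    qed
    have eq: "KS (r t) p = - (r t p * divergence S ?b p + metric S p (grad S (r t) p) (?b p))"
      using cdiv_scaleR[OF E.rho_Mk E.b_Vk p] by (simp add: K_S_def entropy_grad_def)
    have "\<bar>divergence S ?b p\<bar> \<le> D * rkhs_norm S ?b" by (rule D(2)[rule_format, OF E.b_rkhs p])
    also have "\<dots> \<le> D * (B + 1)" by (rule mult_left_mono[OF n D(1)])
    finally have dv: "\<bar>divergence S ?b p\<bar> \<le> D * (B + 1)" .
    have rA: "\<bar>r t p\<bar> \<le> A" by (rule A[rule_format, OF t p])
    have 1: "\<bar>r t p * divergence S ?b p\<bar> \<le> A * (D * (B + 1))" unfolding abs_mult
      by (rule mult_mono[OF rA dv order_trans[OF abs_ge_zero rA] abs_ge_zero])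
    have "\<bar>metric S p (grad S (r t) p) (?b p)\<bar> \<le> metric S p (grad S (r t) p) (grad S (r t) p) + metric S p (?b p) (?b p)"
      by (rule metric_abs_le[OF p])
    moreover have "metric S p (grad S (r t) p) (grad S (r t) p) \<le> G" using G[rule_format, OF t p] by simp
    moreover have "metric S p (?b p) (?b p) \<le> C * rkhs_inner S ?b ?b" by (rule C(2)[rule_format, OF E.b_rkhs p])
    moreover have "C * rkhs_inner S ?b ?b \<le> C * B" by (rule mult_left_mono[OF _ C(1)]) (use B[OF t] in simp)
    ultimately have 2: "\<bar>metric S p (grad S (r t) p) (?b p)\<bar> \<le> G + C * B" by linarith
    show ?thesis unfolding eq using 1 2 by linarith
  qed
  then show ?thesis by blast
qed

lemma entropy_along:
  assumes r: "law_curve S J r" and t0: "t0 \<in> J"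
    and der: "\<And>t x. t \<in> J \<Longrightarrow> x \<in> pts S \<Longrightarrow> ((\<lambda>s. r s x) has_real_derivative \<sigma> t x) (at t within J)"
    and bd: "\<And>K. compact K \<Longrightarrow> K \<subseteq> J \<Longrightarrow> \<exists>C. \<forall>t\<in>K. \<forall>p\<in>pts S. \<bar>\<sigma> t p\<bar> \<le> C"
  shows "((\<lambda>t. Ent S \<pi> (r t)) has_real_derivative (\<integral>x. \<sigma> t0 x * (log_ratio \<pi> (r t0) x + 1) \<partial>vol S)) (at t0 within J)"
  unfolding Ent_def
proof (rule integral_has_derivative[OF curve_interval[OF r] t0])
  show "Mfam 0 J (\<lambda>t x. r t x * ln (r t x / \<pi> x))"
    using Mfam_mult[OF curve_Mfam[OF r] curve_phi[OF r]] unfolding log_ratio_def .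
  fix t x assume t: "t \<in> J" and x: "x \<in> pts S"
  have rp: "r t x > 0" "\<pi> x > 0" by (rule curve_pos[OF r t x], rule P.rho_pos[OF x])
  have q: "((\<lambda>s. r s x / \<pi> x) has_real_derivative \<sigma> t x / \<pi> x) (at t within J)"
    by (rule DERIV_cdivide[OF der[OF t x]])
  have "r t x / \<pi> x > 0" using rp by simp
  from DERIV_mult[OF der[OF t x] DERIV_chain2[OF DERIV_ln[OF this] q]]
  show "((\<lambda>s. r s x * ln (r s x / \<pi> x)) has_real_derivative \<sigma> t x * (log_ratio \<pi> (r t) x + 1)) (at t within J)"
    using rp by (simp add: log_ratio_def field_simps)
next
  fix K assume K: "compact K" "K \<subseteq> J"
  obtain C where C: "\<forall>t\<in>K. \<forall>p\<in>pts S. \<bar>\<sigma> t p\<bar> \<le> C" using bd[OF K] by (elim exE) (rule that)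
  obtain D where D: "\<forall>t\<in>K. \<forall>p\<in>pts S. \<bar>log_ratio \<pi> (r t) p + 1\<bar> \<le> D"
    using Mfam_bounded[OF Mfam_add[OF curve_phi[OF r] Mfam_const[of 0 J 1]] K] by (elim exE) (rule that)
  have "\<bar>\<sigma> t p * (log_ratio \<pi> (r t) p + 1)\<bar> \<le> C * D" if "t \<in> K" "p \<in> pts S" for t p
  proof -
    note c = C[rule_format, OF that] D[rule_format, OF that]
    show ?thesis unfolding abs_mult by (rule mult_mono[OF c order_trans[OF abs_ge_zero c(1)] abs_ge_zero])
  qed
  then show "\<exists>C. \<forall>t\<in>K. \<forall>p\<in>pts S. \<bar>\<sigma> t p * (log_ratio \<pi> (r t) p + 1)\<bar> \<le> C" by blast
qed

theorem entropy_along_W: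
  assumes "wasserstein_flow S \<pi> J r" "t \<in> J"
  shows "((\<lambda>t. Ent S \<pi> (r t)) has_real_derivative - L2_inner S (r t) (uu (r t)) (uu (r t))) (at t within J)"
proof -
  have r: "law_curve S J r" using assms(1) unfolding wasserstein_flow_def by simp
  interpret E: stein_entropy S "r t" \<pi> by (rule entropy_at[OF curve_density[OF r assms(2)]])
  show ?thesis unfolding E.K_W_entropy[symmetric]
    by (rule entropy_along[OF r assms(2)])
      (use assms(1) Mfam_bounded[OF curve_KW[OF r]] in \<open>simp_all add: wasserstein_flow_def\<close>)
qed

theorem entropy_along_S:
  assumes "stein_flow S \<pi> J r" "t \<in> J"
  shows "((\<lambda>t. Ent S \<pi> (r t)) has_real_derivative - L2_inner S (r t) (uu (r t)) (bb (r t))) (at t within J)"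
proof -
  have r: "law_curve S J r" using assms(1) unfolding stein_flow_def by simp
  interpret E: stein_entropy S "r t" \<pi> by (rule entropy_at[OF curve_density[OF r assms(2)]])
  show ?thesis unfolding E.K_S_entropy[symmetric]
    by (rule entropy_along[OF r assms(2)])
      (use assms(1) curve_KS_bounded[OF r] in \<open>simp_all add: stein_flow_def\<close>)
qed

end


section \<open>Unparametrised trajectories\<close>

context stein_target
begin

text \<open>In terms of \<open>h = \<rho>/\<pi> - 1\<close> this is the inner product in
  \<open>L\<^sup>2(\<pi>)\<close>.\<close>

definition cov :: "('a \<Rightarrow> real) \<Rightarrow> ('a \<Rightarrow> real) \<Rightarrow> real" where
  "cov p q = (\<integral>x. (p x - \<pi> x) * (q x / \<pi> x - 1) \<partial>vol S)"

abbreviation "excess p \<equiv> cov p p"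

lemma dens_Mk: "p \<in> densities S \<Longrightarrow> Mk k p"
  by (rule riem_density.rho_Mk[OF stein_entropy.axioms(1)[OF entropy_at, THEN stein_density.axioms(2)]])

lemma dev_Mk: "p \<in> densities S \<Longrightarrow> Mk k (\<lambda>x. p x / \<pi> x - 1)"
  by (intro Mfam_diff Mfam_divide dens_Mk P.rho_Mk Mfam_const) (simp_all add: pi_neq)

lemma cov_integrand_Mk: "p \<in> densities S \<Longrightarrow> q \<in> densities S \<Longrightarrow> Mk k (\<lambda>x. (p x - \<pi> x) * (q x / \<pi> x - 1))"
  by (intro Mfam_mult Mfam_diff[OF dens_Mk P.rho_Mk] dev_Mk)

lemma excess_integrand: "x \<in> pts S \<Longrightarrow> (p x - \<pi> x) * (q x / \<pi> x - 1) = (p x - \<pi> x) * (q x - \<pi> x) / \<pi> x"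
  using P.rho_pos[of x] by (simp add: field_simps)

lemma excess_integrand_nonneg: "x \<in> pts S \<Longrightarrow> 0 \<le> (p x - \<pi> x) * (p x / \<pi> x - 1)"
  unfolding excess_integrand using P.rho_pos[of x] by (simp add: divide_nonneg_pos)

lemma excess_nonneg: "0 \<le> excess p"
  unfolding cov_def by (rule Bochner_Integration.integral_nonneg) (simp add: space_vol excess_integrand_nonneg)

lemma excess_pi: "excess \<pi> = 0"
  unfolding cov_def by simp

lemma excess_zero: assumes p: "p \<in> densities S" and z: "excess p = 0" shows "p = \<pi>"
proof
  fix x
  interpret E: stein_entropy S p \<pi> by (rule entropy_at[OF p])
  show "p x = \<pi> x"
  proof (cases "x \<in> pts S")
    case True
    show ?thesis
    proof (rule ccontr)
      assume n: "p x \<noteq> \<pi> x"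
      have "(p x - \<pi> x) * (p x - \<pi> x) > 0" using n by (metis not_real_square_gt_zero right_minus_eq)
      then have "0 < (p x - \<pi> x) * (p x / \<pi> x - 1)"
        unfolding excess_integrand[OF True] by (rule divide_pos_pos[OF _ P.rho_pos[OF True]])
      then have "excess p > 0" unfolding cov_def
        by (intro integral_pos[where f = "\<lambda>x. (p x - \<pi> x) * (p x / \<pi> x - 1)" and k = 0, OF cov_integrand_Mk[OF p p] _ True] excess_integrand_nonneg)
      then show False using z by simp
    qed
  next
    case False
    then show ?thesis by (simp add: E.rho_outside P.rho_outside)
  qed
qed

text \<open>The Cauchy inequality with a weight \<open>e\<close>, which is chosen according to the sizes of
  the two factors.\<close>

lemma cov_bound:
  assumes pq: "p \<in> densities S" "q \<in> densities S" and e: "e > 0"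
  shows "2 * cov p q \<le> excess p / e + e * excess q"
proof -
  let ?f = "\<lambda>p q x. (p x - \<pi> x) * (q x / \<pi> x - 1)"
  note i = integrable_Mk[OF cov_integrand_Mk]
  have "2 * cov p q = (\<integral>x. 2 * ?f p q x \<partial>vol S)" unfolding cov_def by simp
  also have "\<dots> \<le> (\<integral>x. ?f p p x / e + e * ?f q q x \<partial>vol S)"
  proof (rule integral_mono)
    show "integrable (vol S) (\<lambda>x. 2 * ?f p q x)" by (rule integrable_mult_right[OF i[OF pq]])
    show "integrable (vol S) (\<lambda>x. ?f p p x / e + e * ?f q q x)"
      by (intro Bochner_Integration.integrable_add integrable_mult_right integrable_divide i pq)
    fix x assume "x \<in> space (vol S)"
    then have x: "x \<in> pts S" by (simp add: space_vol)
    have alg: "2 * (a * b / P) \<le> a * a / P / e + e * (b * b / P)" if P: "P > 0" for a b P :: real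
    proof -
      have "0 \<le> (a - e * b)\<^sup>2 / (P * e)" using P e by simp
      also have "\<dots> = a * a / P / e + e * (b * b / P) - 2 * (a * b / P)"
        using P e by (simp add: power2_eq_square field_simps)
      finally show ?thesis by simp
    qed
    show "2 * ?f p q x \<le> ?f p p x / e + e * ?f q q x"
      unfolding excess_integrand[OF x] by (rule alg[OF P.rho_pos[OF x]])
  qed
  also have "\<dots> = excess p / e + e * excess q"
    unfolding cov_def by (subst Bochner_Integration.integral_add) (simp_all add: i pq)
  finally show ?thesis .
qed

text \<open>The Dirichlet form of \<open>\<pi>\<close>, evaluated at \<open>p/\<pi> - 1\<close> and
  \<open>q/\<pi> - 1\<close>.\<close>

definition dirichlet :: "('a \<Rightarrow> real) \<Rightarrow> ('a \<Rightarrow> real) \<Rightarrow> real" where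
  "dirichlet p q = (\<integral>x. metric S x (grad S (\<lambda>y. p y / \<pi> y - 1) x) (grad S (\<lambda>y. q y / \<pi> y - 1) x) * \<pi> x \<partial>vol S)"

lemma dirichlet_sym: "dirichlet p q = dirichlet q p"
  unfolding dirichlet_def by (rule Bochner_Integration.integral_cong[OF refl]) (simp add: space_vol metric_sym)

lemma dirichlet_nonneg: "0 \<le> dirichlet p p"
  unfolding dirichlet_def
  by (rule Bochner_Integration.integral_nonneg) (simp add: space_vol metric_nonneg P.rho_pos less_imp_le)

text \<open>The generator of the Wasserstein entropy flow is symmetric in \<open>L\<^sup>2(\<pi>)\<close>.\<close>

lemma KW_dirichlet:
  assumes p: "p \<in> densities S" and q: "q \<in> densities S"
  shows "(\<integral>x. (q x / \<pi> x - 1) * KW p x \<partial>vol S) = dirichlet p q"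
proof -
  interpret E: stein_entropy S p \<pi> by (rule entropy_at[OF p])
  have g: "grad S (\<lambda>y. p y / \<pi> y - 1) = grad S (\<lambda>y. p y / \<pi> y)"
    using grad_add[OF E.ratio_Mk Mfam_const[of _ UNIV "-1"]] by (simp add: grad_const)
  have "(\<integral>x. (q x / \<pi> x - 1) * KW p x \<partial>vol S) = L2_inner S p (uu p) (grad S (\<lambda>y. q y / \<pi> y - 1))"
    by (rule E.K_W_weak[OF dev_Mk[OF q]])
  also have "\<dots> = dirichlet p q"
    unfolding L2_inner_def dirichlet_def
  proof (rule Bochner_Integration.integral_cong[OF refl])
    fix x assume "x \<in> space (vol S)"
    then have x: "x \<in> pts S" by (simp add: space_vol)
    show "metric S x (uu p x) (grad S (\<lambda>y. q y / \<pi> y - 1) x) * p x =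
      metric S x (grad S (\<lambda>y. p y / \<pi> y - 1) x) (grad S (\<lambda>y. q y / \<pi> y - 1) x) * \<pi> x"
      using arg_cong[OF E.flux[OF x], of "\<lambda>v. metric S x v (grad S (\<lambda>y. q y / \<pi> y - 1) x)"]
      unfolding g metric_scale(1)[OF x] by (simp add: mult.commute)
  qed
  finally show ?thesis .
qed

lemma cov_derivative:
  assumes p: "law_curve S J p" and q: "law_curve S J q" and t0: "t0 \<in> J"
    and dp: "\<And>t x. t \<in> J \<Longrightarrow> x \<in> pts S \<Longrightarrow> ((\<lambda>s. p s x) has_real_derivative c t * KW (p t) x) (at t within J)"
    and dq: "\<And>t x. t \<in> J \<Longrightarrow> x \<in> pts S \<Longrightarrow> ((\<lambda>s. q s x) has_real_derivative d t * KW (q t) x) (at t within J)"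
    and C: "\<And>t. t \<in> J \<Longrightarrow> \<bar>c t\<bar> \<le> C" "\<And>t. t \<in> J \<Longrightarrow> \<bar>d t\<bar> \<le> C"
  shows "((\<lambda>t. cov (p t) (q t)) has_real_derivative (c t0 + d t0) * dirichlet (p t0) (q t0)) (at t0 within J)"
proof -
  let ?f' = "\<lambda>t x. c t * ((q t x / \<pi> x - 1) * KW (p t) x) + d t * ((p t x / \<pi> x - 1) * KW (q t) x)"
  have dev: "Mfam 0 J (\<lambda>t x. r t x / \<pi> x - 1)" if "law_curve S J r" for r
    by (rule Mfam_diff[OF curve_ratio[OF that] Mfam_const])
  have "((\<lambda>t. cov (p t) (q t)) has_real_derivative (\<integral>x. ?f' t0 x \<partial>vol S)) (at t0 within J)"
    unfolding cov_def
  proof (rule integral_has_derivative[OF curve_interval[OF p] t0])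
    show "Mfam 0 J (\<lambda>t x. (p t x - \<pi> x) * (q t x / \<pi> x - 1))"
      by (rule Mfam_mult[OF Mfam_diff[OF curve_Mfam[OF p] Mfam_of_Mk[OF P.rho_Mk]] dev[OF q]])
    fix t x assume t: "t \<in> J" and x: "x \<in> pts S"
    have d1: "((\<lambda>s. p s x - \<pi> x) has_real_derivative c t * KW (p t) x - 0) (at t within J)"
      by (rule DERIV_diff[OF dp[OF t x] DERIV_const])
    have d2: "((\<lambda>s. q s x / \<pi> x - 1) has_real_derivative d t * KW (q t) x / \<pi> x - 0) (at t within J)"
      by (rule DERIV_diff[OF DERIV_cdivide[OF dq[OF t x]] DERIV_const])
    have alg: "(a - 0) * Q + (b / P - 0) * (z - P) = a * Q + b * (z / P - 1)" if "P > 0" for a b P Q z :: real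
      using that by (simp add: field_simps)
    have "?f' t x = c t * KW (p t) x * (q t x / \<pi> x - 1) + d t * KW (q t) x * (p t x / \<pi> x - 1)"
      by (simp only: mult_ac)
    then show "((\<lambda>s. (p s x - \<pi> x) * (q s x / \<pi> x - 1)) has_real_derivative ?f' t x) (at t within J)"
      by (rule ssubst) (rule DERIV_cong[OF DERIV_mult[OF d1 d2] alg[OF P.rho_pos[OF x]]])
  next
    fix K assume K: "compact K" "K \<subseteq> J"
    obtain A where A: "\<forall>t\<in>K. \<forall>x\<in>pts S. \<bar>(q t x / \<pi> x - 1) * KW (p t) x\<bar> \<le> A"
      using Mfam_bounded[OF Mfam_mult[OF dev[OF q] curve_KW[OF p]] K] by (elim exE) (rule that)
    obtain B where B: "\<forall>t\<in>K. \<forall>x\<in>pts S. \<bar>(p t x / \<pi> x - 1) * KW (q t) x\<bar> \<le> B"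
      using Mfam_bounded[OF Mfam_mult[OF dev[OF p] curve_KW[OF q]] K] by (elim exE) (rule that)
    have "\<bar>?f' t x\<bar> \<le> C * A + C * B" if t: "t \<in> K" and x: "x \<in> pts S" for t x
    proof -
      have tJ: "t \<in> J" by (rule subsetD[OF K(2) t])
      have m: "\<bar>a * y\<bar> \<le> C * Y" if "\<bar>a\<bar> \<le> C" "\<bar>y\<bar> \<le> Y" for a y Y :: real
        unfolding abs_mult by (rule mult_mono[OF that order_trans[OF abs_ge_zero that(1)] abs_ge_zero])
      show ?thesis
        using m[OF C(1)[OF tJ] A[rule_format, OF t x]] m[OF C(2)[OF tJ] B[rule_format, OF t x]] by linarith
    qed
    then show "\<exists>C. \<forall>t\<in>K. \<forall>x\<in>pts S. \<bar>?f' t x\<bar> \<le> C" by blast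
  qed
  also have "(\<integral>x. ?f' t0 x \<partial>vol S) = (c t0 + d t0) * dirichlet (p t0) (q t0)"
  proof -
    have i: "integrable (vol S) (\<lambda>x. (b x / \<pi> x - 1) * KW a x)" if "a \<in> densities S" "b \<in> densities S" for a b
      by (rule integrable_Mk[OF Mfam_mult[OF dev_Mk[OF that(2)] riem_entropy.K_W_Mk[OF stein_entropy.axioms(2)[OF entropy_at[OF that(1)]]]]])
    note D = curve_density[OF p t0] curve_density[OF q t0]
    show ?thesis
      by (subst Bochner_Integration.integral_add)
        (simp_all add: i D KW_dirichlet dirichlet_sym[of "q t0"] distrib_right)
  qed
  finally show ?thesis .
qed

lemma excess_antimono:
  assumes r: "law_curve S J r" and c: "\<And>t. t \<in> J \<Longrightarrow> 0 \<le> c t" "\<And>t. t \<in> J \<Longrightarrow> c t \<le> C"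
    and der: "\<And>t x. t \<in> J \<Longrightarrow> x \<in> pts S \<Longrightarrow> ((\<lambda>s. r s x) has_real_derivative - c t * KW (r t) x) (at t within J)"
    and st: "s \<in> J" "t \<in> J" "s \<le> t"
  shows "excess (r t) \<le> excess (r s)"
proof (cases "s = t")
  case False
  then have lt: "s < t" using st by simp
  have sub: "{s..t} \<subseteq> J" using mem_is_interval_1_I[OF curve_interval[OF r] st(1,2)] by auto
  let ?d = "\<lambda>x. (- c x + - c x) * dirichlet (r x) (r x)"
  have hd: "((\<lambda>t. excess (r t)) has_derivative (*) (?d x)) (at x within {s..t})" if "s \<le> x" "x \<le> t" for x
  proof -
    have x: "x \<in> J" using sub that by auto
    have "((\<lambda>t. excess (r t)) has_real_derivative ?d x) (at x within J)"
      by (rule cov_derivative[OF r r x der der]) (use c in simp_all)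
    from DERIV_subset[OF this sub] show ?thesis by (simp add: has_field_derivative_def)
  qed
  have "\<exists>x\<in>{s<..<t}. excess (r t) - excess (r s) = ?d x * (t - s)" by (rule mvt_simple[OF lt hd])
  then obtain x where x: "x \<in> {s<..<t}" "excess (r t) - excess (r s) = ?d x * (t - s)"
    by (elim bexE) (rule that)
  have "x \<in> J" using x(1) sub by auto
  have "?d x \<le> 0" by (rule mult_nonpos_nonneg[OF _ dirichlet_nonneg]) (use c(1)[OF \<open>x \<in> J\<close>] in simp)
  then have "?d x * (t - s) \<le> 0" by (rule mult_nonpos_nonneg) (use lt in simp)
  then show ?thesis using x(2) by linarith
qed simp

text \<open>Moving one factor forward and the other one backward in time, the two contributions to the
  derivative cancel by symmetry of the Dirichlet form.\<close>

lemma cov_reflection: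
  assumes W: "wasserstein_flow S \<pi> J r" and s: "0 \<le> s" "m - s \<in> J" "m + s \<in> J"
  shows "cov (r (m + s)) (r (m - s)) = excess (r m)"
proof (cases "s = 0")
  case False
  then have s0: "0 < s" using s by simp
  have r: "law_curve S J r"
    and der: "\<And>t x. t \<in> J \<Longrightarrow> x \<in> pts S \<Longrightarrow> ((\<lambda>s. r s x) has_real_derivative - KW (r t) x) (at t within J)"
    using W unfolding wasserstein_flow_def by simp_all
  let ?I = "{0..s}"
  have sub: "m + k * x \<in> J" if "x \<in> ?I" "\<bar>k\<bar> = 1" for x k
  proof -
    have "m - s \<le> m + k * x \<and> m + k * x \<le> m + s" using that by (auto simp: abs_if split: if_splits)
    then show ?thesis using mem_is_interval_1_I[OF curve_interval[OF r] s(2,3)] by simp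
  qed
  have lc: "law_curve S ?I (\<lambda>x. r (m + k * x))" if k: "\<bar>k\<bar> = 1" for k
  proof -
    have "law_curve S ?I (r \<circ> (\<lambda>x. m + k * x))"
    proof (rule law_curve_compose[OF r])
      show "is_interval ?I" by simp
      show "interior ?I \<noteq> {}" using s0 by simp
    qed (auto intro!: continuous_intros sub k simp del: atLeastAtMost_iff)
    then show ?thesis by (simp add: comp_def)
  qed
  have d: "((\<lambda>x. r (m + k * x) y) has_real_derivative (- k) * KW (r (m + k * x)) y) (at x within ?I)"
    if k: "\<bar>k\<bar> = 1" and x: "x \<in> ?I" and y: "y \<in> pts S" for k x y
  proof -
    have "(\<lambda>x. m + k * x) ` ?I \<subseteq> J" using sub k by (auto simp del: atLeastAtMost_iff)
    from DERIV_subset[OF der[OF sub[OF x k] y] this]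
    have 1: "((\<lambda>t. r t y) has_real_derivative - KW (r (m + k * x)) y) (at (m + k * x) within (\<lambda>x. m + k * x) ` ?I)" .
    have 2: "((\<lambda>x. m + k * x) has_real_derivative k) (at x within ?I)" by (auto intro!: derivative_eq_intros)
    from DERIV_image_chain[OF 1 2] show ?thesis by (simp add: comp_def mult.commute)
  qed
  let ?G = "\<lambda>x. cov (r (m + 1 * x)) (r (m + (-1) * x))"
  have z: "(?G has_real_derivative 0) (at x within ?I)" if x: "x \<in> ?I" for x
  proof -
    have "(?G has_real_derivative (- 1 + - (- 1)) * dirichlet (r (m + 1 * x)) (r (m + (-1) * x))) (at x within ?I)"
      by (rule cov_derivative[OF lc lc x d d, where C = 1]) simp_all
    then show ?thesis by simp
  qed
  have "\<exists>K. \<forall>x\<in>?I. ?G x = K" by (rule has_field_derivative_zero_constant[OF convex_real_interval(5) z])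
  then obtain K where K: "\<And>x. x \<in> ?I \<Longrightarrow> ?G x = K" by (elim exE) (rule that, simp)
  have "?G s = ?G 0" using K[of s] K[of 0] s0 by simp
  then show ?thesis by simp
qed simp

lemma excess_continuous:
  assumes r: "law_curve S J r" shows "continuous_on J (\<lambda>t. excess (r t))"
  unfolding cov_def
  by (rule integral_continuous[OF Mfam_mult[OF Mfam_diff[OF curve_Mfam[OF r] Mfam_of_Mk[OF P.rho_Mk]] Mfam_diff[OF curve_ratio[OF r] Mfam_const]]])

text \<open>Forward in time the excess decreases.  Backward in time, let \<open>z\<close> be the first time
  at which \<open>\<pi>\<close> is reached.  Before \<open>z\<close> the speed is continuous, so
  the curve is a Wasserstein flow in another time, which runs through a bounded interval as the
  speed is bounded.  By reflection at the midpoint of this interval, the excess at the midpoint is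
  at most the geometric mean of an excess that tends to \<open>0\<close> and a bounded one.  So
  \<open>\<pi>\<close> is reached before \<open>z\<close> already.\<close>

lemma equilibrium_propagates:
  assumes r: "law_curve S J r" and c: "\<And>t. t \<in> J \<Longrightarrow> 0 < c t" "\<And>t. t \<in> J \<Longrightarrow> c t \<le> C"
    and cc: "continuous_on {t \<in> J. r t \<noteq> \<pi>} c"
    and der: "\<And>t x. t \<in> J \<Longrightarrow> x \<in> pts S \<Longrightarrow> ((\<lambda>s. r s x) has_real_derivative - c t * KW (r t) x) (at t within J)"
    and t0: "t0 \<in> J" "r t0 = \<pi>" and t: "t \<in> J"
  shows "r t = \<pi>"
proof -
  have e0: "excess (r t0) = 0" using t0 excess_pi by simp
  have "excess (r t) = 0"
  proof (cases "t0 \<le> t")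
    case True
    have "excess (r t) \<le> excess (r t0)"
      by (rule excess_antimono[OF r less_imp_le[OF c(1)] c(2) der t0(1) t True])
    then show ?thesis using e0 excess_nonneg[of "r t"] by simp
  next
    case False
    then have lt: "t < t0" by simp
    have sub: "{t..t0} \<subseteq> J" using mem_is_interval_1_I[OF curve_interval[OF r] t t0(1)] by auto
    have ce: "continuous_on {t..t0} (\<lambda>x. excess (r x))" by (rule continuous_on_subset[OF excess_continuous[OF r] sub])
    define Z where "Z = {x \<in> {t..t0}. excess (r x) = 0}"
    have Zc: "closed Z" unfolding Z_def by (rule continuous_closed_preimage_constant[OF ce]) simp
    have Zn: "Z \<noteq> {}" "bdd_below Z" using e0 lt by (auto simp: Z_def intro!: bdd_belowI[of _ t])
    define z where "z = Inf Z"
    have zZ: "z \<in> Z" unfolding z_def by (rule closed_contains_Inf[OF Zn Zc])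
    then have z: "t \<le> z" "z \<le> t0" "excess (r z) = 0" by (simp_all add: Z_def)
    show ?thesis
    proof (cases "z = t")
      case False
      with z have tz: "t < z" by simp
      let ?I = "{t..<z}"
      have IJ: "?I \<subseteq> J" using sub z by auto
      have ne: "r x \<noteq> \<pi>" if "x \<in> ?I" for x
      proof
        assume "r x = \<pi>"
        then have "x \<in> Z" using that z excess_pi by (simp add: Z_def)
        from cInf_lower[OF this Zn(2)] show False using that by (simp add: z_def)
      qed
      have lcI: "law_curve S ?I r"
        by (rule law_curve_subset[OF r IJ]) (use tz in \<open>simp_all add: interior_atLeastLessThan\<close>)
      have ccI: "continuous_on ?I c" by (rule continuous_on_subset[OF cc]) (use IJ ne in blast)
      have derI: "((\<lambda>s. r s x) has_real_derivative c t' * (- KW (r t') x)) (at t' within ?I)" if "t' \<in> ?I" "x \<in> pts S" for t' x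
        using DERIV_subset[OF der[OF subsetD[OF IJ that(1)] that(2)] IJ] by simp
      obtain J' \<tau> \<sigma> where J': "time_change \<tau> J' ?I" "law_curve S J' (r \<circ> \<tau>)"
        "\<And>s x. s \<in> J' \<Longrightarrow> x \<in> pts S \<Longrightarrow> ((\<lambda>s. (r \<circ> \<tau>) s x) has_real_derivative - KW (r (\<tau> s)) x) (at s within J')"
        "\<sigma> ` ?I = J'" "\<And>t. t \<in> ?I \<Longrightarrow> \<tau> (\<sigma> t) = t"
        "\<And>t. t \<in> ?I \<Longrightarrow> (\<sigma> has_real_derivative c t) (at t within ?I)" "strict_mono_on ?I \<sigma>"
        by (rule reparametrised_curve[OF lcI ccI c(1)[OF subsetD[OF IJ]] derI]; assumption?)
          (rule that, assumption, assumption, simp only:, assumption, simp only:, simp only:, assumption)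
      have W: "wasserstein_flow S \<pi> J' (r \<circ> \<tau>)" unfolding wasserstein_flow_def using J'(2,3) by simp
      have iv: "is_interval J'" by (rule curve_interval[OF J'(2)])
      have tI: "t \<in> ?I" using tz by simp
      have ub: "\<sigma> x \<le> \<sigma> t + C * (z - t)" if x: "x \<in> ?I" for x
      proof (cases "x = t")
        case True
        have "0 \<le> C * (z - t)" using c[OF t] tz by (intro mult_nonneg_nonneg) simp_all
        then show ?thesis using True by simp
      next
        case False
        with x have tx: "t < x" "x < z" by simp_all
        have hd: "(\<sigma> has_derivative (*) (c y)) (at y within {t..x})" if "t \<le> y" "y \<le> x" for y
        proof -
          have "y \<in> ?I" "{t..x} \<subseteq> ?I" using that tx by auto
          from DERIV_subset[OF J'(6)[OF this(1)] this(2)] show ?thesis by (simp add: has_field_derivative_def)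
        qed
        have "\<exists>y\<in>{t<..<x}. \<sigma> x - \<sigma> t = c y * (x - t)" by (rule mvt_simple[OF tx(1) hd])
        then obtain y where y: "y \<in> {t<..<x}" "\<sigma> x - \<sigma> t = c y * (x - t)"
          by (elim bexE) (rule that)
        have yJ: "y \<in> J" using y(1) tx IJ by auto
        have "c y * (x - t) \<le> C * (z - t)"
          by (rule mult_mono[OF c(2)[OF yJ]]) (use c[OF yJ] tx in simp_all)
        then show ?thesis using y(2) by linarith
      qed
      define s0 where "s0 = \<sigma> t"
      have s0J: "s0 \<in> J'" unfolding s0_def J'(4)[symmetric] by (rule imageI[OF tI])
      have bdd: "bdd_above J'" unfolding J'(4)[symmetric] by (rule bdd_aboveI2[OF ub])
      define s1 where "s1 = Sup J'"
      have below: "\<sigma> x < s1" if "x \<in> ?I" for x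
      proof -
        have h: "(x + z) / 2 \<in> ?I" using that by simp
        have "\<sigma> x < \<sigma> ((x + z) / 2)" by (rule strict_mono_onD[OF J'(7) that h]) (use that in simp)
        also have "\<dots> \<le> s1" unfolding s1_def by (rule cSup_upper[OF _ bdd]) (use h J'(4) in blast)
        finally show ?thesis .
      qed
      have lower: "s0 \<le> \<sigma> x" if "x \<in> ?I" for x
        unfolding s0_def using strict_mono_onD[OF J'(7) tI that] that by (cases "x = t") auto
      \<comment> \<open>The midpoint, so that reflection maps times between \<open>m\<close> and \<open>s1\<close> into the interval.\<close>
      define m where "m = (s0 + s1) / 2"
      have s01: "s0 < s1" using below[OF tI] by (simp add: s0_def)
      have "\<exists>y\<in>J'. m < y" using less_cSupD[of J' m] s0J s01 by (auto simp: m_def s1_def)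
      then obtain y0 where y0: "y0 \<in> J'" "m < y0" by (elim bexE) (rule that)
      have mJ: "m \<in> J'" by (rule mem_is_interval_1_I[OF iv s0J y0(1)]) (use s01 y0 in \<open>simp_all add: m_def\<close>)
      then obtain xm where xm: "xm \<in> ?I" "m = \<sigma> xm" unfolding J'(4)[symmetric] by (elim imageE) (rule that)
      let ?N = "\<lambda>s. excess ((r \<circ> \<tau>) s)"
      have dens: "(r \<circ> \<tau>) s \<in> densities S" if "s \<in> J'" for s by (rule curve_density[OF J'(2) that])
      have nonzero: "?N (\<sigma> x) \<noteq> 0" if "x \<in> ?I" for x
        using excess_zero[OF curve_density[OF lcI that]] ne[OF that] J'(5)[OF that] by auto
      have Nm: "?N m > 0" using excess_nonneg[of "(r \<circ> \<tau>) m"] nonzero[OF xm(1)] unfolding xm(2) by linarith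
      have N0: "?N s0 > 0" using excess_nonneg[of "(r \<circ> \<tau>) s0"] nonzero[OF tI] unfolding s0_def by linarith
      have Nmono: "?N b \<le> ?N a" if "a \<in> J'" "b \<in> J'" "a \<le> b" for a b
      proof -
        have dd: "((\<lambda>s. (r \<circ> \<tau>) s x) has_real_derivative - 1 * KW ((r \<circ> \<tau>) s) x) (at s within J')"
          if "s \<in> J'" "x \<in> pts S" for s x using J'(3)[OF that] by simp
        show ?thesis by (rule excess_antimono[OF J'(2) _ _ dd that, where C = 1]) simp_all
      qed
      have low: "?N m * ?N m \<le> ?N s0 * excess (r x)" if x: "x \<in> ?I" "xm \<le> x" for x
      proof -
        define y where "y = \<sigma> x"
        have yJ: "y \<in> J'" unfolding y_def J'(4)[symmetric] by (rule imageI[OF x(1)])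
        have ym: "m \<le> y" unfolding y_def xm(2) using strict_mono_onD[OF J'(7) xm(1) x(1)] x(2) by (cases "x = xm") auto
        have y1: "y < s1" unfolding y_def by (rule below[OF x(1)])
        have y': "m - (y - m) \<in> J'"
          by (rule mem_is_interval_1_I[OF iv s0J mJ]) (use ym y1 in \<open>simp_all add: m_def field_simps\<close>)
        \<comment> \<open>With this weight the second summand of \<open>cov_bound\<close> is at most \<open>?N m\<close>, and the first one carries the estimate.\<close>
        define e where "e = ?N m / ?N s0"
        have e: "e > 0" unfolding e_def using Nm N0 by simp
        have "cov ((r \<circ> \<tau>) (m + (y - m))) ((r \<circ> \<tau>) (m - (y - m))) = ?N m"
          by (rule cov_reflection[OF W _ y']) (use ym yJ in simp_all)
        then have "2 * ?N m \<le> ?N y / e + e * ?N (m - (y - m))"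
          using cov_bound[OF dens[OF yJ] dens[OF y'] e] by simp
        also have "e * ?N (m - (y - m)) \<le> e * ?N s0"
          by (rule mult_left_mono[OF Nmono[OF s0J y'] less_imp_le[OF e]]) (use y1 in \<open>simp add: m_def field_simps\<close>)
        finally have "2 * ?N m \<le> ?N y / e + e * ?N s0" by simp
        moreover have "e * ?N s0 = ?N m" unfolding e_def using N0 by simp
        ultimately have "?N m \<le> ?N y / e" by linarith
        then have "?N m \<le> ?N s0 * ?N y / ?N m" unfolding e_def using Nm N0 by (simp add: mult.commute)
        then have "?N m * ?N m \<le> ?N s0 * ?N y" using Nm by (simp add: pos_le_divide_eq)
        moreover have "?N y = excess (r x)" unfolding y_def using J'(5)[OF x(1)] by simp
        ultimately show ?thesis by simp
      qed
      have "continuous_on {xm..z} (\<lambda>x. ?N s0 * excess (r x))"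
        by (intro continuous_on_mult_left continuous_on_subset[OF ce]) (use xm(1) z in auto)
      then have "((\<lambda>x. ?N s0 * excess (r x)) \<longlongrightarrow> ?N s0 * excess (r z)) (at z within {xm..z})"
        unfolding continuous_on_def using xm(1) by simp
      then have "((\<lambda>x. ?N s0 * excess (r x)) \<longlongrightarrow> 0) (at z within {xm..z})" using z(3) by simp
      moreover have "at z within {xm..z} = at_left z" by (rule at_within_Icc_at_left) (use xm(1) in simp)
      ultimately have lim: "((\<lambda>x. ?N s0 * excess (r x)) \<longlongrightarrow> 0) (at_left z)" by simp
      have "\<forall>\<^sub>F x in at_left z. x \<in> {xm<..<z}" by (rule eventually_at_left_real) (use xm(1) in simp)
      then have "\<forall>\<^sub>F x in at_left z. ?N m * ?N m \<le> ?N s0 * excess (r x)"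
      proof (rule eventually_mono)
        fix x assume "x \<in> {xm<..<z}"
        then show "?N m * ?N m \<le> ?N s0 * excess (r x)" using xm(1) by (intro low) simp_all
      qed
      from tendsto_lowerbound[OF lim this] have "?N m * ?N m \<le> 0" by (simp add: trivial_limit_at_left_real)
      then show ?thesis using mult_pos_pos[OF Nm Nm] by linarith
    qed (use z in simp)
  qed
  then show ?thesis by (rule excess_zero[OF curve_density[OF r t]])
qed

lemma stationary_tangents:
  assumes "\<rho> \<in> densities S" "uu \<rho> = (\<lambda>x. 0)" "AE x in vol S. M_op S \<rho> (uu \<rho>) x = a *\<^sub>R uu \<rho> x" and x: "x \<in> pts S"
  shows "KS \<rho> x = 0" "KW \<rho> x = 0"
proof -
  interpret E: stein_entropy S \<rho> \<pi> by (rule entropy_at[OF assms(1)])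
  have z: "AE x in vol S. M_op S \<rho> (uu \<rho>) x = s *\<^sub>R uu \<rho> x" for s using assms(3) unfolding assms(2) by simp
  have "KS \<rho> x = s * KW \<rho> x" for s using E.tangents_proportional_iff[of s] z x by simp
  from this[of 0] this[of 1] show "KS \<rho> x = 0" "KW \<rho> x = 0" by simp_all
qed

lemma uu_pi: "uu \<pi> = (\<lambda>x. 0)"
proof -
  have "log_ratio \<pi> \<pi> = (\<lambda>x. 0)" unfolding log_ratio_def
  proof
    fix x show "ln (\<pi> x / \<pi> x) = 0" by (cases "\<pi> x = 0") simp_all
  qed
  then show ?thesis unfolding entropy_grad_def by (simp add: grad_const)
qed

text \<open>The factor between the two tangents, wherever they are proportional.  At \<open>\<pi>\<close>
  both tangents vanish, and the value \<open>1\<close> is a choice.\<close>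

definition speed :: "('a \<Rightarrow> real) \<Rightarrow> real" where
  "speed \<rho> = (if \<rho> = \<pi> then 1 else rkhs_inner S (bb \<rho>) (bb \<rho>) / L2_inner S \<rho> (uu \<rho>) (uu \<rho>))"

lemma speed:
  assumes r: "\<rho> \<in> densities S" and a: "a > 0" "AE x in vol S. M_op S \<rho> (uu \<rho>) x = a *\<^sub>R uu \<rho> x"
  shows "speed \<rho> > 0" "x \<in> pts S \<Longrightarrow> KS \<rho> x = speed \<rho> * KW \<rho> x"
proof -
  interpret E: stein_entropy S \<rho> \<pi> by (rule entropy_at[OF r])
  have *: "speed \<rho> = a" if "\<rho> \<noteq> \<pi>"
    using E.steady_state that E.M_op_proportional_norm[OF a(2)] by (auto simp: speed_def)
  show "speed \<rho> > 0" using * a(1) by (cases "\<rho> = \<pi>") (simp_all add: speed_def)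
  show "KS \<rho> x = speed \<rho> * KW \<rho> x" if x: "x \<in> pts S"
  proof (cases "\<rho> = \<pi>")
    case True
    then have "uu \<rho> = (\<lambda>x. 0)" using uu_pi by simp
    from stationary_tangents[OF r this a(2) x] show ?thesis by simp
  next
    case False
    then show ?thesis using E.tangents_proportional_iff[of a] a(2) x * by simp
  qed
qed

text \<open>By the reproducing property, \<open>\<parallel>b\<parallel>\<^sup>2 = \<langle>u,
  b\<rangle>\<close>, which is at most the product of the norms in
  \<open>L\<^sup>2(\<rho>)\<close>; the norm of \<open>b\<close> in
  \<open>L\<^sup>2(\<rho>)\<close> is bounded by its norm in the Hilbert space, with a constant
  that does not depend on \<open>\<rho>\<close> because \<open>\<rho>\<close> has integral
  \<open>1\<close>.\<close>

lemma speed_bound: "\<exists>C. \<forall>\<rho>\<in>densities S. speed \<rho> \<le> C"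
proof -
  obtain C where C: "C \<ge> 0" "\<forall>V\<in>rkhs S. \<forall>p\<in>pts S. metric S p (V p) (V p) \<le> C * rkhs_inner S V V"
    using rkhs_metric_bound by (elim exE conjE) (rule that)
  have "speed \<rho> \<le> C + 1" if r: "\<rho> \<in> densities S" for \<rho>
  proof (cases "\<rho> = \<pi>")
    case False
    interpret E: stein_entropy S \<rho> \<pi> by (rule entropy_at[OF r])
    let ?n = "rkhs_inner S (bb \<rho>) (bb \<rho>)" and ?U = "L2_inner S \<rho> (uu \<rho>) (uu \<rho>)"
    have n: "0 \<le> ?n" by (rule RK.nonneg[OF E.b_rkhs])
    have U: "0 < ?U" using E.steady_state False E.L2.nonneg[OF E.u_L2] by (cases "?U = 0") auto
    have "L2_inner S \<rho> (bb \<rho>) (bb \<rho>) \<le> (\<integral>x. C * ?n * \<rho> x \<partial>vol S)"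
      unfolding L2_inner_def
    proof (rule integral_mono)
      show "integrable (vol S) (\<lambda>x. metric S x (bb \<rho> x) (bb \<rho> x) * \<rho> x)" by (rule E.L2_pair_integrable[OF E.b_L2 E.b_L2])
      show "integrable (vol S) (\<lambda>x. C * ?n * \<rho> x)" by (rule integrable_mult_right[OF integrable_Mk[OF E.rho_Mk]])
      fix x assume "x \<in> space (vol S)"
      then have x: "x \<in> pts S" by (simp add: space_vol)
      show "metric S x (bb \<rho> x) (bb \<rho> x) * \<rho> x \<le> C * ?n * \<rho> x"
        by (rule mult_right_mono[OF C(2)[rule_format, OF E.b_rkhs x] less_imp_le[OF E.rho_pos[OF x]]])
    qed
    also have "\<dots> = C * ?n" using E.rho_integral by simp
    finally have B: "L2_inner S \<rho> (bb \<rho>) (bb \<rho>) \<le> C * ?n" .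
    have "?n = L2_inner S \<rho> (uu \<rho>) (bb \<rho>)" by (rule E.b_norm)
    also have "\<dots> \<le> sqrt ?U * sqrt (L2_inner S \<rho> (bb \<rho>) (bb \<rho>))"
      using E.L2.Cauchy_Schwarz[OF E.u_L2 E.b_L2] by simp
    also have "\<dots> \<le> sqrt ?U * sqrt (C * ?n)" by (rule mult_left_mono[OF real_sqrt_le_mono[OF B]]) (use U in simp)
    finally have le: "?n \<le> sqrt (?U * (C * ?n))" by (simp add: real_sqrt_mult)
    have "?n * ?n \<le> ?U * (C * ?n)"
    proof -
      have "?n\<^sup>2 \<le> (sqrt (?U * (C * ?n)))\<^sup>2" by (rule power_mono[OF le n])
      then show ?thesis using U C(1) n by (simp add: power2_eq_square)
    qed
    then have "?n \<le> C * ?U" using n U C(1) by (cases "?n = 0") (simp_all add: mult_ac)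
    then show ?thesis using False U C(1) by (simp add: speed_def divide_le_eq distrib_right)
  qed (use C in \<open>simp add: speed_def\<close>)
  then show ?thesis by blast
qed

lemma speed_continuous:
  assumes r: "law_curve S J r" shows "continuous_on {t \<in> J. r t \<noteq> \<pi>} (\<lambda>t. speed (r t))"
proof -
  let ?U = "\<lambda>t. L2_inner S (r t) (uu (r t)) (uu (r t))"
  have "continuous_on J ?U" unfolding L2_inner_def
    by (rule integral_continuous[OF Mfam_mult[OF Mfam_metric[OF curve_u[OF r] curve_u[OF r]] curve_Mfam[OF r]]])
  then have U: "continuous_on {t \<in> J. r t \<noteq> \<pi>} ?U" by (rule continuous_on_subset) simp
  have n: "?U t \<noteq> 0" if "t \<in> {t \<in> J. r t \<noteq> \<pi>}" for t
    using riem_entropy.steady_state[OF stein_entropy.axioms(2)[OF entropy_at[OF curve_density[OF r]]]] that by auto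
  have "continuous_on {t \<in> J. r t \<noteq> \<pi>} (\<lambda>t. rkhs_inner S (bb (r t)) (bb (r t)) / ?U t)"
    by (rule continuous_on_divide[OF continuous_on_subset[OF curve_b_continuous[OF r]] U]) (use n in auto)
  then show ?thesis by (rule continuous_on_cong[THEN iffD1, rotated -1]) (simp_all add: speed_def)
qed

lemma flow_reparametrisation:
  assumes r: "law_curve S J r" and c: "continuous_on J c" "\<And>t. t \<in> J \<Longrightarrow> 0 < (c t :: real)"
    and der: "\<And>t x. t \<in> J \<Longrightarrow> x \<in> pts S \<Longrightarrow> ((\<lambda>s. r s x) has_real_derivative - (c t * K (r t) x)) (at t within J)"
  shows "\<exists>J' \<tau>. time_change \<tau> J' J \<and> law_curve S J' (r \<circ> \<tau>) \<and>
    (\<forall>t\<in>J'. \<forall>x\<in>pts S. ((\<lambda>s. (r \<circ> \<tau>) s x) has_real_derivative - K ((r \<circ> \<tau>) t) x) (at t within J'))"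
proof -
  have d: "((\<lambda>s. r s x) has_real_derivative c t * - K (r t) x) (at t within J)" if "t \<in> J" "x \<in> pts S" for t x
    using der[OF that] by simp
  show ?thesis
  proof (rule reparametrised_curve[OF r c d])
    fix J' \<tau> assume h: "time_change \<tau> J' J" "law_curve S J' (r \<circ> \<tau>)"
      "\<And>s x. s \<in> J' \<Longrightarrow> x \<in> pts S \<Longrightarrow> ((\<lambda>s. (r \<circ> \<tau>) s x) has_real_derivative - K (r (\<tau> s)) x) (at s within J')"
    show ?thesis by (rule exI[of _ J'], rule exI[of _ \<tau>]) (use h in simp)
  qed
qed

text \<open>A flow in the region either rests at \<open>\<pi>\<close>, where both velocities vanish, or
  never meets \<open>\<pi>\<close>, and then the speed is continuous and the change of time is
  available.\<close>

theorem same_trajectories: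
  assumes R: "R \<subseteq> densities S"
    and a: "\<And>\<sigma>. \<sigma> \<in> R \<Longrightarrow> a \<sigma> > (0::real)" "\<And>\<sigma>. \<sigma> \<in> R \<Longrightarrow> AE x in vol S. M_op S \<sigma> (uu \<sigma>) x = a \<sigma> *\<^sub>R uu \<sigma> x"
  shows "same_unparametrised_trajectories S \<pi> R"
proof -
  obtain C where C: "\<forall>\<rho>\<in>densities S. speed \<rho> \<le> C" using speed_bound by (elim exE) (rule that)
  have sp: "speed \<sigma> > 0" and KSW: "\<And>x. x \<in> pts S \<Longrightarrow> KS \<sigma> x = speed \<sigma> * KW \<sigma> x" if "\<sigma> \<in> R" for \<sigma>
    using speed[OF subsetD[OF R that] a(1)[OF that] a(2)[OF that]] by simp_all
  have all_or_none: "(\<forall>t\<in>J. r t = \<pi>) \<or> (\<forall>t\<in>J. r t \<noteq> \<pi>)"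
    if r: "law_curve S J r" and c: "\<And>t. t \<in> J \<Longrightarrow> 0 < c t" "\<And>t. t \<in> J \<Longrightarrow> c t \<le> B"
      "continuous_on {t \<in> J. r t \<noteq> \<pi>} c"
      and der: "\<And>t x. t \<in> J \<Longrightarrow> x \<in> pts S \<Longrightarrow> ((\<lambda>s. r s x) has_real_derivative - c t * KW (r t) x) (at t within J)" for J r c B
    using equilibrium_propagates[OF r c der] by blast
  have still: "\<exists>J' \<tau>. time_change \<tau> J' J \<and> law_curve S J' (r \<circ> \<tau>) \<and>
    (\<forall>t\<in>J'. \<forall>x\<in>pts S. ((\<lambda>s. (r \<circ> \<tau>) s x) has_real_derivative - K ((r \<circ> \<tau>) t) x) (at t within J'))"
    if r: "law_curve S J r" and d: "\<And>t x. t \<in> J \<Longrightarrow> x \<in> pts S \<Longrightarrow> ((\<lambda>s. r s x) has_real_derivative - L (r t) x) (at t within J)"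
      and e: "\<And>t x. t \<in> J \<Longrightarrow> x \<in> pts S \<Longrightarrow> K (r t) x = L (r t) x" for J r and K L :: "('a \<Rightarrow> real) \<Rightarrow> 'a \<Rightarrow> real"
    by (rule flow_reparametrisation[OF r continuous_on_const[of J 1]]) (use d e in simp_all)
  show ?thesis unfolding same_unparametrised_trajectories_def
  proof (intro conjI allI impI)
    fix J r assume h: "stein_flow S \<pi> J r \<and> r ` J \<subseteq> R"
    have r: "law_curve S J r" and d: "\<And>t x. t \<in> J \<Longrightarrow> x \<in> pts S \<Longrightarrow> ((\<lambda>s. r s x) has_real_derivative - KS (r t) x) (at t within J)"
      using h unfolding stein_flow_def by simp_all
    have rR: "r t \<in> R" if "t \<in> J" for t using h that by blast
    have d': "((\<lambda>s. r s x) has_real_derivative - speed (r t) * KW (r t) x) (at t within J)" if "t \<in> J" "x \<in> pts S" for t x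
      using d[OF that] KSW[OF rR[OF that(1)] that(2)] by simp
    have "(\<forall>t\<in>J. r t = \<pi>) \<or> (\<forall>t\<in>J. r t \<noteq> \<pi>)"
      by (rule all_or_none[OF r sp[OF rR] C[rule_format, OF curve_density[OF r]] speed_continuous[OF r] d'])
    then show "\<exists>J' \<tau>. time_change \<tau> J' J \<and> wasserstein_flow S \<pi> J' (r \<circ> \<tau>)"
    proof (elim disjE)
      assume eq: "\<forall>t\<in>J. r t = \<pi>"
      have e: "KW (r t) x = KS (r t) x" if "t \<in> J" "x \<in> pts S" for t x
        using KSW[OF rR[OF that(1)] that(2)] eq that(1) by (simp add: speed_def)
      show ?thesis unfolding wasserstein_flow_def by (rule still[OF r d e])
    next
      assume "\<forall>t\<in>J. r t \<noteq> \<pi>"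
      then have "{t \<in> J. r t \<noteq> \<pi>} = J" by blast
      with speed_continuous[OF r] have cc: "continuous_on J (\<lambda>t. speed (r t))" by simp
      show ?thesis unfolding wasserstein_flow_def by (rule flow_reparametrisation[OF r cc sp[OF rR]]) (use d' in simp_all)
    qed
  next
    fix J r assume h: "wasserstein_flow S \<pi> J r \<and> r ` J \<subseteq> R"
    have r: "law_curve S J r" and d: "\<And>t x. t \<in> J \<Longrightarrow> x \<in> pts S \<Longrightarrow> ((\<lambda>s. r s x) has_real_derivative - KW (r t) x) (at t within J)"
      using h unfolding wasserstein_flow_def by simp_all
    have rR: "r t \<in> R" if "t \<in> J" for t using h that by blast
    have "(\<forall>t\<in>J. r t = \<pi>) \<or> (\<forall>t\<in>J. r t \<noteq> \<pi>)"
      by (rule all_or_none[OF r, of "\<lambda>_. 1" 1]) (use d in simp_all)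
    then show "\<exists>J' \<tau>. time_change \<tau> J' J \<and> stein_flow S \<pi> J' (r \<circ> \<tau>)"
    proof (elim disjE)
      assume eq: "\<forall>t\<in>J. r t = \<pi>"
      have e: "KS (r t) x = KW (r t) x" if "t \<in> J" "x \<in> pts S" for t x
        using KSW[OF rR[OF that(1)] that(2)] eq that(1) by (simp add: speed_def)
      show ?thesis unfolding stein_flow_def by (rule still[OF r d e])
    next
      assume "\<forall>t\<in>J. r t \<noteq> \<pi>"
      then have "{t \<in> J. r t \<noteq> \<pi>} = J" by blast
      with speed_continuous[OF r] have cc: "continuous_on J (\<lambda>t. speed (r t))" by simp
      have nz: "speed (r t) \<noteq> 0" if "t \<in> J" for t using sp[OF rR[OF that]] by simp
      show ?thesis unfolding stein_flow_def
      proof (rule flow_reparametrisation[OF r, of "\<lambda>t. 1 / speed (r t)"])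
        show "continuous_on J (\<lambda>t. 1 / speed (r t))" by (intro continuous_on_divide continuous_on_const cc ballI nz)
        show "0 < 1 / speed (r t)" if "t \<in> J" for t using sp[OF rR[OF that]] by simp
        show "((\<lambda>s. r s x) has_real_derivative - (1 / speed (r t) * KS (r t) x)) (at t within J)"
          if "t \<in> J" "x \<in> pts S" for t x
          using d[OF that] KSW[OF rR[OF that(1)] that(2)] nz[OF that(1)] by simp
      qed
    qed
  qed
qed

end


section \<open>Kernels of rank one\<close>

text \<open>Meaningful only if \<open>e\<close> is not the zero field and \<open>U\<close> is a multiple of
  it.\<close>

definition coefficient :: "('a \<Rightarrow> 'v::real_vector) \<Rightarrow> ('a \<Rightarrow> 'v) \<Rightarrow> real" where
  "coefficient e U = (THE r. U = (\<lambda>x. r *\<^sub>R e x))"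

text \<open>The kernel \<open>k(x,y) v = \<langle>e(x), v\<rangle> e(y)\<close>.  Its reproducing kernel
  Hilbert space is spanned by \<open>e\<close>, and \<open>e\<close> has norm \<open>1\<close> in
  it.\<close>

definition rank_one :: "('a, 'n) vfield \<Rightarrow> ('a, 'n::finite) stein \<Rightarrow> ('a, 'n) stein" where
  "rank_one e S = S\<lparr>kernel := \<lambda>x y v. metric S x (e x) v *\<^sub>R e y, rkhs := range (\<lambda>r x. r *\<^sub>R e x),
     rkhs_inner := \<lambda>U V. coefficient e U * coefficient e V\<rparr>"

lemma coefficient: "e \<noteq> (\<lambda>x. 0) \<Longrightarrow> coefficient e (\<lambda>x. r *\<^sub>R e x) = r"
  unfolding coefficient_def
proof (rule the_equality)
  fix s assume e: "e \<noteq> (\<lambda>x. 0)" and s: "(\<lambda>x. r *\<^sub>R e x) = (\<lambda>x. s *\<^sub>R e x)"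
  obtain x where x: "e x \<noteq> 0" using e by (auto simp: fun_eq_iff)
  have "r *\<^sub>R e x = s *\<^sub>R e x" using fun_cong[OF s] .
  then show "s = r" using x by simp
qed simp

lemma rank_one_fields [simp]:
  "mtop (rank_one e S) = mtop S" "atlas (rank_one e S) = atlas S" "metric (rank_one e S) = metric S" "vol (rank_one e S) = vol S"
  "kernel (rank_one e S) = (\<lambda>x y v. metric S x (e x) v *\<^sub>R e y)" "rkhs (rank_one e S) = range (\<lambda>r x. r *\<^sub>R e x)"
  "rkhs_inner (rank_one e S) = (\<lambda>U V. coefficient e U * coefficient e V)"
  by (simp_all add: rank_one_def)

lemma rank_one_geometry1 [simp]:
  "chart_at (rank_one e S) = chart_at S" "smooth_fun (rank_one e S) = smooth_fun S"
  "L2_inner (rank_one e S) = L2_inner S"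
  by (simp_all add: chart_at_def smooth_fun_def L2_inner_def fun_eq_iff)

lemma rank_one_geometry2 [simp]:
  "coord (rank_one e S) = coord S" "frame (rank_one e S) = frame S" "grad (rank_one e S) = grad S"
  "densities (rank_one e S) = densities S"
  by (simp_all add: coord_def frame_def grad_def densities_def fun_eq_iff)

lemma rank_one_geometry3 [simp]:
  "gram (rank_one e S) = gram S" "C1_vfield (rank_one e S) = C1_vfield S" "entropy_grad (rank_one e S) = entropy_grad S"
  by (simp_all add: gram_def C1_vfield_def entropy_grad_def fun_eq_iff)

lemma rank_one_closed_riemannian [simp]: "closed_riemannian (rank_one e S) = closed_riemannian S"
  by (simp add: closed_riemannian_def closed_oriented_manifold_def riemannian_metric_def riemannian_volume_def)

locale rank_one_kernel = riem S for S :: "('a, 'n::finite) stein" +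
  fixes e :: "('a, 'n) vfield"
  assumes e_outside: "\<And>x. x \<notin> pts S \<Longrightarrow> e x = 0" and e_Vk: "\<And>k. Vk k e" and e_ne: "e \<noteq> (\<lambda>x. 0)"
begin

lemma coefficient_e [simp]: "coefficient e (\<lambda>x. r *\<^sub>R e x) = r"
  by (rule coefficient[OF e_ne])

lemma coefficient_0 [simp]: "coefficient e (\<lambda>x. 0) = 0"
  using coefficient_e[of 0] by simp

lemma coefficient_combination [simp]:
  "coefficient e (\<lambda>x. r *\<^sub>R e x + s *\<^sub>R e x) = r + s"
  "coefficient e (\<lambda>x. r *\<^sub>R e x - s *\<^sub>R e x) = r - s"
  "coefficient e (\<lambda>x. r *\<^sub>R s *\<^sub>R e x) = r * s"
  using coefficient_e[of "r + s"] coefficient_e[of "r - s"] coefficient_e[of "r * s"]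
  by (simp_all add: scaleR_left_distrib scaleR_left_diff_distrib)

lemma rank_one_norm: "rkhs_norm (rank_one e S) (\<lambda>x. r *\<^sub>R e x) = \<bar>r\<bar>"
  by (simp add: rkhs_norm_def)

lemma rank_one_hilbert: "hilbert_space_of_fields (rank_one e S)"
proof -
  let ?T = "rank_one e S"
  have cauchy: "\<exists>L\<in>rkhs ?T. (\<lambda>n. rkhs_norm ?T (\<lambda>x. F n x - L x)) \<longlonglongrightarrow> 0"
    if F: "\<forall>n. F n \<in> rkhs ?T" and C: "\<forall>d>0. \<exists>N. \<forall>m\<ge>N. \<forall>n\<ge>N. rkhs_norm ?T (\<lambda>x. F m x - F n x) < d" for F :: "nat \<Rightarrow> _"
  proof -
    have "\<forall>n. \<exists>r. F n = (\<lambda>x. r *\<^sub>R e x)" using F by (simp add: image_iff)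
    from choice[OF this] obtain r where r: "\<forall>n. F n = (\<lambda>x. r n *\<^sub>R e x)" by (elim exE) (rule that)
    have d: "rkhs_norm ?T (\<lambda>x. F m x - F n x) = \<bar>r m - r n\<bar>" for m n
      using rank_one_norm[of "r m - r n"] by (simp add: r scaleR_left_diff_distrib)
    have "Cauchy r" unfolding Cauchy_def dist_real_def using C unfolding d .
    then obtain l where l: "r \<longlonglongrightarrow> l" using Cauchy_convergent_iff convergent_def by blast
    have "(\<lambda>n. \<bar>r n - l\<bar>) \<longlonglongrightarrow> 0" using tendsto_rabs[OF LIM_zero[OF l]] by simp
    moreover have "rkhs_norm ?T (\<lambda>x. F n x - l *\<^sub>R e x) = \<bar>r n - l\<bar>" for n
      using rank_one_norm[of "r n - l"] by (simp add: r scaleR_left_diff_distrib)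
    ultimately show ?thesis by (intro bexI[of _ "\<lambda>x. l *\<^sub>R e x"]) simp_all
  qed
  have mem: "(\<lambda>x. s *\<^sub>R r *\<^sub>R e x) \<in> range (\<lambda>r x. r *\<^sub>R e x)" "(\<lambda>x. s *\<^sub>R e x + r *\<^sub>R e x) \<in> range (\<lambda>r x. r *\<^sub>R e x)" for r s
    using rangeI[of "\<lambda>r x. r *\<^sub>R e x" "s * r"] rangeI[of "\<lambda>r x. r *\<^sub>R e x" "s + r"] by (simp_all add: scaleR_left_distrib)
  have zero: "(\<lambda>x. 0) \<in> range (\<lambda>r x. r *\<^sub>R e x)" using rangeI[of "\<lambda>r x. r *\<^sub>R e x" 0] by simp
  show ?thesis unfolding hilbert_space_of_fields_def
  proof (intro conjI)
    show "\<forall>F :: nat \<Rightarrow> _. (\<forall>n. F n \<in> rkhs ?T) \<and> (\<forall>d>0. \<exists>N. \<forall>m\<ge>N. \<forall>n\<ge>N. rkhs_norm ?T (\<lambda>x. F m x - F n x) < d) \<longrightarrow>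
      (\<exists>L\<in>rkhs ?T. (\<lambda>n. rkhs_norm ?T (\<lambda>x. F n x - L x)) \<longlonglongrightarrow> 0)"
      using cauchy by (intro allI impI) (elim conjE)
    show "\<forall>V\<in>rkhs ?T. V \<noteq> (\<lambda>x. 0) \<longrightarrow> rkhs_inner ?T V V > 0"
    proof (intro ballI impI)
      fix V assume V: "V \<in> rkhs ?T" "V \<noteq> (\<lambda>x. 0)"
      then obtain r where r: "V = (\<lambda>x. r *\<^sub>R e x)" by auto
      then have "r \<noteq> 0" using V(2) by auto
      then show "rkhs_inner ?T V V > 0" unfolding r by (auto simp: zero_less_mult_iff neq_iff)
    qed
  qed (simp_all add: e_outside mem zero algebra_simps)
qed

lemma rank_one_reproducing: "reproducing_space (rank_one e S)"
  unfolding reproducing_space_def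
proof (intro conjI ballI allI rank_one_hilbert)
  fix x v assume "x \<in> pts (rank_one e S)"
  then have x: "x \<in> pts S" by simp
  have ks: "kernel_section (rank_one e S) x v = (\<lambda>y. metric S x (e x) v *\<^sub>R e y)"
    unfolding kernel_section_def by (auto simp: fun_eq_iff e_outside)
  show "kernel_section (rank_one e S) x v \<in> rkhs (rank_one e S)" unfolding ks by simp
  fix V assume "V \<in> rkhs (rank_one e S)"
  then obtain r where r: "V = (\<lambda>x. r *\<^sub>R e x)" by auto
  show "rkhs_inner (rank_one e S) V (kernel_section (rank_one e S) x v) = metric (rank_one e S) x (V x) v"
    unfolding ks r by (simp add: metric_scale[OF x])
qed

lemma e_coord_Ck: "c \<in> atlas S \<Longrightarrow> Ck k (img c) (\<lambda>y. coord S c e (cinv c y))"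
  using e_Vk[of k] unfolding Vfam_def by simp

lemma rank_one_smooth: "smooth_pd_kernel (rank_one e S)"
  unfolding smooth_pd_kernel_def
proof (intro conjI ballI allI impI)
  let ?T = "rank_one e S"
  fix x y assume xy: "x \<in> pts ?T" "y \<in> pts ?T"
  then have x: "x \<in> pts S" and y: "y \<in> pts S" by simp_all
  show "linear (kernel ?T x y)"
    by (rule linearI) (simp_all add: metric_add[OF x] metric_scale[OF x] scaleR_left_distrib)
  fix v w show "metric ?T y (kernel ?T x y v) w = metric ?T x v (kernel ?T y x w)"
    by (simp add: metric_scale[OF x] metric_scale[OF y] metric_sym[OF x, of v])
next
  let ?T = "rank_one e S"
  fix F :: "'a set" and v assume F: "finite F \<and> F \<subseteq> pts ?T"
  have "(\<Sum>x\<in>F. \<Sum>y\<in>F. metric ?T y (kernel ?T x y (v x)) (v y)) = (\<Sum>x\<in>F. \<Sum>y\<in>F. metric S x (e x) (v x) * metric S y (e y) (v y))"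
    using F by (intro sum.cong refl) (simp add: metric_scale subset_iff)
  also have "\<dots> = (\<Sum>x\<in>F. metric S x (e x) (v x)) * (\<Sum>x\<in>F. metric S x (e x) (v x))"
    by (simp add: sum_product)
  finally show "0 \<le> (\<Sum>x\<in>F. \<Sum>y\<in>F. metric ?T y (kernel ?T x y (v x)) (v y))" by simp
next
  let ?T = "rank_one e S"
  fix c d w assume "c \<in> atlas ?T" "d \<in> atlas ?T"
  then have c: "c \<in> atlas S" and d: "d \<in> atlas S" by simp_all
  let ?f = "\<lambda>a. \<Sum>i\<in>UNIV. \<Sum>j\<in>UNIV. coord S c e (cinv c a) $ i * w $ j * gram S c (cinv c a) $ i $ j"
  have op: "open (img c \<times> img d)" by (rule open_Times[OF open_img[OF c] open_img[OF d]])
  have f: "Ck k (img c) ?f" for k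
    by (intro Cfam_sum Cfam_mult Cfam_nth[OF open_img[OF c] e_coord_Ck[OF c]] Cfam_const gram_Cfam[OF c] open_img[OF c])
  have fst: "Ck k (img c \<times> img d) (\<lambda>z. fst z)" and snd: "Ck k (img c \<times> img d) (\<lambda>z. snd z)" for k
    by (rule Cfam_linear[OF op bounded_linear_fst Ck_ident[OF op]], rule Cfam_linear[OF op bounded_linear_snd Ck_ident[OF op]])
  have f1: "Ck k (img c \<times> img d) (\<lambda>z. ?f (fst z))" for k
    by (rule Cfam_compose[OF op _ f fst]) (simp only: mem_Times_iff)
  have f2: "Ck k (img c \<times> img d) (\<lambda>z. coord S d e (cinv d (snd z)))" for k
    by (rule Cfam_compose[OF op _ e_coord_Ck[OF d] snd]) (simp only: mem_Times_iff)
  have "Ck k (img c \<times> img d) (\<lambda>(a, b). comps d (cinv d b) (metric S (cinv c a) (e (cinv c a)) (frame S c (cinv c a) w) *\<^sub>R e (cinv d b)))" for k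
  proof (rule Cfam_cong[OF op, THEN iffD1, OF _ Cfam_scaleR[OF op f1 f2]])
    fix z assume "z \<in> img c \<times> img d"
    then have a: "fst z \<in> img c" and b: "snd z \<in> img d" by (simp_all only: mem_Times_iff)
    have "metric S (cinv c (fst z)) (e (cinv c (fst z))) (frame S c (cinv c (fst z)) w) = ?f (fst z)"
      by (simp only: metric_coords[OF c cinv_in[OF a]] comps_frame[OF c cinv_in[OF a]] coord_comps)
    then show "?f (fst z) *\<^sub>R coord S d e (cinv d (snd z)) =
      (\<lambda>(a, b). comps d (cinv d b) (metric S (cinv c a) (e (cinv c a)) (frame S c (cinv c a) w) *\<^sub>R e (cinv d b))) z"
      by (simp only: case_prod_unfold coord_comps linear_scale[OF comps_linear[OF d cinv_in[OF b]]])
  qed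
  then show "smooth_on (img c \<times> img d) (\<lambda>(a, b). jac (chart_at ?T (cinv d b)) d (cinv d b) (kernel ?T (cinv c a) (cinv d b) (frame ?T c (cinv c a) w)))"
    unfolding smooth_on_iff[OF op] by simp
qed

lemma rank_one_C1: "continuously_in_C1 (rank_one e S)"
  unfolding continuously_in_C1_def
proof (intro conjI ballI allI impI)
  fix V assume "V \<in> rkhs (rank_one e S)"
  then obtain r where r: "V = (\<lambda>x. r *\<^sub>R e x)" by auto
  have "Vk 1 (\<lambda>x. r *\<^sub>R e x)" by (rule Vfam_scaleR[OF Mfam_const e_Vk])
  then show "C1_vfield (rank_one e S) V"
    unfolding C1_vfield_def r rank_one_fields rank_one_geometry2 Vfam_def comp_def
    using C1_on_iff[OF open_img] e_outside by (metis scaleR_zero_right)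
next
  fix c K assume "c \<in> atlas (rank_one e S)" and K: "compact K \<and> K \<subseteq> img c"
  then have c: "c \<in> atlas S" by simp
  let ?g = "\<lambda>y. coord S c e (cinv c y)"
  have g1: "Ck (Suc 0) (img c) ?g" by (rule e_coord_Ck[OF c])
  have bd: "\<exists>B. \<forall>y\<in>K. norm (h y) \<le> B" if "Ck 0 (img c) h" for h :: "real ^ 'n \<Rightarrow> real ^ 'n"
  proof -
    have "continuous_on K h" by (rule continuous_on_subset[OF Ck_continuous[OF that]]) (use K in simp)
    from compact_imp_bounded[OF compact_continuous_image[OF this]] K show ?thesis unfolding bounded_iff by simp
  qed
  obtain A where A: "\<forall>y\<in>K. norm (?g y) \<le> A" using bd[OF e_coord_Ck[OF c]] by (elim exE) (rule that)
  have "\<forall>b. \<exists>B. \<forall>y\<in>K. norm (frechet_derivative ?g (at y) b) \<le> B"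
    by (intro allI bd) (rule Cfam_deriv[OF g1])
  from choice[OF this] obtain B where B: "\<forall>b. \<forall>y\<in>K. norm (frechet_derivative ?g (at y) b) \<le> B b" by (elim exE) (rule that)
  define D where "D = (\<Sum>b\<in>Basis. \<bar>B b\<bar>)"
  have gw: "norm (frechet_derivative ?g (at y) w) \<le> D * norm w" if y: "y \<in> K" for y w
  proof -
    have "(?g has_derivative frechet_derivative ?g (at y)) (at y)"
      using Cfam_has_derivative[OF g1] y K by auto
    then have lin: "linear (frechet_derivative ?g (at y))" by (rule has_derivative_linear)
    have "frechet_derivative ?g (at y) w = frechet_derivative ?g (at y) (\<Sum>b\<in>Basis. (w \<bullet> b) *\<^sub>R b)"
      by (simp add: euclidean_representation)
    also have "\<dots> = (\<Sum>b\<in>Basis. (w \<bullet> b) *\<^sub>R frechet_derivative ?g (at y) b)"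
      by (simp only: linear_sum[OF lin] linear_scale[OF lin])
    also have "norm \<dots> \<le> (\<Sum>b\<in>Basis. \<bar>B b\<bar> * norm w)"
    proof (rule sum_norm_le)
      fix b :: "real ^ 'n" assume b: "b \<in> Basis"
      have 1: "\<bar>w \<bullet> b\<bar> \<le> norm w" by (rule Basis_le_norm[OF b])
      have 2: "norm (frechet_derivative ?g (at y) b) \<le> \<bar>B b\<bar>" using B y by (meson abs_ge_self order_trans)
      show "norm ((w \<bullet> b) *\<^sub>R frechet_derivative ?g (at y) b) \<le> \<bar>B b\<bar> * norm w"
        unfolding norm_scaleR mult.commute[of "\<bar>B b\<bar>"] by (rule mult_mono[OF 1 2]) simp_all
    qed
    finally show ?thesis by (simp add: D_def sum_distrib_right)
  qed
  show "\<exists>C. \<forall>V\<in>rkhs (rank_one e S). \<forall>y\<in>K.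
      norm (coord (rank_one e S) c V (cinv c y)) \<le> C * rkhs_norm (rank_one e S) V \<and>
      (\<forall>w. norm (frechet_derivative (coord (rank_one e S) c V \<circ> cinv c) (at y) w) \<le> C * rkhs_norm (rank_one e S) V * norm w)"
  proof (intro exI[of _ "max A D"] ballI)
    fix V y assume "V \<in> rkhs (rank_one e S)" and y: "y \<in> K"
    then obtain r where r: "V = (\<lambda>x. r *\<^sub>R e x)" by auto
    have yc: "y \<in> img c" using y K by auto
    have lin: "coord S c V (cinv c z) = r *\<^sub>R ?g z" if "z \<in> img c" for z
      unfolding r coord_comps by (rule linear_scale[OF comps_linear[OF c cinv_in[OF that]]])
    have "(?g has_derivative frechet_derivative ?g (at y)) (at y)" using Cfam_has_derivative[OF g1] yc by simp
    from has_derivative_transform_within_open[OF has_derivative_scaleR_right[OF this, of r] open_img[OF c] yc lin[symmetric]]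
    have "(coord S c V \<circ> cinv c has_derivative (\<lambda>w. r *\<^sub>R frechet_derivative ?g (at y) w)) (at y)" by (simp add: comp_def)
    then have fd: "frechet_derivative (coord S c V \<circ> cinv c) (at y) = (\<lambda>w. r *\<^sub>R frechet_derivative ?g (at y) w)"
      by (rule frechet_derivative_at[symmetric])
    have 1: "norm (coord S c V (cinv c y)) \<le> max A D * \<bar>r\<bar>"
      unfolding lin[OF yc] norm_scaleR mult.commute[of "max A D"] by (rule mult_left_mono) (use A y in \<open>simp_all add: le_max_iff_disj\<close>)
    have 2: "norm (frechet_derivative (coord S c V \<circ> cinv c) (at y) w) \<le> max A D * \<bar>r\<bar> * norm w" for w
    proof -
      have "norm (frechet_derivative ?g (at y) w) \<le> max A D * norm w"
        by (rule order_trans[OF gw[OF y]]) (simp add: mult_right_mono)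
      from mult_left_mono[OF this abs_ge_zero[of r]] show ?thesis unfolding fd by (simp add: mult_ac)
    qed
    show "norm (coord (rank_one e S) c V (cinv c y)) \<le> max A D * rkhs_norm (rank_one e S) V \<and>
      (\<forall>w. norm (frechet_derivative (coord (rank_one e S) c V \<circ> cinv c) (at y) w) \<le> max A D * rkhs_norm (rank_one e S) V * norm w)"
      using 1 2 unfolding r rank_one_norm by simp
  qed
qed

theorem rank_one_setting: "stein_setting (rank_one e S)"
  unfolding stein_setting_def
  using closed_riemannian rank_one_smooth rank_one_reproducing rank_one_C1 by simp

end

text \<open>The field is \<open>e = u / \<parallel>u\<parallel> + h\<close>, where \<open>h\<close> is
  obtained from \<open>grad f\<close> by subtracting its component along \<open>u\<close>.  The
  hypothesis on \<open>f\<close> says that \<open>grad f\<close> is not a multiple of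
  \<open>u\<close>, so that \<open>h\<close> is not zero.\<close>

theorem equal_dissipation_distinct_tangents:
  fixes S :: "('a, 'n::finite) stein"
  assumes "riem_entropy S \<rho> \<pi>" and ne: "\<rho> \<noteq> \<pi>" and f: "smooth_fun S f"
    and indep: "\<And>r. \<exists>p\<in>pts S. \<exists>q\<in>pts S. f p - r * log_ratio \<pi> \<rho> p \<noteq> f q - r * log_ratio \<pi> \<rho> q"
  shows "\<exists>T :: ('a, 'n) stein. stein_setting T \<and> \<pi> \<in> densities T \<and> \<rho> \<in> densities T \<and>
    L2_inner T \<rho> (entropy_grad T \<pi> \<rho>) (M_op T \<rho> (entropy_grad T \<pi> \<rho>)) =
      L2_inner T \<rho> (entropy_grad T \<pi> \<rho>) (entropy_grad T \<pi> \<rho>) \<and>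
    \<not> (\<forall>x\<in>pts T. K_W T \<rho> (log_ratio \<pi> \<rho>) x = K_S T \<rho> (log_ratio \<pi> \<rho>) x)"
proof -
  interpret E: riem_entropy S \<rho> \<pi> by fact
  let ?in = "L2_inner S \<rho>"
  have fM: "E.Mk k f" for k using f by (simp add: E.smooth_fun_iff)
  define A where "A = ?in E.u E.u"
  have A: "A > 0" using E.steady_state ne E.L2.nonneg[OF E.u_L2] unfolding A_def by (cases "?in E.u E.u = 0") auto
  \<comment> \<open>Gram-Schmidt: \<open>r u\<close> is the component of \<open>grad f\<close> along \<open>u\<close>.\<close>
  define r where "r = ?in E.u (grad S f) / A"
  define g where "g = (\<lambda>x. f x - r * E.phi x)"
  have gM: "E.Mk k g" for k unfolding g_def by (intro E.Mfam_diff E.Mfam_mult E.Mfam_const E.phi_Mk fM)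
  have gs: "smooth_fun S g" using gM by (simp add: E.smooth_fun_iff)
  define h where "h = grad S g"
  have h_eq: "h = (\<lambda>x. grad S f x + (- r) *\<^sub>R E.u x)"
  proof -
    have m: "E.Mk 1 (\<lambda>x. (- r) * E.phi x)" by (intro E.Mfam_mult E.Mfam_const E.phi_Mk)
    have "g = (\<lambda>x. f x + (- r) * E.phi x)" unfolding g_def by simp
    then show ?thesis unfolding h_def by (simp only: E.grad_add[OF fM m] E.grad_scale[OF E.phi_Mk] entropy_grad_def)
  qed
  have hL2: "h \<in> L2_fields S \<rho>" unfolding h_def by (rule E.grad_smooth_L2[OF gs])
  have uh: "?in E.u h = 0"
  proof -
    have "?in E.u h = ?in E.u (grad S f) + ?in E.u (\<lambda>x. (- r) *\<^sub>R E.u x)"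
      unfolding h_eq by (rule E.L2.add_right[OF E.grad_smooth_L2[OF f] E.L2_scale_mem[OF E.u_L2] E.u_L2])
    also have "?in E.u (\<lambda>x. (- r) *\<^sub>R E.u x) = (- r) * A"
      unfolding A_def by (rule E.L2.scale_right[OF E.u_L2 E.u_L2])
    finally have "?in E.u h = ?in E.u (grad S f) + (- r) * A" .
    then show ?thesis using A by (simp add: r_def)
  qed
  have hh: "?in h h > 0"
  proof (rule ccontr)
    assume "\<not> ?in h h > 0"
    then have z: "?in h h = 0" using E.L2.nonneg[OF hL2] by simp
    have hV: "E.Vk 0 h" unfolding h_def by (rule E.Vfam_grad[OF gM])
    obtain p q where pq: "p \<in> pts S" "q \<in> pts S" "f p - r * log_ratio \<pi> \<rho> p \<noteq> f q - r * log_ratio \<pi> \<rho> q"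
      using indep[of r] by (elim bexE) (rule that)
    have "g p = g q"
      by (rule E.zero_gradient_constant[OF gM _ pq(2,1)]) (use E.smooth_field_zero[OF hV z] in \<open>simp add: h_def\<close>)
    then show False using pq(3) by (simp add: g_def)
  qed
  \<comment> \<open>Normalised so that \<open>\<langle>u, e\<rangle> = \<parallel>u\<parallel>\<close>.\<close>
  define s where "s = 1 / sqrt A"
  define e where "e = (\<lambda>x. h x + s *\<^sub>R E.u x)"
  have e_grad: "e = grad S (\<lambda>x. g x + s * E.phi x)"
    unfolding e_def h_def entropy_grad_def
    by (simp only: E.grad_add[OF gM E.Mfam_mult[OF E.Mfam_const E.phi_Mk]] E.grad_scale[OF E.phi_Mk])
  have eM: "E.Mk k (\<lambda>x. g x + s * E.phi x)" for k by (intro E.Mfam_add E.Mfam_mult E.Mfam_const E.phi_Mk gM)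
  have eL2: "e \<in> L2_fields S \<rho>" unfolding e_grad
    by (rule E.grad_smooth_L2) (use eM in \<open>simp add: E.smooth_fun_iff\<close>)
  have ue: "?in E.u e = sqrt A"
  proof -
    have "?in E.u e = ?in E.u h + ?in E.u (\<lambda>x. s *\<^sub>R E.u x)"
      unfolding e_def by (rule E.L2.add_right[OF hL2 E.L2_scale_mem[OF E.u_L2] E.u_L2])
    also have "?in E.u (\<lambda>x. s *\<^sub>R E.u x) = s * A" unfolding A_def by (rule E.L2.scale_right[OF E.u_L2 E.u_L2])
    also have "?in E.u h + s * A = s * A" using uh by simp
    also have "\<dots> = sqrt A" using A by (simp add: s_def real_div_sqrt)
    finally show ?thesis .
  qed
  have eh: "?in e h = ?in h h"
  proof -
    have "?in e h = ?in h h + ?in (\<lambda>x. s *\<^sub>R E.u x) h"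
      unfolding e_def by (rule E.L2.add_left[OF hL2 E.L2_scale_mem[OF E.u_L2] hL2])
    also have "?in (\<lambda>x. s *\<^sub>R E.u x) h = s * ?in E.u h" by (rule E.L2.scale_left[OF E.u_L2 hL2])
    finally have "?in e h = ?in h h + s * ?in E.u h" .
    then show ?thesis using uh by simp
  qed
  interpret R: rank_one_kernel S e
  proof unfold_locales
    show "e x = 0" if "x \<notin> pts S" for x unfolding e_grad by (rule E.grad_outside[OF that])
    show "E.Vk k e" for k unfolding e_grad by (rule E.Vfam_grad[OF eM])
    show "e \<noteq> (\<lambda>x. 0)"
    proof
      assume z: "e = (\<lambda>x. 0)"
      have "?in E.u e = 0" using E.L2.scale_right[OF eL2 E.u_L2, of 0] unfolding z by simp
      then show False using ue A by simp
    qed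
  qed
  let ?T = "rank_one e S"
  have \<rho>T: "\<rho> \<in> densities ?T" and \<pi>T: "\<pi> \<in> densities ?T" using E.density E.P.density by simp_all
  interpret T: stein_entropy ?T \<rho> \<pi>
    by unfold_locales (use R.rank_one_setting \<rho>T \<pi>T in \<open>simp_all add: stein_setting_def\<close>)
  have b: "T.b = (\<lambda>x. sqrt A *\<^sub>R e x)"
  proof (rule T.I_adj_unique[OF T.u_L2])
    show "(\<lambda>x. sqrt A *\<^sub>R e x) \<in> rkhs ?T" by simp
    show "\<forall>k\<in>rkhs ?T. rkhs_inner ?T (\<lambda>x. sqrt A *\<^sub>R e x) k = L2_inner ?T \<rho> T.u k"
    proof
      fix k assume "k \<in> rkhs ?T"
      then obtain c where k: "k = (\<lambda>x. c *\<^sub>R e x)" by auto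
      have "L2_inner ?T \<rho> T.u k = c * sqrt A"
        unfolding k using E.L2.scale_right[OF eL2 E.u_L2, of c] ue by simp
      then show "rkhs_inner ?T (\<lambda>x. sqrt A *\<^sub>R e x) k = L2_inner ?T \<rho> T.u k" unfolding k by (simp add: R.coefficient_e)
    qed
  qed
  have eq: "L2_inner ?T \<rho> T.u (M_op ?T \<rho> T.u) = L2_inner ?T \<rho> T.u T.u"
  proof -
    have "L2_inner ?T \<rho> T.u (M_op ?T \<rho> T.u) = sqrt A * sqrt A"
      unfolding T.M_op_inner b using E.L2.scale_right[OF eL2 E.u_L2, of "sqrt A"] ue by simp
    also have "\<dots> = L2_inner ?T \<rho> T.u T.u" using A by (simp add: A_def)
    finally show ?thesis .
  qed
  have ne: "\<not> (\<forall>x\<in>pts ?T. K_W ?T \<rho> T.phi x = K_S ?T \<rho> T.phi x)"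
  proof
    assume k: "\<forall>x\<in>pts ?T. K_W ?T \<rho> T.phi x = K_S ?T \<rho> T.phi x"
    have gT: "T.Mk 1 g" using gs T.smooth_fun_iff by simp
    have "L2_inner ?T \<rho> T.u (grad ?T g) = L2_inner ?T \<rho> T.b (grad ?T g)"
      unfolding T.K_W_weak[OF gT, symmetric] T.K_S_weak[OF gT, symmetric]
      by (rule Bochner_Integration.integral_cong[OF refl]) (use k in \<open>simp only: T.space_vol\<close>)
    then have "?in E.u h = ?in (\<lambda>x. sqrt A *\<^sub>R e x) h" unfolding b h_def by simp
    then have "sqrt A * ?in h h = 0" using E.L2.scale_left[OF eL2 hL2, of "sqrt A"] uh eh by simp
    then show False using A hh by simp
  qed
  show ?thesis by (rule exI[of _ ?T]) (use R.rank_one_setting \<rho>T \<pi>T eq ne in blast)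
qed

section \<open>The unit circle\<close>

lemma Ck_sin_cos: "Ck k UNIV (\<lambda>t::real. a * cos t + b * sin t)"
proof (induction k arbitrary: a b)
  case 0
  show ?case unfolding Ck_0 by (intro continuous_intros)
next
  case (Suc k)
  show ?case
  proof (rule Ck_SucI[OF open_UNIV])
    show "((\<lambda>t. a * cos t + b * sin t) has_derivative (\<lambda>v. (b * v) * cos t + (- a * v) * sin t)) (at t)" for t :: real
      by (auto intro!: derivative_eq_intros simp: algebra_simps)
    show "Ck k UNIV (\<lambda>t. (b * v) * cos t + (- a * v) * sin t)" for v by (rule Suc.IH)
  qed
qed

abbreviation circle :: "complex set" where "circle \<equiv> sphere 0 1"

abbreviation straight :: "(real ^ 1) set" where "straight \<equiv> {y. - pi < y $ 1 \<and> y $ 1 < pi}"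

text \<open>For \<open>\<epsilon>\<close> equal to \<open>1\<close> or \<open>- 1\<close> the chart is the
  angle measured from \<open>\<epsilon>\<close>, with values in the open interval from \<open>-
  pi\<close> to \<open>pi\<close>; the antipode of \<open>\<epsilon>\<close> is left out.\<close>

definition circle_chart :: "complex \<Rightarrow> (complex, 1) chart" where
  "circle_chart \<epsilon> = (circle - {- \<epsilon>}, \<lambda>z. vec (Arg (\<epsilon> * z)))"

definition circle_volume :: "complex measure" where
  "circle_volume = distr (restrict_space lborel straight) (restrict_space borel circle) (\<lambda>y. cis (y $ 1))"

text \<open>The components for the kernel and its Hilbert space are placeholders that
  \<open>rank_one\<close> replaces.\<close>

definition circle_space :: "(complex, 1) stein" where
  "circle_space = \<lparr>mtop = top_of_set circle, atlas = circle_chart ` {1, -1}, metric = \<lambda>p. (\<bullet>), vol = circle_volume,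
     kernel = \<lambda>x y v. 0, rkhs = {}, rkhs_inner = \<lambda>U V. 0\<rparr>"

lemma circle_space_fields [simp]:
  "mtop circle_space = top_of_set circle" "atlas circle_space = circle_chart ` {1, -1}"
  "metric circle_space = (\<lambda>p. (\<bullet>))" "vol circle_space = circle_volume"
  by (simp_all add: circle_space_def)

lemma cdom_arc: "cdom (circle_chart \<epsilon>) = circle - {- \<epsilon>}" and cmap_arc: "cmap (circle_chart \<epsilon>) z = vec (Arg (\<epsilon> * z))"
  by (simp_all add: circle_chart_def)

lemma open_straight: "open straight" "open {y :: real ^ 1. 0 < y $ 1 \<and> y $ 1 < pi}" "open {y :: real ^ 1. - pi < y $ 1 \<and> y $ 1 < 0}"
  by (intro open_Collect_conj open_Collect_less continuous_intros)+

lemma vec_1: "vec (y $ 1) = (y :: real ^ 1)"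
  by (simp add: vec_eq_iff)

lemma cis_shift: "- cis t = cis (t - pi)" "- cis t = cis (t + pi)"
  by (simp_all add: complex_eq_iff cos_diff sin_diff cos_add sin_add)

lemma arc_coordinate:
  assumes \<epsilon>: "\<epsilon> \<in> {1, -1}" and z: "z \<in> cdom (circle_chart \<epsilon>)"
  shows "cmap (circle_chart \<epsilon>) z \<in> straight" "\<epsilon> * cis (cmap (circle_chart \<epsilon>) z $ 1) = z"
proof -
  have n: "norm (\<epsilon> * z) = 1" using \<epsilon> z by (auto simp: cdom_arc)
  have m: "\<epsilon> * z \<noteq> - 1" using \<epsilon> z by (auto simp: cdom_arc)
  have "Arg (\<epsilon> * z) \<noteq> pi"
  proof
    assume "Arg (\<epsilon> * z) = pi"
    then have "cis (Arg (\<epsilon> * z)) = -1" by simp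
    moreover have "cis (Arg (\<epsilon> * z)) = \<epsilon> * z" using n by (subst cis_Arg) (auto simp: sgn_eq)
    ultimately show False using m by simp
  qed
  then show "cmap (circle_chart \<epsilon>) z \<in> straight"
    using mpi_less_Arg[of "\<epsilon> * z"] Arg_le_pi[of "\<epsilon> * z"] by (simp add: cmap_arc)
  have "cis (Arg (\<epsilon> * z)) = \<epsilon> * z" using n by (subst cis_Arg) (auto simp: sgn_eq)
  then show "\<epsilon> * cis (cmap (circle_chart \<epsilon>) z $ 1) = z" using \<epsilon> by (auto simp: cmap_arc)
qed

lemma arc_point:
  assumes \<epsilon>: "\<epsilon> \<in> {1, -1}" and y: "y \<in> straight"
  shows "\<epsilon> * cis (y $ 1) \<in> cdom (circle_chart \<epsilon>)" "cmap (circle_chart \<epsilon>) (\<epsilon> * cis (y $ 1)) = y"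
proof -
  have a: "Arg (cis (y $ 1)) = y $ 1" by (rule Arg_cis) (use y in simp)
  have e: "\<epsilon> * (\<epsilon> * z) = z" for z using \<epsilon> by auto
  have "cis (y $ 1) \<noteq> - 1"
  proof
    assume "cis (y $ 1) = - 1"
    moreover have "Arg (- 1) = pi" by (simp add: Arg_eq_pi)
    ultimately have "y $ 1 = pi" using a by simp
    then show False using y by simp
  qed
  then have "\<epsilon> * cis (y $ 1) \<noteq> - \<epsilon>" using \<epsilon> e[of "cis (y $ 1)"] by (auto dest: arg_cong[where f = uminus])
  then show "\<epsilon> * cis (y $ 1) \<in> cdom (circle_chart \<epsilon>)" using \<epsilon> by (auto simp: cdom_arc norm_mult)
  show "cmap (circle_chart \<epsilon>) (\<epsilon> * cis (y $ 1)) = y" by (simp only: cmap_arc e a vec_1)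
qed

lemma img_arc: assumes "\<epsilon> \<in> {1, -1}" shows "img (circle_chart \<epsilon>) = straight"
proof
  show "img (circle_chart \<epsilon>) \<subseteq> straight" using arc_coordinate(1)[OF assms] by (intro image_subsetI)
  show "straight \<subseteq> img (circle_chart \<epsilon>)"
  proof
    fix y assume y: "y \<in> straight"
    from imageI[OF arc_point(1)[OF assms y], of "cmap (circle_chart \<epsilon>)"] show "y \<in> img (circle_chart \<epsilon>)" unfolding arc_point(2)[OF assms y] .
  qed
qed

lemma cinv_arc: assumes \<epsilon>: "\<epsilon> \<in> {1, -1}" and y: "y \<in> straight" shows "cinv (circle_chart \<epsilon>) y = \<epsilon> * cis (y $ 1)"
  unfolding cinv_def
proof (rule inv_into_f_eq[where f = "cmap (circle_chart \<epsilon>)" and A = "cdom (circle_chart \<epsilon>)" and x = "\<epsilon> * cis (y $ 1)" and y = y, OF _ arc_point[OF \<epsilon> y]])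
  show "inj_on (cmap (circle_chart \<epsilon>)) (cdom (circle_chart \<epsilon>))"
    by (rule inj_on_inverseI[where g = "\<lambda>y. \<epsilon> * cis (y $ 1)"]) (rule arc_coordinate(2)[OF \<epsilon>])
qed

text \<open>Two angles of the same point differ by a locally constant amount.  Hence all Jacobians are the
  identity, and the Euclidean inner product of components is a well-defined metric.\<close>

lemma arc_translation:
  assumes \<epsilon>: "\<epsilon> \<in> {1, -1}" and \<delta>: "\<delta> \<in> {1, -1}" and z: "z \<in> cdom (circle_chart \<epsilon>) \<inter> cdom (circle_chart \<delta>)"
  shows "\<exists>U \<kappa>. open U \<and> cmap (circle_chart \<epsilon>) z \<in> U \<and> U \<subseteq> cmap (circle_chart \<epsilon>) ` (cdom (circle_chart \<epsilon>) \<inter> cdom (circle_chart \<delta>)) \<and>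
    (\<forall>y\<in>U. trans_map (circle_chart \<epsilon>) (circle_chart \<delta>) y = y + \<kappa>)"
proof (cases "\<epsilon> = \<delta>")
  case True
  show ?thesis
  proof (rule exI[of _ straight], rule exI[of _ 0], intro conjI ballI)
    show "open straight" by (rule open_straight)
    show "cmap (circle_chart \<epsilon>) z \<in> straight" using arc_coordinate(1)[OF \<epsilon>] z by blast
    show "straight \<subseteq> cmap (circle_chart \<epsilon>) ` (cdom (circle_chart \<epsilon>) \<inter> cdom (circle_chart \<delta>))" using img_arc[OF \<epsilon>] True by simp
    show "trans_map (circle_chart \<epsilon>) (circle_chart \<delta>) y = y + 0" if "y \<in> straight" for y
      using cinv_arc[OF \<epsilon> that] arc_point(2)[OF \<epsilon> that] True by (simp add: trans_map_def)
  qed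
next
  case False
  then have ed: "\<delta> = - \<epsilon>" and e2: "\<epsilon> * \<epsilon> = 1" using \<epsilon> \<delta> by auto
  define y0 where "y0 = cmap (circle_chart \<epsilon>) z"
  have y0: "y0 \<in> straight" "\<epsilon> * cis (y0 $ 1) = z" unfolding y0_def using arc_coordinate[OF \<epsilon>] z by blast+
  have "z \<noteq> \<epsilon>" using z ed by (simp add: cdom_arc)
  then have "y0 $ 1 \<noteq> 0" using y0(2) by auto
  then consider "y0 $ 1 > 0" | "y0 $ 1 < 0" by linarith
  then obtain U \<kappa> where U: "open U" "y0 \<in> U" "U \<subseteq> straight" "\<And>y. y \<in> U \<Longrightarrow> y $ 1 \<noteq> 0"
    "\<And>y. y \<in> U \<Longrightarrow> - cis (y $ 1) = cis (y $ 1 + \<kappa>) \<and> y $ 1 + \<kappa> \<in> {-pi<..pi}"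
  proof cases
    case 1
    show ?thesis
    proof (rule that[OF open_straight(2)])
      show "- cis (y $ 1) = cis (y $ 1 + - pi) \<and> y $ 1 + - pi \<in> {-pi<..pi}" if "y \<in> {y. 0 < y $ 1 \<and> y $ 1 < pi}" for y :: "real ^ 1"
        using that cis_shift(1)[of "y $ 1"] by simp
    qed (use 1 y0(1) in auto)
  next
    case 2
    show ?thesis
    proof (rule that[OF open_straight(3)])
      show "- cis (y $ 1) = cis (y $ 1 + pi) \<and> y $ 1 + pi \<in> {-pi<..pi}" if "y \<in> {y. - pi < y $ 1 \<and> y $ 1 < 0}" for y :: "real ^ 1"
        using that cis_shift(2)[of "y $ 1"] by simp
    qed (use 2 y0(1) in auto)
  qed
  show ?thesis
  proof (rule exI[of _ U], rule exI[of _ "vec \<kappa>"], intro conjI ballI)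
    show "open U" by (rule U)
    show "cmap (circle_chart \<epsilon>) z \<in> U" using U(2) by (simp add: y0_def)
    show "U \<subseteq> cmap (circle_chart \<epsilon>) ` (cdom (circle_chart \<epsilon>) \<inter> cdom (circle_chart \<delta>))"
    proof
      fix y assume y: "y \<in> U"
      then have ys: "y \<in> straight" using U(3) by blast
      have "cis (y $ 1) \<noteq> 1"
      proof
        assume "cis (y $ 1) = 1"
        moreover have "Arg (cis (y $ 1)) = y $ 1" by (rule Arg_cis) (use ys in simp)
        ultimately show False using U(4)[OF y] by simp
      qed
      then have "\<epsilon> * cis (y $ 1) \<noteq> \<epsilon>" using \<epsilon> by auto
      then have "\<epsilon> * cis (y $ 1) \<in> cdom (circle_chart \<epsilon>) \<inter> cdom (circle_chart \<delta>)"
        using arc_point(1)[OF \<epsilon> ys] ed by (simp add: cdom_arc)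
      from imageI[OF this, of "cmap (circle_chart \<epsilon>)"] show "y \<in> cmap (circle_chart \<epsilon>) ` (cdom (circle_chart \<epsilon>) \<inter> cdom (circle_chart \<delta>))"
        unfolding arc_point(2)[OF \<epsilon> ys] .
    qed
    fix y assume y: "y \<in> U"
    then have ys: "y \<in> straight" using U(3) by blast
    have "\<delta> * (\<epsilon> * cis (y $ 1)) = - cis (y $ 1)" using ed e2 by (simp add: mult.assoc[symmetric])
    then have "trans_map (circle_chart \<epsilon>) (circle_chart \<delta>) y = vec (Arg (- cis (y $ 1)))"
      by (simp only: trans_map_def comp_def cinv_arc[OF \<epsilon> ys] cmap_arc)
    also have "Arg (- cis (y $ 1)) = y $ 1 + \<kappa>" using U(5)[OF y] Arg_cis by simp
    also have "vec (y $ 1 + \<kappa>) = y + vec \<kappa>" by (simp add: vec_eq_iff)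
    finally show "trans_map (circle_chart \<epsilon>) (circle_chart \<delta>) y = y + vec \<kappa>" .
  qed
qed

lemma arc_overlap:
  assumes \<epsilon>: "\<epsilon> \<in> {1, -1}" and \<delta>: "\<delta> \<in> {1, -1}"
  shows "smooth_on (cmap (circle_chart \<epsilon>) ` (cdom (circle_chart \<epsilon>) \<inter> cdom (circle_chart \<delta>))) (trans_map (circle_chart \<epsilon>) (circle_chart \<delta>))"
    and "z \<in> cdom (circle_chart \<epsilon>) \<inter> cdom (circle_chart \<delta>) \<Longrightarrow> jac (circle_chart \<epsilon>) (circle_chart \<delta>) z = (\<lambda>v. v)"
proof -
  let ?O = "cmap (circle_chart \<epsilon>) ` (cdom (circle_chart \<epsilon>) \<inter> cdom (circle_chart \<delta>))" and ?t = "trans_map (circle_chart \<epsilon>) (circle_chart \<delta>)"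
  have loc: "\<exists>U \<kappa>. open U \<and> y \<in> U \<and> U \<subseteq> ?O \<and> (\<forall>y\<in>U. ?t y = y + \<kappa>)" if "y \<in> ?O" for y
    using that by (elim imageE) (simp only: arc_translation[OF \<epsilon> \<delta>])
  have op: "open ?O" by (subst open_subopen) (use loc in blast)
  show "smooth_on ?O ?t" unfolding smooth_on_iff[OF op]
  proof (intro allI Cfam_local[OF op])
    fix k y assume "y \<in> ?O"
    from loc[OF this] obtain U \<kappa> where U: "open U" "y \<in> U" "U \<subseteq> ?O" "\<forall>y\<in>U. ?t y = y + \<kappa>" by (elim exE conjE) (rule that)
    have "Ck k U (\<lambda>y. y + \<kappa>)" by (rule Cfam_add[OF U(1) Ck_ident[OF U(1)] Cfam_const])
    then have "Ck k U ?t" by (subst Cfam_cong[OF U(1)]) (use U(4) in simp_all)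
    moreover have "U \<inter> ?O = U" using U(3) by blast
    ultimately show "\<exists>V. open V \<and> y \<in> V \<and> Ck k (V \<inter> ?O) ?t" using U(1,2) by (intro exI[of _ U]) simp
  qed
  assume z: "z \<in> cdom (circle_chart \<epsilon>) \<inter> cdom (circle_chart \<delta>)"
  from loc[OF imageI[OF z]] obtain U \<kappa> where U: "open U" "cmap (circle_chart \<epsilon>) z \<in> U" "U \<subseteq> ?O" "\<forall>y\<in>U. ?t y = y + \<kappa>"
    by (elim exE conjE) (rule that)
  have "((\<lambda>y. y + \<kappa>) has_derivative (\<lambda>v. v)) (at (cmap (circle_chart \<epsilon>) z))" by (auto intro!: derivative_eq_intros)
  from has_derivative_transform_within_open[OF this U(1,2)] U(4)
  have "(?t has_derivative (\<lambda>v. v)) (at (cmap (circle_chart \<epsilon>) z))" by simp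
  then show "jac (circle_chart \<epsilon>) (circle_chart \<delta>) z = (\<lambda>v. v)" unfolding jac_def by (rule frechet_derivative_at[symmetric])
qed

lemma arc_homeomorphic:
  assumes \<epsilon>: "\<epsilon> \<in> {1, -1}"
  shows "homeomorphic_map (subtopology (top_of_set circle) (cdom (circle_chart \<epsilon>))) (top_of_set straight) (cmap (circle_chart \<epsilon>))"
proof (rule homeomorphic_maps_imp_map[where g = "\<lambda>y. \<epsilon> * cis (y $ 1)"])
  have t: "subtopology (top_of_set circle) (cdom (circle_chart \<epsilon>)) = top_of_set (cdom (circle_chart \<epsilon>))"
    by (simp add: subtopology_subtopology cdom_arc Int_absorb1)
  have "continuous_on (cdom (circle_chart \<epsilon>)) (\<lambda>z. vec (Arg (\<epsilon> * z)) :: real ^ 1)"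
    unfolding continuous_on_componentwise[where 'b = "real ^ 1"]
  proof -
    have A: "continuous_on (cdom (circle_chart \<epsilon>)) (\<lambda>z. Arg (\<epsilon> * z))"
    proof (intro continuous_on_Arg' continuous_intros)
      fix z assume z: "z \<in> cdom (circle_chart \<epsilon>)"
      show "\<epsilon> * z \<notin> \<real>\<^sub>\<le>\<^sub>0"
      proof
        assume n: "\<epsilon> * z \<in> \<real>\<^sub>\<le>\<^sub>0"
        have "norm (\<epsilon> * z) = 1" using \<epsilon> z by (auto simp: cdom_arc)
        then have "\<epsilon> * z \<noteq> 0" by auto
        with n have "Re (\<epsilon> * z) < 0 \<and> Im (\<epsilon> * z) = 0"
          by (metis complex_eq_iff complex_nonpos_Reals_iff less_eq_real_def zero_complex.simps)
        then have "Arg (\<epsilon> * z) = pi" by (simp only: Arg_eq_pi)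
        then show False using arc_coordinate(1)[OF \<epsilon> z] by (simp add: cmap_arc)
      qed
    qed
    then show "\<forall>i\<in>Basis. continuous_on (cdom (circle_chart \<epsilon>)) (\<lambda>z. (vec (Arg (\<epsilon> * z)) :: real ^ 1) \<bullet> i)"
      by (auto simp: Basis_vec_def inner_axis intro!: continuous_intros)
  qed
  then have c1: "continuous_on (cdom (circle_chart \<epsilon>)) (cmap (circle_chart \<epsilon>))" by (simp add: cmap_arc)
  have "continuous_on straight (\<lambda>y. cis (y $ 1))" by (intro continuous_intros)
  then have c2: "continuous_on straight (\<lambda>y. \<epsilon> * cis (y $ 1))" by (intro continuous_on_mult_left)
  have "cmap (circle_chart \<epsilon>) \<in> cdom (circle_chart \<epsilon>) \<rightarrow> straight" using arc_coordinate(1)[OF \<epsilon>] by blast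
  moreover have "(\<lambda>y. \<epsilon> * cis (y $ 1)) \<in> straight \<rightarrow> cdom (circle_chart \<epsilon>)" using arc_point(1)[OF \<epsilon>] by blast
  ultimately show "homeomorphic_maps (subtopology (top_of_set circle) (cdom (circle_chart \<epsilon>))) (top_of_set straight) (cmap (circle_chart \<epsilon>)) (\<lambda>y. \<epsilon> * cis (y $ 1))"
    unfolding homeomorphic_maps_def t continuous_map_subtopology_eu topspace_euclidean_subtopology
    using c1 c2 arc_coordinate(2)[OF \<epsilon>] arc_point(2)[OF \<epsilon>] by blast
qed

lemma second_countable_euclidean: "second_countable (euclidean :: 'b::second_countable_topology topology)"
proof -
  obtain B :: "'b set set" where B: "countable B" "topological_basis B" using ex_countable_basis by blast
  show ?thesis unfolding second_countable_def
  proof (intro exI[of _ B] conjI ballI allI impI B(1))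
    show "openin euclidean V" if "V \<in> B" for V using topological_basis_open[OF B(2) that] by simp
    fix U and x :: 'b assume "openin euclidean U \<and> x \<in> U"
    then show "\<exists>V\<in>B. x \<in> V \<and> V \<subseteq> U" using topological_basisE[OF B(2), of U x] by (metis open_openin)
  qed
qed

lemma circle_manifold: "closed_oriented_manifold circle_space"
  unfolding closed_oriented_manifold_def circle_space_fields topspace_euclidean_subtopology
proof (intro conjI ballI)
  show "circle \<noteq> {}" by simp
  show "compact_space (top_of_set circle)" by (rule compact_space_subtopology) simp
  show "connected_space (top_of_set circle)"
    by (rule connected_space_subtopology) (simp add: connected_sphere)
  show "Hausdorff_space (top_of_set circle)" by (intro Hausdorff_space_subtopology Hausdorff_space_euclidean)
  show "second_countable (top_of_set circle)" by (intro second_countable_subtopology second_countable_euclidean)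
  show "(\<Union>c\<in>circle_chart ` {1, -1}. cdom c) = circle" by (auto simp: cdom_arc)
next
  fix c assume "c \<in> circle_chart ` {1, -1}"
  then obtain \<epsilon> where \<epsilon>: "c = circle_chart \<epsilon>" "\<epsilon> \<in> {1, -1}" by (elim imageE) (rule that)
  show "openin (top_of_set circle) (cdom c)"
    unfolding \<epsilon>(1) cdom_arc by (intro openin_diff openin_subtopology_self closedin_singleton[THEN iffD2]) (use \<epsilon>(2) in auto)
  show "open (img c)" unfolding \<epsilon>(1) img_arc[OF \<epsilon>(2)] by (rule open_straight)
  show "homeomorphic_map (subtopology (top_of_set circle) (cdom c)) (top_of_set (img c)) (cmap c)"
    unfolding \<epsilon>(1) img_arc[OF \<epsilon>(2)] by (rule arc_homeomorphic[OF \<epsilon>(2)])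
  fix d assume "d \<in> circle_chart ` {1, -1}"
  then obtain \<delta> where \<delta>: "d = circle_chart \<delta>" "\<delta> \<in> {1, -1}" by (elim imageE) (rule that)
  show "smooth_on (cmap c ` (cdom c \<inter> cdom d)) (trans_map c d)" unfolding \<epsilon>(1) \<delta>(1) by (rule arc_overlap(1)[OF \<epsilon>(2) \<delta>(2)])
  fix p assume "p \<in> cdom c \<inter> cdom d"
  then have "jac c d p = id" unfolding \<epsilon>(1) \<delta>(1) id_def by (rule arc_overlap(2)[OF \<epsilon>(2) \<delta>(2)])
  then show "det (matrix (jac c d p)) > 0" by (simp add: matrix_id_mat_1)
qed

lemma circle_gram:
  assumes c: "c \<in> circle_chart ` {1, -1}" and p: "p \<in> cdom c" shows "gram circle_space c p = (\<chi> i j. 1)"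
proof -
  have ex: "c \<in> atlas circle_space \<and> p \<in> cdom c" using c p by simp
  have d: "chart_at circle_space p \<in> circle_chart ` {1, -1}" "p \<in> cdom (chart_at circle_space p)"
    using someI[of "\<lambda>c. c \<in> atlas circle_space \<and> p \<in> cdom c", OF ex] unfolding chart_at_def by simp_all
  obtain \<epsilon> where \<epsilon>: "c = circle_chart \<epsilon>" "\<epsilon> \<in> {1, -1}" using c by (elim imageE) (rule that)
  obtain \<delta> where \<delta>: "chart_at circle_space p = circle_chart \<delta>" "\<delta> \<in> {1, -1}" using d(1) by (elim imageE) (rule that)
  have pp: "p \<in> cdom (circle_chart \<epsilon>) \<inter> cdom (circle_chart \<delta>)" using p d(2) unfolding \<epsilon>(1) \<delta>(1) by (rule IntI)
  have "frame circle_space c p = (\<lambda>w. w)"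
    unfolding frame_def \<delta>(1) unfolding \<epsilon>(1) arc_overlap(2)[OF \<epsilon>(2) \<delta>(2) pp] ..
  then show ?thesis unfolding gram_def by (simp only: circle_space_fields) (simp add: vec_eq_iff inner_axis_axis)
qed

lemma circle_metric: "riemannian_metric circle_space"
  unfolding riemannian_metric_def
proof (intro conjI ballI)
  fix p
  show "bilinear (metric circle_space p)" by (simp add: bilinear_conv_bounded_bilinear bounded_bilinear_inner)
  show "\<forall>v w. metric circle_space p v w = metric circle_space p w v" by (simp add: inner_commute)
  show "\<forall>v. v \<noteq> 0 \<longrightarrow> metric circle_space p v v > 0" by simp
next
  fix c assume "c \<in> atlas circle_space"
  then have c: "c \<in> circle_chart ` {1, -1}" by simp
  then obtain \<epsilon> where \<epsilon>: "c = circle_chart \<epsilon>" "\<epsilon> \<in> {1, -1}" by (elim imageE) (rule that)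
  have "Ck k (img c) (gram circle_space c \<circ> cinv c)" for k
    unfolding \<epsilon>(1) img_arc[OF \<epsilon>(2)]
  proof (rule Cfam_cong[OF open_straight(1), THEN iffD1, OF _ Cfam_const])
    fix y :: "real ^ 1" assume y: "y \<in> straight"
    show "(\<chi> i j. 1) = (gram circle_space (circle_chart \<epsilon>) \<circ> cinv (circle_chart \<epsilon>)) y"
      unfolding comp_def cinv_arc[OF \<epsilon>(2) y]
      by (rule circle_gram[OF imageI[OF \<epsilon>(2)] arc_point(1)[OF \<epsilon>(2) y], symmetric])
  qed
  then show "smooth_on (img c) (gram circle_space c \<circ> cinv c)"
    using smooth_on_iff open_straight(1) img_arc[OF \<epsilon>(2)] \<epsilon>(1) by metis
qed

text \<open>In the chart around \<open>1\<close> the volume is the Lebesgue measure of angles by definition.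
  In the chart around \<open>- 1\<close>, the upper and the lower half circle are translated by
  \<open>pi\<close> in opposite directions, and the two points \<open>1\<close> and \<open>-
  1\<close> have measure zero.\<close>

lemma circle_volume: "riemannian_volume circle_space"
  unfolding riemannian_volume_def
proof (intro conjI ballI impI)
  have eq: "sets (vol circle_space) = sets (restrict_space borel circle)" by (simp add: circle_volume_def)
  show sp: "space (vol circle_space) = pts circle_space" by (simp add: circle_volume_def space_restrict_space)
  have op: "{U. openin (top_of_set circle) U} = (\<inter>) circle ` {S. open S}" by (auto simp: openin_open)
  have "sets (restrict_space borel circle) = (\<inter>) circle ` sigma_sets UNIV {S. open S}"
    by (simp add: sets_restrict_space borel_def)
  also have "\<dots> = sigma_sets circle ((\<inter>) circle ` {S. open S})" by (rule sigma_sets_Int) (use borel_closed[OF closed_sphere[of 0 1]] in \<open>simp_all add: borel_def\<close>)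
  finally show "sets (vol circle_space) = sigma_sets (pts circle_space) {U. openin (mtop circle_space) U}"
    unfolding eq by (simp add: op)
  fix c B assume "c \<in> atlas circle_space" and B: "B \<in> sets (vol circle_space)" and Bc: "B \<subseteq> cdom c"
  then have c: "c \<in> circle_chart ` {1, -1}" by simp
  then obtain \<epsilon> where \<epsilon>: "c = circle_chart \<epsilon>" "\<epsilon> \<in> {1, -1}" by (elim imageE) (rule that)
  have BM: "B \<subseteq> circle" using Bc unfolding \<epsilon>(1) cdom_arc by blast
  have Bb: "B \<in> sets borel" using B unfolding eq by (auto simp: sets_restrict_space)
  have Br: "B \<in> sets (restrict_space borel circle)" using B unfolding eq .
  define lift :: "complex \<Rightarrow> (real ^ 1) set" where "lift \<delta> = {y \<in> straight. \<delta> * cis (y $ 1) \<in> B}" for \<delta>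
  have meas: "(\<lambda>y :: real ^ 1. \<delta> * cis (y $ 1)) \<in> borel_measurable borel" for \<delta>
    by (intro borel_measurable_continuous_onI continuous_intros)
  have lift: "lift \<delta> \<in> sets borel" for \<delta>
  proof -
    have "lift \<delta> = straight \<inter> ((\<lambda>y. \<delta> * cis (y $ 1)) -` B \<inter> space borel)" unfolding lift_def by auto
    then show ?thesis using measurable_sets[OF meas Bb] open_straight(1) by (simp add: sets.Int borel_open)
  qed
  have m: "(\<lambda>y :: real ^ 1. cis (y $ 1)) \<in> measurable (restrict_space lborel straight) (restrict_space borel circle)"
    by (intro measurable_restrict_space2 measurable_restrict_space1) (use meas[of 1] in \<open>simp_all add: Pi_def\<close>)
  have "emeasure (vol circle_space) B = emeasure (restrict_space lborel straight) ((\<lambda>y. cis (y $ 1)) -` B \<inter> space (restrict_space lborel straight))"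
    unfolding circle_space_fields circle_volume_def by (rule emeasure_distr[OF m Br])
  also have "(\<lambda>y. cis (y $ 1)) -` B \<inter> space (restrict_space lborel straight) = lift 1"
    by (auto simp: lift_def space_restrict_space)
  also have "emeasure (restrict_space lborel straight) (lift 1) = emeasure lborel (lift 1)"
    by (rule emeasure_restrict_space) (use open_straight(1) in \<open>auto simp: lift_def borel_open\<close>)
  finally have vol: "emeasure (vol circle_space) B = emeasure lborel (lift 1)" .
  have shift: "emeasure lborel (lift 1) = emeasure lborel (lift (-1))"
  proof -
    define P where "P = lift 1 \<inter> {y. 0 < y $ 1}"
    define N where "N = lift 1 \<inter> {y. y $ 1 < 0}"
    have half: "open {y :: real ^ 1. 0 < y $ 1}" "open {y :: real ^ 1. y $ 1 < 0}"
      by (intro open_Collect_less continuous_intros)+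
    have PN: "P \<in> sets borel" "N \<in> sets borel" unfolding P_def N_def using lift[of 1] half by (simp_all add: sets.Int borel_open)
    have tr: "emeasure lborel ((+) a -` A) = emeasure lborel A" if "A \<in> sets borel" for a and A :: "(real ^ 1) set"
    proof -
      have "emeasure lborel A = emeasure (distr lborel borel ((+) a)) A" by (simp add: lborel_distr_plus)
      also have "\<dots> = emeasure lborel ((+) a -` A)" using that by (subst emeasure_distr) simp_all
      finally show ?thesis ..
    qed
    let ?P = "(+) (vec pi) -` P" and ?N = "(+) (vec (- pi)) -` N"
    have PN': "?P \<in> sets borel" "?N \<in> sets borel"
      using measurable_sets[of "(+) (vec pi)" borel borel P] measurable_sets[of "(+) (vec (- pi))" borel borel N] PN by simp_all
    have Z: "emeasure lborel (lift \<delta> \<inter> {0}) = 0" for \<delta>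
      by (rule emeasure_lborel_countable) (rule countable_subset[of _ "{0}"], simp_all)
    have z1: "y = 0 \<longleftrightarrow> y $ 1 = 0" for y :: "real ^ 1" by (simp add: vec_eq_iff)
    have split: "emeasure lborel (X \<union> Y \<union> (lift \<delta> \<inter> {0})) = emeasure lborel X + emeasure lborel Y"
      if "X \<in> sets borel" "Y \<in> sets borel" "X \<inter> Y = {}" for X Y \<delta>
    proof -
      have "emeasure lborel (X \<union> Y \<union> (lift \<delta> \<inter> {0})) = emeasure lborel (X \<union> Y)"
        by (rule emeasure_Un_null_set) (use that lift Z in \<open>auto intro!: null_setsI\<close>)
      then show ?thesis using plus_emeasure[of X lborel Y] that by simp
    qed
    have l1: "lift 1 = P \<union> N \<union> (lift 1 \<inter> {0})"
    proof (rule set_eqI)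
      fix y :: "real ^ 1"
      consider "y $ 1 = 0" | "y $ 1 < 0" | "0 < y $ 1" by linarith
      then show "y \<in> lift 1 \<longleftrightarrow> y \<in> P \<union> N \<union> (lift 1 \<inter> {0})" by cases (simp_all add: P_def N_def z1)
    qed
    have l2: "lift (-1) = ?P \<union> ?N \<union> (lift (-1) \<inter> {0})"
    proof (rule set_eqI)
      fix y :: "real ^ 1"
      have c: "cis (pi + y $ 1) = - cis (y $ 1)" "cis (- pi + y $ 1) = - cis (y $ 1)"
        using cis_shift[of "y $ 1"] by (simp_all add: add.commute)
      have v: "(vec pi + y) $ 1 = pi + y $ 1" "(vec (- pi) + y) $ 1 = - pi + y $ 1" by simp_all
      have "y \<in> ?P \<longleftrightarrow> - pi < y $ 1 \<and> y $ 1 < 0 \<and> - cis (y $ 1) \<in> B"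
        unfolding vimage_eq P_def lift_def Int_iff mem_Collect_eq v c using pi_gt_zero by (simp only: mult_1) argo
      moreover have "y \<in> ?N \<longleftrightarrow> 0 < y $ 1 \<and> y $ 1 < pi \<and> - cis (y $ 1) \<in> B"
        unfolding vimage_eq N_def lift_def Int_iff mem_Collect_eq v c using pi_gt_zero by (simp only: mult_1) argo
      moreover have "y \<in> lift (-1) \<longleftrightarrow> - pi < y $ 1 \<and> y $ 1 < pi \<and> - cis (y $ 1) \<in> B" unfolding lift_def by simp
      moreover have "y $ 1 = 0 \<or> y $ 1 < 0 \<or> 0 < y $ 1" by linarith
      ultimately show "y \<in> lift (-1) \<longleftrightarrow> y \<in> ?P \<union> ?N \<union> (lift (-1) \<inter> {0})"
        unfolding Un_iff Int_iff singleton_iff z1[of y] using pi_gt_zero by argo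
    qed
    have "emeasure lborel (lift 1) = emeasure lborel P + emeasure lborel N"
      by (subst l1) (rule split[OF PN], force simp: P_def N_def)
    also have "\<dots> = emeasure lborel ?P + emeasure lborel ?N" by (simp only: tr[OF PN(1)] tr[OF PN(2)])
    also have "\<dots> = emeasure lborel (lift (-1))"
    proof -
      have "y \<notin> ?N" if "y \<in> ?P" for y
      proof
        assume "y \<in> ?N"
        with that have "pi + y $ 1 < pi" "0 < - pi + y $ 1 + pi"
          unfolding P_def N_def lift_def by simp_all
        then show False by simp
      qed
      then have "?P \<inter> ?N = {}" by blast
      then show ?thesis by (subst l2) (rule split[OF PN', symmetric])
    qed
    finally show ?thesis .
  qed
  have im: "cmap c ` B = lift \<epsilon>"
  proof
    show "cmap c ` B \<subseteq> lift \<epsilon>"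
    proof (rule image_subsetI)
      fix z assume z: "z \<in> B"
      then have "z \<in> cdom (circle_chart \<epsilon>)" using Bc \<epsilon>(1) by blast
      from arc_coordinate[OF \<epsilon>(2) this] z show "cmap c z \<in> lift \<epsilon>" unfolding lift_def \<epsilon>(1) by simp
    qed
    show "lift \<epsilon> \<subseteq> cmap c ` B"
    proof
      fix y assume "y \<in> lift \<epsilon>"
      then have y: "y \<in> straight" "\<epsilon> * cis (y $ 1) \<in> B" unfolding lift_def by simp_all
      from imageI[OF y(2), of "cmap c"] show "y \<in> cmap c ` B" unfolding \<epsilon>(1) arc_point(2)[OF \<epsilon>(2) y(1)] .
    qed
  qed
  have "(\<integral>\<^sup>+ y\<in>cmap c ` B. ennreal (sqrt (det (gram circle_space c (cinv c y)))) \<partial>lborel) = (\<integral>\<^sup>+ y. indicator (lift \<epsilon>) y \<partial>lborel)"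
    unfolding im
  proof (rule nn_integral_cong)
    fix y
    show "ennreal (sqrt (det (gram circle_space c (cinv c y)))) * indicator (lift \<epsilon>) y = indicator (lift \<epsilon>) y"
    proof (cases "y \<in> lift \<epsilon>")
      case True
      then have y: "y \<in> straight" by (simp add: lift_def)
      have "gram circle_space c (cinv c y) = (\<chi> i j. 1)"
        by (rule circle_gram[OF c]) (simp only: \<epsilon>(1) cinv_arc[OF \<epsilon>(2) y] arc_point(1)[OF \<epsilon>(2) y])
      then show ?thesis by (simp add: det_1)
    qed simp
  qed
  also have "\<dots> = emeasure lborel (lift \<epsilon>)" using lift by simp
  also have "\<dots> = emeasure lborel (lift 1)" using \<epsilon>(2) shift by auto
  finally show "emeasure (vol circle_space) B = (\<integral>\<^sup>+ y\<in>cmap c ` B. ennreal (sqrt (det (gram circle_space c (cinv c y)))) \<partial>lborel)"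
    unfolding vol ..
qed

interpretation circle: riem circle_space
  by unfold_locales (simp only: closed_riemannian_def circle_manifold circle_metric circle_volume simp_thms)

lemma circle_function_Mk:
  assumes f: "\<And>z. z \<in> circle \<Longrightarrow> f z = a * Re z + b * Im z + d" shows "circle.Mk k f"
  unfolding circle.Mfam_def
proof
  fix c assume "c \<in> atlas circle_space"
  then have "c \<in> circle_chart ` {1, -1}" by simp
  then obtain \<epsilon> where \<epsilon>: "c = circle_chart \<epsilon>" "\<epsilon> \<in> {1, -1}" by (elim imageE) (rule that)
  have "Ck k straight (\<lambda>y. Re \<epsilon> * (a * cos (y $ 1) + b * sin (y $ 1)) + d)"
    by (intro Cfam_add Cfam_mult Cfam_const open_straight
        Cfam_comp_real[where \<phi> = "\<lambda>t. a * cos t + b * sin t", OF _ Cfam_nth[OF _ Ck_ident] Ck_sin_cos]) simp_all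
  then show "Ck k (img c) (\<lambda>y. f (cinv c y))"
    unfolding \<epsilon>(1) img_arc[OF \<epsilon>(2)]
  proof (rule Cfam_cong[OF open_straight(1), THEN iffD1, rotated])
    fix y :: "real ^ 1" assume y: "y \<in> straight"
    have "\<epsilon> * cis (y $ 1) \<in> circle" using arc_point(1)[OF \<epsilon>(2) y] by (simp add: cdom_arc)
    then show "Re \<epsilon> * (a * cos (y $ 1) + b * sin (y $ 1)) + d = f (cinv (circle_chart \<epsilon>) y)"
      unfolding cinv_arc[OF \<epsilon>(2) y] using \<epsilon>(2) by (auto simp: f algebra_simps)
  qed
qed

context riem
begin

text \<open>A supply of densities that does not require the value of any integral.\<close>

lemma normalised_density:
  assumes w: "\<And>k. Mk k w" and pos: "\<And>x. x \<in> pts S \<Longrightarrow> w x > 0"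
  shows "integral\<^sup>L (vol S) w > 0" "(\<lambda>x. if x \<in> pts S then w x / integral\<^sup>L (vol S) w else 0) \<in> densities S"
proof -
  obtain p where p: "p \<in> pts S" using pts_ne by blast
  show Z: "integral\<^sup>L (vol S) w > 0" by (rule integral_pos[OF w[of 0] _ p pos[OF p]]) (rule less_imp_le[OF pos])
  let ?d = "\<lambda>x. if x \<in> pts S then w x / integral\<^sup>L (vol S) w else 0"
  have "Mk k (\<lambda>x. w x / integral\<^sup>L (vol S) w)" for k by (rule Mfam_divide[OF w Mfam_const]) (use Z in simp)
  then have "Mk k ?d" for k by (rule Mfam_cong[THEN iffD1, rotated]) simp
  then have "smooth_fun S ?d" unfolding smooth_fun_iff by blast
  moreover have "(\<integral>x. ?d x \<partial>vol S) = (\<integral>x. w x / integral\<^sup>L (vol S) w \<partial>vol S)"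
    by (rule Bochner_Integration.integral_cong[OF refl]) (simp add: space_vol)
  then have "(\<integral>x. ?d x \<partial>vol S) = 1" using Z by simp
  ultimately show "?d \<in> densities S" unfolding densities_def using Z pos by simp
qed

end

text \<open>With \<open>\<rho>\<close> uniform and \<open>\<pi>\<close> proportional to \<open>2 + Re
  z\<close>, the logarithm of \<open>\<rho>/\<pi>\<close> takes the same value at
  \<open>\<i>\<close> and \<open>- \<i>\<close>, while \<open>Im\<close> does not.\<close>

theorem circle_example:
  "\<exists>(T :: (complex, 1) stein) \<pi> \<rho>. stein_setting T \<and> \<pi> \<in> densities T \<and> \<rho> \<in> densities T \<and>
    L2_inner T \<rho> (entropy_grad T \<pi> \<rho>) (M_op T \<rho> (entropy_grad T \<pi> \<rho>)) =
      L2_inner T \<rho> (entropy_grad T \<pi> \<rho>) (entropy_grad T \<pi> \<rho>) \<and>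
    \<not> (\<forall>x\<in>pts T. K_W T \<rho> (log_ratio \<pi> \<rho>) x = K_S T \<rho> (log_ratio \<pi> \<rho>) x)"
proof -
  have pts: "pts circle_space = circle" by simp
  define Z where "Z = integral\<^sup>L (vol circle_space) (\<lambda>z. 2 + Re z)"
  define \<pi> where "\<pi> = (\<lambda>z. if z \<in> pts circle_space then (2 + Re z) / Z else 0)"
  define m where "m = integral\<^sup>L (vol circle_space) (\<lambda>z. 1 :: real)"
  define \<rho> where "\<rho> = (\<lambda>z. if z \<in> pts circle_space then 1 / m else 0)"
  have p: "2 + Re z > 0" if "z \<in> pts circle_space" for z
    using that abs_Re_le_cmod[of z] by simp
  have M: "circle.Mk k (\<lambda>z. 2 + Re z)" "circle.Mk k (\<lambda>z. 1)" for k
    by (rule circle_function_Mk[of _ 1 0 2], simp, rule circle_function_Mk[of _ 0 0 1], simp)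
  have Z: "Z > 0" and \<pi>: "\<pi> \<in> densities circle_space"
    using circle.normalised_density[OF M(1) p] unfolding Z_def \<pi>_def by simp_all
  have m: "m > 0" and \<rho>: "\<rho> \<in> densities circle_space"
    using circle.normalised_density[OF M(2)] unfolding m_def \<rho>_def by simp_all
  have "\<exists>T :: (complex, 1) stein. stein_setting T \<and> \<pi> \<in> densities T \<and> \<rho> \<in> densities T \<and>
    L2_inner T \<rho> (entropy_grad T \<pi> \<rho>) (M_op T \<rho> (entropy_grad T \<pi> \<rho>)) =
      L2_inner T \<rho> (entropy_grad T \<pi> \<rho>) (entropy_grad T \<pi> \<rho>) \<and>
    \<not> (\<forall>x\<in>pts T. K_W T \<rho> (log_ratio \<pi> \<rho>) x = K_S T \<rho> (log_ratio \<pi> \<rho>) x)"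
  proof (rule equal_dissipation_distinct_tangents[of circle_space _ _ Im])
    show "riem_entropy circle_space \<rho> \<pi>" by unfold_locales (rule \<rho>, rule \<pi>)
    show "\<rho> \<noteq> \<pi>"
    proof
      assume "\<rho> = \<pi>"
      then have "\<rho> 1 = \<pi> 1" "\<rho> (-1) = \<pi> (-1)" by simp_all
      then show False using Z by (simp add: \<rho>_def \<pi>_def pts)
    qed
    show "smooth_fun circle_space Im"
      using circle_function_Mk[of Im 0 1 0] by (simp add: circle.smooth_fun_iff)
    fix r
    have "log_ratio \<pi> \<rho> \<i> = log_ratio \<pi> \<rho> (- \<i>)" by (simp add: log_ratio_def \<rho>_def \<pi>_def)
    then have "Im \<i> - r * log_ratio \<pi> \<rho> \<i> \<noteq> Im (- \<i>) - r * log_ratio \<pi> \<rho> (- \<i>)" by simp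
    moreover have "\<i> \<in> pts circle_space" "- \<i> \<in> pts circle_space" by simp_all
    ultimately show "\<exists>p\<in>pts circle_space. \<exists>q\<in>pts circle_space. Im p - r * log_ratio \<pi> \<rho> p \<noteq> Im q - r * log_ratio \<pi> \<rho> q"
      by blast
  qed
  then show ?thesis by blast
qed

section \<open>Wasserstein and Stein entropy flows\<close>

theorem corollary8p3:
  fixes S :: "('a, 'n::finite) stein" and \<pi> \<rho> :: "'a \<Rightarrow> real"
  assumes "stein_setting S" and "\<pi> \<in> densities S" and "\<rho> \<in> densities S"
  shows
    "((\<forall>x\<in>pts S. K_W S \<rho> (log_ratio \<pi> \<rho>) x = K_S S \<rho> (log_ratio \<pi> \<rho>) x) \<longleftrightarrow>
        (AE x in vol S. M_op S \<rho> (entropy_grad S \<pi> \<rho>) x = entropy_grad S \<pi> \<rho> x)) \<and>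
     (\<forall>R a. R \<subseteq> densities S \<and>
        (\<forall>\<sigma>\<in>R. a \<sigma> > (0::real) \<and>
           (AE x in vol S. M_op S \<sigma> (entropy_grad S \<pi> \<sigma>) x = a \<sigma> *\<^sub>R entropy_grad S \<pi> \<sigma> x)) \<longrightarrow>
        same_unparametrised_trajectories S \<pi> R) \<and>
     (dissipation_W S \<pi> \<rho> = dissipation_S S \<pi> \<rho> \<longleftrightarrow>
        L2_inner S \<rho> (entropy_grad S \<pi> \<rho>) (M_op S \<rho> (entropy_grad S \<pi> \<rho>)) =
        L2_inner S \<rho> (entropy_grad S \<pi> \<rho>) (entropy_grad S \<pi> \<rho>)) \<and>
     (\<forall>J r t J' q s.
        wasserstein_flow S \<pi> J r \<and> t \<in> J \<and> r t = \<rho> \<and>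
        stein_flow S \<pi> J' q \<and> s \<in> J' \<and> q s = \<rho> \<longrightarrow>
        (\<exists>dW dS.
           ((\<lambda>t. Ent S \<pi> (r t)) has_real_derivative dW) (at t within J) \<and>
           ((\<lambda>s. Ent S \<pi> (q s)) has_real_derivative dS) (at s within J') \<and>
           (dW = dS \<longleftrightarrow>
              L2_inner S \<rho> (entropy_grad S \<pi> \<rho>) (M_op S \<rho> (entropy_grad S \<pi> \<rho>)) =
              L2_inner S \<rho> (entropy_grad S \<pi> \<rho>) (entropy_grad S \<pi> \<rho>)))) \<and>
     (\<exists>(T :: (complex, 1) stein) \<pi>' \<rho>'.
        stein_setting T \<and> \<pi>' \<in> densities T \<and> \<rho>' \<in> densities T \<and>
        L2_inner T \<rho>' (entropy_grad T \<pi>' \<rho>') (M_op T \<rho>' (entropy_grad T \<pi>' \<rho>')) =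
        L2_inner T \<rho>' (entropy_grad T \<pi>' \<rho>') (entropy_grad T \<pi>' \<rho>') \<and>
        \<not> (\<forall>x\<in>pts T. K_W T \<rho>' (log_ratio \<pi>' \<rho>') x = K_S T \<rho>' (log_ratio \<pi>' \<rho>') x))"
proof -
  interpret E: stein_entropy S \<rho> \<pi>
    by unfold_locales (use assms in \<open>simp_all add: stein_setting_def\<close>)
  interpret F: stein_target S \<pi>
    by unfold_locales
  have "(\<forall>x\<in>pts S. K_W S \<rho> (log_ratio \<pi> \<rho>) x = K_S S \<rho> (log_ratio \<pi> \<rho>) x) \<longleftrightarrow>
      (AE x in vol S. M_op S \<rho> (entropy_grad S \<pi> \<rho>) x = entropy_grad S \<pi> \<rho> x)"
    using E.tangents_proportional_iff[of 1] by (simp add: eq_commute)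
  moreover have "same_unparametrised_trajectories S \<pi> R"
    if "R \<subseteq> densities S \<and> (\<forall>\<sigma>\<in>R. a \<sigma> > (0::real) \<and>
        (AE x in vol S. M_op S \<sigma> (entropy_grad S \<pi> \<sigma>) x = a \<sigma> *\<^sub>R entropy_grad S \<pi> \<sigma> x))" for R a
    by (rule F.same_trajectories[of R a]) (use that in blast)+
  moreover have "dissipation_W S \<pi> \<rho> = dissipation_S S \<pi> \<rho> \<longleftrightarrow> L2_inner S \<rho> E.u (M_op S \<rho> E.u) = L2_inner S \<rho> E.u E.u"
    unfolding E.dissipation_W_eq E.dissipation_S_eq E.M_op_inner by auto
  moreover have "\<exists>dW dS. ((\<lambda>t. Ent S \<pi> (r t)) has_real_derivative dW) (at t within J) \<and>
      ((\<lambda>s. Ent S \<pi> (q s)) has_real_derivative dS) (at s within J') \<and>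
      (dW = dS \<longleftrightarrow> L2_inner S \<rho> E.u (M_op S \<rho> E.u) = L2_inner S \<rho> E.u E.u)"
    if h: "wasserstein_flow S \<pi> J r \<and> t \<in> J \<and> r t = \<rho> \<and> stein_flow S \<pi> J' q \<and> s \<in> J' \<and> q s = \<rho>" for J r t J' q s
  proof (rule exI[of _ "- L2_inner S \<rho> E.u E.u"], rule exI[of _ "- L2_inner S \<rho> E.u E.b"], intro conjI)
    show "((\<lambda>t. Ent S \<pi> (r t)) has_real_derivative - L2_inner S \<rho> E.u E.u) (at t within J)"
      using F.entropy_along_W[of J r t] h by simp
    show "((\<lambda>s. Ent S \<pi> (q s)) has_real_derivative - L2_inner S \<rho> E.u E.b) (at s within J')"
      using F.entropy_along_S[of J' q s] h by simp
    show "- L2_inner S \<rho> E.u E.u = - L2_inner S \<rho> E.u E.b \<longleftrightarrow> L2_inner S \<rho> E.u (M_op S \<rho> E.u) = L2_inner S \<rho> E.u E.u"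
      unfolding E.M_op_inner by auto
  qed
  ultimately show ?thesis using circle_example by (intro conjI allI impI)
qed

end
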